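(* Let $p\geq 3$ be a prime, $F$ an algebraically closed field of characteristic $p$, $b\geq 1$ and $r\in[0,2p-3]$. Then, for $F\mathfrak{S}_p$-modules, \[(\Omega^r(D_1))^{\otimes 2b}\equiv\bigoplus_{0\leq 2\ell\leq p-3}m_\ell\,\Omega^{2br}(D_{2\ell}),\] where, for each $\ell\in[0,\frac{p-3}{2}]$, $m_\ell$ is the number of walks of length $2b$ in the path graph $\mathsf{P}_{p-1}$ starting at the vertex $2\ell+1$ and ending at the vertex $1$. In particular, $[D_1^{\otimes 2b}:D_0]$ is the number of Dyck paths of length $2b$ with height restricted to be at most $p-2$.
   Context: For integers $a\leq b$, $[a,b]$ denotes the set of integers $c$ with $a\leq c\leq b$. $\mathfrak{S}_p$ is the symmetric group on $p$ letters. Modules are finite-dimensional; $V\otimes W$ is the tensor product over $F$ with diagonal group action. For $i\in[0,p-2]$, $D_i=D^{(p-i,1^i)}$ is the simple $F\mathfrak{S}_p$-module labelled by the ($p$-regular) hook partition $(p-i,1^i)$, i.e. the unique simple quotient (James) of the Specht module of that partition. $\Omega^r(V)$ is the $r$th Heller translate of $V$. $V\equiv W$ means $V\oplus P\cong W\oplus Q$ for some projective modules $P,Q$. For a non-negative integer $a$, $aV$ means the direct sum of $a$ copies of $V$. For $W$ indecomposable, $[V:W]$ is the multiplicity of $W$ as a direct summand of $V$. The path graph $\mathsf{P}_r$ has vertices $1,2,\ldots,r$, with $i$ and $j$ adjacent if and only if $|i-j|=1$. A walk of length $n$ in $\mathsf{P}_r$ is a sequence $(s_0,s_1,\ldots,s_n)$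 of vertices with $|s_t-s_{t+1}|=1$ for all $t\in[0,n-1]$; it starts at $s_0$ and ends at $s_n$. A Dyck path of length $2b$ with height at most $c$ is a sequence of $2b$ steps $\pm1$ starting at $0$ and ending at $0$ all of whose partial sums lie in $[0,c]$. *)

theory Defs
  imports
    "HOL-Computational_Algebra.Computational_Algebra"
    "HOL-Combinatorics.Permutations"
    "HOL-Algebra.Sym_Groups"
    "Jordan_Normal_Form.Matrix"
begin

section \<open>Finite-dimensional modules over a group algebra\<close>

text \<open>
  A finite-dimensional left module over the group algebra of \<open>G\<close> is represented by coordinates:
  its dimension together with a matrix for every group element. Every finite-dimensional module
  arises in this way after a choice of basis. Only the matrices of elements of \<open>carrier G\<close> matter.
\<close>

datatype ('g, 'a) gmod = Gmod (gdim: nat) (gact: "'g \<Rightarrow> 'a mat")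

abbreviation gvecs :: "('g, 'a) gmod \<Rightarrow> 'a vec set" where
  "gvecs V \<equiv> carrier_vec (gdim V)"

definition is_gmod :: "('g, 'c) monoid_scheme \<Rightarrow> ('g, 'a :: field) gmod \<Rightarrow> bool" where
  "is_gmod G V \<longleftrightarrow>
     (\<forall>g \<in> carrier G. gact V g \<in> carrier_mat (gdim V) (gdim V)) \<and>
     gact V \<one>\<^bsub>G\<^esub> = 1\<^sub>m (gdim V) \<and>
     (\<forall>g \<in> carrier G. \<forall>h \<in> carrier G. gact V (g \<otimes>\<^bsub>G\<^esub> h) = gact V g * gact V h)"

text \<open>A homomorphism \<open>V \<rightarrow> W\<close> is given by the matrix \<open>A\<close> of the linear map \<open>v \<mapsto> A *\<^sub>v v\<close>.\<close>

definition is_ghom ::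
  "('g, 'c) monoid_scheme \<Rightarrow> ('g, 'a :: field) gmod \<Rightarrow> ('g, 'a) gmod \<Rightarrow> 'a mat \<Rightarrow> bool" where
  "is_ghom G V W A \<longleftrightarrow>
     A \<in> carrier_mat (gdim W) (gdim V) \<and>
     (\<forall>g \<in> carrier G. A * gact V g = gact W g * A)"

definition gsurj :: "('g, 'a :: field) gmod \<Rightarrow> ('g, 'a) gmod \<Rightarrow> 'a mat \<Rightarrow> bool" where
  "gsurj V W A \<longleftrightarrow> (\<lambda>v. A *\<^sub>v v) ` gvecs V = gvecs W"

definition ginj :: "('g, 'a :: field) gmod \<Rightarrow> 'a mat \<Rightarrow> bool" where
  "ginj V A \<longleftrightarrow> inj_on (\<lambda>v. A *\<^sub>v v) (gvecs V)"

definition giso :: "('g, 'c) monoid_scheme \<Rightarrow> ('g, 'a :: field) gmod \<Rightarrow> ('g, 'a) gmod \<Rightarrow> bool" where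
  "giso G V W \<longleftrightarrow> (\<exists>A. is_ghom G V W A \<and> ginj V A \<and> gsurj V W A)"

definition is_submodule ::
  "('g, 'c) monoid_scheme \<Rightarrow> ('g, 'a :: field) gmod \<Rightarrow> 'a vec set \<Rightarrow> bool" where
  "is_submodule G V U \<longleftrightarrow>
     U \<subseteq> gvecs V \<and> 0\<^sub>v (gdim V) \<in> U \<and>
     (\<forall>u \<in> U. \<forall>v \<in> U. u + v \<in> U) \<and>
     (\<forall>c. \<forall>u \<in> U. c \<cdot>\<^sub>v u \<in> U) \<and>
     (\<forall>g \<in> carrier G. \<forall>u \<in> U. gact V g *\<^sub>v u \<in> U)"

definition gsimple :: "('g, 'c) monoid_scheme \<Rightarrow> ('g, 'a :: field) gmod \<Rightarrow> bool" where
  "gsimple G V \<longleftrightarrow>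
     is_gmod G V \<and> gdim V \<noteq> 0 \<and>
     (\<forall>U. is_submodule G V U \<longrightarrow> U = {0\<^sub>v (gdim V)} \<or> U = gvecs V)"


section \<open>Direct sums and tensor products\<close>

definition gzero :: "('g, 'a :: field) gmod" where
  "gzero = Gmod 0 (\<lambda>_. 1\<^sub>m 0)"

definition gtriv :: "('g, 'a :: field) gmod" where
  "gtriv = Gmod 1 (\<lambda>_. 1\<^sub>m 1)"

definition gsum :: "('g, 'a :: field) gmod \<Rightarrow> ('g, 'a) gmod \<Rightarrow> ('g, 'a) gmod" where
  "gsum V W = Gmod (gdim V + gdim W)
     (\<lambda>g. four_block_mat (gact V g) (0\<^sub>m (gdim V) (gdim W))
                         (0\<^sub>m (gdim W) (gdim V)) (gact W g))"

definition gsum_list :: "('g, 'a :: field) gmod list \<Rightarrow> ('g, 'a) gmod" where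
  "gsum_list Vs = foldr gsum Vs gzero"

definition gcopies :: "nat \<Rightarrow> ('g, 'a :: field) gmod \<Rightarrow> ('g, 'a) gmod" where
  "gcopies a V = gsum_list (replicate a V)"

text \<open>
  The Kronecker product is the matrix of the tensor product of two linear maps with respect to the
  lexicographically ordered basis of pure tensors of basis vectors.
\<close>

definition kronecker :: "'a :: semiring_0 mat \<Rightarrow> 'a mat \<Rightarrow> 'a mat" where
  "kronecker A B = mat (dim_row A * dim_row B) (dim_col A * dim_col B)
     (\<lambda>(i, j). A $$ (i div dim_row B, j div dim_col B) * B $$ (i mod dim_row B, j mod dim_col B))"

definition gtensor :: "('g, 'a :: field) gmod \<Rightarrow> ('g, 'a) gmod \<Rightarrow> ('g, 'a) gmod" where
  "gtensor V W = Gmod (gdim V * gdim W) (\<lambda>g. kronecker (gact V g) (gact W g))"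

primrec gtensor_pow :: "('g, 'a :: field) gmod \<Rightarrow> nat \<Rightarrow> ('g, 'a) gmod" where
  "gtensor_pow V 0 = gtriv"
| "gtensor_pow V (Suc n) = gtensor V (gtensor_pow V n)"


section \<open>Projective modules, Heller translates, stable isomorphism, multiplicities\<close>

definition gprojective :: "('g, 'c) monoid_scheme \<Rightarrow> ('g, 'a :: field) gmod \<Rightarrow> bool" where
  "gprojective G P \<longleftrightarrow>
     is_gmod G P \<and>
     (\<forall>M N A B. is_gmod G M \<longrightarrow> is_gmod G N \<longrightarrow>
        is_ghom G M N A \<longrightarrow> gsurj M N A \<longrightarrow> is_ghom G P N B \<longrightarrow>
        (\<exists>C. is_ghom G P M C \<and> A * C = B))"

definition is_projective_cover ::
  "('g, 'c) monoid_scheme \<Rightarrow> ('g, 'a :: field) gmod \<Rightarrow> ('g, 'a) gmod \<Rightarrow> 'a mat \<Rightarrow> bool" where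
  "is_projective_cover G P V A \<longleftrightarrow>
     gprojective G P \<and> is_ghom G P V A \<and> gsurj P V A \<and>
     (\<forall>U. is_submodule G P U \<longrightarrow> (\<lambda>v. A *\<^sub>v v) ` U = gvecs V \<longrightarrow> U = gvecs P)"

text \<open>\<open>W\<close> is isomorphic to the kernel of a projective cover of \<open>V\<close>.\<close>

definition is_heller ::
  "('g, 'c) monoid_scheme \<Rightarrow> ('g, 'a :: field) gmod \<Rightarrow> ('g, 'a) gmod \<Rightarrow> bool" where
  "is_heller G V W \<longleftrightarrow>
     is_gmod G W \<and>
     (\<exists>P A B. is_projective_cover G P V A \<and> is_ghom G W P B \<and> ginj W B \<and>
        (\<lambda>w. B *\<^sub>v w) ` gvecs W = {v \<in> gvecs P. A *\<^sub>v v = 0\<^sub>v (gdim V)})"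

text \<open>The Heller translate is determined up to isomorphism; a representative is chosen.\<close>

definition heller :: "('g, 'c) monoid_scheme \<Rightarrow> ('g, 'a :: field) gmod \<Rightarrow> ('g, 'a) gmod" where
  "heller G V = (SOME W. is_heller G V W)"

definition heller_pow ::
  "('g, 'c) monoid_scheme \<Rightarrow> nat \<Rightarrow> ('g, 'a :: field) gmod \<Rightarrow> ('g, 'a) gmod" where
  "heller_pow G r V = (heller G ^^ r) V"

definition stably_iso ::
  "('g, 'c) monoid_scheme \<Rightarrow> ('g, 'a :: field) gmod \<Rightarrow> ('g, 'a) gmod \<Rightarrow> bool" where
  "stably_iso G V W \<longleftrightarrow>
     (\<exists>P Q. gprojective G P \<and> gprojective G Q \<and> giso G (gsum V P) (gsum W Q))"

definition gindecomposable :: "('g, 'c) monoid_scheme \<Rightarrow> ('g, 'a :: field) gmod \<Rightarrow> bool" where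
  "gindecomposable G V \<longleftrightarrow>
     is_gmod G V \<and> gdim V \<noteq> 0 \<and>
     (\<forall>X Y. is_gmod G X \<longrightarrow> is_gmod G Y \<longrightarrow> giso G V (gsum X Y) \<longrightarrow> gdim X = 0 \<or> gdim Y = 0)"

text \<open>
  The number of summands isomorphic to the indecomposable module \<open>W\<close> in a decomposition of \<open>V\<close>
  into indecomposables, which does not depend on the decomposition by Krull--Schmidt.
\<close>

definition multiplicity_in ::
  "('g, 'c) monoid_scheme \<Rightarrow> ('g, 'a :: field) gmod \<Rightarrow> ('g, 'a) gmod \<Rightarrow> nat" where
  "multiplicity_in G V W = (THE m.
     \<exists>Vs. (\<forall>X \<in> set Vs. gindecomposable G X) \<and> giso G V (gsum_list Vs) \<and>
          m = length (filter (\<lambda>X. giso G X W) Vs))"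


section \<open>Specht modules and the simple modules of hook shape\<close>

text \<open>
  A partition is the list of its parts. Tableaux are bijective fillings of the diagram by
  \<open>1, \<dots>, n\<close>; a filling is only relevant on the cells of the diagram. The tabloid of a tableau is
  the list of the sets of entries of its rows. Conventions are those of James: the Specht module
  of \<open>(n)\<close> is trivial, and that of a \<open>p\<close>-regular partition has a simple head.
\<close>

definition cells :: "nat list \<Rightarrow> (nat \<times> nat) set" where
  "cells lam = {(i, j). i < length lam \<and> j < lam ! i}"

definition tableaux :: "nat list \<Rightarrow> (nat \<times> nat \<Rightarrow> nat) set" where
  "tableaux lam = {t. bij_betw t (cells lam) {1..sum_list lam}}"

definition tabloid :: "nat list \<Rightarrow> (nat \<times> nat \<Rightarrow> nat) \<Rightarrow> nat set list" where
  "tabloid lam t = map (\<lambda>i. {t (i, j) | j. (i, j) \<in> cells lam}) [0..<length lam]"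

definition column_stabilizer :: "nat list \<Rightarrow> (nat \<times> nat \<Rightarrow> nat) \<Rightarrow> (nat \<Rightarrow> nat) set" where
  "column_stabilizer lam t = {\<sigma>. \<sigma> permutes {1..sum_list lam} \<and>
     (\<forall>j. \<sigma> ` {t (i, j) | i. (i, j) \<in> cells lam} = {t (i, j) | i. (i, j) \<in> cells lam})}"

text \<open>
  Elements of the permutation module on tabloids are written as their coefficient functions, so
  that \<open>\<pi>\<close> sends the basis vector of a tabloid \<open>T\<close> to that of \<open>map ((`) \<pi>) T\<close>.
\<close>

definition tabloid_act :: "(nat \<Rightarrow> nat) \<Rightarrow> (nat set list \<Rightarrow> 'a) \<Rightarrow> nat set list \<Rightarrow> 'a" where
  "tabloid_act \<pi> x = (\<lambda>T. x (map ((`) (inv_into UNIV \<pi>)) T))"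

definition polytabloid ::
  "nat list \<Rightarrow> (nat \<times> nat \<Rightarrow> nat) \<Rightarrow> nat set list \<Rightarrow> 'a :: field" where
  "polytabloid lam t = (\<lambda>T. \<Sum>\<sigma> \<in> column_stabilizer lam t.
     if tabloid lam (\<sigma> \<circ> t) = T then of_int (sign \<sigma>) else 0)"

text \<open>The linear span of the polytabloids.\<close>

definition specht :: "nat list \<Rightarrow> (nat set list \<Rightarrow> 'a :: field) set" where
  "specht lam = {\<lambda>T. \<Sum>t \<in> B. c t * polytabloid lam t T | B c. finite B \<and> B \<subseteq> tableaux lam}"

definition is_specht_quotient :: "nat list \<Rightarrow> (nat \<Rightarrow> nat, 'a :: field) gmod \<Rightarrow> bool" where
  "is_specht_quotient lam V \<longleftrightarrow>
     is_gmod (sym_group (sum_list lam)) V \<and>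
     (\<exists>\<phi>. \<phi> ` specht lam = gvecs V \<and>
        (\<forall>x \<in> specht lam. \<forall>y \<in> specht lam. \<phi> (\<lambda>T. x T + y T) = \<phi> x + \<phi> y) \<and>
        (\<forall>c. \<forall>x \<in> specht lam. \<phi> (\<lambda>T. c * x T) = c \<cdot>\<^sub>v \<phi> x) \<and>
        (\<forall>\<pi> \<in> carrier (sym_group (sum_list lam)). \<forall>x \<in> specht lam.
           \<phi> (tabloid_act \<pi> x) = gact V \<pi> *\<^sub>v \<phi> x))"

text \<open>The simple quotient of the Specht module, for \<open>lam\<close> regular with respect to \<open>CHAR('a)\<close>.\<close>

definition james_simple :: "nat list \<Rightarrow> (nat \<Rightarrow> nat, 'a :: field) gmod" where
  "james_simple lam =
     (SOME V. gsimple (sym_group (sum_list lam)) V \<and> is_specht_quotient lam V)"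

definition hook_simple :: "nat \<Rightarrow> nat \<Rightarrow> (nat \<Rightarrow> nat, 'a :: field) gmod" where
  "hook_simple p i = james_simple ((p - i) # replicate i 1)"


section \<open>Walks and Dyck paths\<close>

definition path_graph_adj :: "nat \<Rightarrow> nat \<Rightarrow> nat \<Rightarrow> bool" where
  "path_graph_adj r i j \<longleftrightarrow> i \<in> {1..r} \<and> j \<in> {1..r} \<and> \<bar>int i - int j\<bar> = 1"

definition path_graph_walks :: "nat \<Rightarrow> nat \<Rightarrow> nat \<Rightarrow> nat \<Rightarrow> nat list set" where
  "path_graph_walks r n u v = {s. length s = Suc n \<and> set s \<subseteq> {1..r} \<and>
     (\<forall>t < n. path_graph_adj r (s ! t) (s ! Suc t)) \<and> s ! 0 = u \<and> s ! n = v}"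

definition dyck_paths :: "nat \<Rightarrow> nat \<Rightarrow> int list set" where
  "dyck_paths n c = {xs. length xs = n \<and> set xs \<subseteq> {-1, 1} \<and> sum_list xs = 0 \<and>
     (\<forall>k \<le> n. sum_list (take k xs) \<in> {0..int c})}"

end

theory Submission
  imports Defs "Jordan_Normal_Form.Determinant"
begin

no_notation fps_nth (infixl "$" 75)

text \<open>
  Let \<open>T\<close> be the module of sum-zero vectors modulo constants, of dimension \<open>n = p - 2\<close>. The sum of all
  transpositions, acting on \<open>T \<otimes> T\<close>, is a relative trace and evaluates to a multiple of
  \<open>1 + swap + cup * cap\<close>, so modulo maps factoring through projectives the swap equals \<open>- (1 + cup * cap)\<close>.
  Hence the complement of \<open>\<Lambda>\<^bsup>i+1\<^esup>T\<close> in \<open>T \<otimes> \<Lambda>\<^sup>iT\<close> is stably \<open>\<Lambda>\<^bsup>i-1\<^esup>T\<close>, and since \<open>\<Lambda>\<^bsup>p-1\<^esup>T = 0\<close>, tensoring with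
  \<open>T\<close> is one step of a walk in the path graph on \<open>p - 1\<close> vertices. James' antisymmetrizer argument
  identifies \<open>\<Lambda>\<^sup>iT\<close> with the simple head of the hook Specht module: it is generated by the image of a
  polytabloid and carries a nondegenerate invariant form. Heller translates commute stably with
  tensor products. Finally, the multiplicity of the trivial module is the rank of the pairing of
  invariant forms with invariant vectors, which is a stable invariant because \<open>p\<close> divides \<open>p!\<close>.
\<close>

text \<open>Calculations take place modulo relative traces from the trivial subgroup: by Higman's
  criterion these are the maps that factor through projective modules, so stable statements become
  matrix identities, and projective summands reappear only in \<open>sim_imp_stably_iso\<close>.
  What makes the recursion run is that \<open>dim T = p - 2\<close> equals \<open>-2\<close> in
  \<open>F\<close>. The Gram matrix of the form on \<open>T\<close> is then its own inverse, the
  loop \<open>cap * cup\<close> is \<open>-2\<close>, and contracting the antisymmetrizer on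
  \<open>i + 1\<close> factors gives a multiple of the one on \<open>i\<close> factors with scalar
  \<open>-(i + 2) / (i + 1)\<close>. This scalar is nonzero for \<open>i + 2 < p\<close>; it keeps
  \<open>\<Lambda>^i T\<close> nonzero up to \<open>i = p - 2\<close> and makes the contraction
  split. The antisymmetrizer itself has denominators \<open>1, ..., i\<close>, so it still exists in
  degree \<open>p - 1\<close>, just far enough to see that it vanishes there. The base point
  \<open>p\<close> makes the coordinates of \<open>T\<close> simple but the action affine on the
  classes of \<open>e_y - e_p\<close>; on polytabloids the resulting shifts cancel by
  antisymmetry.\<close>

type_synonym 'a smod = "(nat \<Rightarrow> nat, 'a) gmod"

abbreviation gid :: "('g, 'a :: zero_neq_one) gmod \<Rightarrow> 'a mat" where
  "gid V \<equiv> 1\<^sub>m (gdim V)"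

abbreviation gmats :: "('g, 'a) gmod \<Rightarrow> ('g, 'a) gmod \<Rightarrow> 'a mat set" where
  "gmats V W \<equiv> carrier_mat (gdim W) (gdim V)"

declare assoc_mult_mat [simp del] assoc_mult_mat_vec [simp del]

section \<open>Matrices and Kronecker products\<close>

text \<open>Dimension equations take the place of carrier membership here and in the next rules: the
  simplifier can discharge them from the known dimensions of the maps involved, and products are
  normalized to the right.\<close>

lemma mat_assoc:
  fixes A B C :: "'a :: semiring_0 mat"
  assumes "dim_col A = dim_row B" "dim_col B = dim_row C"
  shows "(A * B) * C = A * (B * C)"
  using assms by (intro assoc_mult_mat[of A "dim_row A" "dim_row B" B "dim_row C" C "dim_col C"] carrier_matI) simp_all

lemma mat_mult_add:
  fixes A B C :: "'a :: semiring_0 mat"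
  assumes "dim_col A = dim_row B" "dim_row C = dim_row B" "dim_col B = dim_col C"
  shows "A * (B + C) = A * B + A * C"
  using assms by (intro mult_add_distrib_mat[of A "dim_row A" "dim_row B" B "dim_col B" C] carrier_matI) simp_all

lemma mat_add_mult:
  fixes A B C :: "'a :: semiring_0 mat"
  assumes "dim_col A = dim_row C" "dim_row A = dim_row B" "dim_col A = dim_col B"
  shows "(A + B) * C = A * C + B * C"
  using assms by (intro add_mult_distrib_mat[of A "dim_row A" "dim_col A" B C "dim_col C"] carrier_matI) simp_all

lemma mat_mult_minus:
  fixes A B C :: "'a :: ring mat"
  assumes "dim_col A = dim_row B" "dim_row C = dim_row B" "dim_col B = dim_col C"
  shows "A * (B - C) = A * B - A * C"
  using assms by (intro mult_minus_distrib_mat[of A "dim_row A" "dim_row B" B "dim_col B" C] carrier_matI) simp_all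

lemma mat_minus_mult:
  fixes A B C :: "'a :: ring mat"
  assumes "dim_col A = dim_row C" "dim_row A = dim_row B" "dim_col A = dim_col B"
  shows "(A - B) * C = A * C - B * C"
  using assms by (intro minus_mult_distrib_mat[of A "dim_row A" "dim_col A" B C "dim_col C"] carrier_matI) simp_all

lemma mat_mult_smult:
  fixes A B :: "'a :: comm_semiring_0 mat"
  assumes "dim_col A = dim_row B"
  shows "A * (c \<cdot>\<^sub>m B) = c \<cdot>\<^sub>m (A * B)"
  using assms by (intro mult_smult_distrib[of A "dim_row A" "dim_row B" B "dim_col B" c] carrier_matI) simp_all

lemma mat_smult_mult:
  fixes A B :: "'a :: comm_semiring_0 mat"
  assumes "dim_col A = dim_row B"
  shows "(c \<cdot>\<^sub>m A) * B = c \<cdot>\<^sub>m (A * B)"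
  using assms by (intro mult_smult_assoc_mat[of A "dim_row A" "dim_row B" B "dim_col B" c] carrier_matI) simp_all

lemma mat_one_mult:
  fixes A :: "'a :: semiring_1 mat"
  shows "dim_row A = n \<Longrightarrow> 1\<^sub>m n * A = A"
  by (auto intro: left_mult_one_mat)

lemma mat_mult_one:
  fixes A :: "'a :: semiring_1 mat"
  shows "dim_col A = n \<Longrightarrow> A * 1\<^sub>m n = A"
  by (auto intro: right_mult_one_mat)

lemma mat_smult_smult:
  fixes A :: "'a :: comm_semiring_1 mat"
  shows "c \<cdot>\<^sub>m (d \<cdot>\<^sub>m A) = (c * d) \<cdot>\<^sub>m A"
  by (rule eq_matI) (auto simp: mult.assoc)

lemmas mat_distribs = mat_mult_add mat_add_mult mat_mult_minus mat_minus_mult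
  mat_mult_smult mat_smult_mult mat_one_mult mat_mult_one

lemma mat_vec_assoc:
  fixes A B :: "'a :: semiring_0 mat"
  assumes "dim_col A = dim_row B" "dim_col B = dim_vec v"
  shows "(A * B) *\<^sub>v v = A *\<^sub>v (B *\<^sub>v v)"
  using assms
  by (intro assoc_mult_mat_vec[of A "dim_row A" "dim_row B" B "dim_vec v" v] carrier_matI carrier_vecI) simp_all

lemma mat_mult_eqI_vec:
  fixes A B :: "'a :: semiring_1 mat"
  assumes "A \<in> carrier_mat m n" "B \<in> carrier_mat m n"
    and "\<And>v. v \<in> carrier_vec n \<Longrightarrow> A *\<^sub>v v = B *\<^sub>v v"
  shows "A = B"
proof (rule eq_matI)
  fix i j assume ij: "i < dim_row B" "j < dim_col B"
  have "col A j = A *\<^sub>v unit_vec n j" "col B j = B *\<^sub>v unit_vec n j"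
    using assms(1,2) ij by (auto intro!: eq_vecI)
  then have "col A j = col B j" using assms(3) by simp
  then show "A $$ (i, j) = B $$ (i, j)" using ij assms
    by (metis carrier_matD index_col)
qed (use assms in auto)

section \<open>Linear systems, kernels and inverses\<close>

lemma mat_choose_cols:
  assumes "\<And>j. j < n \<Longrightarrow> \<exists>x \<in> carrier_vec m. R j x"
  obtains A where "A \<in> carrier_mat m n" "\<And>j. j < n \<Longrightarrow> R j (col A j)"
proof -
  from assms obtain f where f: "\<And>j. j < n \<Longrightarrow> f j \<in> carrier_vec m \<and> R j (f j)" by metis
  let ?A = "mat m n (\<lambda>(i, j). f j $ i)"
  have "col ?A j = f j" if "j < n" for j using f[OF that] that by (auto intro!: eq_vecI)
  then show thesis using f by (intro that[of ?A]) auto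
qed

text \<open>Solving for the unit vectors gives the columns of \<open>B\<close>. Linear sections of
  surjections, coordinates on submodules and retractions onto kernels are obtained this way.\<close>

lemma mat_factor_through:
  fixes A :: "'a :: semiring_1 mat"
  assumes A: "A \<in> carrier_mat m n" and C: "C \<in> carrier_mat m k"
    and "\<And>v. v \<in> carrier_vec k \<Longrightarrow> \<exists>x \<in> carrier_vec n. A *\<^sub>v x = C *\<^sub>v v"
  obtains B where "B \<in> carrier_mat n k" "A * B = C"
proof -
  have "\<exists>x \<in> carrier_vec n. A *\<^sub>v x = col C j" if "j < k" for j
  proof -
    have "col C j = C *\<^sub>v unit_vec k j" using C that by (auto intro!: eq_vecI)
    then show ?thesis using assms(3)[of "unit_vec k j"] by auto
  qed
  then obtain B where B: "B \<in> carrier_mat n k" "\<And>j. j < k \<Longrightarrow> A *\<^sub>v col B j = col C j"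
    using mat_choose_cols[where R = "\<lambda>j x. A *\<^sub>v x = col C j"] by blast
  have "A * B = C"
  proof (rule eq_matI)
    fix i j assume ij: "i < dim_row C" "j < dim_col C"
    have "(A * B) $$ (i, j) = (A *\<^sub>v col B j) $ i" using ij A B(1) C by auto
    also have "\<dots> = col C j $ i" using B(2) ij C by auto
    finally show "(A * B) $$ (i, j) = C $$ (i, j)" using ij C by simp
  qed (use A B C in auto)
  with B show thesis using that by blast
qed

lemma ker_nontrivial:
  fixes A :: "'a :: field mat"
  assumes A: "A \<in> carrier_mat m n" and "m < n"
  shows "\<exists>v \<in> carrier_vec n. v \<noteq> 0\<^sub>v n \<and> A *\<^sub>v v = 0\<^sub>v m"
proof -
  \<comment> \<open>Padding with zero rows makes the matrix square. Its last row vanishes because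
    \<open>m < n\<close>, so its determinant is zero and it has a kernel vector.\<close>
  define A' where "A' = mat n n (\<lambda>(i, j). if i < m then A $$ (i, j) else 0)"
  have A': "A' \<in> carrier_mat n n" by (simp add: A'_def)
  have "transpose_mat A' *\<^sub>v unit_vec n (n - 1) = 0\<^sub>v n"
    using assms A' by (auto intro!: eq_vecI simp: A'_def)
  then have "det (transpose_mat A') = 0"
    using det_0_iff_vec_prod_zero_field[of "transpose_mat A'" n] A' \<open>m < n\<close>
    by (auto intro!: exI[of _ "unit_vec n (n - 1)"])
  then have "det A' = 0" using det_transpose[OF A'] by simp
  then obtain v where v: "v \<in> carrier_vec n" "v \<noteq> 0\<^sub>v n" "A' *\<^sub>v v = 0\<^sub>v n"
    using det_0_iff_vec_prod_zero_field[OF A'] by auto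
  have "A *\<^sub>v v = 0\<^sub>v m"
  proof (rule eq_vecI)
    fix i assume "i < dim_vec (0\<^sub>v m :: 'a vec)"
    then have i: "i < m" by simp
    have "row A' i = row A i" using i assms by (auto simp: A'_def intro!: eq_vecI)
    then have "(A *\<^sub>v v) $ i = (A' *\<^sub>v v) $ i" using i assms A' by auto
    then show "(A *\<^sub>v v) $ i = 0\<^sub>v m $ i" using i v(3) assms by simp
  qed (use A in auto)
  with v show ?thesis by blast
qed

lemma inj_mat_iff:
  fixes A :: "'a :: field mat"
  assumes A: "A \<in> carrier_mat m n"
  shows "inj_on (\<lambda>v. A *\<^sub>v v) (carrier_vec n) \<longleftrightarrow>
    (\<forall>v \<in> carrier_vec n. A *\<^sub>v v = 0\<^sub>v m \<longrightarrow> v = 0\<^sub>v n)"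
proof
  assume inj: "inj_on (\<lambda>v. A *\<^sub>v v) (carrier_vec n)"
  show "\<forall>v \<in> carrier_vec n. A *\<^sub>v v = 0\<^sub>v m \<longrightarrow> v = 0\<^sub>v n"
  proof (intro ballI impI)
    fix v assume v: "v \<in> carrier_vec n" "A *\<^sub>v v = 0\<^sub>v m"
    have "A *\<^sub>v 0\<^sub>v n = 0\<^sub>v m" using A by auto
    with v show "v = 0\<^sub>v n" using inj_onD[OF inj, of v "0\<^sub>v n"] by auto
  qed
next
  assume R: "\<forall>v \<in> carrier_vec n. A *\<^sub>v v = 0\<^sub>v m \<longrightarrow> v = 0\<^sub>v n"
  show "inj_on (\<lambda>v. A *\<^sub>v v) (carrier_vec n)"
  proof (rule inj_onI)
    fix v w assume v: "v \<in> carrier_vec n" and w: "w \<in> carrier_vec n" and eq: "A *\<^sub>v v = A *\<^sub>v w"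
    have "A *\<^sub>v (v - w) = A *\<^sub>v v - A *\<^sub>v w" using A v w by (rule mult_minus_distrib_mat_vec)
    then have "A *\<^sub>v (v - w) = 0\<^sub>v m" using A w eq by auto
    with R v w have *: "v - w = 0\<^sub>v n" by auto
    show "v = w"
    proof (rule eq_vecI)
      fix i assume "i < dim_vec w"
      then have "(v - w) $ i = 0" using * w by auto
      then show "v $ i = w $ i" using \<open>i < dim_vec w\<close> v w by auto
    qed (use v w in auto)
  qed
qed

text \<open>If \<open>k\<close> exceeded \<open>m\<close>, then \<open>B\<close> would kill a
  nonzero vector. This serves as the rank bound for identities that factor through a smaller
  space.\<close>

lemma mat_left_inverse_dim:
  fixes A B :: "'a :: field mat"
  assumes A: "A \<in> carrier_mat k m" and B: "B \<in> carrier_mat m k" and AB: "A * B = 1\<^sub>m k"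
  shows "k \<le> m"
proof (rule ccontr)
  assume "\<not> k \<le> m"
  then obtain v where v: "v \<in> carrier_vec k" "v \<noteq> 0\<^sub>v k" "B *\<^sub>v v = 0\<^sub>v m"
    using ker_nontrivial[OF B] by auto
  have "v = (A * B) *\<^sub>v v" using AB v by simp
  also have "\<dots> = A *\<^sub>v (B *\<^sub>v v)" using A B v by (intro mat_vec_assoc) auto
  also have "\<dots> = 0\<^sub>v k" using A v by auto
  finally show False using v by simp
qed

section \<open>Kronecker products\<close>

lemma sum_div_mod:
  fixes f :: "nat \<Rightarrow> nat \<Rightarrow> 'a :: comm_monoid_add"
  shows "(\<Sum>k<n * m. f (k div m) (k mod m)) = (\<Sum>i<n. \<Sum>j<m. f i j)"
proof -
  have "(\<Sum>k<n * m. f (k div m) (k mod m)) = (\<Sum>i<n. \<Sum>k = i * m..<i * m + m. f (k div m) (k mod m))"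
    by (rule sum.nat_group[symmetric])
  also have "\<dots> = (\<Sum>i<n. \<Sum>j<m. f i j)"
  proof (rule sum.cong[OF refl])
    fix i
    have "(\<Sum>k = i * m..<i * m + m. f (k div m) (k mod m))
      = (\<Sum>j = 0..<m. f ((j + i * m) div m) ((j + i * m) mod m))"
      using sum.shift_bounds_nat_ivl[of "\<lambda>k. f (k div m) (k mod m)" 0 "i * m" m]
      by (simp add: add.commute)
    also have "\<dots> = (\<Sum>j<m. f i j)" by (auto simp: lessThan_atLeast0 intro!: sum.cong)
    finally show "(\<Sum>k = i * m..<i * m + m. f (k div m) (k mod m)) = (\<Sum>j<m. f i j)" .
  qed
  finally show ?thesis .
qed

lemma div_mod_bounds:
  fixes i n m :: nat
  assumes "i < n * m"
  shows "i div m < n" "i mod m < m"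
  using assms less_mult_imp_div_less[OF assms] by (cases "m = 0"; simp)+

lemma kron_dim [simp]:
  "dim_row (kronecker A B) = dim_row A * dim_row B"
  "dim_col (kronecker A B) = dim_col A * dim_col B"
  by (auto simp: kronecker_def)

lemma kron_carrier [intro]:
  "A \<in> carrier_mat m n \<Longrightarrow> B \<in> carrier_mat k l \<Longrightarrow> kronecker A B \<in> carrier_mat (m * k) (n * l)"
  by (auto simp: kronecker_def)

lemma kron_index:
  assumes "i < dim_row A * dim_row B" "j < dim_col A * dim_col B"
  shows "kronecker A B $$ (i, j)
    = A $$ (i div dim_row B, j div dim_col B) * B $$ (i mod dim_row B, j mod dim_col B)"
  using assms by (simp add: kronecker_def)

lemma kron_mult:
  fixes A B C D :: "'a :: comm_semiring_0 mat"
  assumes "dim_col A = dim_row C" "dim_col B = dim_row D"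
  shows "kronecker A B * kronecker C D = kronecker (A * C) (B * D)"
proof (rule eq_matI)
  fix i j
  assume "i < dim_row (kronecker (A * C) (B * D))" "j < dim_col (kronecker (A * C) (B * D))"
  then have i: "i < dim_row A * dim_row B" and j: "j < dim_col C * dim_col D" by auto
  note b = div_mod_bounds[OF i] div_mod_bounds[OF j]
  let ?n = "dim_row C" and ?m = "dim_row D"
  have "(kronecker A B * kronecker C D) $$ (i, j)
    = (\<Sum>k<?n * ?m. kronecker A B $$ (i, k) * kronecker C D $$ (k, j))"
    using i j assms by (simp add: scalar_prod_def lessThan_atLeast0)
  \<comment> \<open>Regrouped as a function of quotient and remainder, the shape in which
    \<open>sum_div_mod\<close> turns the sum over the tensor basis into a double sum.\<close>
  also have "\<dots> = (\<Sum>k<?n * ?m. (\<lambda>x y. (A $$ (i div dim_row B, x) * B $$ (i mod dim_row B, y))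
      * (C $$ (x, j div dim_col D) * D $$ (y, j mod dim_col D))) (k div ?m) (k mod ?m))"
    using i j assms by (intro sum.cong) (auto simp: kron_index)
  also have "\<dots> = (\<Sum>x<?n. \<Sum>y<?m. (A $$ (i div dim_row B, x) * B $$ (i mod dim_row B, y))
      * (C $$ (x, j div dim_col D) * D $$ (y, j mod dim_col D)))"
    by (rule sum_div_mod)
  also have "\<dots> = (\<Sum>x<?n. A $$ (i div dim_row B, x) * C $$ (x, j div dim_col D))
      * (\<Sum>y<?m. B $$ (i mod dim_row B, y) * D $$ (y, j mod dim_col D))"
    by (simp add: sum_product mult_ac)
  also have "\<dots> = kronecker (A * C) (B * D) $$ (i, j)"
    using i j b assms by (simp add: kron_index scalar_prod_def lessThan_atLeast0)
  finally show "(kronecker A B * kronecker C D) $$ (i, j) = kronecker (A * C) (B * D) $$ (i, j)" .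
qed auto

lemma kron_add_left:
  fixes A A' B :: "'a :: semiring_0 mat"
  assumes "dim_row A = dim_row A'" "dim_col A = dim_col A'"
  shows "kronecker (A + A') B = kronecker A B + kronecker A' B"
  using assms by (auto intro!: eq_matI simp: kron_index div_mod_bounds distrib_right)

lemma kron_add_right:
  fixes A B B' :: "'a :: semiring_0 mat"
  assumes "dim_row B = dim_row B'" "dim_col B = dim_col B'"
  shows "kronecker A (B + B') = kronecker A B + kronecker A B'"
  using assms by (auto intro!: eq_matI simp: kron_index div_mod_bounds distrib_left)

lemma kron_minus_left:
  fixes A A' B :: "'a :: ring mat"
  assumes "dim_row A = dim_row A'" "dim_col A = dim_col A'"
  shows "kronecker (A - A') B = kronecker A B - kronecker A' B"
  using assms by (auto intro!: eq_matI simp: kron_index div_mod_bounds left_diff_distrib)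

lemma kron_minus_right:
  fixes A B B' :: "'a :: ring mat"
  assumes "dim_row B = dim_row B'" "dim_col B = dim_col B'"
  shows "kronecker A (B - B') = kronecker A B - kronecker A B'"
  using assms by (auto intro!: eq_matI simp: kron_index div_mod_bounds right_diff_distrib)

lemma kron_smult_left:
  fixes A B :: "'a :: semiring_0 mat"
  shows "kronecker (c \<cdot>\<^sub>m A) B = c \<cdot>\<^sub>m kronecker A B"
  by (auto intro!: eq_matI simp: kron_index div_mod_bounds mult.assoc)

lemma kron_smult_right:
  fixes A B :: "'a :: comm_semiring_0 mat"
  shows "kronecker A (c \<cdot>\<^sub>m B) = c \<cdot>\<^sub>m kronecker A B"
  by (auto intro!: eq_matI simp: kron_index div_mod_bounds mult.left_commute)

lemma kron_one: "kronecker (1\<^sub>m m) (1\<^sub>m n) = (1\<^sub>m (m * n) :: 'a :: semiring_1 mat)"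
proof (rule eq_matI)
  fix i j assume "i < dim_row (1\<^sub>m (m * n) :: 'a mat)" "j < dim_col (1\<^sub>m (m * n) :: 'a mat)"
  then have ij: "i < m * n" "j < m * n" by auto
  have "i = j \<longleftrightarrow> i div n = j div n \<and> i mod n = j mod n"
    by (metis div_mult_mod_eq)
  then show "kronecker (1\<^sub>m m) (1\<^sub>m n) $$ (i, j) = (1\<^sub>m (m * n) :: 'a mat) $$ (i, j)"
    using ij by (auto simp: kron_index div_mod_bounds)
qed auto

lemma kron_zero_left:
  "kronecker (0\<^sub>m m n) B = (0\<^sub>m (m * dim_row B) (n * dim_col B) :: 'a :: semiring_0 mat)"
  by (auto intro!: eq_matI simp: kron_index div_mod_bounds)

lemma kron_zero_right:
  "kronecker B (0\<^sub>m m n) = (0\<^sub>m (dim_row B * m) (dim_col B * n) :: 'a :: semiring_0 mat)"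
  by (auto intro!: eq_matI simp: kron_index div_mod_bounds)

text \<open>The lexicographic order of the basis makes associativity an equality of matrices, not
  just an isomorphism, so tensor products of modules can be rebracketed by rewriting.\<close>

lemma kron_assoc:
  fixes A B C :: "'a :: semiring_0 mat"
  shows "kronecker (kronecker A B) C = kronecker A (kronecker B C)"
proof (rule eq_matI)
  fix i j
  assume "i < dim_row (kronecker A (kronecker B C))" "j < dim_col (kronecker A (kronecker B C))"
  then have i: "i < (dim_row A * dim_row B) * dim_row C" and j: "j < (dim_col A * dim_col B) * dim_col C"
    and i': "i < dim_row A * (dim_row B * dim_row C)" and j': "j < dim_col A * (dim_col B * dim_col C)"
    by (auto simp: mult.assoc)
  have dd: "x div m div k = x div (k * m)" for x m k :: nat
    by (metis div_mult2_eq mult.commute)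
  have mm: "x mod (k * m) div m = x div m mod k" for x m k :: nat
    by (cases "m = 0") (simp_all add: mod_mult2_eq mult.commute[of k m])
  have mr: "x mod (k * m) mod m = x mod m" for x m k :: nat
    by (simp add: mod_mult_right_eq mod_mod_cancel)
  show "kronecker (kronecker A B) C $$ (i, j) = kronecker A (kronecker B C) $$ (i, j)"
    using i j i' j' div_mod_bounds[OF i] div_mod_bounds[OF j] div_mod_bounds[OF i'] div_mod_bounds[OF j']
    by (simp add: kron_index dd mm mr mult.assoc)
qed (auto simp: mult.assoc)

lemma kron_one_left: "kronecker (1\<^sub>m 1) A = (A :: 'a :: semiring_1 mat)"
  by (auto intro!: eq_matI simp: kron_index)

lemma kron_one_right: "kronecker A (1\<^sub>m 1) = (A :: 'a :: semiring_1 mat)"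
  by (auto intro!: eq_matI simp: kron_index)

lemma kron_transpose:
  "transpose_mat (kronecker A B) = kronecker (transpose_mat A) (transpose_mat B)"
  by (auto intro!: eq_matI simp: kron_index div_mod_bounds)

text \<open>The zero matrix depends on the dimensions, so a sum over an arbitrary index set has to
  carry them; entries are summed one at a time.\<close>

definition msum :: "nat \<Rightarrow> nat \<Rightarrow> ('b \<Rightarrow> 'a mat) \<Rightarrow> 'b set \<Rightarrow> 'a :: comm_monoid_add mat" where
  "msum m n F S = mat m n (\<lambda>(i, j). \<Sum>s\<in>S. F s $$ (i, j))"

lemma msum_dim [simp]: "dim_row (msum m n F S) = m" "dim_col (msum m n F S) = n"
  by (auto simp: msum_def)

lemma msum_carrier [simp, intro]: "msum m n F S \<in> carrier_mat m n"
  by (auto simp: msum_def)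

lemma msum_cong:
  "S = S' \<Longrightarrow> (\<And>s. s \<in> S' \<Longrightarrow> F s = G s) \<Longrightarrow> msum m n F S = msum m n G S'"
  by (auto simp: msum_def intro!: eq_matI sum.cong)

lemma mult_msum:
  fixes A :: "'a :: semiring_0 mat"
  assumes "A \<in> carrier_mat k m" "\<And>s. s \<in> S \<Longrightarrow> F s \<in> carrier_mat m n"
  shows "A * msum m n F S = msum k n (\<lambda>s. A * F s) S"
proof (rule eq_matI)
  fix i j assume "i < dim_row (msum k n (\<lambda>s. A * F s) S)" "j < dim_col (msum k n (\<lambda>s. A * F s) S)"
  then have ij: "i < k" "j < n" by auto
  have "(A * msum m n F S) $$ (i, j) = (\<Sum>l = 0..<m. A $$ (i, l) * (\<Sum>s\<in>S. F s $$ (l, j)))"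
    using assms ij by (auto simp: scalar_prod_def msum_def)
  also have "\<dots> = (\<Sum>s\<in>S. \<Sum>l = 0..<m. A $$ (i, l) * F s $$ (l, j))"
    by (subst sum.swap) (simp add: sum_distrib_left)
  also have "\<dots> = (\<Sum>s\<in>S. (A * F s) $$ (i, j))"
  proof (rule sum.cong[OF refl])
    fix s assume "s \<in> S"
    then show "(\<Sum>l = 0..<m. A $$ (i, l) * F s $$ (l, j)) = (A * F s) $$ (i, j)"
      using assms(1) assms(2)[of s] ij by (auto simp: scalar_prod_def)
  qed
  finally show "(A * msum m n F S) $$ (i, j) = msum k n (\<lambda>s. A * F s) S $$ (i, j)"
    using ij by (simp add: msum_def)
qed (use assms in auto)

lemma msum_mult:
  fixes A :: "'a :: semiring_0 mat"
  assumes "A \<in> carrier_mat n k" "\<And>s. s \<in> S \<Longrightarrow> F s \<in> carrier_mat m n"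
  shows "msum m n F S * A = msum m k (\<lambda>s. F s * A) S"
proof (rule eq_matI)
  fix i j assume "i < dim_row (msum m k (\<lambda>s. F s * A) S)" "j < dim_col (msum m k (\<lambda>s. F s * A) S)"
  then have ij: "i < m" "j < k" by auto
  have "(msum m n F S * A) $$ (i, j) = (\<Sum>l = 0..<n. (\<Sum>s\<in>S. F s $$ (i, l)) * A $$ (l, j))"
    using assms ij by (auto simp: scalar_prod_def msum_def)
  also have "\<dots> = (\<Sum>s\<in>S. \<Sum>l = 0..<n. F s $$ (i, l) * A $$ (l, j))"
    by (subst sum.swap) (simp add: sum_distrib_right)
  also have "\<dots> = (\<Sum>s\<in>S. (F s * A) $$ (i, j))"
  proof (rule sum.cong[OF refl])
    fix s assume "s \<in> S"
    then show "(\<Sum>l = 0..<n. F s $$ (i, l) * A $$ (l, j)) = (F s * A) $$ (i, j)"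
      using assms(1) assms(2)[of s] ij by (auto simp: scalar_prod_def)
  qed
  finally show "(msum m n F S * A) $$ (i, j) = msum m k (\<lambda>s. F s * A) S $$ (i, j)"
    using ij by (simp add: msum_def)
qed (use assms in auto)

lemma msum_add:
  assumes "\<And>s. s \<in> S \<Longrightarrow> F s \<in> carrier_mat m n" "\<And>s. s \<in> S \<Longrightarrow> H s \<in> carrier_mat m n"
  shows "msum m n F S + msum m n H S = msum m n (\<lambda>s. F s + H s) S"
  using assms[THEN carrier_matD(1)] assms[THEN carrier_matD(2)]
  by (auto intro!: eq_matI sum.cong simp: msum_def sum.distrib[symmetric])

lemma msum_smult:
  fixes F :: "'b \<Rightarrow> 'a :: semiring_0 mat"
  assumes "\<And>s. s \<in> S \<Longrightarrow> F s \<in> carrier_mat m n"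
  shows "c \<cdot>\<^sub>m msum m n F S = msum m n (\<lambda>s. c \<cdot>\<^sub>m F s) S"
  using assms[THEN carrier_matD(1)] assms[THEN carrier_matD(2)]
  by (auto intro!: eq_matI sum.cong simp: msum_def sum_distrib_left)

lemma msum_zero [simp]: "msum m n (\<lambda>_. 0\<^sub>m m n) S = 0\<^sub>m m n"
  by (auto intro!: eq_matI simp: msum_def)

lemma msum_reindex_bij_betw:
  "bij_betw h S S' \<Longrightarrow> msum m n (\<lambda>s. F (h s)) S = msum m n F S'"
  by (auto intro!: eq_matI simp: msum_def sum.reindex_bij_betw[of h S S' "\<lambda>s. F s $$ _"])

lemma kron_msum_left:
  fixes B :: "'a :: semiring_0 mat"
  assumes "B \<in> carrier_mat k l" "\<And>s. s \<in> S \<Longrightarrow> F s \<in> carrier_mat m n"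
  shows "kronecker (msum m n F S) B = msum (m * k) (n * l) (\<lambda>s. kronecker (F s) B) S"
proof (rule eq_matI)
  fix i j assume "i < dim_row (msum (m * k) (n * l) (\<lambda>s. kronecker (F s) B) S)"
    "j < dim_col (msum (m * k) (n * l) (\<lambda>s. kronecker (F s) B) S)"
  then have ij: "i < m * k" "j < n * l" by auto
  have "(\<Sum>s\<in>S. kronecker (F s) B $$ (i, j))
    = (\<Sum>s\<in>S. F s $$ (i div k, j div l) * B $$ (i mod k, j mod l))"
  proof (rule sum.cong[OF refl])
    fix s assume "s \<in> S"
    then show "kronecker (F s) B $$ (i, j) = F s $$ (i div k, j div l) * B $$ (i mod k, j mod l)"
      using assms(1) assms(2)[of s] ij by (subst kron_index) auto
  qed
  then show "kronecker (msum m n F S) B $$ (i, j) = msum (m * k) (n * l) (\<lambda>s. kronecker (F s) B) S $$ (i, j)"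
    using ij assms by (simp add: kron_index msum_def div_mod_bounds sum_distrib_right)
qed (use assms in auto)

lemma kron_msum_right:
  fixes B :: "'a :: semiring_0 mat"
  assumes "B \<in> carrier_mat k l" "\<And>s. s \<in> S \<Longrightarrow> F s \<in> carrier_mat m n"
  shows "kronecker B (msum m n F S) = msum (k * m) (l * n) (\<lambda>s. kronecker B (F s)) S"
proof (rule eq_matI)
  fix i j assume "i < dim_row (msum (k * m) (l * n) (\<lambda>s. kronecker B (F s)) S)"
    "j < dim_col (msum (k * m) (l * n) (\<lambda>s. kronecker B (F s)) S)"
  then have ij: "i < k * m" "j < l * n" by auto
  have "(\<Sum>s\<in>S. kronecker B (F s) $$ (i, j))
    = (\<Sum>s\<in>S. B $$ (i div m, j div n) * F s $$ (i mod m, j mod n))"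
  proof (rule sum.cong[OF refl])
    fix s assume "s \<in> S"
    then show "kronecker B (F s) $$ (i, j) = B $$ (i div m, j div n) * F s $$ (i mod m, j mod n)"
      using assms(1) assms(2)[of s] ij by (subst kron_index) auto
  qed
  then show "kronecker B (msum m n F S) $$ (i, j) = msum (k * m) (l * n) (\<lambda>s. kronecker B (F s)) S $$ (i, j)"
    using ij assms by (simp add: kron_index msum_def div_mod_bounds sum_distrib_left)
qed (use assms in auto)

section \<open>Modules and relative traces\<close>

text \<open>Applies a relation between two neighbouring factors inside a product that is associated
  to the right.\<close>

lemma mat_rewr:
  fixes A B C X :: "'a :: semiring_0 mat"
  assumes "A * B = C" "dim_col A = dim_row B" "dim_col B = dim_row X"
  shows "A * (B * X) = C * X"
  using assms by (simp flip: mat_assoc)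

lemma mat_mult_index:
  fixes A B :: "'a :: semiring_0 mat"
  assumes "A \<in> carrier_mat m n" "B \<in> carrier_mat n k" "i < m" "j < k"
  shows "(A * B) $$ (i, j) = (\<Sum>l = 0..<n. A $$ (i, l) * B $$ (l, j))"
  using assms by (auto simp: scalar_prod_def)

section \<open>Modules and homomorphisms\<close>

lemma is_gmodD:
  assumes "is_gmod G V"
  shows "\<And>g. g \<in> carrier G \<Longrightarrow> gact V g \<in> gmats V V"
    and "gact V \<one>\<^bsub>G\<^esub> = gid V"
    and "\<And>g h. g \<in> carrier G \<Longrightarrow> h \<in> carrier G \<Longrightarrow> gact V (g \<otimes>\<^bsub>G\<^esub> h) = gact V g * gact V h"
  using assms by (auto simp: is_gmod_def)

lemma is_gmod_dim:
  assumes "is_gmod G V" "g \<in> carrier G"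
  shows "dim_row (gact V g) = gdim V" "dim_col (gact V g) = gdim V"
  using is_gmodD(1)[OF assms] by auto

lemma is_ghomD:
  assumes "is_ghom G V W A"
  shows "A \<in> gmats V W" "dim_row A = gdim W" "dim_col A = gdim V"
    and "\<And>g. g \<in> carrier G \<Longrightarrow> A * gact V g = gact W g * A"
  using assms by (auto simp: is_ghom_def)

lemma ghom_one: "is_gmod G V \<Longrightarrow> is_ghom G V V (gid V)"
  by (auto simp: is_ghom_def mat_distribs is_gmod_dim)

lemma ghom_comp:
  assumes V: "is_gmod G V" and W: "is_gmod G W" and U: "is_gmod G U"
    and A: "is_ghom G V W A" and B: "is_ghom G U V B"
  shows "is_ghom G U W (A * B)"
  unfolding is_ghom_def
proof (intro conjI ballI)
  fix g assume g: "g \<in> carrier G"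
  note [simp] = is_ghomD[OF A] is_ghomD[OF B] is_gmod_dim[OF V g] is_gmod_dim[OF W g] is_gmod_dim[OF U g]
  have "A * B * gact U g = A * (gact V g * B)" using g by (simp add: mat_assoc)
  also have "\<dots> = gact W g * (A * B)" using g by (simp flip: mat_assoc)
  finally show "A * B * gact U g = gact W g * (A * B)" .
qed (use is_ghomD[OF A] is_ghomD[OF B] in auto)

lemma ghom_add:
  assumes "is_gmod G V" "is_gmod G W" "is_ghom G V W A" "is_ghom G V W B"
  shows "is_ghom G V W (A + B)"
  using assms is_ghomD[OF assms(3)] is_ghomD[OF assms(4)]
  by (auto simp: is_ghom_def mat_distribs is_gmod_dim)

lemma ghom_minus:
  assumes "is_gmod G V" "is_gmod G W" "is_ghom G V W A" "is_ghom G V W B"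
  shows "is_ghom G V W (A - B)"
  using assms is_ghomD[OF assms(3)] is_ghomD[OF assms(4)]
  by (auto simp: is_ghom_def mat_distribs is_gmod_dim intro: minus_carrier_mat)

lemma ghom_smult:
  assumes "is_gmod G V" "is_gmod G W" "is_ghom G V W A"
  shows "is_ghom G V W (c \<cdot>\<^sub>m A)"
  using assms is_ghomD[OF assms(3)]
  by (auto simp: is_ghom_def mat_distribs is_gmod_dim)

section \<open>Tensor products of modules\<close>

lemma gtensor_simps [simp]:
  "gdim (gtensor V W) = gdim V * gdim W"
  "gact (gtensor V W) g = kronecker (gact V g) (gact W g)"
  by (auto simp: gtensor_def)

lemma gtriv_simps [simp]: "gdim gtriv = 1" "gact gtriv g = 1\<^sub>m 1"
  by (auto simp: gtriv_def)

lemma is_gmod_gtriv: "is_gmod G gtriv"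
  by (auto simp: is_gmod_def)

lemma is_gmod_gtensor:
  assumes V: "is_gmod G V" and W: "is_gmod G W"
  shows "is_gmod G (gtensor V W)"
  using is_gmodD[OF V] is_gmodD[OF W]
  by (auto simp: is_gmod_def kron_one kron_mult is_gmod_dim[OF V] is_gmod_dim[OF W])

lemma gtensor_assoc: "gtensor (gtensor U V) W = gtensor U (gtensor V W)"
  by (simp add: gtensor_def kron_assoc mult.assoc)

lemma gtensor_gtriv_left: "gtensor gtriv V = V"
  by (cases V) (simp add: gtensor_def kron_one_left del: One_nat_def)

lemma gtensor_gtriv_right: "gtensor V gtriv = V"
  by (cases V) (simp add: gtensor_def kron_one_right del: One_nat_def)

lemma ghom_kron:
  assumes V: "is_gmod G V" and W: "is_gmod G W" and X: "is_gmod G X" and Y: "is_gmod G Y"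
    and A: "is_ghom G V W A" and B: "is_ghom G X Y B"
  shows "is_ghom G (gtensor V X) (gtensor W Y) (kronecker A B)"
  using is_ghomD[OF A] is_ghomD[OF B]
  by (auto simp: is_ghom_def kron_mult is_gmod_dim[OF V] is_gmod_dim[OF W] is_gmod_dim[OF X]
      is_gmod_dim[OF Y])

section \<open>Relative traces over a finite group\<close>

locale fin_group = group G for G (structure) +
  assumes finite_carrier: "finite (carrier G)"
begin

lemma gact_inv:
  assumes "is_gmod G V" "g \<in> carrier G"
  shows "gact V g * gact V (inv g) = gid V" "gact V (inv g) * gact V g = gid V"
  using is_gmodD(2,3)[OF assms(1)] assms(2) by (metis inv_closed r_inv l_inv)+

text \<open>The relative trace from the trivial subgroup to \<open>G\<close>.\<close>

definition gtrace :: "('a, 'f :: field) gmod \<Rightarrow> ('a, 'f) gmod \<Rightarrow> 'f mat \<Rightarrow> 'f mat" where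
  "gtrace V W f = msum (gdim W) (gdim V) (\<lambda>g. gact W g * f * gact V (inv g)) (carrier G)"

text \<open>The image of the relative trace is an ideal of the module category, closed under
  tensoring with homomorphisms; its members are the zero maps of the stable category.\<close>

definition tmap :: "('a, 'f :: field) gmod \<Rightarrow> ('a, 'f) gmod \<Rightarrow> 'f mat \<Rightarrow> bool" where
  "tmap V W A \<longleftrightarrow> (\<exists>f \<in> gmats V W. A = gtrace V W f)"

lemma conj_carrier:
  assumes V: "is_gmod G V" and W: "is_gmod G W" and f: "f \<in> gmats V W"
    and g: "g \<in> carrier G"
  shows "gact W g * f * gact V (inv g) \<in> gmats V W"
  using f is_gmodD(1)[OF V, of "inv g"] is_gmodD(1)[OF W g] g by (auto intro!: carrier_matI)

lemma bij_betw_left_mult: "h \<in> carrier G \<Longrightarrow> bij_betw (\<lambda>g. h \<otimes> g) (carrier G) (carrier G)"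
  by (rule bij_betw_byWitness[where f' = "\<lambda>g. inv h \<otimes> g"]) (auto simp: inv_solve_left' m_assoc[symmetric])

text \<open>Shifting the summation index by \<open>h\<close> on the left absorbs
  \<open>gact V h\<close> on the right of each summand and releases \<open>gact W h\<close> on its
  left.\<close>

lemma gtrace_hom:
  assumes V: "is_gmod G V" and W: "is_gmod G W" and f: "f \<in> gmats V W"
  shows "is_ghom G V W (gtrace V W f)"
  unfolding is_ghom_def
proof (intro conjI ballI)
  fix h assume h: "h \<in> carrier G"
  let ?F = "\<lambda>g. gact W g * f * gact V (inv g)"
  let ?m = "msum (gdim W) (gdim V)"
  note c = conj_carrier[OF V W f] is_gmodD(1)[OF V h] is_gmodD(1)[OF W h]
  note dV = is_gmod_dim[OF V] and dW = is_gmod_dim[OF W]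
  have step: "?F (h \<otimes> g) * gact V h = gact W h * ?F g" if g: "g \<in> carrier G" for g
  proof -
    have "gact V (inv (h \<otimes> g)) * gact V h = gact V (inv (h \<otimes> g) \<otimes> h)"
      using g h is_gmodD(3)[OF V, of "inv (h \<otimes> g)" h] by simp
    also have "inv (h \<otimes> g) \<otimes> h = inv g" using g h by (simp add: inv_mult_group m_assoc)
    finally have e: "gact V (inv (h \<otimes> g)) * gact V h = gact V (inv g)" .
    have "?F (h \<otimes> g) * gact V h = gact W h * gact W g * f * (gact V (inv (h \<otimes> g)) * gact V h)"
      using g h f by (simp add: is_gmodD(3)[OF W g h] is_gmodD(3)[OF W h g] mat_assoc dV dW)
    then show ?thesis using g h f by (simp add: e mat_assoc dV dW)
  qed
  have "gtrace V W f * gact V h = ?m (\<lambda>g. ?F g * gact V h) (carrier G)"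
    unfolding gtrace_def using c by (intro msum_mult) auto
  also have "\<dots> = ?m (\<lambda>g. ?F (h \<otimes> g) * gact V h) (carrier G)"
    by (rule msum_reindex_bij_betw[OF bij_betw_left_mult[OF h], symmetric, of _ _ "\<lambda>g. ?F g * gact V h"])
  also have "\<dots> = ?m (\<lambda>g. gact W h * ?F g) (carrier G)" by (intro msum_cong refl step)
  also have "\<dots> = gact W h * gtrace V W f"
    unfolding gtrace_def using c by (intro mult_msum[symmetric]) auto
  finally show "gtrace V W f * gact V h = gact W h * gtrace V W f" .
qed (auto simp: gtrace_def)

text \<open>An equivariant map commutes with the group elements in each summand and can be moved
  inside. Together with \<open>gtrace_ghom\<close> this is the ideal property.\<close>

lemma ghom_gtrace:
  assumes V: "is_gmod G V" and W: "is_gmod G W" and X: "is_gmod G X"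
    and f: "f \<in> gmats V W" and B: "is_ghom G W X B"
  shows "B * gtrace V W f = gtrace V X (B * f)"
proof -
  note d = is_gmod_dim[OF V] is_gmod_dim[OF W] is_gmod_dim[OF X] is_ghomD[OF B] inv_closed
  have "B * gtrace V W f = msum (gdim X) (gdim V) (\<lambda>g. B * (gact W g * f * gact V (inv g))) (carrier G)"
    unfolding gtrace_def using conj_carrier[OF V W f] is_ghomD[OF B] by (intro mult_msum) auto
  also have "\<dots> = gtrace V X (B * f)"
    unfolding gtrace_def
  proof (intro msum_cong refl)
    fix g assume g: "g \<in> carrier G"
    have "B * (gact W g * f * gact V (inv g)) = (B * gact W g) * f * gact V (inv g)"
      using f g by (simp add: mat_assoc d(1-6) is_ghomD(2,3)[OF B] inv_closed)
    also have "B * gact W g = gact X g * B" using g by (rule is_ghomD(4)[OF B])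
    finally show "B * (gact W g * f * gact V (inv g)) = gact X g * (B * f) * gact V (inv g)"
      using f g by (simp add: mat_assoc d(1-6) is_ghomD(2,3)[OF B] inv_closed)
  qed
  finally show ?thesis .
qed

lemma gtrace_ghom:
  assumes V: "is_gmod G V" and W: "is_gmod G W" and U: "is_gmod G U"
    and f: "f \<in> gmats V W" and B: "is_ghom G U V B"
  shows "gtrace V W f * B = gtrace U W (f * B)"
proof -
  note d = is_gmod_dim[OF V] is_gmod_dim[OF W] is_gmod_dim[OF U] is_ghomD[OF B] inv_closed
  have "gtrace V W f * B = msum (gdim W) (gdim U) (\<lambda>g. (gact W g * f * gact V (inv g)) * B) (carrier G)"
    unfolding gtrace_def using conj_carrier[OF V W f] is_ghomD[OF B] by (intro msum_mult) auto
  also have "\<dots> = gtrace U W (f * B)"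
    unfolding gtrace_def
  proof (intro msum_cong refl)
    fix g assume g: "g \<in> carrier G"
    have "(gact W g * f * gact V (inv g)) * B = gact W g * f * (gact V (inv g) * B)"
      using f g by (simp add: mat_assoc d)
    also have "gact V (inv g) * B = B * gact U (inv g)" using g by (simp add: d)
    finally show "(gact W g * f * gact V (inv g)) * B = gact W g * (f * B) * gact U (inv g)"
      using f g by (simp add: mat_assoc d)
  qed
  finally show ?thesis .
qed

lemma tmap_hom: "is_gmod G V \<Longrightarrow> is_gmod G W \<Longrightarrow> tmap V W A \<Longrightarrow> is_ghom G V W A"
  by (auto simp: tmap_def gtrace_hom)

lemma tmap_comp_left:
  assumes "is_gmod G V" "is_gmod G W" "is_gmod G X" "is_ghom G W X B" "tmap V W A"
  shows "tmap V X (B * A)"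
  using assms ghom_gtrace[of V W X _ B] is_ghomD(1)[OF assms(4)]
  by (auto simp: tmap_def intro!: bexI[of _ "B * _"])

lemma tmap_comp_right:
  assumes "is_gmod G V" "is_gmod G W" "is_gmod G U" "is_ghom G U V B" "tmap V W A"
  shows "tmap U W (A * B)"
  using assms gtrace_ghom[of V W U _ B] is_ghomD(1)[OF assms(4)]
  by (auto simp: tmap_def intro!: bexI[of _ "_ * B"])

lemma tmap_add:
  assumes V: "is_gmod G V" and W: "is_gmod G W" and "tmap V W A" "tmap V W B"
  shows "tmap V W (A + B)"
proof -
  obtain f h where f: "f \<in> gmats V W" "A = gtrace V W f"
    and h: "h \<in> gmats V W" "B = gtrace V W h"
    using assms by (auto simp: tmap_def)
  have "A + B = gtrace V W (f + h)"
    unfolding f(2) h(2) gtrace_def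
    by (subst msum_add)
      (use conj_carrier[OF V W] f h in \<open>auto intro!: msum_cong simp: mat_distribs is_gmod_dim[OF V] is_gmod_dim[OF W]\<close>)
  then show ?thesis using f h by (auto simp: tmap_def)
qed

lemma tmap_smult:
  assumes V: "is_gmod G V" and W: "is_gmod G W" and "tmap V W A"
  shows "tmap V W (c \<cdot>\<^sub>m A)"
proof -
  obtain f where f: "f \<in> gmats V W" "A = gtrace V W f"
    using assms by (auto simp: tmap_def)
  have "c \<cdot>\<^sub>m A = gtrace V W (c \<cdot>\<^sub>m f)"
    unfolding f(2) gtrace_def
    by (subst msum_smult)
      (use conj_carrier[OF V W] f in \<open>auto intro!: msum_cong simp: mat_distribs is_gmod_dim[OF V] is_gmod_dim[OF W]\<close>)
  then show ?thesis using f by (auto simp: tmap_def)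
qed

lemma tmap_zero:
  assumes V: "is_gmod G V" and W: "is_gmod G W"
  shows "tmap V W (0\<^sub>m (gdim W) (gdim V))"
proof -
  have "gtrace V W (0\<^sub>m (gdim W) (gdim V)) = msum (gdim W) (gdim V) (\<lambda>_. 0\<^sub>m (gdim W) (gdim V)) (carrier G)"
    unfolding gtrace_def using is_gmodD(1)[OF V] is_gmodD(1)[OF W]
    by (intro msum_cong refl) (metis inv_closed left_mult_zero_mat right_mult_zero_mat)
  then show ?thesis by (auto simp: tmap_def intro!: bexI[of _ "0\<^sub>m (gdim W) (gdim V)"])
qed

lemma tmap_minus:
  assumes V: "is_gmod G V" and W: "is_gmod G W" and A: "tmap V W A" and B: "tmap V W B"
  shows "tmap V W (A - B)"
proof -
  have "A - B = A + (-1) \<cdot>\<^sub>m B"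
    using is_ghomD(1)[OF tmap_hom[OF V W A]] is_ghomD(1)[OF tmap_hom[OF V W B]]
    by (auto intro!: eq_matI)
  then show ?thesis using tmap_add[OF V W A tmap_smult[OF V W B]] by metis
qed

text \<open>Conjugation by \<open>g\<close> fixes the homomorphism \<open>B\<close>, so
  \<open>B\<close> can be tensored into every summand of the trace. Applied to identities, it shows
  that tensoring with a module preserves projectivity.\<close>

lemma tmap_kron_left:
  assumes V: "is_gmod G V" and W: "is_gmod G W" and X: "is_gmod G X" and Y: "is_gmod G Y"
    and A: "tmap V W A" and B: "is_ghom G X Y B"
  shows "tmap (gtensor V X) (gtensor W Y) (kronecker A B)"
proof -
  obtain f where f: "f \<in> gmats V W" "A = gtrace V W f"
    using A by (auto simp: tmap_def)
  note d = is_gmod_dim[OF V] is_gmod_dim[OF W] is_gmod_dim[OF X] is_gmod_dim[OF Y] is_ghomD[OF B]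
  have "kronecker A B = msum (gdim W * gdim Y) (gdim V * gdim X)
      (\<lambda>g. kronecker (gact W g * f * gact V (inv g)) B) (carrier G)"
    unfolding f(2) gtrace_def using conj_carrier[OF V W f(1)] d by (intro kron_msum_left) auto
  also have "\<dots> = gtrace (gtensor V X) (gtensor W Y) (kronecker f B)"
    unfolding gtrace_def
  proof (simp, intro msum_cong refl)
    fix g assume g: "g \<in> carrier G"
    have "gact Y g * B * gact X (inv g) = B * (gact X g * gact X (inv g))"
      using g by (simp add: d flip: mat_assoc)
    also have "\<dots> = B" using g by (simp add: gact_inv[OF X g] mat_mult_one d)
    finally show "kronecker (gact W g * f * gact V (inv g)) B
        = kronecker (gact W g) (gact Y g) * kronecker f B * kronecker (gact V (inv g)) (gact X (inv g))"
      using f g by (simp add: kron_mult d)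
  qed
  finally show ?thesis using f d by (auto simp: tmap_def)
qed

lemma tmap_kron_right:
  assumes V: "is_gmod G V" and W: "is_gmod G W" and X: "is_gmod G X" and Y: "is_gmod G Y"
    and A: "tmap V W A" and B: "is_ghom G X Y B"
  shows "tmap (gtensor X V) (gtensor Y W) (kronecker B A)"
proof -
  obtain f where f: "f \<in> gmats V W" "A = gtrace V W f"
    using A by (auto simp: tmap_def)
  note d = is_gmod_dim[OF V] is_gmod_dim[OF W] is_gmod_dim[OF X] is_gmod_dim[OF Y] is_ghomD[OF B]
  have "kronecker B A = msum (gdim Y * gdim W) (gdim X * gdim V)
      (\<lambda>g. kronecker B (gact W g * f * gact V (inv g))) (carrier G)"
    unfolding f(2) gtrace_def using conj_carrier[OF V W f(1)] d by (intro kron_msum_right) auto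
  also have "\<dots> = gtrace (gtensor X V) (gtensor Y W) (kronecker B f)"
    unfolding gtrace_def
  proof (simp, intro msum_cong refl)
    fix g assume g: "g \<in> carrier G"
    have "gact Y g * B * gact X (inv g) = B * (gact X g * gact X (inv g))"
      using g by (simp add: d flip: mat_assoc)
    also have "\<dots> = B" using g by (simp add: gact_inv[OF X g] mat_mult_one d)
    finally show "kronecker B (gact W g * f * gact V (inv g))
        = kronecker (gact Y g) (gact W g) * kronecker B f * kronecker (gact X (inv g)) (gact V (inv g))"
      using f g by (simp add: kron_mult d)
  qed
  finally show ?thesis using f d by (auto simp: tmap_def)
qed

text \<open>The cover is the group algebra tensored with \<open>V\<close>, with diagonal action. As
  traces form a tensor ideal, it suffices that the identity of the regular module \<open>R\<close>
  is a trace. The section \<open>s\<close> is only linear.\<close>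

lemma exists_free_cover:
  assumes V: "is_gmod G (V :: ('a, 'f :: field) gmod)"
  obtains P A s where "is_gmod G P" "tmap P P (gid P)" "is_ghom G P V A"
    "s \<in> gmats V P" "A * s = gid V"
proof -
  define N where "N = card (carrier G)"
  obtain e where e: "bij_betw e {0..<N} (carrier G)"
    using ex_bij_betw_nat_finite[OF finite_carrier] by (auto simp: N_def)
  have eG: "e i \<in> carrier G" if "i < N" for i using e that by (auto simp: bij_betw_def)
  have e_inj: "e i = e j \<longleftrightarrow> i = j" if "i < N" "j < N" for i j
    using e that by (auto simp: bij_betw_def inj_on_def)
  have sum_e: "(\<Sum>i = 0..<N. F (e i)) = (\<Sum>g\<in>carrier G. F g)" for F :: "'a \<Rightarrow> 'f"
    by (rule sum.reindex_bij_betw[OF e])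
  define R where "R = Gmod N (\<lambda>g. mat N N (\<lambda>(i, j). if e i = g \<otimes> e j then 1 else 0 :: 'f))"
  have dim [simp]: "gdim R = N" "dim_row (gact R g) = N" "dim_col (gact R g) = N" for g
    by (auto simp: R_def)
  have idx: "gact R g $$ (i, j) = (if e i = g \<otimes> e j then 1 else 0)" if "i < N" "j < N" for g i j
    using that by (simp add: R_def)
  have mult: "(gact R g * gact R h) $$ (i, j) = (if e i = g \<otimes> h \<otimes> e j then 1 else 0)"
    if "i < N" "j < N" "g \<in> carrier G" "h \<in> carrier G" for g h i j
  proof -
    have "(gact R g * gact R h) $$ (i, j)
      = (\<Sum>k = 0..<N. (if e i = g \<otimes> e k then 1 else 0) * (if e k = h \<otimes> e j then 1 else 0))"
      using that by (auto simp: scalar_prod_def idx intro!: sum.cong)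
    also have "\<dots> = (\<Sum>x\<in>carrier G. (if e i = g \<otimes> x then 1 else 0) * (if x = h \<otimes> e j then 1 else 0))"
      by (rule sum_e)
    also have "\<dots> = (\<Sum>x\<in>carrier G. if x = h \<otimes> e j then (if e i = g \<otimes> x then 1 else 0) else 0)"
      by (rule sum.cong) auto
    also have "\<dots> = (if e i = g \<otimes> h \<otimes> e j then 1 else 0)"
      using that eG finite_carrier by (simp add: m_assoc)
    finally show ?thesis .
  qed
  have R: "is_gmod G R"
    unfolding is_gmod_def
  proof (intro conjI ballI)
    show "gact R \<one> = gid R" by (rule eq_matI) (auto simp: idx eG e_inj)
    show "gact R (g \<otimes> h) = gact R g * gact R h" if "g \<in> carrier G" "h \<in> carrier G" for g h
      by (rule eq_matI) (use that in \<open>auto simp: idx mult simp del: index_mult_mat(1)\<close>)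
  qed (auto intro!: carrier_matI)
  define i0 where "i0 = the_inv_into {0..<N} e \<one>"
  have i0: "i0 < N" "e i0 = \<one>"
    using e the_inv_into_into[of e "{0..<N}" \<one> "{0..<N}"] f_the_inv_into_f[of e "{0..<N}" \<one>]
    by (auto simp: i0_def bij_betw_def)
  \<comment> \<open>\<open>f\<close> projects onto the basis vector of the identity element. Its
    conjugate by \<open>g\<close> projects onto the basis vector of \<open>g\<close>, so the
    conjugates add up to the identity matrix.\<close>
  define f where "f = mat N N (\<lambda>(i, j). if i = i0 \<and> j = i0 then 1 else 0 :: 'f)"
  have f: "f \<in> carrier_mat N N" by (simp add: f_def)
  have conj: "(gact R g * f * gact R (inv g)) $$ (i, j) = (if g = e i then (if i = j then 1 else 0) else 0)"
    if "i < N" "j < N" "g \<in> carrier G" for g i j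
  proof -
    have c: "gact R h \<in> carrier_mat N N" for h by (auto intro!: carrier_matI)
    have left: "(gact R g * f) $$ (i, k) = (if k = i0 \<and> e i = g then 1 else 0)" if "k < N" for k
    proof -
      have "(gact R g * f) $$ (i, k) = (\<Sum>l = 0..<N. gact R g $$ (i, l) * f $$ (l, k))"
        using that \<open>i < N\<close> by (intro mat_mult_index[OF c f])
      also have "\<dots> = (\<Sum>l = 0..<N. if l = i0 then (if k = i0 \<and> e i = g \<otimes> e l then 1 else 0) else 0)"
        using that \<open>i < N\<close> by (intro sum.cong) (auto simp: idx f_def)
      also have "\<dots> = (if k = i0 \<and> e i = g then 1 else 0)" using i0 \<open>g \<in> carrier G\<close> by simp
      finally show ?thesis .
    qed
    have "(gact R g * f * gact R (inv g)) $$ (i, j)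
      = (\<Sum>k = 0..<N. (gact R g * f) $$ (i, k) * gact R (inv g) $$ (k, j))"
      using that by (intro mat_mult_index[OF mult_carrier_mat[OF c f] c])
    also have "\<dots> = (\<Sum>k = 0..<N. if k = i0 then (if e i = g \<and> e k = inv g \<otimes> e j then 1 else 0) else 0)"
      using that by (intro sum.cong) (auto simp: idx left simp del: index_mult_mat)
    also have "\<dots> = (if e i = g \<and> \<one> = inv g \<otimes> e j then 1 else 0)" using i0 by simp
    also have "\<dots> = (if g = e i then (if i = j then 1 else 0) else 0)"
      using that eG[of i] eG[of j] e_inj[of i j] inv_solve_left'[of \<one> g "e j"] by auto
    finally show ?thesis .
  qed
  have "gtrace R R f = 1\<^sub>m N"
  proof (rule eq_matI)
    fix i j assume "i < dim_row (1\<^sub>m N :: 'f mat)" "j < dim_col (1\<^sub>m N :: 'f mat)"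
    then have ij: "i < N" "j < N" by auto
    have "gtrace R R f $$ (i, j) = (\<Sum>g\<in>carrier G. if g = e i then (if i = j then 1 else 0) else 0)"
      using ij by (simp add: gtrace_def msum_def conj del: index_mult_mat(1))
    then show "gtrace R R f $$ (i, j) = (1\<^sub>m N :: 'f mat) $$ (i, j)"
      using ij eG finite_carrier by simp
  qed (auto simp: gtrace_def)
  then have tR: "tmap R R (gid R)" using f by (metis tmap_def dim(1))
  \<comment> \<open>The augmentation of the group algebra, and a linear section of it with value at
    the identity element.\<close>
  define a where "a = mat 1 N (\<lambda>_. 1 :: 'f)"
  define s where "s = mat N 1 (\<lambda>(i, _). if i = i0 then 1 else 0 :: 'f)"
  have a: "is_ghom G R gtriv a"
    unfolding is_ghom_def
  proof (intro conjI ballI)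
    fix g assume g: "g \<in> carrier G"
    show "a * gact R g = gact gtriv g * a"
    proof (rule eq_matI)
      fix i j assume "i < dim_row (gact gtriv g * a)" "j < dim_col (gact gtriv g * a)"
      then have ij: "i = 0" "j < N" by (auto simp: a_def)
      have "(a * gact R g) $$ (i, j) = (\<Sum>k = 0..<N. if e k = g \<otimes> e j then 1 else 0)"
        using ij by (auto simp: scalar_prod_def a_def idx intro!: sum.cong)
      also have "\<dots> = (\<Sum>x\<in>carrier G. if x = g \<otimes> e j then 1 else 0)" by (rule sum_e)
      also have "\<dots> = 1" using ij g eG finite_carrier by simp
      also have "\<dots> = (gact gtriv g * a) $$ (i, j)" using ij by (simp add: a_def mat_one_mult)
      finally show "(a * gact R g) $$ (i, j) = (gact gtriv g * a) $$ (i, j)" .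
    qed (auto simp: a_def)
  qed (auto simp: a_def)
  have as: "a * s = 1\<^sub>m 1"
    using i0 by (auto intro!: eq_matI simp: a_def s_def scalar_prod_def)
  note one = ghom_one[OF V]
  show thesis
  proof (rule that[of "gtensor R V" "kronecker a (gid V)" "kronecker s (gid V)"])
    show "is_gmod G (gtensor R V)" by (rule is_gmod_gtensor[OF R V])
    show "tmap (gtensor R V) (gtensor R V) (gid (gtensor R V))"
      using tmap_kron_left[OF R R V V tR one] by (simp add: kron_one)
    show "is_ghom G (gtensor R V) V (kronecker a (gid V))"
      using ghom_kron[OF R is_gmod_gtriv V V a one] by (simp add: gtensor_gtriv_left)
    show "kronecker s (gid V) \<in> gmats V (gtensor R V)"
      by (auto intro!: carrier_matI simp: s_def)
    have "kronecker a (gid V) * kronecker s (gid V) = kronecker (a * s) (gid V * gid V)"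
      by (rule kron_mult) (auto simp: a_def s_def)
    then show "kronecker a (gid V) * kronecker s (gid V) = gid V"
      by (simp add: as kron_one_left del: One_nat_def)
  qed
qed

end

section \<open>Submodules and direct sums\<close>

lemma surj_section:
  fixes A :: "'a :: field mat"
  assumes "A \<in> carrier_mat m n" "(\<lambda>v. A *\<^sub>v v) ` carrier_vec n = carrier_vec m"
  obtains s where "s \<in> carrier_mat n m" "A * s = 1\<^sub>m m"
proof (rule mat_factor_through[OF assms(1), of "1\<^sub>m m" m])
  fix v :: "'a vec" assume "v \<in> carrier_vec m"
  moreover from this obtain x where "x \<in> carrier_vec n" "v = A *\<^sub>v x" using assms(2) by (metis imageE)
  ultimately show "\<exists>x\<in>carrier_vec n. A *\<^sub>v x = 1\<^sub>m m *\<^sub>v v" by (intro bexI[of _ x]) auto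
qed (use that in auto)

lemma section_surj:
  fixes A :: "'a :: field mat"
  assumes A: "A \<in> carrier_mat m n" and s: "s \<in> carrier_mat n m" and As: "A * s = 1\<^sub>m m"
  shows "(\<lambda>v. A *\<^sub>v v) ` carrier_vec n = carrier_vec m"
proof
  show "(\<lambda>v. A *\<^sub>v v) ` carrier_vec n \<subseteq> carrier_vec m" using A by auto
  show "carrier_vec m \<subseteq> (\<lambda>v. A *\<^sub>v v) ` carrier_vec n"
  proof
    fix w :: "'a vec" assume w: "w \<in> carrier_vec m"
    have "A *\<^sub>v (s *\<^sub>v w) = (A * s) *\<^sub>v w" using A s w by (intro mat_vec_assoc[symmetric]) auto
    then show "w \<in> (\<lambda>v. A *\<^sub>v v) ` carrier_vec n" using As w s by (auto intro!: image_eqI[of _ _ "s *\<^sub>v w"])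
  qed
qed

lemma retraction_inj:
  fixes A :: "'a :: field mat"
  assumes A: "A \<in> carrier_mat m n" and r: "r \<in> carrier_mat n m" and rA: "r * A = 1\<^sub>m n"
  shows "inj_on (\<lambda>v. A *\<^sub>v v) (carrier_vec n)"
proof (rule inj_on_inverseI[where g = "\<lambda>v. r *\<^sub>v v"])
  fix v :: "'a vec" assume v: "v \<in> carrier_vec n"
  have "r *\<^sub>v (A *\<^sub>v v) = (r * A) *\<^sub>v v" using A r v by (intro mat_vec_assoc[symmetric]) auto
  then show "r *\<^sub>v (A *\<^sub>v v) = v" using rA v by simp
qed

lemma inj_mat_cancel:
  fixes A :: "'a :: field mat"
  assumes A: "A \<in> carrier_mat m n" and inj: "inj_on (\<lambda>v. A *\<^sub>v v) (carrier_vec n)"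
    and B: "B \<in> carrier_mat n k" and C: "C \<in> carrier_mat n k" and eq: "A * B = A * C"
  shows "B = C"
proof (rule mat_mult_eqI_vec[OF B C])
  fix v :: "'a vec" assume v: "v \<in> carrier_vec k"
  have "A *\<^sub>v (B *\<^sub>v v) = A *\<^sub>v (C *\<^sub>v v)"
    using eq A B C v by (simp flip: mat_vec_assoc)
  then show "B *\<^sub>v v = C *\<^sub>v v" using inj B C v by (auto dest: inj_onD)
qed

lemma inverse_ghom:
  assumes V: "is_gmod G V" and W: "is_gmod G W" and A: "is_ghom G V W A"
    and B: "B \<in> gmats W V" and AB: "A * B = gid W" and BA: "B * A = gid V"
  shows "is_ghom G W V B"
  unfolding is_ghom_def
proof (intro conjI ballI)
  fix g assume g: "g \<in> carrier G"
  note d = is_gmod_dim[OF V g] is_gmod_dim[OF W g] is_ghomD(2,3)[OF A]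
  have "B * gact W g = B * gact W g * (A * B)" using B by (simp add: AB d mat_distribs)
  also have "\<dots> = B * (gact W g * A) * B" using B by (simp add: d mat_assoc)
  also have "gact W g * A = A * gact V g" using is_ghomD(4)[OF A g] by simp
  also have "B * (A * gact V g) * B = (B * A) * gact V g * B" using B by (simp add: d mat_assoc)
  finally show "B * gact W g = gact V g * B" using B by (simp add: BA d mat_distribs)
qed (rule B)

lemma gisoI:
  assumes "is_ghom G V W A" "B \<in> gmats W V"
    and "A * B = gid W" "B * A = gid V"
  shows "giso G V W"
  unfolding giso_def ginj_def gsurj_def
  using assms(1) section_surj[OF is_ghomD(1)[OF assms(1)] assms(2,3)]
    retraction_inj[OF is_ghomD(1)[OF assms(1)] assms(2,4)] by blast

text \<open>Surjectivity gives a linear right inverse, injectivity makes it two-sided, and the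
  inverse of an equivariant map is equivariant.\<close>

lemma gisoE:
  assumes "giso G V W" "is_gmod G V" "is_gmod G W"
  obtains A B where "is_ghom G V W A" "is_ghom G W V B"
    "A * B = gid W" "B * A = gid V"
proof -
  obtain A where A: "is_ghom G V W A" "ginj V A" "gsurj V W A" using assms(1) by (auto simp: giso_def)
  note c = is_ghomD(1)[OF A(1)]
  obtain B where B: "B \<in> gmats W V" "A * B = gid W"
    using surj_section[OF c] A(3) by (auto simp: gsurj_def)
  have "A * (B * A) = A * gid V"
    using B c by (simp add: mat_distribs flip: mat_assoc)
  moreover have "B * A \<in> gmats V V" using B c by auto
  ultimately have "B * A = gid V"
    using A(2) by (intro inj_mat_cancel[OF c, of "B * A" "gdim V" "gid V"]) (auto simp: ginj_def)
  with A B inverse_ghom[OF assms(2,3) A(1)] show thesis by (intro that) auto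
qed

lemma giso_refl: "is_gmod G V \<Longrightarrow> giso G V V"
  by (rule gisoI[OF ghom_one, of _ _ "gid V"]) auto

lemma giso_sym:
  assumes "giso G V W" "is_gmod G V" "is_gmod G W"
  shows "giso G W V"
proof -
  obtain A B where "is_ghom G V W A" "is_ghom G W V B"
    "A * B = gid W" "B * A = gid V" by (rule gisoE[OF assms])
  then show ?thesis using is_ghomD(1) by (intro gisoI[of G W V B A]) auto
qed

lemma giso_trans:
  assumes "giso G U V" "giso G V W" "is_gmod G U" "is_gmod G V" "is_gmod G W"
  shows "giso G U W"
proof -
  obtain A B where A: "is_ghom G U V A" and B: "is_ghom G V U B"
    and AB: "A * B = gid V" "B * A = gid U" by (rule gisoE[OF assms(1,3,4)])
  obtain C D where C: "is_ghom G V W C" and D: "is_ghom G W V D"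
    and CD: "C * D = gid W" "D * C = gid V" by (rule gisoE[OF assms(2,4,5)])
  note d = is_ghomD(2,3)[OF A] is_ghomD(2,3)[OF B] is_ghomD(2,3)[OF C] is_ghomD(2,3)[OF D]
  show ?thesis
  proof (rule gisoI[OF ghom_comp[OF assms(4,5,3) C A], of "B * D"])
    show "B * D \<in> gmats W U" by (auto simp: d intro!: carrier_matI)
    show "C * A * (B * D) = gid W"
      by (simp add: mat_assoc d mat_rewr[OF AB(1)] mat_rewr[OF AB(2)] mat_rewr[OF CD(2)] mat_distribs AB CD)
    show "B * D * (C * A) = gid U"
      by (simp add: mat_assoc d mat_rewr[OF CD(2)] mat_distribs AB)
  qed
qed

lemma giso_dim:
  fixes V W :: "('g, 'f :: field) gmod"
  assumes "giso G V W" "is_gmod G V" "is_gmod G W"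
  shows "gdim V = gdim W"
proof -
  obtain A B where "is_ghom G V W A" "is_ghom G W V B"
    "A * B = gid W" "B * A = gid V" by (rule gisoE[OF assms])
  then show ?thesis
    using mat_left_inverse_dim[of A "gdim W" "gdim V" B] mat_left_inverse_dim[of B "gdim V" "gdim W" A]
      is_ghomD(1) by (metis le_antisym)
qed

text \<open>An injective matrix into \<open>U\<close> with as many columns as possible already has
  image \<open>U\<close>: a vector of \<open>U\<close> outside the image could be adjoined as a
  further column.\<close>

lemma subspace_basis:
  fixes U :: "'a :: field vec set"
  assumes U: "U \<subseteq> carrier_vec n" and zero: "0\<^sub>v n \<in> U"
    and add: "\<And>u v. u \<in> U \<Longrightarrow> v \<in> U \<Longrightarrow> u + v \<in> U" and smult: "\<And>c u. u \<in> U \<Longrightarrow> c \<cdot>\<^sub>v u \<in> U"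
  obtains k B where "B \<in> carrier_mat n k" "inj_on (\<lambda>v. B *\<^sub>v v) (carrier_vec k)"
    "(\<lambda>v. B *\<^sub>v v) ` carrier_vec k = U"
proof -
  define P where "P = (\<lambda>k. \<exists>B \<in> carrier_mat n k. inj_on (\<lambda>v. B *\<^sub>v v) (carrier_vec k) \<and> (\<lambda>v. B *\<^sub>v v) ` carrier_vec k \<subseteq> U)"
  have bound: "k \<le> n" if "P k" for k
  proof (rule ccontr)
    assume "\<not> k \<le> n"
    from that obtain B :: "'a mat" where B: "B \<in> carrier_mat n k" "inj_on (\<lambda>v. B *\<^sub>v v) (carrier_vec k)" by (auto simp: P_def)
    from \<open>\<not> k \<le> n\<close> obtain v where "v \<in> carrier_vec k" "v \<noteq> 0\<^sub>v k" "B *\<^sub>v v = 0\<^sub>v n"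
      using ker_nontrivial[OF B(1)] by auto
    then show False using B(2) unfolding inj_mat_iff[OF B(1)] by blast
  qed
  have P0: "P 0"
    unfolding P_def
  proof (intro bexI conjI)
    show "(0\<^sub>m n 0 :: 'a mat) \<in> carrier_mat n 0" by simp
    show "inj_on (\<lambda>v. (0\<^sub>m n 0 :: 'a mat) *\<^sub>v v) (carrier_vec 0)" by (auto simp: inj_on_def)
    have "(0\<^sub>m n 0 :: 'a mat) *\<^sub>v v = 0\<^sub>v n" if "v \<in> carrier_vec 0" for v
      using that by (intro eq_vecI) (auto simp: scalar_prod_def)
    then show "(\<lambda>v. (0\<^sub>m n 0 :: 'a mat) *\<^sub>v v) ` carrier_vec 0 \<subseteq> U" using zero by auto
  qed
  obtain k where k: "P k" and max: "\<And>l. P l \<Longrightarrow> l \<le> k"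
    using ex_has_greatest_nat[of P 0 "\<lambda>x. x" "Suc n"] P0 bound by (auto simp: less_Suc_eq_le)
  then obtain B where B: "B \<in> carrier_mat n k" and inj: "inj_on (\<lambda>v. B *\<^sub>v v) (carrier_vec k)"
    and im: "(\<lambda>v. B *\<^sub>v v) ` carrier_vec k \<subseteq> U"
    unfolding P_def by blast
  have "U \<subseteq> (\<lambda>v. B *\<^sub>v v) ` carrier_vec k"
  proof (rule ccontr)
    assume "\<not> ?thesis"
    then obtain u where u: "u \<in> U" "u \<notin> (\<lambda>v. B *\<^sub>v v) ` carrier_vec k" by blast
    have un: "u \<in> carrier_vec n" using u U by auto
    define B' where "B' = mat n (Suc k) (\<lambda>(i, j). if j < k then B $$ (i, j) else u $ i)"
    have B': "B' \<in> carrier_mat n (Suc k)" by (simp add: B'_def)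
    define tr where "tr = (\<lambda>v :: 'a vec. vec k (\<lambda>i. v $ i))"
    have tr: "tr v \<in> carrier_vec k" for v by (simp add: tr_def)
    have act: "B' *\<^sub>v v = B *\<^sub>v tr v + v $ k \<cdot>\<^sub>v u" if "v \<in> carrier_vec (Suc k)" for v
    proof (rule eq_vecI)
      fix i assume "i < dim_vec (B *\<^sub>v tr v + v $ k \<cdot>\<^sub>v u)"
      then have i: "i < n" using un by simp
      show "(B' *\<^sub>v v) $ i = (B *\<^sub>v tr v + v $ k \<cdot>\<^sub>v u) $ i"
        using i that B un by (auto simp: B'_def tr_def scalar_prod_def mult.commute intro!: sum.cong)
    qed (use B' un in auto)
    have "P (Suc k)"
      unfolding P_def
    proof (intro bexI conjI)
      show "B' \<in> carrier_mat n (Suc k)" by (rule B')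
      show "(\<lambda>v. B' *\<^sub>v v) ` carrier_vec (Suc k) \<subseteq> U"
        using im tr u by (auto simp: act intro!: add smult)
      show "inj_on (\<lambda>v. B' *\<^sub>v v) (carrier_vec (Suc k))"
        unfolding inj_mat_iff[OF B']
      proof (intro ballI impI)
        fix v assume v: "v \<in> carrier_vec (Suc k)" and z: "B' *\<^sub>v v = 0\<^sub>v n"
        have eq: "B *\<^sub>v tr v + v $ k \<cdot>\<^sub>v u = 0\<^sub>v n" using act[OF v] z by simp
        \<comment> \<open>A nonzero last coefficient would express \<open>u\<close> through the
          columns of \<open>B\<close>.\<close>
        have "v $ k = 0"
        proof (rule ccontr)
          assume nz: "v $ k \<noteq> 0"
          have "u = B *\<^sub>v ((- inverse (v $ k)) \<cdot>\<^sub>v tr v)"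
          proof (rule eq_vecI)
            fix i assume "i < dim_vec (B *\<^sub>v ((- inverse (v $ k)) \<cdot>\<^sub>v tr v))"
            then have i: "i < n" using B by auto
            have "(B *\<^sub>v tr v + v $ k \<cdot>\<^sub>v u) $ i = 0" using eq i by simp
            then have "(B *\<^sub>v tr v) $ i + v $ k * u $ i = 0" using i B un by (simp del: index_mult_mat_vec)
            then have "u $ i = - inverse (v $ k) * (B *\<^sub>v tr v) $ i"
              using nz by (simp add: field_simps eq_neg_iff_add_eq_0 del: index_mult_mat_vec)
            also have "\<dots> = ((- inverse (v $ k)) \<cdot>\<^sub>v (B *\<^sub>v tr v)) $ i" using i B by (simp del: index_mult_mat_vec)
            also have "\<dots> = (B *\<^sub>v ((- inverse (v $ k)) \<cdot>\<^sub>v tr v)) $ i"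
              using mult_mat_vec[OF B tr] by simp
            finally show "u $ i = (B *\<^sub>v ((- inverse (v $ k)) \<cdot>\<^sub>v tr v)) $ i" .
          qed (use un B in auto)
          then show False using u(2) tr by auto
        qed
        moreover have "0 \<cdot>\<^sub>v u = 0\<^sub>v n" using un by auto
        moreover have "B *\<^sub>v tr v + 0\<^sub>v n = B *\<^sub>v tr v" using B
          by (intro right_zero_vec carrier_vecI) simp
        ultimately have "B *\<^sub>v tr v = 0\<^sub>v n" using eq by metis
        then have "tr v = 0\<^sub>v k" using inj tr unfolding inj_mat_iff[OF B] by blast
        show "v = 0\<^sub>v (Suc k)"
        proof (rule eq_vecI)
          fix i assume "i < dim_vec (0\<^sub>v (Suc k) :: 'a vec)"
          then consider "i < k" | "i = k" by fastforce
          then show "v $ i = 0\<^sub>v (Suc k) $ i"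
          proof cases
            case 1
            then have "v $ i = tr v $ i" by (simp add: tr_def)
            then show ?thesis using \<open>tr v = 0\<^sub>v k\<close> 1 by simp
          qed (use \<open>v $ k = 0\<close> in simp)
        qed (use v in auto)
      qed
    qed
    with max[of "Suc k"] show False by simp
  qed
  with im that[OF B inj] show thesis by blast
qed

text \<open>The coordinate matrices of the action are unique because \<open>B\<close> is injective,
  so their multiplicativity follows by cancelling \<open>B\<close>.\<close>

lemma submodule_gmod:
  fixes V :: "('g, 'f :: field) gmod"
  assumes V: "is_gmod G V" and U: "is_submodule G V U" and G: "Group.group G"
  obtains W B where "is_gmod G W" "is_ghom G W V B" "ginj W B" "(\<lambda>v. B *\<^sub>v v) ` gvecs W = U"
proof -
  interpret group G by (rule G)
  obtain k B where B: "B \<in> carrier_mat (gdim V) k" and inj: "inj_on (\<lambda>v. B *\<^sub>v v) (carrier_vec k)"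
    and im: "(\<lambda>v. B *\<^sub>v v) ` carrier_vec k = U"
    by (rule subspace_basis[of U "gdim V"]) (use U in \<open>auto simp: is_submodule_def\<close>)
  have "\<exists>C. C \<in> carrier_mat k k \<and> B * C = gact V g * B" if g: "g \<in> carrier G" for g
  proof (rule mat_factor_through[OF B])
    show "gact V g * B \<in> carrier_mat (gdim V) k" using is_gmodD(1)[OF V g] B by auto
    fix v :: "'f vec" assume v: "v \<in> carrier_vec k"
    then have "gact V g *\<^sub>v (B *\<^sub>v v) \<in> U" using U g im by (auto simp: is_submodule_def)
    then have "(gact V g * B) *\<^sub>v v \<in> U"
      using is_gmodD(1)[OF V g] B v by (subst mat_vec_assoc) auto
    then show "\<exists>x\<in>carrier_vec k. B *\<^sub>v x = (gact V g * B) *\<^sub>v v" using im by (metis imageE)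
  qed blast
  then obtain \<rho> where \<rho>: "\<And>g. g \<in> carrier G \<Longrightarrow> \<rho> g \<in> carrier_mat k k"
    "\<And>g. g \<in> carrier G \<Longrightarrow> B * \<rho> g = gact V g * B" by metis
  note cancel = inj_mat_cancel[OF B inj]
  have d: "dim_row (\<rho> g) = k" "dim_col (\<rho> g) = k" if "g \<in> carrier G" for g using \<rho>(1)[OF that] by auto
  have mult: "\<rho> (g \<otimes>\<^bsub>G\<^esub> h) = \<rho> g * \<rho> h" if g: "g \<in> carrier G" and h: "h \<in> carrier G" for g h
  proof (rule cancel)
    have "B * (\<rho> g * \<rho> h) = (B * \<rho> g) * \<rho> h" using B g h by (simp add: mat_assoc d)
    also have "\<dots> = gact V g * (B * \<rho> h)" using B g h by (simp add: \<rho>(2) mat_assoc d is_gmod_dim[OF V])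
    also have "\<dots> = gact V (g \<otimes>\<^bsub>G\<^esub> h) * B"
      using B g h by (simp add: \<rho>(2) is_gmodD(3)[OF V] mat_assoc is_gmod_dim[OF V])
    finally show "B * \<rho> (g \<otimes>\<^bsub>G\<^esub> h) = B * (\<rho> g * \<rho> h)" using g h by (simp add: \<rho>(2))
  qed (use mult_carrier_mat[OF \<rho>(1)[OF g] \<rho>(1)[OF h]] \<rho>(1)[of "g \<otimes>\<^bsub>G\<^esub> h"] g h in auto)
  have one: "\<rho> \<one>\<^bsub>G\<^esub> = 1\<^sub>m k"
  proof (rule cancel)
    have "B * \<rho> \<one>\<^bsub>G\<^esub> = B" using \<rho>(2)[OF one_closed] B by (simp add: is_gmodD(2)[OF V])
    then show "B * \<rho> \<one>\<^bsub>G\<^esub> = B * 1\<^sub>m k" using B by simp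
  qed (rule \<rho>(1)[OF one_closed] one_carrier_mat)+
  show thesis
  proof (rule that[of "Gmod k \<rho>" B])
    show "is_gmod G (Gmod k \<rho>)" using \<rho>(1) mult one by (auto simp: is_gmod_def)
    show "is_ghom G (Gmod k \<rho>) V B" using B \<rho>(2) by (auto simp: is_ghom_def)
  qed (use inj im in \<open>auto simp: ginj_def\<close>)
qed

lemma image_submodule:
  assumes V: "is_gmod G V" and W: "is_gmod G W" and A: "is_ghom G V W A"
  shows "is_submodule G W ((\<lambda>v. A *\<^sub>v v) ` gvecs V)"
  unfolding is_submodule_def
proof (intro conjI ballI allI)
  note c = is_ghomD(1)[OF A]
  show "(\<lambda>v. A *\<^sub>v v) ` gvecs V \<subseteq> gvecs W" using c by auto
  show "0\<^sub>v (gdim W) \<in> (\<lambda>v. A *\<^sub>v v) ` gvecs V"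
    using c by (auto intro!: image_eqI[of _ _ "0\<^sub>v (gdim V)"])
  fix u assume "u \<in> (\<lambda>v. A *\<^sub>v v) ` gvecs V"
  then obtain x where x: "x \<in> gvecs V" "u = A *\<^sub>v x" by auto
  show "c \<cdot>\<^sub>v u \<in> (\<lambda>v. A *\<^sub>v v) ` gvecs V" for c
    using x mult_mat_vec[OF c x(1)] by (auto intro!: image_eqI[of _ _ "c \<cdot>\<^sub>v x"])
  show "u + v \<in> (\<lambda>v. A *\<^sub>v v) ` gvecs V" if v: "v \<in> (\<lambda>v. A *\<^sub>v v) ` gvecs V" for v
  proof -
    obtain y where "y \<in> gvecs V" "v = A *\<^sub>v y" using v by auto
    then show ?thesis using x mult_add_distrib_mat_vec[OF c x(1), of y] by (auto intro!: image_eqI[of _ _ "x + y"])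
  qed
  show "gact W g *\<^sub>v u \<in> (\<lambda>v. A *\<^sub>v v) ` gvecs V" if g: "g \<in> carrier G" for g
  proof (rule image_eqI)
    have "gact W g *\<^sub>v u = (gact W g * A) *\<^sub>v x"
      using x c is_gmodD(1)[OF W g] by (subst mat_vec_assoc) auto
    also have "\<dots> = A *\<^sub>v (gact V g *\<^sub>v x)"
      using x c is_gmodD(1)[OF V g] is_ghomD(4)[OF A g] by (subst mat_vec_assoc[symmetric]) auto
    finally show "gact W g *\<^sub>v u = A *\<^sub>v (gact V g *\<^sub>v x)" .
  qed (use is_gmodD(1)[OF V g] x in auto)
qed

lemma kernel_submodule:
  assumes V: "is_gmod G V" and W: "is_gmod G W" and A: "is_ghom G V W A"
  shows "is_submodule G V {v \<in> gvecs V. A *\<^sub>v v = 0\<^sub>v (gdim W)}"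
  unfolding is_submodule_def
proof (intro conjI ballI allI)
  note c = is_ghomD(1)[OF A]
  show "0\<^sub>v (gdim V) \<in> {v \<in> gvecs V. A *\<^sub>v v = 0\<^sub>v (gdim W)}" using c by auto
  fix u assume u: "u \<in> {v \<in> gvecs V. A *\<^sub>v v = 0\<^sub>v (gdim W)}"
  show "u + v \<in> {v \<in> gvecs V. A *\<^sub>v v = 0\<^sub>v (gdim W)}" if "v \<in> {v \<in> gvecs V. A *\<^sub>v v = 0\<^sub>v (gdim W)}" for v
    using u that mult_add_distrib_mat_vec[OF c, of u v] by auto
  show "k \<cdot>\<^sub>v u \<in> {v \<in> gvecs V. A *\<^sub>v v = 0\<^sub>v (gdim W)}" for k
    using u mult_mat_vec[OF c, of u k] by auto
  show "gact V g *\<^sub>v u \<in> {v \<in> gvecs V. A *\<^sub>v v = 0\<^sub>v (gdim W)}" if g: "g \<in> carrier G" for g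
  proof -
    have "A *\<^sub>v (gact V g *\<^sub>v u) = (A * gact V g) *\<^sub>v u"
      using u c is_gmodD(1)[OF V g] by (subst mat_vec_assoc) auto
    also have "\<dots> = gact W g *\<^sub>v (A *\<^sub>v u)"
      using u c is_gmodD(1)[OF W g] is_ghomD(4)[OF A g] by (subst mat_vec_assoc[symmetric]) auto
    also have "\<dots> = 0\<^sub>v (gdim W)" using u is_gmodD(1)[OF W g] by auto
    finally show ?thesis using u is_gmodD(1)[OF V g] by auto
  qed
qed auto

text \<open>\<open>W\<close> is the image of \<open>e\<close>. The inclusion \<open>i\<close> is
  injective, and the remaining identities, including equivariance of \<open>p\<close>, are obtained
  by cancelling it.\<close>

lemma idempotent_split:
  fixes V :: "('g, 'f :: field) gmod"
  assumes G: "Group.group G" and V: "is_gmod G V" and e: "is_ghom G V V e" and ee: "e * e = e"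
  obtains W i p where "is_gmod G W" "is_ghom G W V i" "is_ghom G V W p"
    "p * i = gid W" "i * p = e"
proof -
  note c = is_ghomD(1)[OF e]
  obtain W i where W: "is_gmod G W" and i: "is_ghom G W V i" and inj: "ginj W i"
    and im: "(\<lambda>v. i *\<^sub>v v) ` gvecs W = (\<lambda>v. e *\<^sub>v v) ` gvecs V"
    using submodule_gmod[OF V image_submodule[OF V V e] G] by blast
  note ci = is_ghomD(1)[OF i]
  note cancel = inj_mat_cancel[OF ci inj[unfolded ginj_def]]
  obtain p where p: "p \<in> gmats V W" "i * p = e"
  proof (rule mat_factor_through[OF ci c])
    fix v assume "v \<in> gvecs V"
    then show "\<exists>x\<in>gvecs W. i *\<^sub>v x = e *\<^sub>v v" using im by (metis imageE imageI)
  qed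
  have ei: "e * i = i"
  proof (rule mat_mult_eqI_vec[OF mult_carrier_mat[OF c ci] ci])
    fix v assume v: "v \<in> gvecs W"
    then obtain x where x: "x \<in> gvecs V" "i *\<^sub>v v = e *\<^sub>v x" using im by (metis imageE imageI)
    have "(e * i) *\<^sub>v v = e *\<^sub>v (e *\<^sub>v x)" using v c ci x by (subst mat_vec_assoc) auto
    also have "\<dots> = (e * e) *\<^sub>v x" using x c by (subst mat_vec_assoc) auto
    finally show "(e * i) *\<^sub>v v = i *\<^sub>v v" using x ee by simp
  qed
  have pi: "p * i = gid W"
  proof (rule cancel)
    have "i * (p * i) = e * i" using p ci c by (simp flip: mat_assoc)
    then show "i * (p * i) = i * gid W" using ei ci by simp
  qed (use p ci in auto)
  have "is_ghom G V W p"
    unfolding is_ghom_def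
  proof (intro conjI ballI)
    show "p \<in> gmats V W" by (rule p)
    fix g assume g: "g \<in> carrier G"
    note d = is_gmod_dim[OF V g] is_gmod_dim[OF W g] is_ghomD(2,3)[OF i]
    have "i * (p * gact V g) = e * gact V g" using p by (simp add: d flip: mat_assoc)
    also have "\<dots> = gact V g * (i * p)" using is_ghomD(4)[OF e g] p by simp
    also have "\<dots> = (gact V g * i) * p" using p by (simp add: d mat_assoc)
    also have "\<dots> = i * (gact W g * p)" using p is_ghomD(4)[OF i g] by (simp add: d flip: mat_assoc)
    finally have "i * (p * gact V g) = i * (gact W g * p)" .
    then show "p * gact V g = gact W g * p"
      by (rule cancel[rotated 2]) (use p d in \<open>auto intro!: carrier_matI\<close>)
  qed
  with W i pi p show thesis by (intro that)
qed

text \<open>Direct sums are accessed through injections and projections, so that arguments about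
  them become calculations with these relations and apply to any module that satisfies them.\<close>

definition is_biprod ::
  "('g, 'c) monoid_scheme \<Rightarrow> ('g, 'a :: field) gmod \<Rightarrow> ('g, 'a) gmod \<Rightarrow> ('g, 'a) gmod \<Rightarrow>
    'a mat \<Rightarrow> 'a mat \<Rightarrow> 'a mat \<Rightarrow> 'a mat \<Rightarrow> bool" where
  "is_biprod G V W S i j p q \<longleftrightarrow>
     is_gmod G V \<and> is_gmod G W \<and> is_gmod G S \<and>
     is_ghom G V S i \<and> is_ghom G W S j \<and> is_ghom G S V p \<and> is_ghom G S W q \<and>
     p * i = gid V \<and> q * j = gid W \<and> p * j = 0\<^sub>m (gdim V) (gdim W) \<and>
     q * i = 0\<^sub>m (gdim W) (gdim V) \<and> i * p + j * q = gid S"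

lemma gsum_simps [simp]:
  "gdim (gsum V W) = gdim V + gdim W"
  "gact (gsum V W) g = four_block_mat (gact V g) (0\<^sub>m (gdim V) (gdim W)) (0\<^sub>m (gdim W) (gdim V)) (gact W g)"
  by (auto simp: gsum_def)

lemma is_gmod_gsum:
  assumes V: "is_gmod G V" and W: "is_gmod G W"
  shows "is_gmod G (gsum V W)"
  unfolding is_gmod_def
proof (intro conjI ballI)
  fix g h assume g: "g \<in> carrier G" and h: "h \<in> carrier G"
  show "gact (gsum V W) (g \<otimes>\<^bsub>G\<^esub> h) = gact (gsum V W) g * gact (gsum V W) h"
    using g h is_gmodD(1)[OF V g] is_gmodD(1)[OF W g] is_gmodD(1)[OF V h] is_gmodD(1)[OF W h]
      is_gmodD(3)[OF V g h] is_gmodD(3)[OF W g h]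
    by (auto simp: right_mult_zero_mat[OF is_gmodD(1)[OF V g]] left_mult_zero_mat[OF is_gmodD(1)[OF W h]]
        right_mult_zero_mat[OF is_gmodD(1)[OF W g]] left_mult_zero_mat[OF is_gmodD(1)[OF V h]] mult_four_block_mat[of _ "gdim V" "gdim V" _ "gdim W" _ "gdim W" _ _ "gdim V" _ "gdim W"])
qed (use is_gmodD[OF V] is_gmodD[OF W] in auto)

text \<open>The interface between block matrices and biproducts: 0-1 matrices insert and extract the
  two ranges of coordinates.\<close>

lemma gsum_biprod:
  fixes V W :: "('g, 'f :: field) gmod"
  assumes V: "is_gmod G V" and W: "is_gmod G W"
  obtains i j p q where "is_biprod G V W (gsum V W) i j p q"
proof -
  let ?m = "gdim V" and ?n = "gdim W"
  define i where "i = mat (?m + ?n) ?m (\<lambda>(x, y). if x = y then 1 else 0 :: 'f)"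
  define j where "j = mat (?m + ?n) ?n (\<lambda>(x, y). if x = y + ?m then 1 else 0 :: 'f)"
  define p where "p = mat ?m (?m + ?n) (\<lambda>(x, y). if x = y then 1 else 0 :: 'f)"
  define q where "q = mat ?n (?m + ?n) (\<lambda>(x, y). if x + ?m = y then 1 else 0 :: 'f)"
  note defs = i_def j_def p_def q_def
  have c: "i \<in> carrier_mat (?m + ?n) ?m" "j \<in> carrier_mat (?m + ?n) ?n"
    "p \<in> carrier_mat ?m (?m + ?n)" "q \<in> carrier_mat ?n (?m + ?n)" by (auto simp: defs)
  have sd: "(\<Sum>k = 0..<N. (if P k then 1 else 0) * F k) = (\<Sum>k \<in> {k \<in> {0..<N}. P k}. F k)"
    "(\<Sum>k = 0..<N. F k * (if P k then 1 else 0)) = (\<Sum>k \<in> {k \<in> {0..<N}. P k}. F k)"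
    for N P and F :: "nat \<Rightarrow> 'f" by (subst sum.inter_filter; auto intro!: sum.cong)+
  have s1: "{k. k < N \<and> k = x} = (if x < N then {x} else {})"
    "{k. k < N \<and> x = k} = (if x < N then {x} else {})" 
    "{k. k < N \<and> k + y = x} = (if y \<le> x \<and> x < N + y then {x - y} else {})"
    "{k. k < N \<and> x = k + y} = (if y \<le> x \<and> x < N + y then {x - y} else {})" for N x y :: nat by auto
  have act: "gact (gsum V W) g $$ (x, y) =
     (if x < ?m then if y < ?m then gact V g $$ (x, y) else 0
      else if y < ?m then 0 else gact W g $$ (x - ?m, y - ?m))"
    if "x < ?m + ?n" "y < ?m + ?n" "g \<in> carrier G" for x y g
    using that is_gmod_dim[OF V] is_gmod_dim[OF W] by auto
  note comp = scalar_prod_def sd s1 defs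
  have "is_biprod G V W (gsum V W) i j p q"
    unfolding is_biprod_def
  proof (intro conjI V W is_gmod_gsum)
    have C: "gact (gsum V W) g \<in> carrier_mat (?m + ?n) (?m + ?n)" if "g \<in> carrier G" for g
      using is_gmodD(1)[OF is_gmod_gsum[OF V W] that] by simp
    note cV = is_gmodD(1)[OF V] and cW = is_gmodD(1)[OF W]
    show "is_ghom G V (gsum V W) i"
      unfolding is_ghom_def
    proof (intro conjI ballI)
      fix g assume g: "g \<in> carrier G"
      show "i * gact V g = gact (gsum V W) g * i"
        using c C[OF g] cV[OF g] g
        by (intro eq_matI, simp_all only: mat_mult_index[OF c(1) cV[OF g]] mat_mult_index[OF C[OF g] c(1)] carrier_matD index_mult_mat(2,3))
          (simp_all add: act defs sd s1 del: gsum_simps)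
    qed (use c in simp)
    show "is_ghom G W (gsum V W) j"
      unfolding is_ghom_def
    proof (intro conjI ballI)
      fix g assume g: "g \<in> carrier G"
      show "j * gact W g = gact (gsum V W) g * j"
        using c C[OF g] cW[OF g] g
        by (intro eq_matI, simp_all only: mat_mult_index[OF c(2) cW[OF g]] mat_mult_index[OF C[OF g] c(2)] carrier_matD index_mult_mat(2,3))
          (simp_all add: act defs sd s1 del: gsum_simps)
    qed (use c in simp)
    show "is_ghom G (gsum V W) V p"
      unfolding is_ghom_def
    proof (intro conjI ballI)
      fix g assume g: "g \<in> carrier G"
      show "p * gact (gsum V W) g = gact V g * p"
        using c C[OF g] cV[OF g] g
        by (intro eq_matI, simp_all only: mat_mult_index[OF c(3) C[OF g]] mat_mult_index[OF cV[OF g] c(3)] carrier_matD index_mult_mat(2,3))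
          (simp_all add: act defs sd s1 del: gsum_simps)
    qed (use c in simp)
    show "is_ghom G (gsum V W) W q"
      unfolding is_ghom_def
    proof (intro conjI ballI)
      fix g assume g: "g \<in> carrier G"
      show "q * gact (gsum V W) g = gact W g * q"
        using c C[OF g] cW[OF g] g
        by (intro eq_matI, simp_all only: mat_mult_index[OF c(4) C[OF g]] mat_mult_index[OF cW[OF g] c(4)] carrier_matD index_mult_mat(2,3))
          (simp_all add: act defs sd s1 del: gsum_simps)
    qed (use c in simp)
    show "p * i = 1\<^sub>m ?m" by (rule eq_matI) (auto simp: comp)
    show "q * j = 1\<^sub>m ?n" by (rule eq_matI) (auto simp: comp)
    show "p * j = 0\<^sub>m ?m ?n" by (rule eq_matI) (auto simp: comp)
    show "q * i = 0\<^sub>m ?n ?m" by (rule eq_matI) (auto simp: comp)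
    show "i * p + j * q = gid (gsum V W)" by (rule eq_matI) (auto simp: comp)
  qed
  then show thesis by (rule that)
qed

section \<open>Stable isomorphism\<close>

lemma mat_zero_mult:
  fixes X :: "'a :: semiring_0 mat"
  shows "dim_row X = n \<Longrightarrow> 0\<^sub>m m n * X = 0\<^sub>m m (dim_col X)"
  by (rule left_mult_zero_mat) (auto intro!: carrier_matI)

lemma mat_mult_zero:
  fixes X :: "'a :: semiring_0 mat"
  shows "dim_col X = m \<Longrightarrow> X * 0\<^sub>m m n = 0\<^sub>m (dim_row X) n"
  by (rule right_mult_zero_mat) (auto intro!: carrier_matI)

lemma mat_zero_add:
  fixes X :: "'a :: monoid_add mat"
  shows "dim_row X = m \<Longrightarrow> dim_col X = n \<Longrightarrow> 0\<^sub>m m n + X = X"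
  by (auto intro!: eq_matI)

lemma mat_add_zero:
  fixes X :: "'a :: monoid_add mat"
  shows "dim_row X = m \<Longrightarrow> dim_col X = n \<Longrightarrow> X + 0\<^sub>m m n = X"
  by (auto intro!: eq_matI)

lemmas mat_zeros = mat_zero_mult mat_mult_zero mat_zero_add mat_add_zero

lemma mat_diff_self: "A - A = 0\<^sub>m (dim_row A) (dim_col A)"
  for A :: "'a :: group_add mat"
  by (auto intro!: eq_matI)

lemma mat_diff_add_diff:
  fixes A B C :: "'a :: ab_group_add mat"
  assumes "dim_row A = dim_row B" "dim_col A = dim_col B" "dim_row B = dim_row C" "dim_col B = dim_col C"
  shows "(A - B) + (B - C) = A - C"
  using assms by (auto intro!: eq_matI)

lemma is_biprodD:
  assumes "is_biprod G V W S i j p q"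
  shows "is_gmod G V" "is_gmod G W" "is_gmod G S"
    "is_ghom G V S i" "is_ghom G W S j" "is_ghom G S V p" "is_ghom G S W q"
    "p * i = gid V" "q * j = gid W" "p * j = 0\<^sub>m (gdim V) (gdim W)"
    "q * i = 0\<^sub>m (gdim W) (gdim V)" "i * p + j * q = gid S"
  using assms by (auto simp: is_biprod_def)

lemma is_biprod_dim:
  assumes "is_biprod G V W S i j p q"
  shows "dim_row i = gdim S" "dim_col i = gdim V" "dim_row j = gdim S" "dim_col j = gdim W"
    "dim_row p = gdim V" "dim_col p = gdim S" "dim_row q = gdim W" "dim_col q = gdim S"
  using is_biprodD(4-7)[OF assms] by (auto dest: is_ghomD(2,3))

context fin_group
begin

text \<open>Isomorphism in the stable module category, given by maps that are mutually inverse
  modulo traces. Projective summands do not occur, which keeps transitivity and compatibility with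
  tensor products and syzygies equational.\<close>

definition sim :: "('a, 'f :: field) gmod \<Rightarrow> ('a, 'f) gmod \<Rightarrow> bool" where
  "sim V W \<longleftrightarrow> is_gmod G V \<and> is_gmod G W \<and>
     (\<exists>A B. is_ghom G V W A \<and> is_ghom G W V B \<and>
        tmap V V (B * A - gid V) \<and> tmap W W (A * B - gid W))"

lemma simI:
  "is_gmod G V \<Longrightarrow> is_gmod G W \<Longrightarrow> is_ghom G V W A \<Longrightarrow> is_ghom G W V B \<Longrightarrow>
    tmap V V (B * A - gid V) \<Longrightarrow> tmap W W (A * B - gid W) \<Longrightarrow> sim V W"
  by (auto simp: sim_def)

lemma simE:
  assumes "sim V W"
  obtains A B where "is_gmod G V" "is_gmod G W" "is_ghom G V W A" "is_ghom G W V B"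
    "tmap V V (B * A - gid V)" "tmap W W (A * B - gid W)"
  using assms by (auto simp: sim_def)

lemma sim_gmod: "sim V W \<Longrightarrow> is_gmod G V" "sim V W \<Longrightarrow> is_gmod G W"
  by (auto simp: sim_def)

lemma sim_sym: "sim V W \<Longrightarrow> sim W V"
  by (auto simp: sim_def)

lemma giso_imp_sim:
  assumes "giso G V W" "is_gmod G V" "is_gmod G W"
  shows "sim V W"
proof -
  obtain A B where AB: "is_ghom G V W A" "is_ghom G W V B"
    "A * B = gid W" "B * A = gid V" by (rule gisoE[OF assms])
  then show ?thesis using assms tmap_zero by (intro simI[of V W A B]) (auto simp: mat_diff_self)
qed

lemma sim_refl: "is_gmod G V \<Longrightarrow> sim V V"
  by (simp add: giso_imp_sim giso_refl)

lemma tmap_sandwich: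
  assumes "is_gmod G V" "is_gmod G W" "is_gmod G X"
    and "is_ghom G V W A" "is_ghom G W X B" "tmap W W T"
  shows "tmap V X (B * T * A)"
  using assms by (meson tmap_comp_left tmap_comp_right)

text \<open>Telescoping: \<open>B D C A - 1 = B (D C - 1) A + (B A - 1)\<close> is a sum of trace
  maps.\<close>

lemma sim_comp_half:
  fixes U V W :: "('a, 'f :: field) gmod"
  assumes U: "is_gmod G U" and V: "is_gmod G V" and W: "is_gmod G W"
    and A: "is_ghom G U V A" and B: "is_ghom G V U B" and C: "is_ghom G V W C" and D: "is_ghom G W V D"
    and t1: "tmap U U (B * A - gid U)" and t2: "tmap V V (D * C - gid V)"
  shows "tmap U U (B * D * (C * A) - gid U)"
proof -
  note d = is_ghomD(2,3)[OF A] is_ghomD(2,3)[OF B] is_ghomD(2,3)[OF C] is_ghomD(2,3)[OF D]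
  have "B * (D * C - gid V) * A + (B * A - gid U) = B * D * (C * A) - gid U"
  proof -
    have "B * (D * C - gid V) * A = B * D * (C * A) - B * A"
      by (simp add: d mat_assoc mat_distribs)
    then show ?thesis by (simp add: mat_diff_add_diff d)
  qed
  then show ?thesis using tmap_add[OF U U tmap_sandwich[OF U V U A B t2] t1] by simp
qed

lemma sim_trans [trans]:
  assumes "sim U V" "sim V W"
  shows "sim U W"
proof -
  obtain A B where U: "is_gmod G U" and V: "is_gmod G V"
    and 1: "is_ghom G U V A" "is_ghom G V U B" "tmap U U (B * A - gid U)" "tmap V V (A * B - gid V)"
    by (rule simE[OF assms(1)])
  obtain C D where W: "is_gmod G W"
    and 2: "is_ghom G V W C" "is_ghom G W V D" "tmap V V (D * C - gid V)" "tmap W W (C * D - gid W)"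
    by (rule simE[OF assms(2)])
  show ?thesis
    by (rule simI[OF U W ghom_comp[OF V W U 2(1) 1(1)] ghom_comp[OF V U W 1(2) 2(2)]
          sim_comp_half[OF U V W 1(1,2) 2(1,2) 1(3) 2(3)] sim_comp_half[OF W V U 2(2,1) 1(2,1) 2(4) 1(4)]])
qed

lemma sim_gtensor_left:
  assumes "sim V W" and X: "is_gmod G X"
  shows "sim (gtensor V X) (gtensor W X)"
proof -
  obtain A B where V: "is_gmod G V" and W: "is_gmod G W" and A: "is_ghom G V W A" and B: "is_ghom G W V B"
    and t: "tmap V V (B * A - gid V)" "tmap W W (A * B - gid W)"
    by (rule simE[OF assms(1)])
  note d = is_ghomD(2,3)[OF A] is_ghomD(2,3)[OF B] and one = ghom_one[OF X]
  show ?thesis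
  proof (rule simI[OF is_gmod_gtensor[OF V X] is_gmod_gtensor[OF W X]
          ghom_kron[OF V W X X A one] ghom_kron[OF W V X X B one]])
    show "tmap (gtensor V X) (gtensor V X)
        (kronecker B (gid X) * kronecker A (gid X) - gid (gtensor V X))"
      using tmap_kron_left[OF V V X X t(1) one] d by (simp add: kron_mult kron_minus_left kron_one)
    show "tmap (gtensor W X) (gtensor W X)
        (kronecker A (gid X) * kronecker B (gid X) - gid (gtensor W X))"
      using tmap_kron_left[OF W W X X t(2) one] d by (simp add: kron_mult kron_minus_left kron_one)
  qed
qed

lemma sim_gtensor_right:
  assumes "sim V W" and X: "is_gmod G X"
  shows "sim (gtensor X V) (gtensor X W)"
proof -
  obtain A B where V: "is_gmod G V" and W: "is_gmod G W" and A: "is_ghom G V W A" and B: "is_ghom G W V B"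
    and t: "tmap V V (B * A - gid V)" "tmap W W (A * B - gid W)"
    by (rule simE[OF assms(1)])
  note d = is_ghomD(2,3)[OF A] is_ghomD(2,3)[OF B] and one = ghom_one[OF X]
  show ?thesis
  proof (rule simI[OF is_gmod_gtensor[OF X V] is_gmod_gtensor[OF X W]
          ghom_kron[OF X X V W one A] ghom_kron[OF X X W V one B]])
    show "tmap (gtensor X V) (gtensor X V)
        (kronecker (gid X) B * kronecker (gid X) A - gid (gtensor X V))"
      using tmap_kron_right[OF V V X X t(1) one] d by (simp add: kron_mult kron_minus_right kron_one)
    show "tmap (gtensor X W) (gtensor X W)
        (kronecker (gid X) A * kronecker (gid X) B - gid (gtensor X W))"
      using tmap_kron_right[OF W W X X t(2) one] d by (simp add: kron_mult kron_minus_right kron_one)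
  qed
qed

text \<open>The composite is diagonal with respect to the biproduct, so its deviation from the
  identity is the sum of the deviations of the two components, each placed between an injection and
  a projection.\<close>

lemma biprod_comp_half:
  fixes V W S V' W' S' :: "('a, 'f :: field) gmod"
  assumes S: "is_biprod G V W S i j p q" and S': "is_biprod G V' W' S' i' j' p' q'"
    and A: "is_ghom G V V' A" and B: "is_ghom G V' V B" and C: "is_ghom G W W' C" and D: "is_ghom G W' W D"
    and t: "tmap V V (B * A - gid V)" "tmap W W (D * C - gid W)"
  shows "tmap S S ((i * B * p' + j * D * q') * (i' * A * p + j' * C * q) - gid S)"
proof -
  note D1 = is_biprodD[OF S] and D2 = is_biprodD[OF S']
  note d = is_ghomD(2,3)[OF A] is_ghomD(2,3)[OF B] is_ghomD(2,3)[OF C] is_ghomD(2,3)[OF D]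
    is_biprod_dim[OF S] is_biprod_dim[OF S']
  have 1: "(i * B * p' + j * D * q') * (i' * A * p + j' * C * q) = i * B * A * p + j * D * C * q"
    by (simp add: d mat_assoc mat_distribs mat_rewr[OF D2(8)] mat_rewr[OF D2(9)] mat_rewr[OF D2(10)]
        mat_rewr[OF D2(11)] mat_zeros)
  have 2: "i * (B * A - gid V) * p + j * (D * C - gid W) * q
     = (i * B * A * p - i * p) + (j * D * C * q - j * q)"
    by (simp add: d mat_assoc mat_distribs)
  also have "\<dots> = (i * B * A * p + j * D * C * q) - (i * p + j * q)"
    by (rule eq_matI) (simp_all add: d del: index_mult_mat(1))
  finally show ?thesis
    using tmap_add[OF D1(3,3) tmap_sandwich[OF D1(3,1,3,6,4) t(1)] tmap_sandwich[OF D1(3,2,3,7,5) t(2)]]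
    by (simp add: 1 D1(12))
qed

lemma sim_biprod:
  assumes S: "is_biprod G V W S i j p q" and S': "is_biprod G V' W' S' i' j' p' q'"
    and "sim V V'" "sim W W'"
  shows "sim S S'"
proof -
  obtain A B where 1: "is_gmod G V" "is_gmod G V'" "is_ghom G V V' A" "is_ghom G V' V B"
    "tmap V V (B * A - gid V)" "tmap V' V' (A * B - gid V')"
    by (rule simE[OF assms(3)])
  obtain C D where 2: "is_gmod G W" "is_gmod G W'" "is_ghom G W W' C" "is_ghom G W' W D"
    "tmap W W (D * C - gid W)" "tmap W' W' (C * D - gid W')"
    by (rule simE[OF assms(4)])
  note D1 = is_biprodD[OF S] and D2 = is_biprodD[OF S']
  show ?thesis
  proof (rule simI)
    show "is_ghom G S S' (i' * A * p + j' * C * q)"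
      using 1 2 D1 D2 by (intro ghom_add ghom_comp) auto
    show "is_ghom G S' S (i * B * p' + j * D * q')"
      using 1 2 D1 D2 by (intro ghom_add ghom_comp) auto
  qed (use D1(3) D2(3) biprod_comp_half[OF S S' 1(3,4) 2(3,4) 1(5) 2(5)]
      biprod_comp_half[OF S' S 1(4,3) 2(4,3) 1(6) 2(6)] in auto)
qed

lemma sim_gsum:
  assumes "sim V V'" "sim W W'"
  shows "sim (gsum V W) (gsum V' W')"
proof -
  obtain i j p q where "is_biprod G V W (gsum V W) i j p q"
    using gsum_biprod sim_gmod assms by metis
  moreover obtain i' j' p' q' where "is_biprod G V' W' (gsum V' W') i' j' p' q'"
    using gsum_biprod sim_gmod assms by metis
  ultimately show ?thesis using sim_biprod assms by blast
qed

lemma sim_biprod_unique: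
  assumes "is_biprod G V W S i j p q" "is_biprod G V W S' i' j' p' q'"
  shows "sim S S'"
  using sim_biprod[OF assms] is_biprodD(1,2)[OF assms(1)] by (simp add: sim_refl)

lemma is_biprod_comm:
  assumes "is_biprod G V W S i j p q"
  shows "is_biprod G W V S j i q p"
proof -
  have "j * q + i * p = i * p + j * q"
    by (rule comm_add_mat[of _ "gdim S" "gdim S"]) (auto simp: is_biprod_dim[OF assms] intro!: carrier_matI)
  then show ?thesis using assms by (auto simp: is_biprod_def)
qed

lemma sim_gsum_comm:
  assumes V: "is_gmod G V" and W: "is_gmod G W"
  shows "sim (gsum V W) (gsum W V)"
  by (metis gsum_biprod[OF V W] gsum_biprod[OF W V] is_biprod_comm sim_biprod_unique)

text \<open>A sum bracketed to the left is also a biproduct for the other bracketing, with composed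
  structure maps. Associativity up to \<open>sim\<close> and up to isomorphism are both read off
  from this.\<close>

lemma is_biprod_assoc:
  assumes S: "is_biprod G U V S i j p q" and R: "is_biprod G S W R i' j' p' q'"
    and X: "is_biprod G V W X k l r s"
  shows "is_biprod G U X R (i' * i) (i' * j * r + j' * s) (p * p') (k * q * p' + l * q')"
proof -
  note D1 = is_biprodD[OF S] and D2 = is_biprodD[OF R] and D3 = is_biprodD[OF X]
  note d = is_biprod_dim[OF S] is_biprod_dim[OF R] is_biprod_dim[OF X]
  note rw = D1(8-11) D2(8-11) D3(8-11) mat_rewr[OF D1(8)] mat_rewr[OF D1(9)] mat_rewr[OF D1(10)] mat_rewr[OF D1(11)]
    mat_rewr[OF D2(8)] mat_rewr[OF D2(9)] mat_rewr[OF D2(10)] mat_rewr[OF D2(11)]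
    mat_rewr[OF D3(8)] mat_rewr[OF D3(9)] mat_rewr[OF D3(10)] mat_rewr[OF D3(11)]
  note calc = d mat_assoc mat_distribs mat_zeros rw
  show ?thesis
    unfolding is_biprod_def
  proof (intro conjI)
    show "(k * q * p' + l * q') * (i' * j * r + j' * s) = gid X"
      using D3(12) by (simp add: calc)
    have "i' * i * (p * p') + (i' * j * r + j' * s) * (k * q * p' + l * q')
        = i' * i * (p * p') + (i' * j * q * p' + j' * q')"
      by (simp add: calc)
    also have "\<dots> = (i' * (i * p) * p' + i' * (j * q) * p') + j' * q'"
      by (rule eq_matI) (simp_all add: d mat_assoc add.assoc del: index_mult_mat(1))
    also have "i' * (i * p) * p' + i' * (j * q) * p' = i' * (i * p + j * q) * p'"
      by (simp add: d mat_assoc mat_distribs)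
    also have "\<dots> = i' * p'" by (simp add: D1(12) d mat_distribs)
    finally show "i' * i * (p * p') + (i' * j * r + j' * s) * (k * q * p' + l * q') = gid R"
      by (simp add: D2(12))
  qed (use D1 D2 D3 in \<open>(intro ghom_add ghom_comp; fastforce)
      | simp add: calc\<close>)+
qed

lemma sim_gsum_assoc:
  assumes U: "is_gmod G U" and V: "is_gmod G V" and W: "is_gmod G W"
  shows "sim (gsum (gsum U V) W) (gsum U (gsum V W))"
proof -
  obtain i j p q where 1: "is_biprod G U V (gsum U V) i j p q" using gsum_biprod[OF U V] .
  obtain i' j' p' q' where 2: "is_biprod G (gsum U V) W (gsum (gsum U V) W) i' j' p' q'"
    using gsum_biprod[OF is_gmod_gsum[OF U V] W] .
  obtain k l r s where 3: "is_biprod G V W (gsum V W) k l r s" using gsum_biprod[OF V W] .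
  obtain k' l' r' s' where 4: "is_biprod G U (gsum V W) (gsum U (gsum V W)) k' l' r' s'"
    using gsum_biprod[OF U is_gmod_gsum[OF V W]] .
  show ?thesis by (rule sim_biprod_unique[OF is_biprod_assoc[OF 1 2 3] 4])
qed

lemma is_biprod_gtensor:
  assumes S: "is_biprod G V W S i j p q" and X: "is_gmod G X"
  shows "is_biprod G (gtensor X V) (gtensor X W) (gtensor X S) (kronecker (gid X) i)
    (kronecker (gid X) j) (kronecker (gid X) p) (kronecker (gid X) q)"
proof -
  note D = is_biprodD[OF S] and d = is_biprod_dim[OF S]
  show ?thesis
    unfolding is_biprod_def
    using D X by (auto intro!: is_gmod_gtensor ghom_kron ghom_one
        simp: kron_mult d kron_one kron_zero_right kron_add_right[symmetric])
qed

lemma sim_gtensor_gsum: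
  assumes "is_gmod G X" "is_gmod G V" "is_gmod G W"
  shows "sim (gtensor X (gsum V W)) (gsum (gtensor X V) (gtensor X W))"
  by (metis assms gsum_biprod is_biprod_gtensor is_gmod_gtensor sim_biprod_unique)

section \<open>Projective modules and stable isomorphism\<close>

lemma projective_lift:
  assumes P: "is_gmod G P" and t: "tmap P P (gid P)" and M: "is_gmod G M" and N: "is_gmod G N"
    and A: "is_ghom G M N A" and s: "s \<in> gmats N M" "A * s = gid N"
    and B: "is_ghom G P N B"
  obtains C where "is_ghom G P M C" "A * C = B"
proof -
  obtain f where f: "f \<in> gmats P P" "gid P = gtrace P P f"
    using t by (auto simp: tmap_def)
  note cB = is_ghomD(1)[OF B] and cA = is_ghomD(1)[OF A]
  have c: "s * (B * f) \<in> gmats P M" using s cB f by auto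
  \<comment> \<open>Lift linearly by \<open>s\<close> and average: since the identity of
    \<open>P\<close> is the trace of \<open>f\<close>, the trace of \<open>s * (B * f)\<close> is an
    equivariant lift of \<open>B\<close>.\<close>
  show thesis
  proof (rule that[OF gtrace_hom[OF P M c]])
    have "A * (s * (B * f)) = B * f"
      using s cA cB f by (simp add: mat_rewr[OF s(2)] mat_distribs)
    then have "A * gtrace P M (s * (B * f)) = gtrace P N (B * f)"
      by (simp add: ghom_gtrace[OF P M N c A])
    also have "\<dots> = B * gtrace P P f" using ghom_gtrace[OF P P N f(1) B] by simp
    finally show "A * gtrace P M (s * (B * f)) = B" using cB by (simp add: f(2)[symmetric])
  qed
qed

text \<open>Higman's criterion. A projective module is a retract of its free cover, and the property
  of having a trace as identity passes to retracts; the converse averages a linear lift.\<close>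

lemma gprojective_iff: "gprojective G P \<longleftrightarrow> is_gmod G P \<and> tmap P P (gid P)"
proof
  assume P: "gprojective G P"
  then have g: "is_gmod G P" by (simp add: gprojective_def)
  obtain M A s where M: "is_gmod G M" and t: "tmap M M (gid M)" and A: "is_ghom G M P A"
    and s: "s \<in> gmats P M" "A * s = gid P"
    by (rule exists_free_cover[OF g])
  have "gsurj M P A" using section_surj[OF is_ghomD(1)[OF A] s] by (simp add: gsurj_def)
  then obtain C where C: "is_ghom G P M C" "A * C = gid P"
    using P M g A ghom_one[OF g] unfolding gprojective_def by metis
  have "tmap P P (A * gid M * C)" by (rule tmap_sandwich[OF g M g C(1) A t])
  then show "is_gmod G P \<and> tmap P P (gid P)"
    using g C(2) is_ghomD(3)[OF A] by (simp add: mat_distribs)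
next
  assume P: "is_gmod G P \<and> tmap P P (gid P)"
  show "gprojective G P"
    unfolding gprojective_def
  proof (intro conjI allI impI)
    fix M N A B
    assume M: "is_gmod G M" and N: "is_gmod G N" and A: "is_ghom G M N A" and surj: "gsurj M N A"
      and B: "is_ghom G P N B"
    obtain s where s: "s \<in> gmats N M" "A * s = gid N"
      using surj_section[OF is_ghomD(1)[OF A]] surj by (auto simp: gsurj_def)
    show "\<exists>C. is_ghom G P M C \<and> A * C = B"
      using projective_lift[OF _ _ M N A s B] P by blast
  qed (use P in simp)
qed

text \<open>Adding a projective \<open>P\<close> that covers \<open>W\<close> turns the stable
  inverse pair into a split surjection of \<open>V \<oplus> P\<close> onto \<open>W\<close>. Its
  kernel \<open>K\<close> is projective, and \<open>V \<oplus> P\<close> is isomorphic to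
  \<open>W \<oplus> K\<close>.\<close>

lemma sim_imp_stably_iso:
  assumes "sim V W"
  shows "stably_iso G V W"
proof -
  obtain A B where V: "is_gmod G V" and W: "is_gmod G W" and A: "is_ghom G V W A" and B: "is_ghom G W V B"
    and t: "tmap V V (B * A - gid V)" "tmap W W (A * B - gid W)"
    by (rule simE[OF assms])
  obtain P \<pi> s where P: "is_gmod G P" and tP: "tmap P P (gid P)" and \<pi>: "is_ghom G P W \<pi>"
    and s: "s \<in> gmats W P" "\<pi> * s = gid W"
    by (rule exists_free_cover[OF W])
  obtain f where f: "f \<in> gmats W W" "A * B - gid W = gtrace W W f"
    using t(2) by (auto simp: tmap_def)
  \<comment> \<open>An equivariant lift of \<open>A * B - 1\<close> along \<open>\<pi>\<close>: the
    linear section \<open>s\<close> moves the trace from \<open>W\<close> to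
    \<open>P\<close>.\<close>
  define c where "c = gtrace W P (s * f)"
  have c: "is_ghom G W P c" unfolding c_def using s f by (intro gtrace_hom W P) auto
  have "\<pi> * c = gtrace W W (\<pi> * (s * f))"
    unfolding c_def using s f by (intro ghom_gtrace W P \<pi>) auto
  also have "\<pi> * (s * f) = f"
    using s f is_ghomD(3)[OF \<pi>] by (simp add: mat_rewr[OF s(2)] mat_distribs)
  finally have \<pi>c: "\<pi> * c = A * B - gid W" using f by simp
  define S where "S = gsum V P"
  obtain i j p q where S: "is_biprod G V P S i j p q" unfolding S_def by (rule gsum_biprod[OF V P])
  note D1 = is_biprodD[OF S]
  note d = is_biprod_dim[OF S] is_ghomD(2,3)[OF A] is_ghomD(2,3)[OF B] is_ghomD(2,3)[OF \<pi>] is_ghomD(2,3)[OF c]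
  note rw = D1(8-11) mat_rewr[OF D1(8)] mat_rewr[OF D1(9)] mat_rewr[OF D1(10)] mat_rewr[OF D1(11)]
  \<comment> \<open>In block form \<open>\<sigma> = (A, \<pi>)\<close> and
    \<open>\<beta> = (B, -c)\<close>, so
    \<open>\<sigma> * \<beta> = A * B - \<pi> * c = 1\<close>.\<close>
  define \<sigma> where "\<sigma> = A * p + \<pi> * q"
  define \<beta> where "\<beta> = i * B - j * c"
  have \<sigma>: "is_ghom G S W \<sigma>" unfolding \<sigma>_def using D1 A \<pi> W P V by (intro ghom_add ghom_comp)
  have \<beta>: "is_ghom G W S \<beta>" unfolding \<beta>_def using D1 B c W P V by (intro ghom_minus ghom_comp)
  note d' = d is_ghomD(2,3)[OF \<sigma>] is_ghomD(2,3)[OF \<beta>]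
  have "\<sigma> * \<beta> = A * B - \<pi> * c"
    unfolding \<sigma>_def \<beta>_def by (simp add: d mat_assoc mat_distribs rw mat_zeros)
  also have "\<dots> = gid W" unfolding \<pi>c by (rule eq_matI) (auto simp: d simp del: index_mult_mat(1))
  finally have \<sigma>\<beta>: "\<sigma> * \<beta> = gid W" .
  define e where "e = gid S - \<beta> * \<sigma>"
  have e: "is_ghom G S S e"
    unfolding e_def using D1 W by (intro ghom_minus ghom_one ghom_comp[OF _ _ _ \<beta> \<sigma>])
  note d'' = d' is_ghomD(2,3)[OF e]
  have "e * e = e"
    unfolding e_def
    by (simp add: d' mat_assoc mat_distribs mat_rewr[OF \<sigma>\<beta>])
      (auto intro!: eq_matI simp: d' simp del: index_mult_mat(1))
  then obtain K \<iota> \<rho> where K: "is_gmod G K" and \<iota>: "is_ghom G K S \<iota>" and \<rho>: "is_ghom G S K \<rho>"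
    and \<rho>\<iota>: "\<rho> * \<iota> = gid K" and \<iota>\<rho>: "\<iota> * \<rho> = e"
    using idempotent_split[OF is_group D1(3) e] by blast
  note d3 = d'' is_ghomD(2,3)[OF \<iota>] is_ghomD(2,3)[OF \<rho>]
  \<comment> \<open>Up to sign, each term of \<open>1 - \<beta> * \<sigma>\<close> either contains
    \<open>B * A - 1\<close> or passes through the identity of \<open>P\<close>; the factors
    \<open>?one\<close> mark the latter.\<close>
  have te: "tmap S S e"
  proof -
    let ?one = "gid P"
    have "tmap S S (i * (B * A - gid V) * p)" by (rule tmap_sandwich[OF D1(3,1,3,6,4) t(1)])
    moreover have "tmap S S (i * B * \<pi> * ?one * q)"
      using D1 B \<pi> W P V by (intro tmap_sandwich[OF D1(3,2,3,7) _ tP] ghom_comp)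
    moreover have "tmap S S (j * ?one * (c * A * p))"
      using D1 A c W P V by (intro tmap_sandwich[OF D1(3,2,3) _ D1(5) tP] ghom_comp)
    moreover have "tmap S S (j * c * \<pi> * ?one * q)"
      using D1 c \<pi> W P V by (intro tmap_sandwich[OF D1(3,2,3,7) _ tP] ghom_comp)
    moreover have "tmap S S (j * ?one * q)"
      using D1 by (intro tmap_sandwich[OF D1(3,2,3,7,5) tP])
    ultimately have "tmap S S ((j * ?one * q + j * c * \<pi> * ?one * q + j * ?one * (c * A * p))
        - (i * (B * A - gid V) * p + i * B * \<pi> * ?one * q))"
      using D1(3) by (intro tmap_minus tmap_add)
    also have "(j * ?one * q + j * c * \<pi> * ?one * q + j * ?one * (c * A * p))
        - (i * (B * A - gid V) * p + i * B * \<pi> * ?one * q) = (i * p + j * q) - \<beta> * \<sigma>"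
      unfolding \<sigma>_def \<beta>_def by (simp add: d mat_assoc mat_distribs)
        (auto intro!: eq_matI simp: d algebra_simps simp del: index_mult_mat(1))
    finally show ?thesis by (simp add: e_def D1(12))
  qed
  \<comment> \<open>\<open>e\<close> restricts to the identity on its image \<open>K\<close>, so the
    identity of \<open>K\<close> is a sandwiched trace.\<close>
  have tK: "tmap K K (gid K)"
  proof -
    have "\<rho> * e * \<iota> = gid K"
      unfolding \<iota>\<rho>[symmetric] by (simp add: d3 mat_assoc mat_rewr[OF \<rho>\<iota>] \<rho>\<iota> mat_distribs)
    then show ?thesis using tmap_sandwich[OF K D1(3) K \<iota> \<rho> te] by simp
  qed
  have \<sigma>e: "\<sigma> * e = 0\<^sub>m (gdim W) (gdim S)"
    unfolding e_def by (simp add: d' mat_assoc mat_distribs mat_rewr[OF \<sigma>\<beta>] mat_diff_self)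
  have e\<beta>: "e * \<beta> = 0\<^sub>m (gdim S) (gdim W)"
    unfolding e_def by (simp add: d' mat_assoc mat_distribs \<sigma>\<beta> mat_diff_self)
  have "\<sigma> * \<iota> = \<sigma> * \<iota> * (\<rho> * \<iota>)" by (simp add: \<rho>\<iota> d3 mat_distribs)
  also have "\<dots> = \<sigma> * (\<iota> * \<rho>) * \<iota>" by (simp add: d3 mat_assoc)
  finally have \<sigma>\<iota>: "\<sigma> * \<iota> = 0\<^sub>m (gdim W) (gdim K)" by (simp add: \<iota>\<rho> \<sigma>e d3 mat_zeros)
  have "\<rho> * \<beta> = (\<rho> * \<iota>) * \<rho> * \<beta>" by (simp add: \<rho>\<iota> d3 mat_distribs)
  also have "\<dots> = \<rho> * ((\<iota> * \<rho>) * \<beta>)" by (simp add: d3 mat_assoc)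
  finally have \<rho>\<beta>: "\<rho> * \<beta> = 0\<^sub>m (gdim K) (gdim W)" by (simp add: \<iota>\<rho> e\<beta> d3 mat_zeros)
  define R where "R = gsum W K"
  obtain i' j' p' q' where R: "is_biprod G W K R i' j' p' q'" unfolding R_def by (rule gsum_biprod[OF W K])
  note D2 = is_biprodD[OF R]
  note d4 = d3 is_biprod_dim[OF R]
  note rw2 = D2(8-11) mat_rewr[OF D2(8)] mat_rewr[OF D2(9)] mat_rewr[OF D2(10)] mat_rewr[OF D2(11)]
    mat_rewr[OF \<rho>\<beta>] mat_rewr[OF \<sigma>\<iota>] mat_rewr[OF \<sigma>\<beta>] mat_rewr[OF \<rho>\<iota>]
  have "giso G S R"
  proof (rule gisoI)
    show "is_ghom G S R (i' * \<sigma> + j' * \<rho>)" using D1 D2 \<sigma> \<rho> by (intro ghom_add ghom_comp)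
    show "\<beta> * p' + \<iota> * q' \<in> gmats R S" by (auto simp: d4 intro!: carrier_matI)
    show "(i' * \<sigma> + j' * \<rho>) * (\<beta> * p' + \<iota> * q') = gid R"
      using D2(12) by (simp add: d4 mat_assoc mat_distribs rw2 mat_zeros)
    have "(\<beta> * p' + \<iota> * q') * (i' * \<sigma> + j' * \<rho>) = \<beta> * \<sigma> + \<iota> * \<rho>"
      by (simp add: d4 mat_assoc mat_distribs rw2 mat_zeros)
    also have "\<dots> = gid S"
      unfolding \<iota>\<rho> e_def by (rule eq_matI) (auto simp: d4 simp del: index_mult_mat(1))
    finally show "(\<beta> * p' + \<iota> * q') * (i' * \<sigma> + j' * \<rho>) = gid S" .
  qed
  then show ?thesis
    unfolding stably_iso_def S_def R_def using P tP K tK gprojective_iff by blast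
qed

end

section \<open>Heller translates\<close>

lemma inj_mat_surj:
  fixes A :: "'a :: field mat"
  assumes A: "A \<in> carrier_mat n k" and inj: "inj_on (\<lambda>v. A *\<^sub>v v) (carrier_vec k)" and "n \<le> k"
  shows "(\<lambda>v. A *\<^sub>v v) ` carrier_vec k = carrier_vec n"
proof -
  note ker = inj[unfolded inj_mat_iff[OF A]]
  have "k \<le> n" using ker_nontrivial[OF A] ker by (meson linorder_not_le)
  with \<open>n \<le> k\<close> have k: "k = n" by simp
  note A = A[unfolded k] and ker = ker[unfolded k]
  have "det A \<noteq> 0" using det_0_iff_vec_prod_zero_field[OF A] ker by blast
  then obtain B where B: "B \<in> carrier_mat n n" "A * B = 1\<^sub>m n"
    using det_non_zero_imp_unit[OF A, of undefined] by (auto simp: Units_def ring_mat_simps)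
  show ?thesis unfolding k by (rule section_surj[OF A B])
qed

text \<open>The retraction \<open>t\<close> of \<open>B\<close> is only linear; equivariance of
  \<open>C\<close> is inherited from \<open>B * C\<close> by cancelling \<open>B\<close> with
  it.\<close>

lemma ghom_factor:
  fixes X W P :: "('g, 'a :: field) gmod"
  assumes X: "is_gmod G X" and W: "is_gmod G W" and P: "is_gmod G P" and B: "is_ghom G W P B"
    and t: "t \<in> gmats P W" "t * B = gid W"
    and C: "C \<in> gmats X W" and BC: "is_ghom G X P (B * C)"
  shows "is_ghom G X W C"
  unfolding is_ghom_def
proof (intro conjI ballI C)
  fix g assume g: "g \<in> carrier G"
  note d = is_gmod_dim[OF X g] is_gmod_dim[OF W g] is_gmod_dim[OF P g] is_ghomD(2,3)[OF B]
    carrier_matD[OF t(1)] carrier_matD[OF C]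
  have "C * gact X g = (t * B) * C * gact X g" by (simp add: t d mat_distribs)
  also have "\<dots> = t * ((B * C) * gact X g)" by (simp add: d mat_assoc)
  also have "(B * C) * gact X g = (gact P g * B) * C" by (simp add: is_ghomD(4)[OF BC g] d mat_assoc)
  also have "gact P g * B = B * gact W g" by (simp add: is_ghomD(4)[OF B g])
  also have "t * (B * gact W g * C) = gact W g * C"
    by (simp add: d mat_assoc mat_rewr[OF t(2)] mat_distribs)
  finally show "C * gact X g = gact W g * C" .
qed

context fin_group
begin

text \<open>A short exact sequence from \<open>W\<close> through a projective \<open>P\<close> to
  \<open>V\<close>. Exactness is expressed by a linear, not necessarily equivariant, splitting
  \<open>s\<close>, \<open>t\<close>; in this form the data survive tensoring with any
  module.\<close>

definition resolves :: "('a, 'f :: field) gmod \<Rightarrow> ('a, 'f) gmod \<Rightarrow> ('a, 'f) gmod \<Rightarrow>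
    'f mat \<Rightarrow> 'f mat \<Rightarrow> 'f mat \<Rightarrow> 'f mat \<Rightarrow> bool" where
  "resolves V W P A B s t \<longleftrightarrow>
     is_gmod G V \<and> is_gmod G W \<and> is_gmod G P \<and> tmap P P (gid P) \<and>
     is_ghom G P V A \<and> is_ghom G W P B \<and>
     s \<in> gmats V P \<and> t \<in> gmats P W \<and>
     A * s = gid V \<and> t * B = gid W \<and> A * B = 0\<^sub>m (gdim V) (gdim W) \<and>
     B * t + s * A = gid P"

definition syz :: "('a, 'f :: field) gmod \<Rightarrow> ('a, 'f) gmod \<Rightarrow> bool" where
  "syz V W \<longleftrightarrow> (\<exists>P A B s t. resolves V W P A B s t)"

lemma resolvesD:
  assumes "resolves V W P A B s t"
  shows "is_gmod G V" "is_gmod G W" "is_gmod G P" "tmap P P (gid P)"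
    "is_ghom G P V A" "is_ghom G W P B" "s \<in> gmats V P" "t \<in> gmats P W"
    "A * s = gid V" "t * B = gid W" "A * B = 0\<^sub>m (gdim V) (gdim W)"
    "B * t + s * A = gid P"
  using assms by (auto simp: resolves_def)

lemma resolves_dim:
  assumes "resolves V W P A B s t"
  shows "dim_row A = gdim V" "dim_col A = gdim P" "dim_row B = gdim P" "dim_col B = gdim W"
    "dim_row s = gdim P" "dim_col s = gdim V" "dim_row t = gdim W" "dim_col t = gdim P"
  using resolvesD(5-8)[OF assms] by (auto dest: is_ghomD(2,3))

text \<open>A stable form of Schanuel's lemma. The trace \<open>b * a - 1\<close> lifts to a
  homomorphism \<open>\<sigma>\<close> into \<open>P\<close>. Then
  \<open>m * l - 1 - \<sigma> * A\<close> is killed by \<open>A\<close>, so it comes from a map into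
  \<open>W\<close>, and \<open>\<beta> * \<alpha> - 1\<close> is that map composed with
  \<open>B\<close>; it factors through \<open>P\<close>.\<close>

lemma schanuel_half:
  assumes R: "resolves V W P A B s t" and R': "resolves V' W' P' A' B' s' t'"
    and a: "is_ghom G V V' a" and b: "is_ghom G V' V b" and ba: "tmap V V (b * a - gid V)"
    and l: "is_ghom G P P' l" "A' * l = a * A" and m: "is_ghom G P' P m" "A * m = b * A'"
    and \<alpha>: "is_ghom G W W' \<alpha>" "B' * \<alpha> = l * B" and \<beta>: "is_ghom G W' W \<beta>" "B * \<beta> = m * B'"
  shows "tmap W W (\<beta> * \<alpha> - gid W)"
proof -
  note D1 = resolvesD[OF R] and D2 = resolvesD[OF R']
  note d = resolves_dim[OF R] resolves_dim[OF R'] is_ghomD(2,3)[OF a] is_ghomD(2,3)[OF b]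
    is_ghomD(2,3)[OF l(1)] is_ghomD(2,3)[OF m(1)] is_ghomD(2,3)[OF \<alpha>(1)] is_ghomD(2,3)[OF \<beta>(1)]
  obtain f where f: "f \<in> gmats V V" "b * a - gid V = gtrace V V f"
    using ba by (auto simp: tmap_def)
  define \<sigma> where "\<sigma> = gtrace V P (s * f)"
  have c: "s * f \<in> gmats V P" using D1(7) f by auto
  have \<sigma>: "is_ghom G V P \<sigma>" unfolding \<sigma>_def by (rule gtrace_hom[OF D1(1,3) c])
  have "A * \<sigma> = gtrace V V (A * (s * f))"
    unfolding \<sigma>_def by (rule ghom_gtrace[OF D1(1,3,1) c D1(5)])
  also have "A * (s * f) = f" using f by (simp add: mat_rewr[OF D1(9)] d mat_distribs)
  finally have A\<sigma>: "A * \<sigma> = b * a - gid V" using f by simp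
  note d = d is_ghomD(2,3)[OF \<sigma>]
  define \<delta> where "\<delta> = m * l - gid P - \<sigma> * A"
  have d\<delta>: "dim_row \<delta> = gdim P" "dim_col \<delta> = gdim P" by (simp_all add: \<delta>_def d)
  have \<delta>: "is_ghom G P P \<delta>" unfolding \<delta>_def
    using D1 D2 l m \<sigma> by (intro ghom_minus ghom_comp ghom_one) auto
  have "A * \<delta> = b * (A' * l) - A - (b * a - gid V) * A"
    unfolding \<delta>_def by (simp add: d mat_assoc mat_distribs mat_rewr[OF m(2)] mat_rewr[OF A\<sigma>])
  also have "\<dots> = 0\<^sub>m (gdim V) (gdim P)"
    unfolding l(2) by (simp add: d mat_assoc mat_distribs mat_diff_self)
  finally have A\<delta>: "A * \<delta> = 0\<^sub>m (gdim V) (gdim P)" .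
  have "\<delta> = (B * t + s * A) * \<delta>" by (simp add: D1(12) d\<delta> mat_distribs)
  also have "\<dots> = B * (t * \<delta>)" by (simp add: d d\<delta> mat_assoc mat_distribs A\<delta> mat_zeros)
  finally have B\<tau>: "B * (t * \<delta>) = \<delta>" by simp
  \<comment> \<open>\<open>t * \<delta>\<close> is equivariant although \<open>t\<close> need not
    be, because \<open>B\<close> carries it to \<open>\<delta>\<close>.\<close>
  have \<tau>: "is_ghom G P W (t * \<delta>)"
    using \<delta> d\<delta> d by (intro ghom_factor[OF D1(3,2,3,6,8,10)]) (auto simp: B\<tau> intro!: carrier_matI)
  have "\<beta> * \<alpha> - gid W = t * (B * (\<beta> * \<alpha> - gid W))"
    by (simp add: d mat_rewr[OF D1(10)] mat_distribs D1(10))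
  also have "B * (\<beta> * \<alpha> - gid W) = m * l * B - B"
    by (simp add: d mat_assoc mat_distribs mat_rewr[OF \<beta>(2)] \<alpha>(2))
  also have "\<dots> = \<delta> * B"
    unfolding \<delta>_def by (simp add: d mat_assoc mat_distribs D1(11) mat_zeros)
      (auto intro!: eq_matI simp: d simp del: index_mult_mat(1))
  also have "t * (\<delta> * B) = (t * \<delta>) * gid P * B" by (simp add: d d\<delta> mat_assoc mat_distribs)
  finally show ?thesis using tmap_sandwich[OF D1(2,3,2,6) \<tau> D1(4)] by simp
qed

text \<open>The maps \<open>a\<close> and \<open>b\<close> lift to the projective middle terms and
  restrict to the kernels; the linear retractions \<open>t\<close> and \<open>t'\<close> compute
  these restrictions.\<close>

lemma syz_unique:
  assumes "syz V W" "syz V' W'" "sim V V'"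
  shows "sim W W'"
proof -
  obtain P A B s t where R: "resolves V W P A B s t" using assms by (auto simp: syz_def)
  obtain P' A' B' s' t' where R': "resolves V' W' P' A' B' s' t'" using assms by (auto simp: syz_def)
  obtain a b where ab: "is_ghom G V V' a" "is_ghom G V' V b"
    "tmap V V (b * a - gid V)" "tmap V' V' (a * b - gid V')"
    by (rule simE[OF assms(3)])
  note D1 = resolvesD[OF R] and D2 = resolvesD[OF R']
  note d = resolves_dim[OF R] resolves_dim[OF R'] is_ghomD(2,3)[OF ab(1)] is_ghomD(2,3)[OF ab(2)]
  obtain l where l: "is_ghom G P P' l" "A' * l = a * A"
    by (rule projective_lift[OF D1(3,4) D2(3,1,5,7,9) ghom_comp[OF D1(1) D2(1) D1(3) ab(1) D1(5)]])
  obtain m where m: "is_ghom G P' P m" "A * m = b * A'"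
    by (rule projective_lift[OF D2(3,4) D1(3,1,5,7,9) ghom_comp[OF D2(1) D1(1) D2(3) ab(2) D2(5)]])
  note d = d is_ghomD(2,3)[OF l(1)] is_ghomD(2,3)[OF m(1)]
  have "B' * (t' * (l * B)) = (B' * t' + s' * A') * (l * B)"
    by (simp add: d mat_assoc mat_distribs mat_rewr[OF l(2)] D1(11) mat_zeros)
  then have \<alpha>: "B' * (t' * (l * B)) = l * B" by (simp add: D2(12) d mat_distribs)
  have "B * (t * (m * B')) = (B * t + s * A) * (m * B')"
    by (simp add: d mat_assoc mat_distribs mat_rewr[OF m(2)] D2(11) mat_zeros)
  then have \<beta>: "B * (t * (m * B')) = m * B'" by (simp add: D1(12) d mat_distribs)
  have h\<alpha>: "is_ghom G W W' (t' * (l * B))"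
    by (rule ghom_factor[OF D1(2) D2(2,3,6,8,10)])
      (use ghom_comp[OF D1(3) D2(3) D1(2) l(1) D1(6)] in \<open>auto simp: \<alpha> d intro!: carrier_matI\<close>)
  have h\<beta>: "is_ghom G W' W (t * (m * B'))"
    by (rule ghom_factor[OF D2(2) D1(2,3,6,8,10)])
      (use ghom_comp[OF D2(3) D1(3) D2(2) m(1) D2(6)] in \<open>auto simp: \<beta> d intro!: carrier_matI\<close>)
  show ?thesis
    by (rule simI[OF D1(2) D2(2) h\<alpha> h\<beta> schanuel_half[OF R R' ab(1,2,3) l m h\<alpha> \<alpha> h\<beta> \<beta>]
          schanuel_half[OF R' R ab(2,1,4) m l h\<beta> \<beta> h\<alpha> \<alpha>]])
qed

lemma syz_gtensor_left:
  assumes "syz V W" and X: "is_gmod G X"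
  shows "syz (gtensor V X) (gtensor W X)"
proof -
  obtain P A B s t where R: "resolves V W P A B s t" using assms by (auto simp: syz_def)
  note D = resolvesD[OF R] and d = resolves_dim[OF R] and one = ghom_one[OF X]
  let ?k = "\<lambda>M. kronecker M (gid X)"
  have "resolves (gtensor V X) (gtensor W X) (gtensor P X) (?k A) (?k B) (?k s) (?k t)"
    unfolding resolves_def
    using D X tmap_kron_left[OF D(3,3) X X D(4) one]
    by (auto intro!: is_gmod_gtensor ghom_kron one
        simp: kron_mult d kron_one kron_zero_left kron_add_left[symmetric])
  then show ?thesis unfolding syz_def by blast
qed

lemma syz_gtensor_right:
  assumes "syz V W" and X: "is_gmod G X"
  shows "syz (gtensor X V) (gtensor X W)"
proof -
  obtain P A B s t where R: "resolves V W P A B s t" using assms by (auto simp: syz_def)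
  note D = resolvesD[OF R] and d = resolves_dim[OF R] and one = ghom_one[OF X]
  let ?k = "\<lambda>M. kronecker (gid X) M"
  have "resolves (gtensor X V) (gtensor X W) (gtensor X P) (?k A) (?k B) (?k s) (?k t)"
    unfolding resolves_def
    using D X tmap_kron_right[OF D(3,3) X X D(4) one]
    by (auto intro!: is_gmod_gtensor ghom_kron one
        simp: kron_mult d kron_one kron_zero_right kron_add_right[symmetric])
  then show ?thesis unfolding syz_def by blast
qed

lemma syz_gsum:
  assumes "syz V W" "syz V' W'"
  shows "syz (gsum V V') (gsum W W')"
proof -
  obtain P A B s t where R: "resolves V W P A B s t" using assms by (auto simp: syz_def)
  obtain P' A' B' s' t' where R': "resolves V' W' P' A' B' s' t'" using assms by (auto simp: syz_def)
  note D1 = resolvesD[OF R] and D2 = resolvesD[OF R']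
  obtain i j p q where SV: "is_biprod G V V' (gsum V V') i j p q" by (rule gsum_biprod[OF D1(1) D2(1)])
  obtain k l r u where SW: "is_biprod G W W' (gsum W W') k l r u" by (rule gsum_biprod[OF D1(2) D2(2)])
  obtain e f g h where SP: "is_biprod G P P' (gsum P P') e f g h" by (rule gsum_biprod[OF D1(3) D2(3)])
  note DV = is_biprodD[OF SV] and DW = is_biprodD[OF SW] and DP = is_biprodD[OF SP]
  note d = resolves_dim[OF R] resolves_dim[OF R'] is_biprod_dim[OF SV] is_biprod_dim[OF SW] is_biprod_dim[OF SP]
  note rw = mat_rewr[OF DV(8)] mat_rewr[OF DV(9)] mat_rewr[OF DV(10)] mat_rewr[OF DV(11)]
    mat_rewr[OF DW(8)] mat_rewr[OF DW(9)] mat_rewr[OF DW(10)] mat_rewr[OF DW(11)]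
    mat_rewr[OF DP(8)] mat_rewr[OF DP(9)] mat_rewr[OF DP(10)] mat_rewr[OF DP(11)]
    mat_rewr[OF D1(9)] mat_rewr[OF D1(10)] mat_rewr[OF D1(11)]
    mat_rewr[OF D2(9)] mat_rewr[OF D2(10)] mat_rewr[OF D2(11)]
  note calc = d mat_assoc mat_distribs rw mat_zeros
  have "resolves (gsum V V') (gsum W W') (gsum P P') (i * A * g + j * A' * h) (e * B * r + f * B' * u)
     (e * s * p + f * s' * q) (k * t * g + l * t' * h)"
    unfolding resolves_def
  proof (intro conjI DV(3) DW(3) DP(3))
    show "is_ghom G (gsum P P') (gsum V V') (i * A * g + j * A' * h)"
      using D1 D2 DV DP by (intro ghom_add ghom_comp)
    show "is_ghom G (gsum W W') (gsum P P') (e * B * r + f * B' * u)"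
      using D1 D2 DW DP by (intro ghom_add ghom_comp)
    have "tmap (gsum P P') (gsum P P') (e * gid P * g + f * gid P' * h)"
      using D1 D2 DP by (intro tmap_add tmap_sandwich)
    then show "tmap (gsum P P') (gsum P P') (gid (gsum P P'))"
      using DP(12) d by (simp add: mat_distribs)
    show "e * s * p + f * s' * q \<in> gmats (gsum V V') (gsum P P')"
      "k * t * g + l * t' * h \<in> gmats (gsum P P') (gsum W W')"
      by (auto simp: d simp del: gsum_simps intro!: carrier_matI)
    show "(i * A * g + j * A' * h) * (e * s * p + f * s' * q) = gid (gsum V V')"
      using DV(12) by (simp add: calc del: gsum_simps)
    show "(k * t * g + l * t' * h) * (e * B * r + f * B' * u) = gid (gsum W W')"
      using DW(12) by (simp add: calc del: gsum_simps)
    show "(i * A * g + j * A' * h) * (e * B * r + f * B' * u) = 0\<^sub>m (gdim (gsum V V')) (gdim (gsum W W'))"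
      by (simp add: calc del: gsum_simps)
    have "(e * B * r + f * B' * u) * (k * t * g + l * t' * h) + (e * s * p + f * s' * q) * (i * A * g + j * A' * h)
       = (e * B * t * g + f * B' * t' * h) + (e * s * A * g + f * s' * A' * h)"
      by (simp add: calc del: gsum_simps)
    also have "\<dots> = e * (B * t + s * A) * g + f * (B' * t' + s' * A') * h"
      by (simp add: d mat_assoc mat_distribs del: gsum_simps)
        (auto intro!: eq_matI simp: d add_ac simp del: index_mult_mat(1) gsum_simps)
    also have "\<dots> = gid (gsum P P')"
      using DP(12) by (simp add: D1(12) D2(12) d mat_distribs del: gsum_simps)
    finally show "(e * B * r + f * B' * u) * (k * t * g + l * t' * h) + (e * s * p + f * s' * q) * (i * A * g + j * A' * h)
       = gid (gsum P P')" .
  qed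
  then show ?thesis unfolding syz_def by blast
qed

lemma is_heller_imp_syz:
  fixes V W :: "('a, 'f :: field) gmod"
  assumes "is_heller G V W" and V: "is_gmod G V"
  shows "syz V W"
proof -
  obtain P A B where W: "is_gmod G W" and cov: "is_projective_cover G P V A" and B: "is_ghom G W P B"
    and inj: "ginj W B" and im: "(\<lambda>w. B *\<^sub>v w) ` gvecs W = {v \<in> gvecs P. A *\<^sub>v v = 0\<^sub>v (gdim V)}"
    using assms by (auto simp: is_heller_def)
  have P: "is_gmod G P" "tmap P P (gid P)" and A: "is_ghom G P V A" and surj: "gsurj P V A"
    using cov by (auto simp: is_projective_cover_def gprojective_iff)
  note cA = is_ghomD(1)[OF A] and cB = is_ghomD(1)[OF B]
  obtain s where s: "s \<in> gmats V P" "A * s = gid V"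
    using surj_section[OF cA] surj by (auto simp: gsurj_def)
  have AB: "A * B = 0\<^sub>m (gdim V) (gdim W)"
  proof (rule mat_mult_eqI_vec[OF mult_carrier_mat[OF cA cB] zero_carrier_mat])
    fix v :: "'f vec" assume v: "v \<in> gvecs W"
    then have "B *\<^sub>v v \<in> {v \<in> gvecs P. A *\<^sub>v v = 0\<^sub>v (gdim V)}" using im by blast
    then have "(A * B) *\<^sub>v v = 0\<^sub>v (gdim V)" using cA cB v by (subst mat_vec_assoc) auto
    also have "\<dots> = 0\<^sub>m (gdim V) (gdim W) *\<^sub>v v" using v by (auto intro!: eq_vecI simp: scalar_prod_def)
    finally show "(A * B) *\<^sub>v v = 0\<^sub>m (gdim V) (gdim W) *\<^sub>v v" .
  qed
  \<comment> \<open>The linear projection onto the kernel of \<open>A\<close> along the image of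
    \<open>s\<close>; factoring it through \<open>B\<close> yields the retraction
    \<open>t\<close>.\<close>
  define K where "K = gid P - s * A"
  have K: "K \<in> gmats P P" using s cA by (auto simp: K_def intro!: carrier_matI)
  have AK: "A * K = 0\<^sub>m (gdim V) (gdim P)"
    unfolding K_def using s cA by (simp add: mat_distribs mat_rewr[OF s(2)] mat_diff_self)
  obtain t where t: "t \<in> gmats P W" "B * t = K"
  proof (rule mat_factor_through[OF cB K])
    fix v :: "'f vec" assume v: "v \<in> gvecs P"
    have "A *\<^sub>v (K *\<^sub>v v) = (A * K) *\<^sub>v v" using cA K v by (subst mat_vec_assoc) auto
    also have "\<dots> = 0\<^sub>v (gdim V)" using v by (auto simp: AK intro!: eq_vecI simp: scalar_prod_def)
    finally have "K *\<^sub>v v \<in> (\<lambda>w. B *\<^sub>v w) ` gvecs W" using K v by (auto simp: im)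
    then show "\<exists>x\<in>gvecs W. B *\<^sub>v x = K *\<^sub>v v" by auto
  qed
  have KB: "K * B = B" unfolding K_def using s cA cB by (simp add: mat_assoc mat_distribs AB mat_zeros)
     (auto intro!: eq_matI)
  have tB: "t * B = gid W"
  proof (rule inj_mat_cancel[OF cB inj[unfolded ginj_def]])
    have "B * (t * B) = K * B" using t cB by (simp flip: mat_assoc)
    then show "B * (t * B) = B * gid W" using KB cB by simp
  qed (use t cB in auto)
  have "B * t + s * A = gid P"
    unfolding t(2) K_def using s cA by (auto intro!: eq_matI)
  then have "resolves V W P A B s t"
    using V W P A B s t tB AB by (simp add: resolves_def)
  then show ?thesis unfolding syz_def by blast
qed

text \<open>Inside a free cover, take a submodule of least dimension that still maps onto
  \<open>V\<close>. Minimality makes the restricted map essential.\<close>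

lemma projective_cover_exists:
  assumes V: "is_gmod G (V :: ('a, 'f :: field) gmod)"
  obtains P A where "is_projective_cover G P V A"
proof -
  obtain P A s where P: "is_gmod G P" "tmap P P (gid P)" and A: "is_ghom G P V A"
    and s: "s \<in> gmats V P" "A * s = gid V"
    by (rule exists_free_cover[OF V])
  define Q where "Q n \<longleftrightarrow> (\<exists>U B. is_gmod G U \<and> gdim U = n \<and> is_ghom G U P B \<and> ginj U B \<and>
      gsurj U V (A * B))" for n
  note cA = is_ghomD(1)[OF A]
  have "Q (gdim P)"
    unfolding Q_def
  proof (intro exI conjI)
    show "is_ghom G P P (gid P)" by (rule ghom_one[OF P(1)])
    show "ginj P (gid P)" by (auto simp: ginj_def inj_on_def)
    show "gsurj P V (A * gid P)" using section_surj[OF cA s] cA by (simp add: gsurj_def)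
  qed (use P in auto)
  then obtain n where "Q n" and min: "\<And>k. Q k \<Longrightarrow> n \<le> k"
    using LeastI_ex[of Q] Least_le[of Q] by blast
  then obtain U B where U: "is_gmod G U" and n: "gdim U = n" and B: "is_ghom G U P B" and inj: "ginj U B"
    and surj: "gsurj U V (A * B)" by (auto simp: Q_def)
  note cB = is_ghomD(1)[OF B]
  have AB: "is_ghom G U V (A * B)" by (rule ghom_comp[OF P(1) V U A B])
  note cAB = is_ghomD(1)[OF AB]
  have ess: "Y = gvecs U" if Y: "is_submodule G U Y" "(\<lambda>v. (A * B) *\<^sub>v v) ` Y = gvecs V" for Y
  proof -
    obtain W C where W: "is_gmod G W" and C: "is_ghom G W U C" and injC: "ginj W C"
      and imC: "(\<lambda>v. C *\<^sub>v v) ` gvecs W = Y"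
      using submodule_gmod[OF U Y(1) is_group] by blast
    note cC = is_ghomD(1)[OF C]
    have "Q (gdim W)"
      unfolding Q_def
    proof (intro exI conjI)
      show "is_ghom G W P (B * C)" by (rule ghom_comp[OF U P(1) W B C])
      show "ginj W (B * C)"
        unfolding ginj_def
      proof (rule inj_onI)
        fix x y assume x: "x \<in> gvecs W" and y: "y \<in> gvecs W" and eq: "(B * C) *\<^sub>v x = (B * C) *\<^sub>v y"
        then have "B *\<^sub>v (C *\<^sub>v x) = B *\<^sub>v (C *\<^sub>v y)" using cB cC by (simp add: mat_vec_assoc)
        then have "C *\<^sub>v x = C *\<^sub>v y" using inj cC x y by (auto simp: ginj_def dest: inj_onD)
        then show "x = y" using injC x y by (auto simp: ginj_def dest: inj_onD)
      qed
      have "(\<lambda>v. (A * (B * C)) *\<^sub>v v) ` gvecs W = (\<lambda>v. (A * B) *\<^sub>v v) ` (\<lambda>v. C *\<^sub>v v) ` gvecs W"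
        unfolding image_image
      proof (rule image_cong[OF refl])
        fix v assume v: "v \<in> gvecs W"
        have "A * (B * C) = (A * B) * C" using cA cB cC by (simp add: mat_assoc)
        then show "(A * (B * C)) *\<^sub>v v = (A * B) *\<^sub>v (C *\<^sub>v v)"
          using v cAB cC mat_vec_assoc[of "A * B" C v] by (simp only: carrier_matD carrier_vecD)
      qed
      then show "gsurj W V (A * (B * C))" using Y(2) by (simp add: gsurj_def imC)
    qed (use W in auto)
    then have "gdim U \<le> gdim W" using min n by simp
    then show "Y = gvecs U" using inj_mat_surj[OF cC] injC imC by (simp add: ginj_def)
  qed
  obtain u where u: "u \<in> gmats V U" "A * B * u = gid V"
    using surj_section[OF cAB] surj by (auto simp: gsurj_def)
  \<comment> \<open>Lifting the free cover through \<open>U\<close> gives an endomorphism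
    \<open>C * B\<close> of \<open>U\<close> over \<open>V\<close>. Essentiality makes it
    surjective, hence invertible, so \<open>U\<close> is a retract of \<open>P\<close> and
    projective.\<close>
  obtain C where C: "is_ghom G P U C" "A * B * C = A"
    by (rule projective_lift[OF P U V AB u A])
  note cC = is_ghomD(1)[OF C(1)]
  have CB: "is_ghom G U U (C * B)" by (rule ghom_comp[OF P(1) U U C(1) B])
  note cCB = is_ghomD(1)[OF CB]
  have "A * B * (C * B) = A * B" using C(2) cAB cC cB by (simp add: mat_rewr)
  then have "(\<lambda>v. (A * B) *\<^sub>v v) ` (\<lambda>v. (C * B) *\<^sub>v v) ` gvecs U = (\<lambda>v. (A * B) *\<^sub>v v) ` gvecs U"
    unfolding image_image
  proof (intro image_cong refl)
    fix v assume "v \<in> gvecs U"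
    then show "(A * B) *\<^sub>v ((C * B) *\<^sub>v v) = (A * B) *\<^sub>v v"
      using mat_vec_assoc[of "A * B" "C * B" v] cAB cCB \<open>A * B * (C * B) = A * B\<close>
      by (simp only: carrier_matD carrier_vecD)
  qed
  then have "(\<lambda>v. (C * B) *\<^sub>v v) ` gvecs U = gvecs U"
    using ess[OF image_submodule[OF U U CB]] surj by (simp add: gsurj_def)
  then obtain w where w: "w \<in> gmats U U" "C * B * w = gid U"
    using surj_section[OF cCB] by blast
  then have "w * (C * B) = gid U" using mat_mult_left_right_inverse[OF cCB w(1)] by simp
  then have hw: "is_ghom G U U w" using inverse_ghom[OF U U CB w] by simp
  have "tmap U U (C * gid P * (B * w))"
    by (rule tmap_sandwich[OF U P(1) U ghom_comp[OF U P(1) U B hw] C(1) P(2)])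
  also have "C * gid P * (B * w) = gid U"
    using w cC cB by (simp add: mat_assoc mat_distribs)
  finally have "gprojective G U" using U by (simp add: gprojective_iff)
  then show thesis
    using that[of U "A * B"] AB surj ess by (simp add: is_projective_cover_def)
qed

lemma heller_exists:
  assumes V: "is_gmod G V"
  shows "\<exists>W. is_heller G V W"
proof -
  obtain P A where cov: "is_projective_cover G P V A" by (rule projective_cover_exists[OF V])
  then have P: "is_gmod G P" and A: "is_ghom G P V A" by (auto simp: is_projective_cover_def gprojective_iff)
  obtain W B where "is_gmod G W" "is_ghom G W P B" "ginj W B"
    "(\<lambda>v. B *\<^sub>v v) ` gvecs W = {v \<in> gvecs P. A *\<^sub>v v = 0\<^sub>v (gdim V)}"
    by (rule submodule_gmod[OF P kernel_submodule[OF P V A] is_group])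
  with cov show ?thesis by (auto simp: is_heller_def)
qed

section \<open>Heller translates up to stable isomorphism\<close>

lemma syz_heller: "is_gmod G V \<Longrightarrow> syz V (heller G V)"
  unfolding heller_def by (rule is_heller_imp_syz[OF someI_ex[OF heller_exists]])

lemma is_gmod_heller: "is_gmod G V \<Longrightarrow> is_gmod G (heller G V)"
  using syz_heller by (auto simp: syz_def resolves_def)

lemma sim_heller: "sim V W \<Longrightarrow> sim (heller G V) (heller G W)"
  by (meson syz_heller sim_gmod syz_unique)

text \<open>Both sides are syzygies of \<open>gtensor V W\<close>, since a resolution of
  \<open>V\<close> tensored with \<open>W\<close> is again a resolution.\<close>

lemma sim_heller_gtensor_left:
  "is_gmod G V \<Longrightarrow> is_gmod G W \<Longrightarrow> sim (gtensor (heller G V) W) (heller G (gtensor V W))"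
  by (meson is_gmod_gtensor sim_refl syz_gtensor_left syz_heller syz_unique)

lemma sim_heller_gtensor_right:
  "is_gmod G V \<Longrightarrow> is_gmod G W \<Longrightarrow> sim (gtensor W (heller G V)) (heller G (gtensor W V))"
  by (meson is_gmod_gtensor sim_refl syz_gtensor_right syz_heller syz_unique)

lemma sim_heller_gsum:
  "is_gmod G V \<Longrightarrow> is_gmod G W \<Longrightarrow> sim (heller G (gsum V W)) (gsum (heller G V) (heller G W))"
  by (meson is_gmod_gsum sim_refl syz_gsum syz_heller syz_unique)

lemma heller_pow_simps:
  "heller_pow G 0 V = V" "heller_pow G (Suc n) V = heller G (heller_pow G n V)"
  "heller_pow G (m + n) V = heller_pow G m (heller_pow G n V)"
  by (auto simp: heller_pow_def funpow_add)

lemma is_gmod_heller_pow: "is_gmod G V \<Longrightarrow> is_gmod G (heller_pow G n V)"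
  by (induction n) (auto simp: heller_pow_simps is_gmod_heller)

lemma sim_heller_pow: "sim V W \<Longrightarrow> sim (heller_pow G n V) (heller_pow G n W)"
  by (induction n) (auto simp: heller_pow_simps sim_heller)

lemma sim_heller_pow_gtensor_left:
  "is_gmod G V \<Longrightarrow> is_gmod G W \<Longrightarrow> sim (gtensor (heller_pow G n V) W) (heller_pow G n (gtensor V W))"
proof (induction n)
  case (Suc n)
  then have "sim (gtensor (heller_pow G (Suc n) V) W) (heller G (gtensor (heller_pow G n V) W))"
    by (simp add: heller_pow_simps sim_heller_gtensor_left is_gmod_heller_pow)
  also have "sim \<dots> (heller_pow G (Suc n) (gtensor V W))"
    using Suc by (simp add: heller_pow_simps sim_heller)
  finally show ?case .
qed (simp add: heller_pow_simps sim_refl is_gmod_gtensor)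

lemma sim_heller_pow_gtensor_right:
  "is_gmod G V \<Longrightarrow> is_gmod G W \<Longrightarrow> sim (gtensor W (heller_pow G n V)) (heller_pow G n (gtensor W V))"
proof (induction n)
  case (Suc n)
  then have "sim (gtensor W (heller_pow G (Suc n) V)) (heller G (gtensor W (heller_pow G n V)))"
    by (simp add: heller_pow_simps sim_heller_gtensor_right is_gmod_heller_pow)
  also have "sim \<dots> (heller_pow G (Suc n) (gtensor W V))"
    using Suc by (simp add: heller_pow_simps sim_heller)
  finally show ?case .
qed (simp add: heller_pow_simps sim_refl is_gmod_gtensor)

lemma sim_heller_pow_gsum:
  "is_gmod G V \<Longrightarrow> is_gmod G W \<Longrightarrow>
    sim (heller_pow G n (gsum V W)) (gsum (heller_pow G n V) (heller_pow G n W))"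
proof (induction n)
  case (Suc n)
  then have "sim (heller_pow G (Suc n) (gsum V W)) (heller G (gsum (heller_pow G n V) (heller_pow G n W)))"
    by (simp add: heller_pow_simps sim_heller)
  also have "sim \<dots> (gsum (heller_pow G (Suc n) V) (heller_pow G (Suc n) W))"
    using Suc by (simp add: heller_pow_simps sim_heller_gsum is_gmod_heller_pow)
  finally show ?case .
qed (simp add: heller_pow_simps sim_refl is_gmod_gsum)

lemma is_gmod_gtensor_pow: "is_gmod G V \<Longrightarrow> is_gmod G (gtensor_pow V n)"
  by (induction n) (auto simp: is_gmod_gtriv is_gmod_gtensor)

lemma sim_gtensor_pow: "sim V W \<Longrightarrow> sim (gtensor_pow V n) (gtensor_pow W n)"
proof (induction n)
  case (Suc n)
  have "sim (gtensor V (gtensor_pow V n)) (gtensor W (gtensor_pow V n))"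
    using Suc sim_gmod by (intro sim_gtensor_left is_gmod_gtensor_pow)
  also have "sim \<dots> (gtensor W (gtensor_pow W n))"
    using Suc sim_gmod by (intro sim_gtensor_right)
  finally show ?case by simp
qed (simp add: sim_refl is_gmod_gtriv)

text \<open>The translates are pulled out of the factors one at a time, each adding \<open>r\<close>
  to the exponent.\<close>

lemma sim_heller_pow_gtensor_pow:
  assumes V: "is_gmod G V"
  shows "sim (gtensor_pow (heller_pow G r V) n) (heller_pow G (n * r) (gtensor_pow V n))"
proof (induction n)
  case (Suc n)
  note g = is_gmod_gtensor_pow[OF V, of n] is_gmod_heller_pow
  have "sim (gtensor (heller_pow G r V) (gtensor_pow (heller_pow G r V) n))
      (gtensor (heller_pow G r V) (heller_pow G (n * r) (gtensor_pow V n)))"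
    by (intro sim_gtensor_right Suc g V)
  also have "sim \<dots> (heller_pow G r (gtensor V (heller_pow G (n * r) (gtensor_pow V n))))"
    by (intro sim_heller_pow_gtensor_left g V)
  also have "sim \<dots> (heller_pow G r (heller_pow G (n * r) (gtensor V (gtensor_pow V n))))"
    by (intro sim_heller_pow sim_heller_pow_gtensor_right g V)
  finally show ?case by (simp add: heller_pow_simps)
qed (simp add: heller_pow_simps sim_refl is_gmod_gtriv)

end

section \<open>Sum-zero vectors modulo constants\<close>

text \<open>Of the sixteen products, the two with all functions at one point carry the factor
  \<open>card S\<close>, which is zero in the ring, and the eight with one function isolated vanish
  by the sum conditions. The six pairings that remain coincide in twos.\<close>

lemma sum_prod_differences:
  fixes a b c d :: "'b \<Rightarrow> 'f :: comm_ring_1"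
  assumes "finite S" "of_nat (card S) = (0 :: 'f)"
    and z: "sum a S = 0" "sum b S = 0" "sum c S = 0" "sum d S = 0"
  shows "(\<Sum>x\<in>S. \<Sum>y\<in>S. (a x - a y) * (b x - b y) * (c x - c y) * (d x - d y)) =
    2 * ((\<Sum>x\<in>S. a x * b x) * (\<Sum>x\<in>S. c x * d x) + (\<Sum>x\<in>S. a x * c x) * (\<Sum>x\<in>S. b x * d x)
       + (\<Sum>x\<in>S. a x * d x) * (\<Sum>x\<in>S. b x * c x))"
proof -
  have prod: "(\<Sum>x\<in>S. \<Sum>y\<in>S. f x * g y) = sum f S * sum g S" for f g :: "'b \<Rightarrow> 'f"
    by (rule sum_product[symmetric])
  have "(\<Sum>x\<in>S. \<Sum>y\<in>S. (a x - a y) * (b x - b y) * (c x - c y) * (d x - d y)) =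
    (\<Sum>x\<in>S. \<Sum>y\<in>S. (a x * b x * c x * d x) * 1 + 1 * (a y * b y * c y * d y)
      - (a x * b x * c x) * d y - (a x * b x * d x) * c y - (a x * c x * d x) * b y - (b x * c x * d x) * a y
      - d x * (a y * b y * c y) - c x * (a y * b y * d y) - b x * (a y * c y * d y) - a x * (b y * c y * d y)
      + (a x * b x) * (c y * d y) + (a x * c x) * (b y * d y) + (a x * d x) * (b y * c y)
      + (c x * d x) * (a y * b y) + (b x * d x) * (a y * c y) + (b x * c x) * (a y * d y))"
    by (intro sum.cong refl) (simp add: algebra_simps)
  then show ?thesis
    using assms(2) by (simp only: sum.distrib sum_subtractf prod z) (simp add: algebra_simps)
qed

lemma sum_prod_differences2:
  fixes a b :: "'b \<Rightarrow> 'f :: comm_ring_1"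
  assumes "finite S" "of_nat (card S) = (0 :: 'f)" and z: "sum a S = 0" "sum b S = 0"
  shows "(\<Sum>x\<in>S. \<Sum>y\<in>S. (a x - a y) * (b x - b y)) = 0"
proof -
  have prod: "(\<Sum>x\<in>S. \<Sum>y\<in>S. f x * g y) = sum f S * sum g S" for f g :: "'b \<Rightarrow> 'f"
    by (rule sum_product[symmetric])
  have "(\<Sum>x\<in>S. \<Sum>y\<in>S. (a x - a y) * (b x - b y)) =
    (\<Sum>x\<in>S. \<Sum>y\<in>S. (a x * b x) * 1 + 1 * (a y * b y) - a x * b y - b x * a y)"
    by (intro sum.cong refl) (simp add: algebra_simps)
  then show ?thesis
    using assms(2) by (simp only: sum.distrib sum_subtractf prod z) simp
qed

section \<open>The symmetric group in its natural characteristic\<close>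

locale sym_char =
  fixes p :: nat and F :: "'f :: field itself"
  assumes prime_p: "prime p" and p_ge_3: "p \<ge> 3" and char_F: "CHAR('f) = p"
begin

abbreviation "\<S> \<equiv> sym_group p"

sublocale fin_group \<S>
proof -
  interpret group \<S> by (rule sym_group_is_group)
  show "fin_group \<S>"
    by unfold_locales (simp add: sym_group_def finite_permutations)
qed

lemma carrier_iff: "g \<in> carrier \<S> \<longleftrightarrow> g permutes {1..p}"
  by (simp add: sym_group_def)

lemma of_nat_p [simp]: "(of_nat p :: 'f) = 0"
  using char_F of_nat_CHAR[where 'a = 'f] by simp

lemma of_nat_eq_0_iff: "(of_nat k :: 'f) = 0 \<longleftrightarrow> p dvd k"
  using of_nat_eq_0_iff_char_dvd[where 'a = 'f] char_F by simp

lemma of_nat_neq_0: "0 < k \<Longrightarrow> k < p \<Longrightarrow> (of_nat k :: 'f) \<noteq> 0"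
  using of_nat_eq_0_iff by (meson nat_dvd_not_less)

definition n :: nat where "n = p - 2"

lemma n_props: "n \<ge> 1" "p = n + 2" using p_ge_3 by (auto simp: n_def)

lemma of_nat_n: "(of_nat n :: 'f) = - 2"
proof -
  have "(of_nat n :: 'f) + 2 = of_nat (n + 2)" by simp
  also have "\<dots> = 0" by (simp only: n_props(2)[symmetric] of_nat_p)
  finally show ?thesis by (simp add: eq_neg_iff_add_eq_0)
qed

text \<open>Sum-zero vectors modulo constants: \<open>qv i y\<close> is the \<open>i\<close>-th coordinate of the class of \<open>e\<^sub>y - e\<^sub>p\<close> with
  respect to the basis of the classes of \<open>e\<^sub>1 - e\<^sub>p, \<dots>, e\<^bsub>p-2\<^esub> - e\<^sub>p\<close>, and \<open>jv y j\<close> is the coefficient of \<open>e\<^sub>y\<close>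
  in the representative \<open>e\<^bsub>j+1\<^esub> - e\<^sub>p\<close> of the \<open>j\<close>-th basis element.\<close>

definition qv :: "nat \<Rightarrow> nat \<Rightarrow> 'f" where
  "qv i y = (if y = i + 1 then 1 else if y = p - 1 then - 1 else 0)"

definition jv :: "nat \<Rightarrow> nat \<Rightarrow> 'f" where
  "jv y j = (if y = j + 1 then 1 else if y = p then - 1 else 0)"

text \<open>The basis vector \<open>e_{j+1} - e_p\<close> goes to
  \<open>e_{g(j+1)} - e_{g p}\<close>, which is a difference of two classes of the form
  \<open>e_y - e_p\<close>.\<close>

definition T :: "'f smod" where
  "T = Gmod n (\<lambda>g. mat n n (\<lambda>(i, j). qv i (g (j + 1)) - qv i (g p)))"

lemma T_dim [simp]: "gdim T = n" "dim_row (gact T g) = n" "dim_col (gact T g) = n"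
  by (auto simp: T_def)

lemma T_carrier: "gact T g \<in> carrier_mat n n" by (auto intro!: carrier_matI)

lemma T_index: "i < n \<Longrightarrow> j < n \<Longrightarrow> gact T g $$ (i, j) = qv i (g (j + 1)) - qv i (g p)"
  by (auto simp: T_def)

lemma sum_upto_p: "(\<Sum>y\<in>{1..p}. f y) = (\<Sum>k<n. f (k + 1)) + f (p - 1) + f p"
  for f :: "nat \<Rightarrow> 'f"
proof -
  have "{1..p} = insert p (insert (p - 1) ((\<lambda>k. k + 1) ` {..<n}))"
    using n_props by (auto simp: image_iff Bex_def) presburger
  moreover have "p \<notin> insert (p - 1) ((\<lambda>k. k + 1) ` {..<n})" "p - 1 \<notin> (\<lambda>k. k + 1) ` {..<n}"
    using n_props by auto
  ultimately show ?thesis by (simp add: sum.reindex add_ac)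
qed

lemma qv_simps: "i < n \<Longrightarrow> k < n \<Longrightarrow> qv i (k + 1) = (if i = k then 1 else 0)"
  "i < n \<Longrightarrow> qv i (p - 1) = - 1" "i < n \<Longrightarrow> qv i p = 0"
  using n_props by (auto simp: qv_def)

lemma jv_simps: "j < n \<Longrightarrow> k < n \<Longrightarrow> jv (k + 1) j = (if k = j then 1 else 0)"
  "j < n \<Longrightarrow> jv (p - 1) j = 0" "j < n \<Longrightarrow> jv p j = - 1"
  using n_props by (auto simp: jv_def)

lemma sum_qv: "i < n \<Longrightarrow> (\<Sum>y\<in>{1..p}. qv i y) = 0"
  unfolding sum_upto_p using qv_simps by simp

lemma sum_jv: "j < n \<Longrightarrow> (\<Sum>y\<in>{1..p}. jv y j) = 0"
  unfolding sum_upto_p using jv_simps by simp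

text \<open>As a function of \<open>y\<close>, \<open>qv i\<close> is
  \<open>e_{i+1} - e_{p-1}\<close>. It is orthogonal to the constants, and pairing it with the
  representatives \<open>jv\<close> recovers the coordinates.\<close>

lemma sum_qv_jv: "i < n \<Longrightarrow> j < n \<Longrightarrow> (\<Sum>y\<in>{1..p}. qv i y * jv y j) = (if i = j then 1 else 0)"
  unfolding sum_upto_p using qv_simps jv_simps
  by (simp add: if_distrib[of "\<lambda>x. x * _"] if_distrib[of "\<lambda>x. _ * x"] cong: if_cong)

lemma sum_qv_qv: "i < n \<Longrightarrow> j < n \<Longrightarrow> (\<Sum>y\<in>{1..p}. qv i y * qv j y) = (if i = j then 2 else 1)"
  unfolding sum_upto_p using qv_simps
  by (simp add: if_distrib[of "\<lambda>x. x * _"] if_distrib[of "\<lambda>x. _ * x"] cong: if_cong)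

lemma sum_jv_jv: "i < n \<Longrightarrow> j < n \<Longrightarrow> (\<Sum>y\<in>{1..p}. jv y i * jv y j) = (if i = j then 2 else 1)"
  unfolding sum_upto_p using jv_simps
  by (simp add: if_distrib[of "\<lambda>x. x * _"] if_distrib[of "\<lambda>x. _ * x"] cong: if_cong)

lemma sum_perm:
  fixes f :: "nat \<Rightarrow> 'f"
  assumes "g \<in> carrier \<S>"
  shows "(\<Sum>y\<in>{1..p}. f (g y)) = (\<Sum>y\<in>{1..p}. f y)"
  using sum.permute[of g "{1..p}" f] assms by (simp add: carrier_iff comp_def)

lemma sum_const_p: "(\<Sum>y\<in>{1..p}. c) = (0 :: 'f)"
  by simp

text \<open>The matrix, defined through basis vectors, acts as expected on the class of every
  \<open>e_y - e_p\<close>; the case with content is \<open>y = p - 1\<close>.\<close>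

lemma T_qv:
  assumes g: "g \<in> carrier \<S>" and i: "i < n" and y: "y \<in> {1..p}"
  shows "(\<Sum>j<n. gact T g $$ (i, j) * qv j y) = qv i (g y) - qv i (g p)"
proof -
  consider k where "k < n" "y = k + 1" | "y = p - 1" | "y = p"
    using y n_props by (cases y) fastforce+
  then show ?thesis
  proof cases
    case 1
    then show ?thesis using i
      by (simp add: T_index qv_simps if_distrib[of "\<lambda>x. _ * x"] del: One_nat_def add_Suc_right cong: if_cong)
  next
    case 2
    \<comment> \<open>Modulo constants the classes of all \<open>e_z - e_p\<close> add up to zero,
      because \<open>p\<close> copies of \<open>qv i (g p)\<close> vanish in \<open>F\<close>. This
      expresses the class for \<open>p - 1\<close> through the basis.\<close>
    have "0 = (\<Sum>z\<in>{1..p}. qv i (g z) - qv i (g p))"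
      using sum_perm[OF g, of "qv i"] sum_qv[OF i] by (simp only: sum_subtractf sum_const_p) simp
    also have "\<dots> = (\<Sum>j<n. gact T g $$ (i, j)) + (qv i (g (p - 1)) - qv i (g p))"
      unfolding sum_upto_p using i by (simp add: T_index)
    finally show ?thesis using 2
      by (simp add: qv_simps sum_negf eq_neg_iff_add_eq_0 neg_eq_iff_add_eq_0 del: One_nat_def)
  next
    case 3
    then show ?thesis by (simp add: qv_simps)
  qed
qed

lemma is_gmod_T: "is_gmod \<S> T"
  unfolding is_gmod_def
proof (intro conjI ballI)
  show "gact T \<one>\<^bsub>\<S>\<^esub> = gid T"
    by (rule eq_matI) (auto simp: T_index sym_group_def qv_simps[simplified])
  fix g h assume g: "g \<in> carrier \<S>" and h: "h \<in> carrier \<S>"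
  show "gact T (g \<otimes>\<^bsub>\<S>\<^esub> h) = gact T g * gact T h"
  proof (rule eq_matI)
    fix i j assume "i < dim_row (gact T g * gact T h)" "j < dim_col (gact T g * gact T h)"
    then have i: "i < n" and j: "j < n" by auto
    have hy: "h (j + 1) \<in> {1..p}" "h p \<in> {1..p}"
      using permutes_in_image[of h "{1..p}"] h j n_props by (auto simp: carrier_iff)
    have "(gact T g * gact T h) $$ (i, j) = (\<Sum>k<n. gact T g $$ (i, k) * gact T h $$ (k, j))"
      using mat_mult_index[OF T_carrier T_carrier i j] by (simp add: lessThan_atLeast0)
    also have "\<dots> = (\<Sum>k<n. gact T g $$ (i, k) * qv k (h (j + 1))) - (\<Sum>k<n. gact T g $$ (i, k) * qv k (h p))"
      using j by (simp add: T_index[of _ j] sum_subtractf[symmetric] right_diff_distrib)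
    also have "\<dots> = qv i (g (h (j + 1))) - qv i (g (h p))"
      unfolding T_qv[OF g i hy(1)] T_qv[OF g i hy(2)] by simp
    finally show "gact T (g \<otimes>\<^bsub>\<S>\<^esub> h) $$ (i, j) = (gact T g * gact T h) $$ (i, j)"
      using i j by (simp add: T_index sym_group_def)
  qed auto
qed (auto intro: T_carrier)

lemma T_sum:
  assumes "i < n" "j < n"
  shows "gact T g $$ (i, j) = (\<Sum>y\<in>{1..p}. qv i (g y) * jv y j)"
  unfolding sum_upto_p using assms jv_simps
  by (simp add: T_index if_distrib[of "\<lambda>x. _ * x"] cong: if_cong)

text \<open>A transposition differs from the identity by a rank-one map, like the reflection in
  \<open>e_x - e_y\<close>.\<close>

lemma T_transpose:
  assumes i: "i < n" and j: "j < n" and x: "x \<in> {1..p}" and y: "y \<in> {1..p}"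
  shows "gact T (transpose x y) $$ (i, j) = (if i = j then 1 else 0) - (qv i x - qv i y) * (jv x j - jv y j)"
proof (cases "x = y")
  case False
  have "gact T (transpose x y) $$ (i, j) - (if i = j then 1 else 0)
    = (\<Sum>z\<in>{1..p}. (qv i (transpose x y z) - qv i z) * jv z j)"
    unfolding T_sum[OF i j] sum_qv_jv[OF i j, symmetric] by (simp add: sum_subtractf left_diff_distrib)
  also have "\<dots> = (\<Sum>z\<in>{x, y}. (qv i (transpose x y z) - qv i z) * jv z j)"
    using x y by (intro sum.mono_neutral_right) (auto simp: transpose_def)
  also have "\<dots> = - (qv i x - qv i y) * (jv x j - jv y j)"
    using False by (simp add: algebra_simps)
  finally show ?thesis by (simp add: algebra_simps)
qed (use i j in \<open>simp add: T_sum sum_qv_jv del: One_nat_def\<close>)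

section \<open>The tensor square of T\<close>

definition TT :: "'f smod" where "TT = gtensor T T"

lemma TT_dim [simp]: "gdim TT = n * n" "dim_row (gact TT g) = n * n" "dim_col (gact TT g) = n * n"
  by (auto simp: TT_def)

lemma is_gmod_TT: "is_gmod \<S> TT"
  unfolding TT_def by (intro is_gmod_gtensor is_gmod_T)

text \<open>The matrix \<open>1 + J\<close>, with \<open>J\<close> the all-ones matrix: the Gram
  matrix of the vectors \<open>e_{j+1} - e_p\<close>. It is its own inverse because
  \<open>n = -2\<close> in \<open>F\<close>, so the same entries define the form \<open>cap\<close>
  and its copairing \<open>cup\<close>.\<close>

definition B :: "nat \<Rightarrow> nat \<Rightarrow> 'f" where "B i j = (if i = j then 2 else 1)"

definition cup :: "'f mat" where "cup = mat (n * n) 1 (\<lambda>(k, _). B (k div n) (k mod n))"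
definition cap :: "'f mat" where "cap = mat 1 (n * n) (\<lambda>(_, k). B (k div n) (k mod n))"
definition swap :: "'f mat" where
  "swap = mat (n * n) (n * n) (\<lambda>(k, l). if k div n = l mod n \<and> k mod n = l div n then 1 else 0)"

lemma cup_dim [simp]: "dim_row cup = n * n" "dim_col cup = 1" by (auto simp: cup_def)
lemma cap_dim [simp]: "dim_row cap = 1" "dim_col cap = n * n" by (auto simp: cap_def)
lemma swap_dim [simp]: "dim_row swap = n * n" "dim_col swap = n * n" by (auto simp: swap_def)

text \<open>Each transposition acts as \<open>(1 - \<theta>) \<otimes> (1 - \<theta>)\<close>.
  Summed over all pairs, the constant and linear parts vanish in characteristic \<open>p\<close>.
  The quadratic part is given by \<open>sum_prod_differences\<close>, whose three pairings are the
  identity, \<open>cup * cap\<close> and the swap.\<close>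

lemma sum_transpositions:
  "msum (n * n) (n * n) (\<lambda>(x, y). gact TT (transpose x y)) {(x, y). x \<in> {1..p} \<and> y \<in> {1..p} \<and> x \<noteq> y}
   = 2 \<cdot>\<^sub>m (1\<^sub>m (n * n) + swap + cup * cap)"
proof (rule eq_matI)
  fix k l assume "k < dim_row (2 \<cdot>\<^sub>m (1\<^sub>m (n * n) + swap + cup * cap))"
    "l < dim_col (2 \<cdot>\<^sub>m (1\<^sub>m (n * n) + swap + cup * cap))"
  then have kl: "k < n * n" "l < n * n" by auto
  define i i' j j' where ij: "i = k div n" "i' = k mod n" "j = l div n" "j' = l mod n"
  have b: "i < n" "i' < n" "j < n" "j' < n"
    unfolding ij using kl div_mod_bounds by blast+
  let ?P = "{1..p}"
  define \<theta> where "\<theta> i j x y = (qv i x - qv i y) * (jv x j - jv y j)" for i j x y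
  define \<delta> :: "nat \<Rightarrow> nat \<Rightarrow> 'f" where "\<delta> i j = (if i = j then 1 else 0)" for i j
  define E where "E x y = gact TT (transpose x y) $$ (k, l)" for x y
  have E: "E x y = (\<delta> i j - \<theta> i j x y) * (\<delta> i' j' - \<theta> i' j' x y)" if "x \<in> ?P" "y \<in> ?P" for x y
    unfolding E_def TT_def using kl b that
    by (simp add: kron_index ij[symmetric] T_transpose \<theta>_def \<delta>_def)
  have card0: "of_nat (card ?P) = (0 :: 'f)" by simp
  have \<theta>0: "(\<Sum>x\<in>?P. \<Sum>y\<in>?P. \<theta> i j x y) = 0" if "i < n" "j < n" for i j
    unfolding \<theta>_def by (rule sum_prod_differences2[OF _ card0 sum_qv sum_jv]) (use that in auto)
  have \<theta>\<theta>: "(\<Sum>x\<in>?P. \<Sum>y\<in>?P. \<theta> i j x y * \<theta> i' j' x y)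
    = 2 * (\<delta> i j * \<delta> i' j' + B i i' * B j j' + \<delta> i j' * \<delta> i' j)"
  proof -
    have "(\<Sum>x\<in>?P. \<Sum>y\<in>?P. \<theta> i j x y * \<theta> i' j' x y) =
      (\<Sum>x\<in>?P. \<Sum>y\<in>?P. (qv i x - qv i y) * (jv x j - jv y j) * (qv i' x - qv i' y) * (jv x j' - jv y j'))"
      by (simp add: \<theta>_def mult.assoc)
    also have "\<dots> = 2 * ((\<Sum>x\<in>?P. qv i x * jv x j) * (\<Sum>x\<in>?P. qv i' x * jv x j')
       + (\<Sum>x\<in>?P. qv i x * qv i' x) * (\<Sum>x\<in>?P. jv x j * jv x j')
       + (\<Sum>x\<in>?P. qv i x * jv x j') * (\<Sum>x\<in>?P. jv x j * qv i' x))"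
      by (rule sum_prod_differences[OF _ card0 sum_qv sum_jv sum_qv sum_jv]) (use b in auto)
    also have "(\<Sum>x\<in>?P. jv x j * qv i' x) = (\<Sum>x\<in>?P. qv i' x * jv x j)" by (simp add: mult.commute)
    finally show ?thesis using b by (simp add: sum_qv_jv sum_qv_qv sum_jv_jv B_def \<delta>_def del: One_nat_def)
  qed
  have "(\<Sum>z\<in>{(x, y). x \<in> ?P \<and> y \<in> ?P \<and> x \<noteq> y}. (case z of (x, y) \<Rightarrow> gact TT (transpose x y)) $$ (k, l))
    = (\<Sum>(x, y)\<in>{(x, y). x \<in> ?P \<and> y \<in> ?P \<and> x \<noteq> y}. E x y)"
    by (rule sum.cong) (auto simp: E_def)
  also have "\<dots> = (\<Sum>(x, y)\<in>?P \<times> ?P. E x y) - (\<Sum>(x, y)\<in>(\<lambda>x. (x, x)) ` ?P. E x y)"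
  proof -
    have "{(x, y). x \<in> ?P \<and> y \<in> ?P \<and> x \<noteq> y} = ?P \<times> ?P - (\<lambda>x. (x, x)) ` ?P" by auto
    then show ?thesis by (simp only:) (rule sum_diff; auto)
  qed
  also have "(\<Sum>(x, y)\<in>(\<lambda>x. (x, x)) ` ?P. E x y) = (\<Sum>x\<in>?P. E x x)"
    by (subst sum.reindex) (auto intro: inj_onI)
  \<comment> \<open>On the diagonal the transposition is the identity, so there are \<open>p\<close>
    equal terms, and they add up to zero.\<close>
  also have "\<dots> = (\<Sum>x\<in>?P. \<delta> i j * \<delta> i' j')" by (rule sum.cong) (auto simp: E \<theta>_def)
  also have "\<dots> = 0" by (rule sum_const_p)
  also have "(\<Sum>(x, y)\<in>?P \<times> ?P. E x y) = (\<Sum>x\<in>?P. \<Sum>y\<in>?P. E x y)"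
    by (rule sum.cartesian_product[symmetric])
  also have "\<dots> = (\<Sum>x\<in>?P. \<Sum>y\<in>?P. \<delta> i j * \<delta> i' j' - \<delta> i j * \<theta> i' j' x y - \<delta> i' j' * \<theta> i j x y
      + \<theta> i j x y * \<theta> i' j' x y)"
    by (intro sum.cong refl) (simp add: E algebra_simps)
  also have "\<dots> = 2 * (\<delta> i j * \<delta> i' j' + B i i' * B j j' + \<delta> i j' * \<delta> i' j)"
    using b by (simp only: sum.distrib sum_subtractf sum_distrib_left[symmetric] \<theta>0 \<theta>\<theta> sum_const_p) simp
  also have "\<dots> = 2 * ((1\<^sub>m (n * n) + swap + cup * cap) $$ (k, l))"
  proof -
    have "(cup * cap) $$ (k, l) = B i i' * B j j'"
      using kl by (simp add: cup_def cap_def ij scalar_prod_def)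
    moreover have "swap $$ (k, l) = \<delta> i j' * \<delta> i' j" using kl by (simp add: swap_def ij \<delta>_def)
    moreover have "(1\<^sub>m (n * n) :: 'f mat) $$ (k, l) = \<delta> i j * \<delta> i' j'"
      using kl by (auto simp: \<delta>_def ij) (metis div_mult_mod_eq)
    ultimately show ?thesis using kl by (simp add: algebra_simps del: index_mult_mat(1))
  qed
  finally show "msum (n * n) (n * n) (\<lambda>(x, y). gact TT (transpose x y))
      {(x, y). x \<in> {1..p} \<and> y \<in> {1..p} \<and> x \<noteq> y} $$ (k, l) = (2 \<cdot>\<^sub>m (1\<^sub>m (n * n) + swap + cup * cap)) $$ (k, l)"
    using kl by (simp add: msum_def del: index_mult_mat(1))
qed auto

end

section \<open>Pure tensors\<close>

definition vkron :: "'a :: semiring_0 vec \<Rightarrow> 'a vec \<Rightarrow> 'a vec" where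
  "vkron u v = vec (dim_vec u * dim_vec v) (\<lambda>i. u $ (i div dim_vec v) * v $ (i mod dim_vec v))"

lemma vkron_dim [simp]: "dim_vec (vkron u v) = dim_vec u * dim_vec v"
  by (simp add: vkron_def)

lemma vkron_carrier: "u \<in> carrier_vec m \<Longrightarrow> v \<in> carrier_vec n \<Longrightarrow> vkron u v \<in> carrier_vec (m * n)"
  by (intro carrier_vecI) (simp add: carrier_vecD)

lemma kron_mult_vkron:
  fixes A B :: "'a :: comm_semiring_0 mat"
  assumes "dim_col A = dim_vec u" "dim_col B = dim_vec v"
  shows "kronecker A B *\<^sub>v vkron u v = vkron (A *\<^sub>v u) (B *\<^sub>v v)"
proof (rule eq_vecI)
  fix i assume "i < dim_vec (vkron (A *\<^sub>v u) (B *\<^sub>v v))"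
  then have i: "i < dim_row A * dim_row B" by simp
  let ?n = "dim_vec u" and ?m = "dim_vec v"
  have "(kronecker A B *\<^sub>v vkron u v) $ i = (\<Sum>k<?n * ?m. kronecker A B $$ (i, k) * vkron u v $ k)"
    using i assms by (simp add: scalar_prod_def lessThan_atLeast0)
  also have "\<dots> = (\<Sum>k<?n * ?m. (\<lambda>x y. (A $$ (i div dim_row B, x) * u $ x)
      * (B $$ (i mod dim_row B, y) * v $ y)) (k div ?m) (k mod ?m))"
    using i assms by (intro sum.cong) (auto simp: kron_index vkron_def mult_ac)
  also have "\<dots> = (\<Sum>x<?n. \<Sum>y<?m. (A $$ (i div dim_row B, x) * u $ x) * (B $$ (i mod dim_row B, y) * v $ y))"
    by (rule sum_div_mod)
  also have "\<dots> = vkron (A *\<^sub>v u) (B *\<^sub>v v) $ i"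
    using i div_mod_bounds[OF i] assms
    by (simp add: vkron_def scalar_prod_def lessThan_atLeast0 sum_product)
  finally show "(kronecker A B *\<^sub>v vkron u v) $ i = vkron (A *\<^sub>v u) (B *\<^sub>v v) $ i" .
qed auto

lemma vkron_assoc: "vkron (vkron u v) w = vkron u (vkron v w)"
  for u v w :: "'a :: semiring_0 vec"
proof (rule eq_vecI)
  fix i assume "i < dim_vec (vkron u (vkron v w))"
  then have i: "i < (dim_vec u * dim_vec v) * dim_vec w" and i': "i < dim_vec u * (dim_vec v * dim_vec w)"
    by (auto simp: mult.assoc)
  have dd: "x div m div k = x div (k * m)" for x m k :: nat
    by (metis div_mult2_eq mult.commute)
  have mm: "x mod (k * m) div m = x div m mod k" for x m k :: nat
    by (cases "m = 0") (simp_all add: mod_mult2_eq mult.commute[of k m])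
  have mr: "x mod (k * m) mod m = x mod m" for x m k :: nat
    by (simp add: mod_mult_right_eq mod_mod_cancel)
  show "vkron (vkron u v) w $ i = vkron u (vkron v w) $ i"
    using i i' div_mod_bounds[OF i] div_mod_bounds[OF i']
    by (simp add: vkron_def dd mm mr mult.assoc)
qed (simp add: mult.assoc)

lemma unit_vec_vkron:
  fixes m n :: nat
  assumes "k < m * n"
  shows "unit_vec (m * n) k = (vkron (unit_vec m (k div n)) (unit_vec n (k mod n)) :: 'a :: semiring_1 vec)"
proof (rule eq_vecI)
  fix i assume "i < dim_vec (vkron (unit_vec m (k div n)) (unit_vec n (k mod n)) :: 'a vec)"
  then have i: "i < m * n" by simp
  have "i = k \<longleftrightarrow> i div n = k div n \<and> i mod n = k mod n" by (metis div_mult_mod_eq)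
  then show "unit_vec (m * n) k $ i = (vkron (unit_vec m (k div n)) (unit_vec n (k mod n)) :: 'a vec) $ i"
    using i assms div_mod_bounds[OF i] div_mod_bounds[OF assms] by (auto simp: vkron_def)
qed simp

lemma mat_eqI_unit:
  fixes M N :: "'a :: semiring_1 mat"
  assumes "M \<in> carrier_mat l m" "N \<in> carrier_mat l m"
    and "\<And>k. k < m \<Longrightarrow> M *\<^sub>v unit_vec m k = N *\<^sub>v unit_vec m k"
  shows "M = N"
proof (rule eq_matI)
  fix i j assume ij: "i < dim_row N" "j < dim_col N"
  have "col M j = M *\<^sub>v unit_vec m j" "col N j = N *\<^sub>v unit_vec m j"
    using assms(1,2) ij by (auto intro!: eq_vecI)
  then have "col M j = col N j" using assms ij by simp
  then show "M $$ (i, j) = N $$ (i, j)" using ij assms by (metis carrier_matD index_col)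
qed (use assms in auto)

text \<open>Unit vectors of a tensor product are pure tensors, so identities between matrices may be
  checked on pure tensors.\<close>

lemma mat_eqI_vkron:
  fixes M N :: "'a :: semiring_1 mat"
  assumes "M \<in> carrier_mat l (m * k)" "N \<in> carrier_mat l (m * k)"
    and "\<And>u v. u \<in> carrier_vec m \<Longrightarrow> v \<in> carrier_vec k \<Longrightarrow> M *\<^sub>v vkron u v = N *\<^sub>v vkron u v"
  shows "M = N"
  by (rule mat_eqI_unit[OF assms(1,2)]) (simp add: unit_vec_vkron assms(3))

lemma mat_eqI_vkron3:
  fixes M N :: "'a :: comm_semiring_1 mat"
  assumes M: "M \<in> carrier_mat l (m * (k * r))" and N: "N \<in> carrier_mat l (m * (k * r))"
    and "\<And>u v w. u \<in> carrier_vec m \<Longrightarrow> v \<in> carrier_vec k \<Longrightarrow> w \<in> carrier_vec r \<Longrightarrow>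
      M *\<^sub>v vkron u (vkron v w) = N *\<^sub>v vkron u (vkron v w)"
  shows "M = N"
proof (rule mat_eqI_unit[OF M N])
  fix t assume t: "t < m * (k * r)"
  show "M *\<^sub>v unit_vec (m * (k * r)) t = N *\<^sub>v unit_vec (m * (k * r)) t"
    unfolding unit_vec_vkron[OF t] unit_vec_vkron[OF div_mod_bounds(2)[OF t]] by (rule assms(3)) auto
qed

context sym_char
begin

lemma kron_swap:
  fixes u v :: "'f vec"
  assumes "u \<in> carrier_vec n" "v \<in> carrier_vec n"
  shows "swap *\<^sub>v vkron u v = vkron v u"
proof (rule eq_vecI)
  fix i assume "i < dim_vec (vkron v u)"
  then have i: "i < n * n" using assms by simp
  note b = div_mod_bounds[OF i]
  have "(swap *\<^sub>v vkron u v) $ i = (\<Sum>k<n * n. swap $$ (i, k) * vkron u v $ k)"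
    using i assms by (simp add: scalar_prod_def lessThan_atLeast0)
  also have "\<dots> = (\<Sum>k<n * n. (\<lambda>x y. (if i mod n = x then u $ x else 0) * (if i div n = y then v $ y else 0)) (k div n) (k mod n))"
    using i assms by (intro sum.cong) (auto simp: swap_def vkron_def)
  also have "\<dots> = (\<Sum>x<n. \<Sum>y<n. (if i mod n = x then u $ x else 0) * (if i div n = y then v $ y else 0))"
    by (rule sum_div_mod)
  also have "\<dots> = u $ (i mod n) * v $ (i div n)" using b by (simp add: sum_product[symmetric])
  finally show "(swap *\<^sub>v vkron u v) $ i = vkron v u $ i"
    using i assms by (simp add: vkron_def mult.commute)
qed (use assms in simp)

lemma swap_kron:
  fixes A C :: "'f mat"
  assumes A: "A \<in> carrier_mat n n" and C: "C \<in> carrier_mat n n"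
  shows "swap * kronecker A C = kronecker C A * swap"
proof (rule mat_eqI_vkron[where l = "n * n" and m = n and k = n])
  fix u v :: "'f vec" assume u: "u \<in> carrier_vec n" and v: "v \<in> carrier_vec n"
  have "A *\<^sub>v u \<in> carrier_vec n" "C *\<^sub>v v \<in> carrier_vec n" using A C u v by auto
  then show "swap * kronecker A C *\<^sub>v vkron u v = kronecker C A * swap *\<^sub>v vkron u v"
    using A C u v by (simp add: mat_vec_assoc kron_mult_vkron kron_swap)
qed (use A C in \<open>auto intro!: carrier_matI\<close>)

lemma swap_swap: "swap * swap = 1\<^sub>m (n * n)"
  by (rule mat_eqI_vkron[where l = "n * n" and m = n and k = n])
    (auto intro!: carrier_matI simp: mat_vec_assoc kron_swap vkron_carrier)

lemma swap_transpose: "swap\<^sup>T = swap"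
  by (auto intro!: eq_matI simp: swap_def)

lemma swap_ghom: "is_ghom \<S> TT TT swap"
  unfolding is_ghom_def TT_def using swap_kron[OF T_carrier T_carrier]
  by (auto intro!: carrier_matI simp: TT_def)

abbreviation I :: "nat \<Rightarrow> 'f mat" where "I i \<equiv> 1\<^sub>m (n ^ i)"

text \<open>Both sides reverse the order of three tensor factors.\<close>

lemma braid:
  "kronecker swap (1\<^sub>m n) * kronecker (1\<^sub>m n) swap * kronecker swap (1\<^sub>m n) =
   kronecker (1\<^sub>m n) swap * kronecker swap (1\<^sub>m n) * kronecker (1\<^sub>m n) swap" (is "?l = ?r")
proof (rule mat_eqI_vkron3[where l = "n * (n * n)" and m = n and k = n and r = n])
  fix u v w :: "'f vec" assume u: "u \<in> carrier_vec n" and v: "v \<in> carrier_vec n" and w: "w \<in> carrier_vec n"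
  note d = u v w carrier_vecD[OF u] carrier_vecD[OF v] carrier_vecD[OF w]
  have 1: "kronecker swap (1\<^sub>m n) *\<^sub>v vkron x (vkron y z) = vkron y (vkron x z)"
    if "x \<in> carrier_vec n" "y \<in> carrier_vec n" "z \<in> carrier_vec n" for x y z :: "'f vec"
    using that kron_mult_vkron[of swap "vkron x y" "1\<^sub>m n" z] by (simp add: kron_swap vkron_assoc)
  have 2: "kronecker (1\<^sub>m n) swap *\<^sub>v vkron x (vkron y z) = vkron x (vkron z y)"
    if "x \<in> carrier_vec n" "y \<in> carrier_vec n" "z \<in> carrier_vec n" for x y z :: "'f vec"
    using that by (simp add: kron_mult_vkron kron_swap)
  show "?l *\<^sub>v vkron u (vkron v w) = ?r *\<^sub>v vkron u (vkron v w)"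
    using d by (simp add: mat_vec_assoc 1 2 mult.assoc)
qed (auto intro!: carrier_matI simp: mult.assoc)

text \<open>\<open>(1 + J)^2 = 1 + (2 + n) J\<close>, and \<open>n = -2\<close> in
  \<open>F\<close>.\<close>

lemma sum_B:
  assumes "i < n" "j < n"
  shows "(\<Sum>k<n. B i k * B k j) = (if i = j then 1 else 0)"
proof -
  have "(\<Sum>k<n. B i k * B k j) = (\<Sum>k<n. 1 + (if k = i then B i j else 0) + (if k = j then 1 else 0))"
    by (intro sum.cong refl) (auto simp: B_def)
  also have "\<dots> = of_nat n + B i j + 1" using assms by (simp add: sum.distrib)
  finally show ?thesis by (auto simp: of_nat_n B_def)
qed

lemma B_sym: "B i j = B j i" by (auto simp: B_def)

lemma cap_cup: "cap * cup = (- 2) \<cdot>\<^sub>m 1\<^sub>m 1"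
proof (rule eq_matI)
  fix i j assume "i < dim_row ((- 2) \<cdot>\<^sub>m (1\<^sub>m 1 :: 'f mat))" "j < dim_col ((- 2) \<cdot>\<^sub>m (1\<^sub>m 1 :: 'f mat))"
  then have ij: "i = 0" "j = 0" by auto
  have "(cap * cup) $$ (i, j) = (\<Sum>k<n * n. (\<lambda>x y. B x y * B y x) (k div n) (k mod n))"
    using ij B_sym by (simp add: scalar_prod_def cap_def cup_def lessThan_atLeast0)
  also have "\<dots> = (\<Sum>x<n. \<Sum>y<n. B x y * B y x)" by (rule sum_div_mod)
  also have "\<dots> = of_nat n" by (simp add: sum_B)
  finally show "(cap * cup) $$ (i, j) = ((- 2) \<cdot>\<^sub>m (1\<^sub>m 1 :: 'f mat)) $$ (i, j)"
    using ij by (simp add: of_nat_n)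
qed auto

text \<open>After the swap, \<open>cap\<close> and \<open>cup\<close> share a single index, so the
  composite is the square of the matrix \<open>B\<close>.\<close>

lemma zigzag:
  "kronecker cap (1\<^sub>m n) * (kronecker (1\<^sub>m n) swap * kronecker cup (1\<^sub>m n)) = 1\<^sub>m n"
proof (rule eq_matI)
  fix l m assume "l < dim_row (1\<^sub>m n :: 'f mat)" "m < dim_col (1\<^sub>m n :: 'f mat)"
  then have lm: "l < n" "m < n" by auto
  define Y where "Y = kronecker (1\<^sub>m n) swap * kronecker cup (1\<^sub>m n)"
  have Yd: "Y \<in> carrier_mat (n * n * n) n" by (auto simp: Y_def mult.assoc intro!: carrier_matI)
  have Y: "Y $$ (r, m) = (if r div n mod n = m then B (r div n div n) (r mod n) else 0)" if r: "r < n * n * n" for r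
  proof -
    have r': "r < n * (n * n)" using r by (simp add: mult.assoc)
    note br = div_mod_bounds[OF r] div_mod_bounds[OF r'] div_mod_bounds[OF div_mod_bounds(1)[OF r]]
    have e: "r mod (n * n) div n = r div n mod n" "r mod (n * n) mod n = r mod n" "r div (n * n) = r div n div n"
      using n_props by (simp_all add: mod_mult2_eq div_mult2_eq)
    \<comment> \<open>The conditions are nested so that the three sums can be collapsed one variable
      at a time.\<close>
    have step: "kronecker (1\<^sub>m n) swap $$ (r, k) * kronecker cup (1\<^sub>m n) $$ (k, m) =
       (\<lambda>x y. (\<lambda>z w. if z = r mod n then if w = r div n mod n then
          if x = r div n div n then if m = w then B x z else 0 else 0 else 0 else 0) (y div n) (y mod n)) (k div (n * n)) (k mod (n * n))"
      if k: "k < n * (n * n)" for k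
    proof -
      have k': "k < n * n * n" using k by (simp add: mult.assoc)
      note bk = div_mod_bounds[OF k] div_mod_bounds[OF k'] div_mod_bounds[OF div_mod_bounds(1)[OF k']]
      have ek: "k mod (n * n) div n = k div n mod n" "k mod (n * n) mod n = k mod n" "k div (n * n) = k div n div n"
        using n_props by (simp_all add: mod_mult2_eq div_mult2_eq)
      show ?thesis
        using r' k k' br bk lm by (auto simp: kron_index swap_def cup_def e ek)
    qed
    have "Y $$ (r, m) = (\<Sum>k<n * (n * n). kronecker (1\<^sub>m n) swap $$ (r, k) * kronecker cup (1\<^sub>m n) $$ (k, m))"
      unfolding Y_def using r' lm
      by (subst mat_mult_index[of _ "n * (n * n)" "n * (n * n)" _ n])
        (auto intro!: carrier_matI simp: lessThan_atLeast0 mult.assoc)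
    also have "\<dots> = (\<Sum>k<n * (n * n). (\<lambda>x y. (\<lambda>z w. if z = r mod n then if w = r div n mod n then
          if x = r div n div n then if m = w then B x z else 0 else 0 else 0 else 0) (y div n) (y mod n)) (k div (n * n)) (k mod (n * n)))"
      using step by (intro sum.cong) auto
    also have "\<dots> = (\<Sum>x<n. \<Sum>y<n * n. (\<lambda>z w. if z = r mod n then if w = r div n mod n then
          if x = r div n div n then if m = w then B x z else 0 else 0 else 0 else 0) (y div n) (y mod n))"
      by (rule sum_div_mod)
    also have "\<dots> = (\<Sum>x<n. \<Sum>z<n. \<Sum>w<n. if z = r mod n then if w = r div n mod n then
          if x = r div n div n then if m = w then B x z else 0 else 0 else 0 else 0)"
      by (intro sum.cong refl sum_div_mod)
    also have "\<dots> = (\<Sum>x<n. \<Sum>z<n. if z = r mod n then if x = r div n div n then if m = r div n mod n then B x z else 0 else 0 else 0)"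
      using br by (intro sum.cong refl) auto
    also have "\<dots> = (\<Sum>x<n. if x = r div n div n then if m = r div n mod n then B x (r mod n) else 0 else 0)"
      using br by (intro sum.cong refl) auto
    also have "\<dots> = (if r div n mod n = m then B (r div n div n) (r mod n) else 0)"
      using br by auto
    finally show ?thesis .
  qed
  have "(kronecker cap (1\<^sub>m n) * Y) $$ (l, m) = (\<Sum>r<n * n * n. kronecker cap (1\<^sub>m n) $$ (l, r) * Y $$ (r, m))"
    using Yd lm by (subst mat_mult_index[of _ n "n * n * n" _ n]) (auto intro!: carrier_matI simp: lessThan_atLeast0)
  also have "\<dots> = (\<Sum>r<n * n * n. (\<lambda>x y. (\<lambda>a b. if l = y then if b = m then B a b * B a y else 0 else 0) (x div n) (x mod n)) (r div n) (r mod n))"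
    using lm by (intro sum.cong refl) (auto simp: Y kron_index cap_def div_mod_bounds)
  also have "\<dots> = (\<Sum>x<n * n. \<Sum>y<n. (\<lambda>a b. if l = y then if b = m then B a b * B a y else 0 else 0) (x div n) (x mod n))"
    by (rule sum_div_mod)
  also have "\<dots> = (\<Sum>x<n * n. (\<lambda>a b. if b = m then B a b * B a l else 0) (x div n) (x mod n))"
    using lm by (intro sum.cong refl) auto
  also have "\<dots> = (\<Sum>a<n. \<Sum>b<n. if b = m then B a b * B a l else 0)" by (rule sum_div_mod)
  also have "\<dots> = (\<Sum>a<n. B l a * B a m)" using lm B_sym by (simp add: mult.commute)
  also have "\<dots> = (1\<^sub>m n :: 'f mat) $$ (l, m)" using lm by (simp add: sum_B)
  finally show "(kronecker cap (1\<^sub>m n) * (kronecker (1\<^sub>m n) swap * kronecker cup (1\<^sub>m n))) $$ (l, m)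
    = (1\<^sub>m n :: 'f mat) $$ (l, m)" unfolding Y_def .
qed auto

section \<open>Invariance of the form and of its copairing\<close>

lemma perm_sum_T:
  assumes g: "g \<in> carrier \<S>" and ij: "i < n" "j < n"
  shows "(\<Sum>y\<in>{1..p}. (qv i (g y) - qv i (g p)) * (qv j (g y) - qv j (g p))) = (\<Sum>y\<in>{1..p}. qv i y * qv j y)"
proof -
  have "(\<Sum>y\<in>{1..p}. (qv i (g y) - qv i (g p)) * (qv j (g y) - qv j (g p)))
    = (\<Sum>z\<in>{1..p}. (qv i z - qv i (g p)) * (qv j z - qv j (g p)))"
    using sum_perm[OF g, of "\<lambda>z. (qv i z - qv i (g p)) * (qv j z - qv j (g p))"] .
  also have "\<dots> = (\<Sum>z\<in>{1..p}. qv i z * qv j z - qv i (g p) * qv j z - qv j (g p) * qv i z + qv i (g p) * qv j (g p))"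
    by (intro sum.cong refl) (simp add: algebra_simps)
  also have "\<dots> = (\<Sum>y\<in>{1..p}. qv i y * qv j y)"
    using ij by (simp only: sum.distrib sum_subtractf sum_distrib_left[symmetric] sum_qv sum_const_p) simp
  finally show ?thesis .
qed

text \<open>\<open>B a c\<close> is the sum over all points \<open>z\<close> of
  \<open>qv a z * qv c z\<close>. The action permutes the points up to a shift by the constants
  \<open>qv _ (g p)\<close>, and sum-zero functions do not notice this shift.\<close>

lemma cup_ghom: "is_ghom \<S> gtriv TT cup"
  unfolding is_ghom_def
proof (intro conjI ballI)
  fix g assume g: "g \<in> carrier \<S>"
  have "cup = gact TT g * cup"
  proof (rule eq_matI)
    fix k j assume "k < dim_row (gact TT g * cup)" "j < dim_col (gact TT g * cup)"
    then have k: "k < n * n" and j: "j = 0" by auto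
    define x y where xy: "x = k div n" "y = k mod n"
    have b: "x < n" "y < n" unfolding xy using div_mod_bounds[OF k] by auto
    have "(gact TT g * cup) $$ (k, j) = (\<Sum>l<n * n. (\<lambda>a c. gact T g $$ (x, a) * gact T g $$ (y, c) * B a c) (l div n) (l mod n))"
      using k j by (auto simp: TT_def scalar_prod_def kron_index cup_def xy lessThan_atLeast0 intro!: sum.cong)
    also have "\<dots> = (\<Sum>a<n. \<Sum>c<n. gact T g $$ (x, a) * gact T g $$ (y, c) * B a c)" by (rule sum_div_mod)
    also have "\<dots> = (\<Sum>a<n. \<Sum>c<n. \<Sum>z\<in>{1..p}. (gact T g $$ (x, a) * qv a z) * (gact T g $$ (y, c) * qv c z))"
    proof (intro sum.cong refl)
      fix a c assume "a \<in> {..<n}" "c \<in> {..<n}"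
      then have "B a c = (\<Sum>z\<in>{1..p}. qv a z * qv c z)" by (subst sum_qv_qv) (auto simp: B_def)
      then show "gact T g $$ (x, a) * gact T g $$ (y, c) * B a c
        = (\<Sum>z\<in>{1..p}. (gact T g $$ (x, a) * qv a z) * (gact T g $$ (y, c) * qv c z))"
        by (simp add: sum_distrib_left mult_ac del: One_nat_def)
    qed
    also have "\<dots> = (\<Sum>z\<in>{1..p}. \<Sum>a<n. \<Sum>c<n. (gact T g $$ (x, a) * qv a z) * (gact T g $$ (y, c) * qv c z))"
      by (simp only: sum.swap[of _ "{1..p}" "{..<n}"])
    also have "\<dots> = (\<Sum>z\<in>{1..p}. (qv x (g z) - qv x (g p)) * (qv y (g z) - qv y (g p)))"
      by (intro sum.cong refl) (simp add: sum_product[symmetric] T_qv[OF g] b del: One_nat_def)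
    also have "\<dots> = cup $$ (k, j)"
      unfolding perm_sum_T[OF g b] using k j b by (simp add: sum_qv_qv cup_def B_def xy del: One_nat_def)
    finally show "cup $$ (k, j) = (gact TT g * cup) $$ (k, j)" by simp
  qed auto
  then show "cup * gact gtriv g = gact TT g * cup" by (simp add: mat_mult_one del: One_nat_def)
qed (auto intro!: carrier_matI)

text \<open>The left side is the coefficient at \<open>y\<close> of the chosen representative of the
  class of \<open>e_z - e_p\<close>. This representative is \<open>e_z - e_p\<close> itself, except
  for \<open>z = p - 1\<close>, where the all-ones vector is subtracted.\<close>

lemma sum_jv_qv:
  assumes y: "y \<in> {1..p}" and z: "z \<in> {1..p}"
  shows "(\<Sum>k<n. jv y k * qv k z) = (if y = z then 1 else 0) - (if y = p then 1 else 0) - (if z = p - 1 then 1 else 0)"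
proof -
  have j: "(\<Sum>k<n. jv y k) = (if y = p then 2 else if y = p - 1 then 0 else 1)"
  proof -
    consider m where "m < n" "y = m + 1" | "y = p - 1" | "y = p"
      using y n_props by (cases y) fastforce+
    then show ?thesis
    proof cases
      case 1
      then show ?thesis using n_props by (simp add: jv_simps del: One_nat_def add_Suc_right)
    next
      case 2
      then show ?thesis using n_props by (simp add: jv_simps del: One_nat_def)
    next
      case 3
      then show ?thesis by (simp add: jv_simps of_nat_n)
    qed
  qed
  consider m where "m < n" "z = m + 1" | "z = p - 1" | "z = p"
    using z n_props by (cases z) fastforce+
  then show ?thesis
  proof cases
    case 1
    then have "(\<Sum>k<n. jv y k * qv k z) = jv y m"
      by (simp add: qv_simps if_distrib[of "\<lambda>x. _ * x"] del: One_nat_def add_Suc_right cong: if_cong)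
    then show ?thesis using 1 n_props by (auto simp: jv_def)
  next
    case 2
    then have "(\<Sum>k<n. jv y k * qv k z) = - (\<Sum>k<n. jv y k)" by (simp add: qv_simps sum_negf del: One_nat_def)
    then show ?thesis using 2 n_props j by (auto simp: algebra_simps)
  next
    case 3
    then show ?thesis using n_props by (simp add: qv_simps)
  qed
qed

lemma cap_ghom: "is_ghom \<S> TT gtriv cap"
  unfolding is_ghom_def
proof (intro conjI ballI)
  fix g assume g: "g \<in> carrier \<S>"
  define h where "h = inv_into UNIV g"
  have gp: "g permutes {1..p}" using g by (simp add: carrier_iff)
  have h: "h \<in> carrier \<S>" unfolding h_def using gp by (simp add: carrier_iff permutes_inv)
  have hg: "h y = z \<longleftrightarrow> y = g z" for y z
    unfolding h_def using permutes_inverses[OF gp] by metis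
  \<comment> \<open>The representative of the image of the \<open>j\<close>-th basis vector differs
    from the permuted representative by the constant \<open>c j\<close>, which drops out against
    sum-zero vectors.\<close>
  define c where "c j = (if g (j + 1) = p - 1 then 1 else 0) - (if g p = p - 1 then 1 else 0 :: 'f)" for j
  have JT: "(\<Sum>k<n. jv y k * gact T g $$ (k, j)) = jv (h y) j - c j" if y: "y \<in> {1..p}" and j: "j < n" for y j
  proof -
    have gy: "g (j + 1) \<in> {1..p}" "g p \<in> {1..p}"
      using permutes_in_image[OF gp] j n_props by auto
    have "(\<Sum>k<n. jv y k * gact T g $$ (k, j)) = (\<Sum>k<n. jv y k * qv k (g (j + 1))) - (\<Sum>k<n. jv y k * qv k (g p))"
      using j by (simp add: T_index sum_subtractf[symmetric] right_diff_distrib)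
    also have "\<dots> = (if y = g (j + 1) then 1 else 0) - (if y = g p then 1 else 0) - c j"
      unfolding sum_jv_qv[OF y gy(1)] sum_jv_qv[OF y gy(2)] c_def by (simp add: algebra_simps)
    also have "(if y = g (j + 1) then 1 else 0) - (if y = g p then 1 else 0) = jv (h y) j"
    proof -
      have "g (j + 1) \<noteq> g p" using permutes_inj[OF gp, THEN injD, of "j + 1" p] j n_props by auto
      then show ?thesis unfolding jv_def hg by simp
    qed
    finally show ?thesis .
  qed
  have "cap * gact TT g = cap"
  proof (rule eq_matI)
    fix i k assume "i < dim_row cap" "k < dim_col cap"
    then have k: "k < n * n" and i: "i = 0" by auto
    define x y where xy: "x = k div n" "y = k mod n"
    have b: "x < n" "y < n" unfolding xy using div_mod_bounds[OF k] by auto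
    have "(cap * gact TT g) $$ (i, k) = (\<Sum>l<n * n. (\<lambda>a c. B a c * (gact T g $$ (a, x) * gact T g $$ (c, y))) (l div n) (l mod n))"
      using k i by (auto simp: TT_def scalar_prod_def kron_index cap_def xy lessThan_atLeast0 intro!: sum.cong)
    also have "\<dots> = (\<Sum>a<n. \<Sum>c<n. B a c * (gact T g $$ (a, x) * gact T g $$ (c, y)))" by (rule sum_div_mod)
    also have "\<dots> = (\<Sum>a<n. \<Sum>c<n. \<Sum>z\<in>{1..p}. (jv z a * gact T g $$ (a, x)) * (jv z c * gact T g $$ (c, y)))"
    proof (intro sum.cong refl)
      fix a c assume "a \<in> {..<n}" "c \<in> {..<n}"
      then have "B a c = (\<Sum>z\<in>{1..p}. jv z a * jv z c)" by (subst sum_jv_jv) (auto simp: B_def)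
      then show "B a c * (gact T g $$ (a, x) * gact T g $$ (c, y))
        = (\<Sum>z\<in>{1..p}. (jv z a * gact T g $$ (a, x)) * (jv z c * gact T g $$ (c, y)))"
        by (simp only:) (simp add: sum_distrib_left sum_distrib_right mult_ac del: One_nat_def)
    qed
    also have "\<dots> = (\<Sum>z\<in>{1..p}. \<Sum>a<n. \<Sum>c<n. (jv z a * gact T g $$ (a, x)) * (jv z c * gact T g $$ (c, y)))"
      by (simp only: sum.swap[of _ "{1..p}" "{..<n}"])
    also have "\<dots> = (\<Sum>z\<in>{1..p}. (\<lambda>z. (jv z x - c x) * (jv z y - c y)) (h z))"
      by (intro sum.cong refl) (simp add: sum_product[symmetric] JT b del: One_nat_def)
    also have "\<dots> = (\<Sum>z\<in>{1..p}. (jv z x - c x) * (jv z y - c y))" by (rule sum_perm[OF h])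
    also have "\<dots> = (\<Sum>z\<in>{1..p}. jv z x * jv z y - c x * jv z y - c y * jv z x + c x * c y)"
      by (intro sum.cong refl) (simp add: algebra_simps)
    also have "\<dots> = (\<Sum>z\<in>{1..p}. jv z x * jv z y)"
      using b by (simp only: sum.distrib sum_subtractf sum_distrib_left[symmetric] sum_jv sum_const_p) simp
    also have "\<dots> = cap $$ (i, k)"
      using k i b by (simp add: sum_jv_jv cap_def B_def xy del: One_nat_def)
    finally show "(cap * gact TT g) $$ (i, k) = cap $$ (i, k)" .
  qed auto
  then show "cap * gact TT g = gact gtriv g * cap" by (simp add: mat_one_mult del: One_nat_def)
qed (auto intro!: carrier_matI)

text \<open>The sum of all transpositions is a class sum of defect zero, hence a relative trace.\<close>

lemma tmap_temperley_lieb: "tmap TT TT (1\<^sub>m (n * n) + swap + cup * cap)"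
proof -
  let ?N = "\<lambda>x y. gact TT (transpose x y)" and ?m = "msum (n * n) (n * n)"
  let ?D = "{(x, y). x \<in> {1..p} \<and> y \<in> {1..p} \<and> x \<noteq> y}"
  have tr: "transpose x y \<in> carrier \<S>" if "x \<in> {1..p}" "y \<in> {1..p}" for x y
    using that by (simp add: carrier_iff permutes_swap_id)
  have one2: "1 \<in> {1..p}" "2 \<in> {1..p}" using p_ge_3 by auto
  \<comment> \<open>Conjugation turns the transposition of \<open>1\<close> and \<open>2\<close>
    into that of \<open>g 1\<close> and \<open>g 2\<close>, so the trace becomes a sum over ordered
    pairs of distinct points.\<close>
  have conj: "gact TT g * ?N 1 2 * gact TT (inv\<^bsub>\<S>\<^esub> g) = ?N (g 1) (g 2)" if g: "g \<in> carrier \<S>" for g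
  proof -
    have gp: "g permutes {1..p}" using g by (simp add: carrier_iff)
    have "g \<otimes>\<^bsub>\<S>\<^esub> transpose 1 2 \<otimes>\<^bsub>\<S>\<^esub> inv\<^bsub>\<S>\<^esub> g = transpose (g 1) (g 2)"
    proof -
      have "inv\<^bsub>\<S>\<^esub> g = inv_into UNIV g" using g by simp
      then have "g \<otimes>\<^bsub>\<S>\<^esub> transpose 1 2 \<otimes>\<^bsub>\<S>\<^esub> inv\<^bsub>\<S>\<^esub> g = g \<circ> transpose 1 2 \<circ> inv_into UNIV g"
        by (simp only: sym_group_mult)
      also have "\<dots> = transpose (g 1) (g 2)"
      proof
        fix x
        have "inv_into UNIV g x = z \<longleftrightarrow> x = g z" for z using permutes_inv_eq[OF gp] by auto
        moreover have "g (inv_into UNIV g x) = x" using permutes_inverses[OF gp] by simp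
        ultimately show "(g \<circ> transpose 1 2 \<circ> inv_into UNIV g) x = transpose (g 1) (g 2) x"
          by (auto simp: transpose_def)
      qed
      finally show ?thesis .
    qed
    then show ?thesis
      using is_gmodD(3)[OF is_gmod_TT g tr[OF one2]] g
        is_gmodD(3)[OF is_gmod_TT m_closed[OF g tr[OF one2]] inv_closed[OF g]] by simp
  qed
  \<comment> \<open>All fibres of the map sending \<open>g\<close> to \<open>(g 1, g 2)\<close> have
    the same size \<open>K\<close>. It will turn out to be \<open>(p - 2)!\<close>, which is prime
    to \<open>p\<close>; this is where the defect of the class enters.\<close>
  define fib where "fib x y = {g \<in> carrier \<S>. g 1 = x \<and> g 2 = y}" for x y
  have fin: "finite (fib x y)" for x y using finite_carrier by (simp add: fib_def)
  define K where "K = card (fib 1 2)"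
  have card_fib: "card (fib x y) = K" if xy: "x \<in> {1..p}" "y \<in> {1..p}" "x \<noteq> y" for x y
  proof -
    obtain h where h: "h \<in> carrier \<S>" "h 1 = x" "h 2 = y"
    proof
      let ?h = "transpose (transpose 1 x 2) y \<circ> transpose 1 x"
      have "transpose 1 x 2 \<in> {1..p}" using xy one2 by (auto simp: transpose_def)
      then show "?h \<in> carrier \<S>" using xy one2 unfolding carrier_iff
        by (intro permutes_compose permutes_swap_id)
      show "?h 1 = x" "?h 2 = y" using xy by (auto simp: transpose_def)
    qed
    have hp: "h permutes {1..p}" using h by (simp add: carrier_iff)
    have "bij_betw (\<lambda>g. h \<circ> g) (fib 1 2) (fib x y)"
    proof (rule bij_betw_byWitness[where f' = "\<lambda>g. inv_into UNIV h \<circ> g"])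
      show "\<forall>g\<in>fib 1 2. inv_into UNIV h \<circ> (h \<circ> g) = g" "\<forall>g\<in>fib x y. h \<circ> (inv_into UNIV h \<circ> g) = g"
        using permutes_inverses[OF hp] by (auto simp: fun_eq_iff)
      show "(\<lambda>g. h \<circ> g) ` fib 1 2 \<subseteq> fib x y"
        using h hp by (auto simp: fib_def carrier_iff intro: permutes_compose)
      show "(\<lambda>g. inv_into UNIV h \<circ> g) ` fib x y \<subseteq> fib 1 2"
        using h hp permutes_inv[OF hp] permutes_inverses[OF hp]
        by (auto simp: fib_def carrier_iff intro: permutes_compose)
    qed
    then show ?thesis by (simp add: K_def bij_betw_same_card)
  qed
  have im: "(\<lambda>g. (g 1, g 2)) ` carrier \<S> \<subseteq> ?D"
    using permutes_in_image[where S = "{1..p}"] one2 by (fastforce simp: carrier_iff dest: permutes_inj[THEN injD])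
  have finD: "finite ?D" by (rule finite_subset[of _ "{1..p} \<times> {1..p}"]) auto
  \<comment> \<open>Stated over an arbitrary semiring: over the natural numbers it determines
    \<open>K\<close>, over \<open>F\<close> it evaluates the trace.\<close>
  have fiber: "(\<Sum>g\<in>carrier \<S>. f (g 1, g 2)) = of_nat K * (\<Sum>z\<in>?D. f z)" for f :: "nat \<times> nat \<Rightarrow> 'b :: semiring_1"
  proof -
    have "(\<Sum>g\<in>carrier \<S>. f (g 1, g 2)) = (\<Sum>z\<in>?D. \<Sum>g\<in>{g \<in> carrier \<S>. (g 1, g 2) = z}. f (g 1, g 2))"
      by (rule sum.group[symmetric, OF finite_carrier finD im])
    also have "\<dots> = (\<Sum>z\<in>?D. of_nat K * f z)"
    proof (rule sum.cong[OF refl])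
      fix z assume z: "z \<in> ?D"
      have "{g \<in> carrier \<S>. (g 1, g 2) = z} = fib (fst z) (snd z)" by (auto simp: fib_def)
      moreover have "(\<Sum>g\<in>fib (fst z) (snd z). f (g 1, g 2)) = (\<Sum>g\<in>fib (fst z) (snd z). f z)"
        by (rule sum.cong) (auto simp: fib_def)
      ultimately show "(\<Sum>g\<in>{g \<in> carrier \<S>. (g 1, g 2) = z}. f (g 1, g 2)) = of_nat K * f z"
        using z card_fib by auto
    qed
    finally show ?thesis by (simp add: sum_distrib_left)
  qed
  have "card ?D = p * (p - 1)"
  proof -
    have "?D = {1..p} \<times> {1..p} - (\<lambda>x. (x, x)) ` {1..p}" by auto
    then have "card ?D = p * p - p"
      by (simp only:) (subst card_Diff_subset; auto simp: card_image inj_on_def card_cartesian_product)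
    then show ?thesis by (simp add: diff_mult_distrib2)
  qed
  moreover have "card (carrier \<S>) = fact p"
    using card_permutations[of "{1..p}" p] by (simp add: sym_group_def)
  ultimately have K: "fact p = K * (p * (p - 1))"
    using fiber[of "\<lambda>_. 1 :: nat"] by simp
  have "(fact p :: nat) = p * (p - 1) * fact (p - 2)"
  proof -
    have "p - 1 - 1 = p - 2" by simp
    then show ?thesis
      using fact_reduce[of p, where 'a = nat] fact_reduce[of "p - 1", where 'a = nat] p_ge_3
      by (simp only: of_nat_id mult.assoc)
  qed
  also have "\<dots> = fact (p - 2) * (p * (p - 1))" by (rule mult.commute)
  finally have eq: "K * (p * (p - 1)) = fact (p - 2) * (p * (p - 1))" unfolding K .
  have "p * (p - 1) \<noteq> 0" using p_ge_3 by simp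
  then have "K = fact (p - 2)" using iffD1[OF mult_right_cancel eq] by simp
  then have K0: "(of_nat K :: 'f) \<noteq> 0"
    using prime_p p_ge_3 by (simp add: of_nat_eq_0_iff prime_dvd_fact_iff del: of_nat_fact)
  have c: "?N 1 2 \<in> carrier_mat (n * n) (n * n)" by (auto intro!: carrier_matI)
  have "gtrace TT TT (?N 1 2) = ?m (\<lambda>g. case (g 1, g 2) of (x, y) \<Rightarrow> ?N x y) (carrier \<S>)"
    unfolding gtrace_def TT_dim by (intro msum_cong refl) (simp only: conj prod.case)
  also have "\<dots> = of_nat K \<cdot>\<^sub>m ?m (\<lambda>(x, y). ?N x y) ?D"
  proof (rule eq_matI)
    fix i j assume "i < dim_row (of_nat K \<cdot>\<^sub>m ?m (\<lambda>(x, y). ?N x y) ?D)" "j < dim_col (of_nat K \<cdot>\<^sub>m ?m (\<lambda>(x, y). ?N x y) ?D)"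
    then show "?m (\<lambda>g. case (g 1, g 2) of (x, y) \<Rightarrow> ?N x y) (carrier \<S>) $$ (i, j) = (of_nat K \<cdot>\<^sub>m ?m (\<lambda>(x, y). ?N x y) ?D) $$ (i, j)"
      using fiber[of "\<lambda>z. (case z of (x, y) \<Rightarrow> ?N x y) $$ (i, j)"] by (simp add: msum_def)
  qed auto
  finally have "tmap TT TT (of_nat K \<cdot>\<^sub>m (2 \<cdot>\<^sub>m (1\<^sub>m (n * n) + swap + cup * cap)))"
    unfolding sum_transpositions using c by (auto simp: tmap_def intro!: bexI[of _ "?N 1 2"])
  then have "tmap TT TT (inverse (of_nat K * 2) \<cdot>\<^sub>m (of_nat K \<cdot>\<^sub>m (2 \<cdot>\<^sub>m (1\<^sub>m (n * n) + swap + cup * cap))))"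
    by (rule tmap_smult[OF is_gmod_TT is_gmod_TT])
  moreover have "(2 :: 'f) \<noteq> 0" using of_nat_neq_0[of 2] p_ge_3 by simp
  moreover have "1 \<cdot>\<^sub>m M = M" for M :: "'f mat" by (rule eq_matI) auto
  ultimately show ?thesis using K0 by (simp add: mat_smult_smult)
qed

end

section \<open>Exterior powers\<close>

text \<open>The mixed composites need not vanish, but they are traces: placing the hypothesis
  \<open>t\<close> between \<open>a1\<close> and \<open>b2\<close> leaves exactly
  \<open>a1 * b2\<close>, because \<open>a1 * b1\<close> and \<open>a2 * b2\<close> are
  identities.\<close>

lemma (in fin_group) stable_biprod:
  fixes M X Y :: "('a, 'f :: field) gmod"
  assumes M: "is_gmod G M" and X: "is_gmod G X" and Y: "is_gmod G Y"
    and a1: "is_ghom G M X a1" and b1: "is_ghom G X M b1" and a2: "is_ghom G M Y a2" and b2: "is_ghom G Y M b2"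
    and ab1: "a1 * b1 = gid X" and ab2: "a2 * b2 = gid Y"
    and t: "tmap M M (b1 * a1 + b2 * a2 - gid M)"
  shows "sim M (gsum X Y)"
proof -
  define S where "S = gsum X Y"
  obtain i j p q where S: "is_biprod G X Y S i j p q" unfolding S_def by (rule gsum_biprod[OF X Y])
  note D = is_biprodD[OF S]
  note d = is_biprod_dim[OF S] is_ghomD(2,3)[OF a1] is_ghomD(2,3)[OF b1] is_ghomD(2,3)[OF a2] is_ghomD(2,3)[OF b2]
  note rw = mat_rewr[OF D(8)] mat_rewr[OF D(9)] mat_rewr[OF D(10)] mat_rewr[OF D(11)]
    mat_rewr[OF ab1] mat_rewr[OF ab2] ab1 ab2
  note calc = d mat_assoc mat_distribs rw mat_zeros
  have "a1 * (b1 * a1 + b2 * a2 - gid M) * b2 = a1 * b2 + a1 * b2 - a1 * b2"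
    by (simp add: calc)
  also have "\<dots> = a1 * b2" by (rule eq_matI) (simp_all add: d del: index_mult_mat(1))
  finally have t12: "tmap Y X (a1 * b2)" using tmap_sandwich[OF Y M X b2 a1 t] by simp
  have "a2 * (b1 * a1 + b2 * a2 - gid M) * b1 = a2 * b1 + a2 * b1 - a2 * b1"
    by (simp add: calc)
  also have "\<dots> = a2 * b1" by (rule eq_matI) (simp_all add: d del: index_mult_mat(1))
  finally have t21: "tmap X Y (a2 * b1)" using tmap_sandwich[OF X M Y b1 a2 t] by simp
  have "sim M S"
  proof (rule simI[OF M D(3)])
    show "is_ghom G M S (i * a1 + j * a2)" using D a1 a2 M by (intro ghom_add ghom_comp)
    show "is_ghom G S M (b1 * p + b2 * q)" using D b1 b2 M by (intro ghom_add ghom_comp)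
    have "(b1 * p + b2 * q) * (i * a1 + j * a2) = b1 * a1 + b2 * a2" by (simp add: calc)
    then show "tmap M M ((b1 * p + b2 * q) * (i * a1 + j * a2) - gid M)" using t by simp
    have "(i * a1 + j * a2) * (b1 * p + b2 * q) - gid S
        = (i * p + i * (a1 * b2) * q + (j * (a2 * b1) * p + j * q)) - (i * p + j * q)"
      unfolding D(12) by (simp add: calc)
        (auto intro!: eq_matI simp: d add_ac simp del: index_mult_mat(1))
    also have "\<dots> = i * (a1 * b2) * q + j * (a2 * b1) * p"
      by (rule eq_matI) (simp_all add: d del: index_mult_mat(1))
    also have "\<dots> = i * (a1 * b2 * q) + j * (a2 * b1 * p)" by (simp add: d mat_assoc)
    finally show "tmap S S ((i * a1 + j * a2) * (b1 * p + b2 * q) - gid S)"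
      using tmap_add[OF D(3,3) tmap_comp_left[OF D(3,1,3,4) tmap_comp_right[OF Y X D(3,7) t12]]
          tmap_comp_left[OF D(3,2,3,5) tmap_comp_right[OF X Y D(3,6) t21]]] by simp
  qed
  then show ?thesis by (simp add: S_def)
qed

context sym_char
begin

definition s1 :: "nat \<Rightarrow> 'f mat" where "s1 i = kronecker swap (I i)"

text \<open>The antisymmetrizer on \<open>i\<close> factors, through the two double cosets of a
  point stabilizer in a symmetric group; the factor \<open>i + 1\<close> is the number of cosets in
  the nontrivial one. The denominators are invertible in degrees below \<open>p\<close>.\<close>

fun alt :: "nat \<Rightarrow> 'f mat" where
  "alt 0 = 1\<^sub>m 1"
| "alt (Suc 0) = 1\<^sub>m n"
| "alt (Suc (Suc i)) = inverse (of_nat (i + 2)) \<cdot>\<^sub>m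
     (kronecker (1\<^sub>m n) (alt (Suc i)) * (I (Suc (Suc i)) - of_nat (i + 1) \<cdot>\<^sub>m s1 i) * kronecker (1\<^sub>m n) (alt (Suc i)))"

abbreviation L :: "nat \<Rightarrow> 'f mat" where "L i \<equiv> kronecker (1\<^sub>m n) (alt i)"
abbreviation Tp :: "nat \<Rightarrow> 'f smod" where "Tp i \<equiv> gtensor_pow T i"

lemma s1_dim [simp]: "dim_row (s1 i) = n * (n * n ^ i)" "dim_col (s1 i) = n * (n * n ^ i)"
  by (auto simp: s1_def mult.assoc)

lemma alt_dim [simp]: "dim_row (alt i) = n ^ i" "dim_col (alt i) = n ^ i"
  by (induction i rule: alt.induct) auto

lemma alt_carrier: "alt i \<in> carrier_mat (n ^ i) (n ^ i)" by (auto intro!: carrier_matI)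

lemma Tp_dim [simp]: "gdim (Tp i) = n ^ i"
  by (induction i) auto

lemma is_gmod_Tp: "is_gmod \<S> (Tp i)"
  by (intro is_gmod_gtensor_pow is_gmod_T)

lemma Tp_Suc_Suc: "Tp (Suc (Suc i)) = gtensor TT (Tp i)"
  by (simp add: TT_def gtensor_assoc)

lemma s1_ghom: "is_ghom \<S> (Tp (Suc (Suc i))) (Tp (Suc (Suc i))) (s1 i)"
  unfolding Tp_Suc_Suc s1_def
  using ghom_kron[OF is_gmod_TT is_gmod_TT is_gmod_Tp is_gmod_Tp swap_ghom ghom_one[OF is_gmod_Tp]] by simp

lemma L_ghom: "is_ghom \<S> (Tp i) (Tp i) (alt i) \<Longrightarrow> is_ghom \<S> (Tp (Suc i)) (Tp (Suc i)) (L i)"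
  using ghom_kron[OF is_gmod_T is_gmod_T is_gmod_Tp is_gmod_Tp ghom_one[OF is_gmod_T]] by simp

lemma alt_ghom: "is_ghom \<S> (Tp i) (Tp i) (alt i)"
proof (induction i rule: alt.induct)
  case 1
  show ?case using ghom_one[OF is_gmod_Tp[of 0]] by simp
next
  case 2
  show ?case using ghom_one[OF is_gmod_Tp[of "Suc 0"]] by simp
next
  case (3 i)
  note g = is_gmod_Tp[of "Suc (Suc i)"]
  have "is_ghom \<S> (Tp (Suc (Suc i))) (Tp (Suc (Suc i))) (I (Suc (Suc i)) - of_nat (i + 1) \<cdot>\<^sub>m s1 i)"
    using ghom_minus[OF g g ghom_one[OF g] ghom_smult[OF g g s1_ghom]] by (simp only: Tp_dim)
  then show ?case unfolding alt.simps
    by (intro ghom_smult[OF g g] ghom_comp[OF g g g] L_ghom[OF 3(1)])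
qed

lemma s1_transpose: "(s1 i)\<^sup>T = s1 i"
  by (simp add: s1_def kron_transpose swap_transpose transpose_one)

lemma alt_transpose: "(alt i)\<^sup>T = alt i"
proof (induction i rule: alt.induct)
  case (3 i)
  let ?c = "carrier_mat (n ^ Suc (Suc i)) (n ^ Suc (Suc i))"
  have L: "L (Suc i) \<in> ?c" and M: "I (Suc (Suc i)) - of_nat (i + 1) \<cdot>\<^sub>m s1 i \<in> ?c"
    by (auto intro!: carrier_matI)
  have LT: "(L (Suc i))\<^sup>T = L (Suc i)" by (simp add: kron_transpose 3 transpose_one)
  have "(I (Suc (Suc i)) - of_nat (i + 1) \<cdot>\<^sub>m s1 i)\<^sup>T = (I (Suc (Suc i)))\<^sup>T - (of_nat (i + 1) \<cdot>\<^sub>m s1 i)\<^sup>T"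
    by (rule transpose_minus[of _ "n ^ Suc (Suc i)" "n ^ Suc (Suc i)"]) (auto intro!: carrier_matI)
  also have "(of_nat (i + 1) \<cdot>\<^sub>m s1 i)\<^sup>T = of_nat (i + 1) \<cdot>\<^sub>m (s1 i)\<^sup>T" by (auto intro!: eq_matI)
  finally have MT: "(I (Suc (Suc i)) - of_nat (i + 1) \<cdot>\<^sub>m s1 i)\<^sup>T = I (Suc (Suc i)) - of_nat (i + 1) \<cdot>\<^sub>m s1 i"
    by (simp add: s1_transpose transpose_one)
  have sm: "(c \<cdot>\<^sub>m X)\<^sup>T = c \<cdot>\<^sub>m X\<^sup>T" for c and X :: "'f mat" by (auto intro!: eq_matI)
  show ?case
    unfolding alt.simps sm transpose_mult[OF mult_carrier_mat[OF L M] L] transpose_mult[OF L M] LT MT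
    by (simp add: mat_assoc)
qed (simp_all add: transpose_one)

lemma s1_s1: "s1 i * s1 i = I (Suc (Suc i))"
  by (simp add: s1_def kron_mult swap_swap mat_distribs kron_one mult.assoc)

lemma s1_braid:
  "s1 (Suc i) * kronecker (1\<^sub>m n) (s1 i) * s1 (Suc i) =
   kronecker (1\<^sub>m n) (s1 i) * s1 (Suc i) * kronecker (1\<^sub>m n) (s1 i)"
proof -
  have 1: "s1 (Suc i) = kronecker (kronecker swap (1\<^sub>m n)) (I i)"
    by (simp add: s1_def kron_assoc kron_one)
  have 2: "kronecker (1\<^sub>m n) (s1 i) = kronecker (kronecker (1\<^sub>m n) swap) (I i)"
    by (simp add: s1_def kron_assoc)
  show ?thesis unfolding 1 2 by (simp add: kron_mult mult.assoc braid[symmetric])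
qed

lemma s1_L_comm: "kronecker (1\<^sub>m n) (L i) * s1 i = s1 i * kronecker (1\<^sub>m n) (L i)"
proof -
  have "kronecker (1\<^sub>m n) (L i) = kronecker (1\<^sub>m (n * n)) (alt i)"
    by (simp add: kron_assoc[symmetric] kron_one)
  then show ?thesis by (simp add: s1_def kron_mult mat_distribs)
qed

lemma L_Suc_Suc: "L (Suc (Suc i)) = inverse (of_nat (i + 2)) \<cdot>\<^sub>m
   (kronecker (1\<^sub>m n) (L (Suc i)) * (I (Suc (Suc (Suc i))) - of_nat (i + 1) \<cdot>\<^sub>m kronecker (1\<^sub>m n) (s1 i))
      * kronecker (1\<^sub>m n) (L (Suc i)))"
proof -
  have "I (Suc (Suc (Suc i))) - of_nat (i + 1) \<cdot>\<^sub>m kronecker (1\<^sub>m n) (s1 i)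
    = kronecker (1\<^sub>m n) (I (Suc (Suc i)) - of_nat (i + 1) \<cdot>\<^sub>m s1 i)"
    by (simp add: kron_minus_right kron_one kron_smult_right)
  then show ?thesis by (simp add: kron_smult_right kron_mult mat_distribs)
qed

text \<open>Expanding the left outer antisymmetrizer \<open>a\<close> by its own recursion gives
  \<open>X = (1 - s) a + c a' s2 s a\<close>. The first part is negated by \<open>s\<close> because
  \<open>s * s = 1\<close>; the second because \<open>s\<close> commutes with \<open>a'\<close>,
  while the braid relation and \<open>s2 * a = -a\<close> turn \<open>s * s2 * s * a\<close> into
  \<open>- s2 * s * a\<close>.\<close>

lemma alt_step:
  assumes "i + 2 < p + 1" and LL: "alt (Suc i) * alt (Suc i) = alt (Suc i)"
    and IH: "\<And>j. i = Suc j \<Longrightarrow> s1 j * alt (Suc i) = (- 1) \<cdot>\<^sub>m alt (Suc i) \<and> L i * alt (Suc i) = alt (Suc i)"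
  defines "X \<equiv> L (Suc i) * (I (Suc (Suc i)) - of_nat (i + 1) \<cdot>\<^sub>m s1 i) * L (Suc i)"
  shows "s1 i * X = (- 1) \<cdot>\<^sub>m X"
proof (cases i)
  case 0
  have X: "X = 1\<^sub>m (n * n) - s1 0"
    by (simp add: X_def 0 kron_one mat_distribs) (auto intro!: eq_matI)
  show ?thesis unfolding 0 X by (simp add: mat_distribs s1_s1) (auto intro!: eq_matI)
next
  case (Suc j)
  define a where "a = L (Suc (Suc j))"
  define a' where "a' = kronecker (1\<^sub>m n) (L (Suc j))"
  define s2 where "s2 = kronecker (1\<^sub>m n) (s1 j)"
  define s where "s = s1 (Suc j)"
  define c :: 'f where "c = of_nat (j + 1)"
  define m :: 'f where "m = of_nat (j + 2)"
  have m: "m = c + 1" "m \<noteq> 0"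
    using assms(1) Suc of_nat_neq_0[of "j + 2"] by (auto simp: m_def c_def)
  have d: "dim_row a = n * (n * (n * n ^ j))" "dim_col a = n * (n * (n * n ^ j))"
    "dim_row a' = n * (n * (n * n ^ j))" "dim_col a' = n * (n * (n * n ^ j))"
    "dim_row s2 = n * (n * (n * n ^ j))" "dim_col s2 = n * (n * (n * n ^ j))"
    "dim_row s = n * (n * (n * n ^ j))" "dim_col s = n * (n * (n * n ^ j))"
    by (auto simp: a_def a'_def s2_def s_def)
  let ?one = "1\<^sub>m (n * (n * (n * n ^ j)))"
  have f1: "a' * a = a" using IH[OF Suc] by (simp add: a_def a'_def kron_mult mat_distribs Suc del: alt.simps)
  have f3: "a' * s = s * a'" unfolding a'_def s_def by (rule s1_L_comm)
  have f4: "s2 * a = (- 1) \<cdot>\<^sub>m a"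
    using IH[OF Suc] by (simp add: a_def s2_def kron_mult mat_distribs Suc kron_smult_right del: alt.simps)
  have f5: "s * s2 * s = s2 * s * s2" unfolding s_def s2_def by (rule s1_braid)
  have f6: "s * s = ?one" by (simp add: s_def s1_s1)
  have f7: "a = inverse m \<cdot>\<^sub>m (a' * (?one - c \<cdot>\<^sub>m s2) * a')"
    unfolding a_def a'_def s2_def m_def c_def L_Suc_Suc by simp
  have X: "X = a * (?one - m \<cdot>\<^sub>m s) * a"
    unfolding X_def Suc a_def s_def m_def by (simp add: add.commute del: alt.simps)
  have a's: "a' * (s * a) = s * a"
    using f1 f3 by (simp add: d flip: mat_assoc) (simp add: d mat_assoc)
  have step1: "a' * ((?one - m \<cdot>\<^sub>m s) * a) = (?one - m \<cdot>\<^sub>m s) * a"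
    by (simp add: d mat_distribs f1 a's)
  have "X = a * ((?one - m \<cdot>\<^sub>m s) * a)" by (simp add: X d mat_assoc)
  also have "\<dots> = inverse m \<cdot>\<^sub>m (a' * (?one - c \<cdot>\<^sub>m s2) * a') * ((?one - m \<cdot>\<^sub>m s) * a)"
    by (rule arg_cong[of _ _ "\<lambda>M. M * _", OF f7])
  also have "\<dots> = inverse m \<cdot>\<^sub>m (a' * ((?one - c \<cdot>\<^sub>m s2) * (a' * ((?one - m \<cdot>\<^sub>m s) * a))))"
    by (simp add: d mat_assoc mat_smult_mult)
  also have "(?one - c \<cdot>\<^sub>m s2) * (a' * ((?one - m \<cdot>\<^sub>m s) * a))
     = a - m \<cdot>\<^sub>m (s * a) - c \<cdot>\<^sub>m (s2 * a) + (c * m) \<cdot>\<^sub>m (s2 * (s * a))"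
    unfolding step1 by (simp add: d mat_assoc mat_distribs mat_smult_smult)
      (auto intro!: eq_matI simp: d algebra_simps simp del: index_mult_mat(1))
  also have "\<dots> = m \<cdot>\<^sub>m (a - s * a + c \<cdot>\<^sub>m (s2 * (s * a)))"
    unfolding f4 by (rule eq_matI) (simp_all add: d m algebra_simps del: index_mult_mat(1))
  also have "inverse m \<cdot>\<^sub>m (a' * (m \<cdot>\<^sub>m (a - s * a + c \<cdot>\<^sub>m (s2 * (s * a)))))
     = a - s * a + c \<cdot>\<^sub>m (a' * (s2 * (s * a)))"
    using m(2) by (simp add: d mat_distribs mat_smult_smult f1 a's)
      (auto intro!: eq_matI simp: d simp del: index_mult_mat(1))
  finally have X2: "X = a - s * a + c \<cdot>\<^sub>m (a' * (s2 * (s * a)))" .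
  have sss: "s * (s2 * (s * a)) = (- 1) \<cdot>\<^sub>m (s2 * (s * a))"
  proof -
    have "s * (s2 * (s * a)) = (s * s2 * s) * a" by (simp add: d mat_assoc)
    also have "\<dots> = s2 * (s * (s2 * a))" unfolding f5 by (simp add: d mat_assoc)
    finally show ?thesis by (simp add: f4 d mat_distribs)
  qed
  have "s * (a' * (s2 * (s * a))) = a' * (s * (s2 * (s * a)))"
    using f3 by (simp add: d flip: mat_assoc)
  then have sa': "s * (a' * (s2 * (s * a))) = (- 1) \<cdot>\<^sub>m (a' * (s2 * (s * a)))"
    by (simp add: sss d mat_distribs)
  have "s * X = s * a - a + c \<cdot>\<^sub>m ((- 1) \<cdot>\<^sub>m (a' * (s2 * (s * a))))"
    unfolding X2 by (simp add: d mat_distribs mat_rewr[OF f6] sa')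
  also have "\<dots> = (- 1) \<cdot>\<^sub>m X"
    unfolding X2 by (rule eq_matI) (simp_all add: d del: index_mult_mat(1))
  finally show ?thesis by (simp add: s_def Suc)
qed

text \<open>Idempotency uses the sign rule of the same degree, whose proof uses the facts one degree
  lower, hence the joint induction. The bound keeps all denominators below \<open>p\<close>.\<close>

lemma alt_props:
  assumes "i + 2 < p + 1"
  shows "alt (Suc i) * alt (Suc i) = alt (Suc i) \<and>
    (\<forall>j. i = Suc j \<longrightarrow> s1 j * alt (Suc i) = (- 1) \<cdot>\<^sub>m alt (Suc i) \<and> L i * alt (Suc i) = alt (Suc i))"
  using assms
proof (induction i)
  case 0
  then show ?case by (simp add: mat_distribs)
next
  case (Suc i)
  then have i: "i + 2 < p + 1" "(of_nat (i + 2) :: 'f) \<noteq> 0" using of_nat_neq_0[of "i + 2"] by auto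
  note IH = Suc.IH[OF i(1)]
  define X where "X = L (Suc i) * (I (Suc (Suc i)) - of_nat (i + 1) \<cdot>\<^sub>m s1 i) * L (Suc i)"
  have sX: "s1 i * X = (- 1) \<cdot>\<^sub>m X"
    unfolding X_def by (rule alt_step) (use IH i in auto)
  have E: "alt (Suc (Suc i)) = inverse (of_nat (i + 2)) \<cdot>\<^sub>m X" by (simp add: X_def)
  define E where "E = alt (Suc (Suc i))"
  have dX: "dim_row X = n * (n * n ^ i)" "dim_col X = n * (n * n ^ i)" by (simp_all add: X_def)
  have dE: "dim_row E = n * (n * n ^ i)" "dim_col E = n * (n * n ^ i)" by (simp_all add: E_def del: alt.simps)
  have LL: "L (Suc i) * L (Suc i) = L (Suc i)" using IH by (simp add: kron_mult mat_distribs)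
  have sE: "s1 i * E = (- 1) \<cdot>\<^sub>m E"
    unfolding E_def E by (simp add: mat_distribs dX sX mat_smult_smult)
  have LE: "L (Suc i) * E = E"
    unfolding E_def E X_def by (simp add: mat_distribs mat_assoc mat_rewr[OF LL])
  \<comment> \<open>\<open>E\<close> is symmetric, so transposition turns the rules for
    multiplication from the left into rules for multiplication from the right.\<close>
  have "(s1 i * E)\<^sup>T = E\<^sup>T * (s1 i)\<^sup>T" by (rule transpose_mult) (auto intro!: carrier_matI simp: dE)
  moreover have "((- 1) \<cdot>\<^sub>m E)\<^sup>T = (- 1) \<cdot>\<^sub>m E\<^sup>T" by (auto intro!: eq_matI)
  moreover have ET: "E\<^sup>T = E" unfolding E_def by (rule alt_transpose)
  ultimately have Es: "E * s1 i = (- 1) \<cdot>\<^sub>m E" by (simp add: sE s1_transpose)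
  have "(L (Suc i) * E)\<^sup>T = E\<^sup>T * (L (Suc i))\<^sup>T" by (rule transpose_mult) (auto intro!: carrier_matI simp: dE)
  then have EL: "E * L (Suc i) = E"
    by (simp add: LE ET kron_transpose alt_transpose transpose_one del: alt.simps)
  have "E * E = inverse (of_nat (i + 2)) \<cdot>\<^sub>m (E * X)"
    unfolding E_def E by (simp add: mat_distribs dX)
  also have "E * X = (E * L (Suc i)) * (I (Suc (Suc i)) - of_nat (i + 1) \<cdot>\<^sub>m s1 i) * L (Suc i)"
    unfolding X_def by (simp add: dE mat_assoc)
  also have "E * L (Suc i) * (I (Suc (Suc i)) - of_nat (i + 1) \<cdot>\<^sub>m s1 i) = of_nat (i + 2) \<cdot>\<^sub>m E"
    unfolding EL by (simp add: dE mat_distribs Es mat_smult_smult)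
      (auto intro!: eq_matI simp: dE algebra_simps simp del: index_mult_mat(1))
  also have "of_nat (i + 2) \<cdot>\<^sub>m E * L (Suc i) = of_nat (i + 2) \<cdot>\<^sub>m E" by (simp add: dE mat_distribs EL)
  finally have "E * E = 1 \<cdot>\<^sub>m E" using i(2) by (simp add: mat_smult_smult)
  moreover have "1 \<cdot>\<^sub>m E = E" by (auto intro!: eq_matI)
  ultimately have "E * E = E" by simp
  then show ?case using sE LE by (simp add: E_def del: alt.simps)
qed

lemma alt_idem: "i < p \<Longrightarrow> alt i * alt i = alt i"
  by (cases i) (use alt_props[of "i - 1"] in \<open>auto simp: mat_distribs simp del: alt.simps(3)\<close>)

lemma s1_alt: "i + 2 < p \<Longrightarrow> s1 i * alt (Suc (Suc i)) = (- 1) \<cdot>\<^sub>m alt (Suc (Suc i))"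
  using alt_props[of "Suc i"] by simp


lemma L_alt: "i + 1 < p \<Longrightarrow> L i * alt (Suc i) = alt (Suc i)"
  by (cases i) (use alt_props[of i] in \<open>auto simp: mat_distribs kron_one_right simp del: alt.simps(3) One_nat_def\<close>)

section \<open>Contraction of the first two factors\<close>

abbreviation "capi i \<equiv> kronecker cap (I i)"
abbreviation "cupi i \<equiv> kronecker cup (I i)"

lemma capi_cupi: "capi i * cupi i = (- 2) \<cdot>\<^sub>m I i"
  by (simp add: kron_mult mat_distribs cap_cup kron_smult_left kron_one_left del: One_nat_def)

lemma capi_L: "capi i * kronecker (1\<^sub>m n) (L i) = alt i * capi i"
proof -
  have "kronecker (1\<^sub>m n) (L i) = kronecker (1\<^sub>m (n * n)) (alt i)"
    by (simp add: kron_assoc[symmetric] kron_one)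
  moreover have "alt i * capi i = kronecker (1\<^sub>m 1) (alt i) * capi i"
    by (simp add: kron_one_left del: One_nat_def)
  ultimately show ?thesis by (simp add: kron_mult mat_distribs del: One_nat_def)
qed

lemma L_cupi: "kronecker (1\<^sub>m n) (L i) * cupi i = cupi i * alt i"
proof -
  have "kronecker (1\<^sub>m n) (L i) = kronecker (1\<^sub>m (n * n)) (alt i)"
    by (simp add: kron_assoc[symmetric] kron_one)
  moreover have "cupi i * alt i = cupi i * kronecker (1\<^sub>m 1) (alt i)"
    by (simp add: kron_one_left del: One_nat_def)
  ultimately show ?thesis by (simp add: kron_mult mat_distribs del: One_nat_def)
qed

lemma capi_swap_cupi: "capi (Suc j) * (kronecker (1\<^sub>m n) (s1 j) * cupi (Suc j)) = I (Suc j)"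
proof -
  have 1: "capi (Suc j) = kronecker (kronecker cap (1\<^sub>m n)) (I j)"
    "cupi (Suc j) = kronecker (kronecker cup (1\<^sub>m n)) (I j)"
    by (simp_all add: kron_assoc kron_one)
  have 2: "kronecker (1\<^sub>m n) (s1 j) = kronecker (kronecker (1\<^sub>m n) swap) (I j)"
    by (simp add: s1_def kron_assoc)
  show ?thesis unfolding 1 2 by (simp add: kron_mult zigzag mat_distribs kron_one mult.assoc)
qed

text \<open>In dimension \<open>d\<close> the scalar is \<open>(d - i) / (i + 1)\<close>; here
  \<open>d = -2\<close> in \<open>F\<close>. The recursion for \<open>alt\<close> opens the loop
  formed by \<open>cap\<close> and \<open>cup\<close>: its two terms are evaluated by
  \<open>capi_cupi\<close> and \<open>capi_swap_cupi\<close>.\<close>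

lemma partial_trace:
  assumes "i + 1 < p"
  shows "capi i * (L (Suc i) * cupi i) = (- of_nat (i + 2) / of_nat (i + 1)) \<cdot>\<^sub>m alt i"
proof (cases i)
  case 0
  show ?thesis unfolding 0
    by (simp add: kron_one mat_distribs cap_cup kron_one_right del: One_nat_def)
next
  case (Suc j)
  define c :: 'f where "c = of_nat (j + 1)"
  define A where "A = alt (Suc j)"
  define a' where "a' = kronecker (1\<^sub>m n) (L (Suc j))"
  define s2 where "s2 = kronecker (1\<^sub>m n) (s1 j)"
  define u where "u = capi (Suc j)"
  define v where "v = cupi (Suc j)"
  let ?N = "n * (n * (n * n ^ j))" and ?M = "n * n ^ j"
  have d: "dim_row A = ?M" "dim_col A = ?M" "dim_row a' = ?N" "dim_col a' = ?N" "dim_row s2 = ?N" "dim_col s2 = ?N"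
    "dim_row u = ?M" "dim_col u = ?N" "dim_row v = ?N" "dim_col v = ?M"
    by (auto simp: A_def a'_def s2_def u_def v_def mult.assoc)
  have r: "u * a' = A * u" "a' * v = v * A" "u * v = (- 2) \<cdot>\<^sub>m 1\<^sub>m ?M" "u * (s2 * v) = 1\<^sub>m ?M"
    unfolding u_def v_def a'_def A_def s2_def
    by (simp_all only: power_Suc[symmetric] capi_L L_cupi capi_cupi capi_swap_cupi)
  have AA: "A * A = A" unfolding A_def using assms Suc by (intro alt_idem) auto
  have L: "L (Suc i) = inverse (of_nat (j + 2)) \<cdot>\<^sub>m (a' * (1\<^sub>m ?N - c \<cdot>\<^sub>m s2) * a')"
    unfolding Suc L_Suc_Suc a'_def s2_def c_def by simp
  have "u * (L (Suc i) * v) = inverse (of_nat (j + 2)) \<cdot>\<^sub>m (u * (a' * ((1\<^sub>m ?N - c \<cdot>\<^sub>m s2) * (a' * v))))"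
    unfolding L by (simp add: d mat_assoc mat_mult_smult mat_smult_mult)
  also have "u * (a' * ((1\<^sub>m ?N - c \<cdot>\<^sub>m s2) * (a' * v))) = A * (u * (v * A) - c \<cdot>\<^sub>m (u * (s2 * (v * A))))"
    by (simp add: r(2) d mat_rewr[OF r(1)] mat_assoc mat_distribs)
  also have "u * (v * A) = (- 2) \<cdot>\<^sub>m A" using mat_rewr[OF r(3), of A] d by (simp add: mat_distribs)
  also have "u * (s2 * (v * A)) = A" using r(4) d by (simp add: mat_distribs flip: mat_assoc)
  also have "A * ((- 2) \<cdot>\<^sub>m A - c \<cdot>\<^sub>m A) = (- of_nat (j + 3)) \<cdot>\<^sub>m A"
    by (simp add: d mat_distribs AA) (auto intro!: eq_matI simp: d c_def algebra_simps)
  also have "inverse (of_nat (j + 2)) \<cdot>\<^sub>m (- of_nat (j + 3) \<cdot>\<^sub>m A) = (- of_nat (i + 2) / of_nat (i + 1)) \<cdot>\<^sub>m A"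
    by (simp add: mat_smult_smult Suc divide_inverse mult.commute add_ac numeral_eq_Suc)
  finally show ?thesis unfolding u_def v_def A_def Suc by simp
qed

definition splits :: "nat \<Rightarrow> 'f smod \<times> 'f mat \<times> 'f mat \<Rightarrow> bool" where
  "splits i = (\<lambda>(W, s, r). is_gmod \<S> W \<and> is_ghom \<S> W (Tp i) s \<and> is_ghom \<S> (Tp i) W r \<and>
     r * s = gid W \<and> s * r = alt i)"

text \<open>The exterior power of \<open>T\<close>, as the image of the antisymmetrizer.\<close>

definition X :: "nat \<Rightarrow> 'f smod" where "X i = fst (SOME x. splits i x)"
definition inc :: "nat \<Rightarrow> 'f mat" where "inc i = fst (snd (SOME x. splits i x))"
definition prj :: "nat \<Rightarrow> 'f mat" where "prj i = snd (snd (SOME x. splits i x))"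

lemma X_props:
  assumes "i < p"
  shows "is_gmod \<S> (X i)" "is_ghom \<S> (X i) (Tp i) (inc i)" "is_ghom \<S> (Tp i) (X i) (prj i)"
    "prj i * inc i = gid (X i)" "inc i * prj i = alt i"
proof -
  obtain W s r where "is_gmod \<S> W" "is_ghom \<S> W (Tp i) s" "is_ghom \<S> (Tp i) W r"
    "r * s = gid W" "s * r = alt i"
    by (rule idempotent_split[OF is_group is_gmod_Tp alt_ghom alt_idem[OF assms]])
  then have "splits i (W, s, r)" by (simp add: splits_def)
  then have "splits i (SOME x. splits i x)" by (rule someI)
  moreover have "(SOME x. splits i x) = (X i, inc i, prj i)" by (simp add: X_def inc_def prj_def)
  ultimately have "splits i (X i, inc i, prj i)" by simp
  then show "is_gmod \<S> (X i)" "is_ghom \<S> (X i) (Tp i) (inc i)" "is_ghom \<S> (Tp i) (X i) (prj i)"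
    "prj i * inc i = gid (X i)" "inc i * prj i = alt i" by (auto simp: splits_def)
qed

lemma X_dim:
  assumes "i < p"
  shows "dim_row (inc i) = n ^ i" "dim_col (inc i) = gdim (X i)"
    "dim_row (prj i) = gdim (X i)" "dim_col (prj i) = n ^ i"
  using X_props(2,3)[OF assms] by (auto dest: is_ghomD(2,3))

lemma alt_inc:
  assumes "i < p"
  shows "alt i * inc i = inc i"
  unfolding X_props(5)[OF assms, symmetric]
  using X_dim[OF assms] X_props(4)[OF assms] by (simp add: mat_assoc mat_distribs)

lemma prj_alt:
  assumes "i < p"
  shows "prj i * alt i = prj i"
  unfolding X_props(5)[OF assms, symmetric]
  using X_dim[OF assms] by (simp add: mat_rewr[OF X_props(4)[OF assms]] mat_distribs)

text \<open>Modulo trace maps the swap equals \<open>- (1 + cup * cap)\<close>, so the complement of the exterior power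
  in \<open>T \<otimes> \<Lambda>\<^sup>jT\<close> is the image of the contraction.\<close>

lemma sim_T_X:
  assumes "j + 2 < p"
  shows "sim (gtensor T (X (Suc j))) (gsum (X (Suc (Suc j))) (X j))"
proof -
  have p: "j < p" "Suc j < p" "Suc (Suc j) < p" using assms by auto
  note X0 = X_props[OF p(1)] and X1 = X_props[OF p(2)] and X2 = X_props[OF p(3)]
  define M where "M = gtensor T (X (Suc j))"
  define \<iota> where "\<iota> = kronecker (1\<^sub>m n) (inc (Suc j))"
  define \<pi> where "\<pi> = kronecker (1\<^sub>m n) (prj (Suc j))"
  define Z where "Z = kronecker (1\<^sub>m (n * n) + swap + cup * cap) (I j)"
  define c :: 'f where "c = of_nat (j + 1)"
  define m :: 'f where "m = of_nat (j + 2)"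
  define a1 where "a1 = prj (Suc (Suc j)) * \<iota>"
  define b1 where "b1 = \<pi> * inc (Suc (Suc j))"
  define a2 where "a2 = prj j * capi j * \<iota>"
  \<comment> \<open>The scalar is the inverse of the one in \<open>partial_trace\<close>, which
    gives \<open>a2 * b2 = 1\<close>.\<close>
  define b2 where "b2 = (- (c / m)) \<cdot>\<^sub>m (\<pi> * cupi j * inc j)"
  let ?N = "n * (n * n ^ j)"
  have M: "is_gmod \<S> M" unfolding M_def by (intro is_gmod_gtensor is_gmod_T X1)
  note gT = is_gmod_Tp[of j] is_gmod_Tp[of "Suc (Suc j)"]
  have \<iota>: "is_ghom \<S> M (Tp (Suc (Suc j))) \<iota>"
    unfolding M_def \<iota>_def using ghom_kron[OF is_gmod_T is_gmod_T X1(1) is_gmod_Tp ghom_one[OF is_gmod_T] X1(2)] by simp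
  have \<pi>: "is_ghom \<S> (Tp (Suc (Suc j))) M \<pi>"
    unfolding M_def \<pi>_def using ghom_kron[OF is_gmod_T is_gmod_T is_gmod_Tp X1(1) ghom_one[OF is_gmod_T] X1(3)] by simp
  have capi: "is_ghom \<S> (Tp (Suc (Suc j))) (Tp j) (capi j)"
    using ghom_kron[OF is_gmod_TT is_gmod_gtriv gT(1) gT(1) cap_ghom ghom_one[OF gT(1)]]
    by (simp only: Tp_Suc_Suc gtensor_gtriv_left Tp_dim)
  have cupi: "is_ghom \<S> (Tp j) (Tp (Suc (Suc j))) (cupi j)"
    using ghom_kron[OF is_gmod_gtriv is_gmod_TT gT(1) gT(1) cup_ghom ghom_one[OF gT(1)]]
    by (simp only: Tp_Suc_Suc gtensor_gtriv_left Tp_dim)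
  have Z: "tmap (Tp (Suc (Suc j))) (Tp (Suc (Suc j))) Z"
    unfolding Z_def using tmap_kron_left[OF is_gmod_TT is_gmod_TT gT(1) gT(1) tmap_temperley_lieb ghom_one[OF gT(1)]]
    by (simp only: Tp_Suc_Suc Tp_dim)
  have dM: "gdim M = n * gdim (X (Suc j))" by (simp add: M_def)
  have d: "dim_row \<iota> = ?N" "dim_col \<iota> = gdim M" "dim_row \<pi> = gdim M" "dim_col \<pi> = ?N"
    "dim_row (inc (Suc (Suc j))) = ?N" "dim_col (inc (Suc (Suc j))) = gdim (X (Suc (Suc j)))"
    "dim_row (prj (Suc (Suc j))) = gdim (X (Suc (Suc j)))" "dim_col (prj (Suc (Suc j))) = ?N"
    "dim_row (capi j) = n ^ j" "dim_col (capi j) = ?N" "dim_row (cupi j) = ?N" "dim_col (cupi j) = n ^ j"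
    "dim_row Z = ?N" "dim_col Z = ?N"
    using X_dim[OF p(2)] X_dim[OF p(3)] by (simp_all add: \<iota>_def \<pi>_def Z_def dM mult.assoc)
  note dX = X_dim[OF p(1)] alt_dim s1_dim
  have \<pi>\<iota>: "\<pi> * \<iota> = gid M"
    unfolding \<pi>_def \<iota>_def dM using X_dim[OF p(2)] X1(4) by (simp add: kron_mult mat_distribs kron_one)
  have \<iota>\<pi>: "\<iota> * \<pi> = L (Suc j)"
    unfolding \<pi>_def \<iota>_def using X_dim[OF p(2)] X1(5) by (simp add: kron_mult mat_distribs)
  have L\<iota>: "L (Suc j) * \<iota> = \<iota>" unfolding \<iota>\<pi>[symmetric] by (simp add: d mat_assoc \<pi>\<iota> mat_distribs)
  have \<pi>L: "\<pi> * L (Suc j) = \<pi>" unfolding \<iota>\<pi>[symmetric] by (simp add: d mat_rewr[OF \<pi>\<iota>] mat_distribs)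
  have LL\<iota>: "kronecker (1\<^sub>m n) (L j) * \<iota> = \<iota>"
  proof -
    have "L j * inc (Suc j) = (L j * alt (Suc j)) * inc (Suc j)"
      using X_dim[OF p(2)] by (simp add: mat_assoc alt_inc[OF p(2)])
    also have "\<dots> = inc (Suc j)" using L_alt[of j] p by (simp add: alt_inc)
    finally show ?thesis unfolding \<iota>_def using X_dim[OF p(2)] by (simp add: kron_mult mat_distribs)
  qed
  have ca1: "is_ghom \<S> M (X (Suc (Suc j))) a1" unfolding a1_def by (rule ghom_comp[OF gT(2) X2(1) M X2(3) \<iota>])
  have cb1: "is_ghom \<S> (X (Suc (Suc j))) M b1" unfolding b1_def by (rule ghom_comp[OF gT(2) M X2(1) \<pi> X2(2)])
  have ca2: "is_ghom \<S> M (X j) a2" unfolding a2_def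
    by (rule ghom_comp[OF gT(2) X0(1) M ghom_comp[OF gT(1) X0(1) gT(2) X0(3) capi] \<iota>])
  have cb2: "is_ghom \<S> (X j) M b2" unfolding b2_def
    by (rule ghom_smult[OF X0(1) M ghom_comp[OF gT(1) M X0(1) ghom_comp[OF gT(2) M gT(1) \<pi> cupi] X0(2)]])
  have m: "m \<noteq> 0" "c \<noteq> 0" "m = c + 1"
    using of_nat_neq_0[of "j + 2"] of_nat_neq_0[of "j + 1"] assms by (simp_all add: m_def c_def)
  have ab1: "a1 * b1 = 1\<^sub>m (gdim (X (Suc (Suc j))))"
  proof -
    have "a1 * b1 = prj (Suc (Suc j)) * (L (Suc j) * inc (Suc (Suc j)))"
      unfolding a1_def b1_def \<iota>\<pi>[symmetric] by (simp add: d mat_assoc)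
    also have "L (Suc j) * inc (Suc (Suc j)) = (L (Suc j) * alt (Suc (Suc j))) * inc (Suc (Suc j))"
      by (simp add: d mat_assoc alt_inc[OF p(3)] del: alt.simps)
    also have "\<dots> = inc (Suc (Suc j))" using L_alt[of "Suc j"] p by (simp add: alt_inc del: alt.simps)
    finally show ?thesis by (simp add: X2)
  qed
  have ab2: "a2 * b2 = gid (X j)"
  proof -
    have "a2 * b2 = (- (c / m)) \<cdot>\<^sub>m (prj j * (capi j * (L (Suc j) * cupi j)) * inc j)"
      unfolding a2_def b2_def \<iota>\<pi>[symmetric] by (simp add: d dX mat_assoc mat_mult_smult)
    also have "capi j * (L (Suc j) * cupi j) = (- m / c) \<cdot>\<^sub>m alt j"
      unfolding m_def c_def by (rule partial_trace) (use assms in simp)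
    also have "(- (c / m)) \<cdot>\<^sub>m (prj j * ((- m / c) \<cdot>\<^sub>m alt j) * inc j) = 1 \<cdot>\<^sub>m gid (X j)"
    proof -
      have "- (c / m) * (- m / c) = 1" using m(1,2) by simp
      then show ?thesis by (simp only: dX mat_distribs mat_smult_smult prj_alt[OF p(1)] X0(4)
        index_smult_mat index_mult_mat)
    qed
    finally show ?thesis by (auto intro!: eq_matI)
  qed
  have e1: "b1 * a1 = \<pi> * ((1 / m) \<cdot>\<^sub>m (1\<^sub>m ?N - c \<cdot>\<^sub>m s1 j)) * \<iota>"
  proof -
    have "b1 * a1 = \<pi> * (inc (Suc (Suc j)) * prj (Suc (Suc j))) * \<iota>"
      unfolding a1_def b1_def by (simp add: d mat_assoc)
    also have "inc (Suc (Suc j)) * prj (Suc (Suc j)) = (1 / m) \<cdot>\<^sub>m (L (Suc j) * (1\<^sub>m ?N - c \<cdot>\<^sub>m s1 j) * L (Suc j))"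
      unfolding X2(5) alt.simps m_def c_def by (simp add: inverse_eq_divide)
    also have "\<pi> * ((1 / m) \<cdot>\<^sub>m (L (Suc j) * (1\<^sub>m ?N - c \<cdot>\<^sub>m s1 j) * L (Suc j))) * \<iota>
      = (1 / m) \<cdot>\<^sub>m ((\<pi> * L (Suc j)) * ((1\<^sub>m ?N - c \<cdot>\<^sub>m s1 j) * (L (Suc j) * \<iota>)))"
      by (simp add: d mat_assoc mat_mult_smult mat_smult_mult del: alt.simps)
    finally show ?thesis unfolding L\<iota> \<pi>L by (simp add: d mat_assoc mat_mult_smult mat_smult_mult)
  qed
  have e2: "b2 * a2 = (- (c / m)) \<cdot>\<^sub>m (\<pi> * kronecker (cup * cap) (I j) * \<iota>)"
  proof -
    have "b2 * a2 = (- (c / m)) \<cdot>\<^sub>m (\<pi> * (cupi j * ((inc j * prj j) * capi j)) * \<iota>)"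
      unfolding a2_def b2_def by (simp add: d dX mat_assoc mat_smult_mult)
    also have "(inc j * prj j) * capi j = capi j * kronecker (1\<^sub>m n) (L j)" by (simp only: X0(5) capi_L)
    also have "\<pi> * (cupi j * (capi j * kronecker (1\<^sub>m n) (L j))) * \<iota>
      = \<pi> * (cupi j * capi j) * (kronecker (1\<^sub>m n) (L j) * \<iota>)" by (simp add: d mat_assoc)
    also have "cupi j * capi j = kronecker (cup * cap) (I j)" by (simp add: kron_mult mat_distribs)
    finally show ?thesis unfolding LL\<iota> .
  qed
  have "b1 * a1 + b2 * a2 - gid M = (- (c / m)) \<cdot>\<^sub>m (\<pi> * Z * \<iota>)"
  proof -
    define K where "K = kronecker (cup * cap) (I j)"
    define A B C where "A = \<pi> * \<iota>" and "B = \<pi> * (s1 j * \<iota>)" and "C = \<pi> * (K * \<iota>)"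
    have dK: "dim_row K = ?N" "dim_col K = ?N" by (simp_all add: K_def mult.assoc)
    have dABC: "dim_row A = gdim M" "dim_col A = gdim M" "dim_row B = gdim M" "dim_col B = gdim M"
      "dim_row C = gdim M" "dim_col C = gdim M" by (simp_all add: A_def B_def C_def d)
    have "Z = 1\<^sub>m ?N + s1 j + K"
      unfolding Z_def K_def s1_def by (simp add: kron_add_left kron_one mult.assoc)
    then have "\<pi> * Z * \<iota> = A + B + C"
      by (simp add: A_def B_def C_def d dK mat_assoc mat_distribs)
    moreover have "b1 * a1 = (1 / m) \<cdot>\<^sub>m (A - c \<cdot>\<^sub>m B)"
      unfolding e1 by (simp add: A_def B_def d mat_assoc mat_distribs)
    moreover have "b2 * a2 = (- (c / m)) \<cdot>\<^sub>m C"
      unfolding e2 K_def[symmetric] by (simp add: C_def d dK mat_assoc)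
    moreover have "gid M = A" by (simp add: A_def \<pi>\<iota>)
    \<comment> \<open>The coefficients match because \<open>1/m - 1 = -c/m\<close>: the deviation
      from a splitting is exactly a multiple of the trace map \<open>Z\<close> on the summand
      \<open>M\<close>.\<close>
    moreover have "1 / m * (x - c * y) + - (c / m) * z - x = - (c / m) * (x + y + z)" for x y z
    proof -
      have e: "1 / m - 1 = - (c / m)" using m by (simp add: field_simps)
      have "1 / m * (x - c * y) + - (c / m) * z - x = (1 / m - 1) * x - (c / m) * y - (c / m) * z"
        by (simp add: algebra_simps)
      also have "\<dots> = - (c / m) * (x + y + z)" unfolding e by (simp add: algebra_simps add_divide_distrib)
      finally show ?thesis .
    qed
    ultimately show ?thesis
      by (simp only:) (rule eq_matI; simp only: dABC index_add_mat index_minus_mat index_smult_mat)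
  qed
  then have "tmap M M (b1 * a1 + b2 * a2 - gid M)"
    using tmap_smult[OF M M tmap_sandwich[OF M gT(2) M \<iota> \<pi> Z]] by simp
  then show ?thesis
    unfolding M_def[symmetric] by (rule stable_biprod[OF M X2(1) X0(1) ca1 cb1 ca2 cb2 ab1 ab2])
qed

end

context fin_group
begin

section \<open>The multiplicity of the trivial module\<close>

lemma giso_biprod:
  fixes V W S V' W' S' :: "('a, 'f :: field) gmod"
  assumes S: "is_biprod G V W S i j p q" and S': "is_biprod G V' W' S' i' j' p' q'"
    and "giso G V V'" "giso G W W'"
  shows "giso G S S'"
proof -
  note D = is_biprodD[OF S] and D' = is_biprodD[OF S']
  obtain A B where A: "is_ghom G V V' A" and B: "is_ghom G V' V B"
    and AB: "A * B = gid V'" "B * A = gid V" by (rule gisoE[OF assms(3) D(1) D'(1)])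
  obtain C E where C: "is_ghom G W W' C" and E: "is_ghom G W' W E"
    and CE: "C * E = gid W'" "E * C = gid W" by (rule gisoE[OF assms(4) D(2) D'(2)])
  note d = is_biprod_dim[OF S] is_biprod_dim[OF S'] is_ghomD(2,3)[OF A] is_ghomD(2,3)[OF B]
    is_ghomD(2,3)[OF C] is_ghomD(2,3)[OF E]
  note calc = d mat_assoc mat_distribs mat_zeros mat_rewr[OF AB(1)] mat_rewr[OF AB(2)] mat_rewr[OF CE(1)] mat_rewr[OF CE(2)]
  show ?thesis
  proof (rule gisoI)
    show "is_ghom G S S' (i' * A * p + j' * C * q)" using D D' A C by (intro ghom_add ghom_comp)
    show "i * B * p' + j * E * q' \<in> gmats S' S" by (auto simp: d intro!: carrier_matI)
    show "(i' * A * p + j' * C * q) * (i * B * p' + j * E * q') = gid S'"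
      using D'(12) by (simp add: calc mat_rewr[OF D(8)] mat_rewr[OF D(9)] mat_rewr[OF D(10)] mat_rewr[OF D(11)])
    show "(i * B * p' + j * E * q') * (i' * A * p + j' * C * q) = gid S"
      using D(12) by (simp add: calc mat_rewr[OF D'(8)] mat_rewr[OF D'(9)] mat_rewr[OF D'(10)] mat_rewr[OF D'(11)])
  qed
qed

lemma giso_gsum:
  assumes "is_gmod G V" "is_gmod G W" "is_gmod G V'" "is_gmod G W'" "giso G V V'" "giso G W W'"
  shows "giso G (gsum V W) (gsum V' W')"
proof -
  obtain i j p q where S: "is_biprod G V W (gsum V W) i j p q" by (rule gsum_biprod[OF assms(1,2)])
  obtain i' j' p' q' where S': "is_biprod G V' W' (gsum V' W') i' j' p' q'" by (rule gsum_biprod[OF assms(3,4)])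
  show ?thesis by (rule giso_biprod[OF S S' assms(5,6)])
qed

lemma giso_gsum_assoc:
  assumes U: "is_gmod G U" and V: "is_gmod G V" and W: "is_gmod G W"
  shows "giso G (gsum (gsum U V) W) (gsum U (gsum V W))"
proof -
  obtain i j p q where 1: "is_biprod G U V (gsum U V) i j p q" using gsum_biprod[OF U V] .
  obtain i' j' p' q' where 2: "is_biprod G (gsum U V) W (gsum (gsum U V) W) i' j' p' q'"
    using gsum_biprod[OF is_gmod_gsum[OF U V] W] .
  obtain k l r s where 3: "is_biprod G V W (gsum V W) k l r s" using gsum_biprod[OF V W] .
  obtain k' l' r' s' where 4: "is_biprod G U (gsum V W) (gsum U (gsum V W)) k' l' r' s'"
    using gsum_biprod[OF U is_gmod_gsum[OF V W]] .
  show ?thesis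
    by (rule giso_biprod[OF is_biprod_assoc[OF 1 2 3] 4 giso_refl[OF U] giso_refl[OF is_gmod_gsum[OF V W]]])
qed

lemma giso_gsum_comm:
  assumes V: "is_gmod G V" and W: "is_gmod G W"
  shows "giso G (gsum V W) (gsum W V)"
proof -
  obtain i j p q where S: "is_biprod G V W (gsum V W) i j p q" by (rule gsum_biprod[OF V W])
  obtain i' j' p' q' where S': "is_biprod G W V (gsum W V) i' j' p' q'" by (rule gsum_biprod[OF W V])
  show ?thesis by (rule giso_biprod[OF is_biprod_comm[OF S] S' giso_refl[OF W] giso_refl[OF V]])
qed

lemma gzero_simps [simp]: "gdim gzero = 0" "gact gzero g = 1\<^sub>m 0"
  by (auto simp: gzero_def)

lemma is_gmod_gzero: "is_gmod G gzero"
  by (auto simp: is_gmod_def)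

lemma gsum_list_simps [simp]: "gsum_list [] = gzero" "gsum_list (V # Vs) = gsum V (gsum_list Vs)"
  by (auto simp: gsum_list_def)

lemma is_gmod_gsum_list: "(\<And>V. V \<in> set Vs \<Longrightarrow> is_gmod G V) \<Longrightarrow> is_gmod G (gsum_list Vs)"
  by (induction Vs) (auto simp: is_gmod_gzero is_gmod_gsum)

lemma giso_gsum_zero_right:
  assumes V: "is_gmod G V" and Z: "is_gmod G Z" "gdim Z = 0"
  shows "giso G (gsum V Z) V"
proof -
  obtain i j p q where S: "is_biprod G V Z (gsum V Z) i j p q" by (rule gsum_biprod[OF V Z(1)])
  note D = is_biprodD[OF S] and d = is_biprod_dim[OF S]
  have "j * q = 0\<^sub>m (gdim (gsum V Z)) (gdim (gsum V Z))"
    by (rule eq_matI) (simp_all add: d Z scalar_prod_def)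
  then have "i * p = gid (gsum V Z)" using D(12) by (simp add: d mat_zeros del: gsum_simps)
  then show ?thesis using D is_ghomD(1)[OF D(4)] by (intro gisoI[of _ _ _ p i]) auto
qed

lemma giso_gsum_zero_left:
  assumes "is_gmod G V" "is_gmod G Z" "gdim Z = 0"
  shows "giso G (gsum Z V) V"
  using giso_trans[OF giso_gsum_comm giso_gsum_zero_right] assms is_gmod_gsum by blast

lemma giso_gsum_list_append:
  assumes "\<And>V. V \<in> set Vs \<Longrightarrow> is_gmod G V" "\<And>V. V \<in> set Ws \<Longrightarrow> is_gmod G V"
  shows "giso G (gsum (gsum_list Vs) (gsum_list Ws)) (gsum_list (Vs @ Ws))"
  using assms
proof (induction Vs)
  case Nil
  then show ?case by (simp add: giso_gsum_zero_left is_gmod_gsum_list is_gmod_gzero)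
next
  case (Cons V Vs)
  have g: "is_gmod G V" "is_gmod G (gsum_list Vs)" "is_gmod G (gsum_list Ws)" "is_gmod G (gsum_list (Vs @ Ws))"
    using Cons.prems by (auto intro!: is_gmod_gsum_list)
  have "giso G (gsum V (gsum (gsum_list Vs) (gsum_list Ws))) (gsum V (gsum_list (Vs @ Ws)))"
    using Cons g by (intro giso_gsum giso_refl is_gmod_gsum) auto
  then show ?case
    using giso_trans[OF giso_gsum_assoc[OF g(1-3)]] g by (simp add: is_gmod_gsum)
qed

lemma sim_gsum_list:
  "list_all2 sim Vs Ws \<Longrightarrow> sim (gsum_list Vs) (gsum_list Ws)"
  by (induction rule: list_all2_induct) (auto simp: sim_refl is_gmod_gzero sim_gsum)

lemma sim_gsum_list_append:
  assumes "\<And>V. V \<in> set Vs \<Longrightarrow> is_gmod G V" "\<And>V. V \<in> set Ws \<Longrightarrow> is_gmod G V"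
  shows "sim (gsum_list (Vs @ Ws)) (gsum (gsum_list Vs) (gsum_list Ws))"
proof -
  have "is_gmod G (gsum_list (Vs @ Ws))" "is_gmod G (gsum (gsum_list Vs) (gsum_list Ws))"
    using assms by (auto intro!: is_gmod_gsum_list is_gmod_gsum)
  then show ?thesis using giso_gsum_list_append[OF assms] by (intro sim_sym[OF giso_imp_sim])
qed

lemma sim_gsum_list_concat:
  assumes "\<And>Vs V. Vs \<in> set Vss \<Longrightarrow> V \<in> set Vs \<Longrightarrow> is_gmod G V"
  shows "sim (gsum_list (concat Vss)) (gsum_list (map gsum_list Vss))"
  using assms
proof (induction Vss)
  case (Cons Vs Vss)
  have "sim (gsum_list (Vs @ concat Vss)) (gsum (gsum_list Vs) (gsum_list (concat Vss)))"
    using Cons.prems by (intro sim_gsum_list_append) auto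
  also have "sim \<dots> (gsum (gsum_list Vs) (gsum_list (map gsum_list Vss)))"
    using Cons by (intro sim_gsum sim_refl is_gmod_gsum_list) auto
  finally show ?case by simp
qed (simp add: sim_refl is_gmod_gzero)

lemma sim_gsum_list_perm:
  assumes "mset Vs = mset Ws" "\<And>V. V \<in> set Vs \<Longrightarrow> is_gmod G V"
  shows "sim (gsum_list Vs) (gsum_list Ws)"
  using assms
proof (induction Vs arbitrary: Ws)
  case (Cons V Vs)
  then have "V \<in> set Ws" using mset_eq_setD by fastforce
  then obtain Xs Ys where Ws: "Ws = Xs @ V # Ys" by (meson split_list)
  have set: "set Ws = set (V # Vs)" using Cons.prems(1) by (metis mset_eq_setD)
  have g: "is_gmod G V" "is_gmod G (gsum_list Xs)" "is_gmod G (gsum_list Ys)" "is_gmod G (gsum_list (Xs @ Ys))"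
    using Cons.prems(2) unfolding set[symmetric] Ws by (auto intro!: is_gmod_gsum_list)
  have "mset Vs = mset (Xs @ Ys)" using Cons.prems(1) Ws by simp
  then have "sim (gsum V (gsum_list Vs)) (gsum V (gsum_list (Xs @ Ys)))"
    using Cons by (intro sim_gsum sim_refl) auto
  also have "sim \<dots> (gsum V (gsum (gsum_list Xs) (gsum_list Ys)))"
    using Cons.prems(2) g unfolding set[symmetric] Ws
    by (intro sim_gsum sim_refl sim_gsum_list_append) auto
  also have "sim \<dots> (gsum (gsum V (gsum_list Xs)) (gsum_list Ys))"
    by (rule sim_sym[OF sim_gsum_assoc[OF g(1-3)]])
  also have "sim \<dots> (gsum (gsum (gsum_list Xs) V) (gsum_list Ys))"
    by (intro sim_gsum sim_gsum_comm sim_refl g)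
  also have "sim \<dots> (gsum (gsum_list Xs) (gsum_list (V # Ys)))"
    using sim_gsum_assoc[OF g(2,1,3)] by simp
  also have "sim \<dots> (gsum_list Ws)"
    unfolding Ws using Cons.prems(2) unfolding set[symmetric] Ws
    by (intro sim_sym[OF sim_gsum_list_append]) auto
  finally show ?case by simp
qed (simp add: sim_refl is_gmod_gzero)

lemma sim_gtensor_gsum_list:
  assumes X: "is_gmod G X" and "\<And>V. V \<in> set Vs \<Longrightarrow> is_gmod G V"
  shows "sim (gtensor X (gsum_list Vs)) (gsum_list (map (gtensor X) Vs))"
  using assms(2)
proof (induction Vs)
  case Nil
  have "giso G (gtensor X gzero) (gzero :: ('a, 'c) gmod)"
    by (rule gisoI[of _ _ _ "1\<^sub>m 0" "1\<^sub>m 0"])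
      (auto simp: is_ghom_def intro!: eq_matI carrier_matI)
  then show ?case using X by (auto intro!: giso_imp_sim is_gmod_gtensor is_gmod_gzero)
next
  case (Cons V Vs)
  have "sim (gtensor X (gsum V (gsum_list Vs))) (gsum (gtensor X V) (gtensor X (gsum_list Vs)))"
    using Cons.prems X by (intro sim_gtensor_gsum is_gmod_gsum_list) auto
  also have "sim \<dots> (gsum (gtensor X V) (gsum_list (map (gtensor X) Vs)))"
    using Cons X by (intro sim_gsum sim_refl is_gmod_gtensor) auto
  finally show ?case by simp
qed

lemma sim_heller_pow_gsum_list:
  fixes Vs :: "('a, 'f :: field) gmod list"
  assumes "\<And>V. V \<in> set Vs \<Longrightarrow> is_gmod G V"
  shows "sim (heller_pow G k (gsum_list Vs)) (gsum_list (map (heller_pow G k) Vs))"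
  using assms
proof (induction Vs)
  case Nil
  have "sim (heller_pow G k gzero) (gzero :: ('a, 'f) gmod)"
  proof (induction k)
    case 0
    then show ?case by (simp add: heller_pow_simps sim_refl is_gmod_gzero)
  next
    case (Suc k)
    \<comment> \<open>The zero module is projective and its own syzygy; in dimension
      \<open>0\<close> the identity matrix and the zero matrix agree.\<close>
    have "(1\<^sub>m 0 :: 'f mat) = 0\<^sub>m 0 0" by (auto intro!: eq_matI)
    then have "tmap gzero gzero (1\<^sub>m 0 :: 'f mat)"
      using tmap_zero[OF is_gmod_gzero is_gmod_gzero] by (metis gzero_simps(1))
    then have "resolves gzero gzero gzero (1\<^sub>m 0 :: 'f mat) (1\<^sub>m 0) (1\<^sub>m 0) (1\<^sub>m 0)"
      by (auto simp: resolves_def is_gmod_gzero is_ghom_def intro!: eq_matI)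
    then have "syz gzero (gzero :: ('a, 'f) gmod)" unfolding syz_def by blast
    then have "sim (heller G (heller_pow G k gzero)) (gzero :: ('a, 'f) gmod)"
      using syz_unique[OF syz_heller _ Suc] sim_gmod(1)[OF Suc] by blast
    then show ?case by (simp add: heller_pow_simps)
  qed
  then show ?case by simp
next
  case (Cons V Vs)
  have "sim (heller_pow G k (gsum V (gsum_list Vs))) (gsum (heller_pow G k V) (heller_pow G k (gsum_list Vs)))"
    using Cons.prems by (intro sim_heller_pow_gsum is_gmod_gsum_list) auto
  also have "sim \<dots> (gsum (heller_pow G k V) (gsum_list (map (heller_pow G k) Vs)))"
    using Cons by (intro sim_gsum sim_refl is_gmod_heller_pow) auto
  finally show ?case by simp
qed

text \<open>The columns of \<open>R\<close> are invariant vectors. Collecting them in a matrix makes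
  the pairing with forms a matrix product, whose rank can be bounded by factorization.\<close>

definition inv_vecs :: "('a, 'f :: field) gmod \<Rightarrow> 'f mat \<Rightarrow> bool" where
  "inv_vecs V R \<longleftrightarrow> dim_row R = gdim V \<and> (\<forall>g \<in> carrier G. gact V g * R = R)"

definition inv_forms :: "('a, 'f :: field) gmod \<Rightarrow> 'f mat \<Rightarrow> bool" where
  "inv_forms V L \<longleftrightarrow> dim_col L = gdim V \<and> (\<forall>g \<in> carrier G. L * gact V g = L)"

text \<open>The rank of the pairing of invariant forms with invariant vectors is \<open>m\<close>. It equals the
  multiplicity of the trivial module as a summand.\<close>

definition triv_rank :: "('a, 'f :: field) gmod \<Rightarrow> nat \<Rightarrow> bool" where
  "triv_rank V m \<longleftrightarrow>
     (\<exists>R L. inv_vecs V R \<and> inv_forms V L \<and> dim_col R = m \<and> dim_row L = m \<and> L * R = 1\<^sub>m m) \<and>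
     (\<forall>R L. inv_vecs V R \<longrightarrow> inv_forms V L \<longrightarrow>
        (\<exists>A B. A \<in> carrier_mat (dim_row L) m \<and> B \<in> carrier_mat m (dim_col R) \<and> L * R = A * B))"

lemma triv_rank_factor:
  assumes "triv_rank V m" "inv_vecs V R" "inv_forms V L"
  obtains A B where "A \<in> carrier_mat (dim_row L) m" "B \<in> carrier_mat m (dim_col R)" "L * R = A * B"
  using assms unfolding triv_rank_def by blast

lemma inv_vecs_ghom:
  assumes "is_gmod G V" "is_gmod G W" "is_ghom G V W A" "inv_vecs V R"
  shows "inv_vecs W (A * R)"
  unfolding inv_vecs_def
proof (intro conjI ballI)
  fix g assume g: "g \<in> carrier G"
  note d = is_gmod_dim[OF assms(1) g] is_gmod_dim[OF assms(2) g] is_ghomD(2,3)[OF assms(3)]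
  have R: "dim_row R = gdim V" "gact V g * R = R" using assms(4) g by (auto simp: inv_vecs_def)
  have "gact W g * (A * R) = A * gact V g * R"
    using is_ghomD(4)[OF assms(3) g] by (simp add: d R(1) flip: mat_assoc)
  then show "gact W g * (A * R) = A * R" by (simp add: d R mat_assoc)
qed (use is_ghomD(2)[OF assms(3)] in simp)

lemma inv_forms_ghom:
  assumes "is_gmod G V" "is_gmod G W" "is_ghom G V W A" "inv_forms W L"
  shows "inv_forms V (L * A)"
  unfolding inv_forms_def
proof (intro conjI ballI)
  fix g assume g: "g \<in> carrier G"
  note d = is_gmod_dim[OF assms(1) g] is_gmod_dim[OF assms(2) g] is_ghomD(2,3)[OF assms(3)]
  have L: "dim_col L = gdim W" "L * gact W g = L" using assms(4) g by (auto simp: inv_forms_def)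
  have "L * A * gact V g = L * gact W g * A"
    by (simp add: d L(1) mat_assoc is_ghomD(4)[OF assms(3) g])
  then show "L * A * gact V g = L * A" by (simp add: L(2))
qed (use is_ghomD(3)[OF assms(3)] in simp)

text \<open>Invariance of \<open>R\<close> and \<open>L\<close> removes the group elements from each
  summand, so all \<open>card (carrier G)\<close> summands are equal.\<close>

lemma inv_pairing_tmap:
  fixes V :: "('a, 'f :: field) gmod"
  assumes V: "is_gmod G V" and "of_nat (card (carrier G)) = (0 :: 'f)"
    and R: "inv_vecs V R" and L: "inv_forms V L" and T: "tmap V V T"
  shows "L * (T * R) = 0\<^sub>m (dim_row L) (dim_col R)"
proof -
  obtain f where f: "f \<in> gmats V V" "T = gtrace V V f"
    using T by (auto simp: tmap_def)
  have c: "L \<in> carrier_mat (dim_row L) (gdim V)" "R \<in> carrier_mat (gdim V) (dim_col R)"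
    using R L by (auto simp: inv_vecs_def inv_forms_def)
  note conj = conj_carrier[OF V V f(1)]
  have TR: "T * R = msum (gdim V) (dim_col R) (\<lambda>g. gact V g * f * gact V (inv g) * R) (carrier G)"
    unfolding f(2) gtrace_def by (rule msum_mult[OF c(2) conj])
  have "L * (T * R) = msum (dim_row L) (dim_col R) (\<lambda>g. L * (gact V g * f * gact V (inv g) * R)) (carrier G)"
    unfolding TR by (rule mult_msum[OF c(1) mult_carrier_mat[OF conj c(2)]])
  also have "\<dots> = msum (dim_row L) (dim_col R) (\<lambda>g. L * (f * R)) (carrier G)"
  proof (intro msum_cong refl)
    fix g assume g: "g \<in> carrier G"
    have "L * (gact V g * f * gact V (inv g) * R) = (L * gact V g) * (f * (gact V (inv g) * R))"
      using c f g by (simp add: mat_assoc is_gmod_dim[OF V])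
    then show "L * (gact V g * f * gact V (inv g) * R) = L * (f * R)"
      using R L g by (simp add: inv_vecs_def inv_forms_def)
  qed
  also have "\<dots> = 0\<^sub>m (dim_row L) (dim_col R)"
    by (rule eq_matI) (simp_all add: msum_def assms(2) del: index_mult_mat(1))
  finally show ?thesis .
qed

text \<open>A stable isomorphism changes the pairing only by a trace, which pairs to zero. Hence an
  identity matrix of size \<open>m\<close> factors through dimension \<open>k\<close>.\<close>

lemma triv_rank_sim_le:
  fixes V W :: "('a, 'f :: field) gmod"
  assumes card0: "of_nat (card (carrier G)) = (0 :: 'f)" and "sim V W" "triv_rank V m" "triv_rank W k"
  shows "m \<le> k"
proof -
  obtain A B where V: "is_gmod G V" and W: "is_gmod G W" and A: "is_ghom G V W A" and B: "is_ghom G W V B"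
    and t: "tmap V V (B * A - gid V)"
    by (rule simE[OF assms(2)])
  note d = is_ghomD(2,3)[OF A] is_ghomD(2,3)[OF B]
  obtain R L where R: "inv_vecs V R" "dim_col R = m" and L: "inv_forms V L" "dim_row L = m" and LR: "L * R = 1\<^sub>m m"
    using assms(3) by (auto simp: triv_rank_def)
  have dRL: "dim_row R = gdim V" "dim_col L = gdim V" using R L by (auto simp: inv_vecs_def inv_forms_def)
  have "L * ((B * A - gid V) * R) = L * B * (A * R) - L * R"
    by (simp add: d dRL mat_assoc mat_distribs)
  then have "L * B * (A * R) - 1\<^sub>m m = 0\<^sub>m m m"
    using inv_pairing_tmap[OF V card0 R(1) L(1) t] R L by (simp add: LR)
  then have "(L * B * (A * R) - 1\<^sub>m m) + 1\<^sub>m m = 0\<^sub>m m m + 1\<^sub>m m" by simp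
  also have "0\<^sub>m m m + 1\<^sub>m m = (1\<^sub>m m :: 'f mat)" by (simp add: mat_zeros)
  also have "(L * B * (A * R) - 1\<^sub>m m) + 1\<^sub>m m = L * B * (A * R)"
    by (rule eq_matI) (simp_all add: d dRL R L del: index_mult_mat(1))
  finally have 1: "L * B * (A * R) = 1\<^sub>m m" .
  obtain P Q where "P \<in> carrier_mat m k" "Q \<in> carrier_mat k m" "L * B * (A * R) = P * Q"
    by (rule triv_rank_factor[OF assms(4) inv_vecs_ghom[OF V W A R(1)] inv_forms_ghom[OF W V B L(1)]])
      (simp add: R(2) L(2))
  then show ?thesis using 1 mat_left_inverse_dim[of P m k Q] by simp
qed

lemma triv_rank_unique:
  fixes V W :: "('a, 'f :: field) gmod"
  assumes "of_nat (card (carrier G)) = (0 :: 'f)" "sim V W" "triv_rank V m" "triv_rank W k"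
  shows "m = k"
  using triv_rank_sim_le[OF assms] triv_rank_sim_le[OF assms(1) sim_sym[OF assms(2)] assms(4,3)] by simp

lemma triv_rank_gsum:
  fixes V W :: "('a, 'f :: field) gmod"
  assumes V: "is_gmod G V" and W: "is_gmod G W" and m: "triv_rank V m" and k: "triv_rank W k"
  shows "triv_rank (gsum V W) (m + k)"
proof -
  define S where "S = gsum V W"
  obtain i j p q where S: "is_biprod G V W S i j p q" unfolding S_def by (rule gsum_biprod[OF V W])
  \<comment> \<open>Auxiliary modules with trivial action, introduced only for the block inclusions
    and projections of their direct sum.\<close>
  define U1 :: "('a, 'f) gmod" where "U1 = Gmod m (\<lambda>_. 1\<^sub>m m)"
  define U2 :: "('a, 'f) gmod" where "U2 = Gmod k (\<lambda>_. 1\<^sub>m k)"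
  have U: "is_gmod G U1" "is_gmod G U2" by (auto simp: U1_def U2_def is_gmod_def)
  obtain e f g h where E: "is_biprod G U1 U2 (gsum U1 U2) e f g h" by (rule gsum_biprod[OF U])
  note D = is_biprodD[OF S] and DE = is_biprodD[OF E]
  have dU: "gdim U1 = m" "gdim U2 = k" by (auto simp: U1_def U2_def)
  note d = is_biprod_dim[OF S] is_biprod_dim[OF E] dU
  note rwE = DE(8)[unfolded dU] DE(9)[unfolded dU] DE(10)[unfolded dU] DE(11)[unfolded dU]
  show ?thesis
    unfolding triv_rank_def S_def[symmetric]
  proof (intro conjI allI impI)
    obtain R L where R: "inv_vecs V R" "dim_col R = m" and L: "inv_forms V L" "dim_row L = m" and LR: "L * R = 1\<^sub>m m"
      using m by (auto simp: triv_rank_def)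
    obtain R' L' where R': "inv_vecs W R'" "dim_col R' = k" and L': "inv_forms W L'" "dim_row L' = k" and LR': "L' * R' = 1\<^sub>m k"
      using k by (auto simp: triv_rank_def)
    have dR: "dim_row R = gdim V" "dim_col L = gdim V" "dim_row R' = gdim W" "dim_col L' = gdim W"
      using R R' L L' by (auto simp: inv_vecs_def inv_forms_def)
    note dd = d dR R(2) L(2) R'(2) L'(2)
    define R2 where "R2 = i * R * g + j * R' * h"
    define L2 where "L2 = e * L * p + f * L' * q"
    have "inv_vecs S R2"
      unfolding inv_vecs_def
    proof (intro conjI ballI)
      fix x assume x: "x \<in> carrier G"
      have 1: "gact S x * (i * R) = i * R" "gact S x * (j * R') = j * R'"
        using inv_vecs_ghom[OF D(1,3,4) R(1)] inv_vecs_ghom[OF D(2,3,5) R'(1)] x by (auto simp: inv_vecs_def)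
      show "gact S x * R2 = R2"
        unfolding R2_def using mat_rewr[OF 1(1)] mat_rewr[OF 1(2)]
        by (simp add: dd is_gmod_dim[OF D(3) x] mat_distribs 1 flip: mat_assoc)
    qed (simp add: R2_def dd)
    moreover have "inv_forms S L2"
      unfolding inv_forms_def
    proof (intro conjI ballI)
      fix x assume x: "x \<in> carrier G"
      have 1: "L * p * gact S x = L * p" "L' * q * gact S x = L' * q"
        using inv_forms_ghom[OF D(3,1,6) L(1)] inv_forms_ghom[OF D(3,2,7) L'(1)] x by (auto simp: inv_forms_def)
      show "L2 * gact S x = L2"
        unfolding L2_def using 1 by (simp add: dd is_gmod_dim[OF D(3) x] mat_distribs mat_assoc)
    qed (simp add: L2_def dd)
    moreover have "L2 * R2 = 1\<^sub>m (m + k)"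
    proof -
      have "L2 * R2 = e * g + f * h"
        unfolding L2_def R2_def
        by (simp add: dd mat_assoc mat_distribs mat_zeros mat_rewr[OF D(8)] mat_rewr[OF D(9)] mat_rewr[OF D(10)]
            mat_rewr[OF D(11)] mat_rewr[OF LR] mat_rewr[OF LR'])
      then show ?thesis using DE(12) dU by simp
    qed
    ultimately show "\<exists>R L. inv_vecs S R \<and> inv_forms S L \<and> dim_col R = m + k \<and> dim_row L = m + k \<and> L * R = 1\<^sub>m (m + k)"
      by (intro exI[of _ R2] exI[of _ L2]) (simp add: R2_def L2_def dd)
  next
    fix R L assume R: "inv_vecs S R" and L: "inv_forms S L"
    have dR: "dim_row R = gdim S" "dim_col L = gdim S" using R L by (auto simp: inv_vecs_def inv_forms_def)
    obtain A B where AB: "A \<in> carrier_mat (dim_row L) m" "B \<in> carrier_mat m (dim_col R)" "(L * i) * (p * R) = A * B"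
      by (rule triv_rank_factor[OF m inv_vecs_ghom[OF D(3,1,6) R] inv_forms_ghom[OF D(1,3,4) L]]) simp
    obtain A' B' where AB': "A' \<in> carrier_mat (dim_row L) k" "B' \<in> carrier_mat k (dim_col R)" "(L * j) * (q * R) = A' * B'"
      by (rule triv_rank_factor[OF k inv_vecs_ghom[OF D(3,2,7) R] inv_forms_ghom[OF D(2,3,5) L]]) simp
    note dd = d dR carrier_matD[OF AB(1)] carrier_matD[OF AB(2)] carrier_matD[OF AB'(1)] carrier_matD[OF AB'(2)]
    have "L * R = L * (i * p + j * q) * R" by (simp add: D(12) dd mat_distribs)
    also have "\<dots> = (L * i) * (p * R) + (L * j) * (q * R)" by (simp add: dd mat_assoc mat_distribs)
    also have "\<dots> = (A * g + A' * h) * (e * B + f * B')"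
      unfolding AB(3) AB'(3)
      by (simp add: dd mat_assoc mat_distribs mat_zeros mat_rewr[OF rwE(1)] mat_rewr[OF rwE(2)] mat_rewr[OF rwE(3)]
          mat_rewr[OF rwE(4)])
    finally show "\<exists>A B. A \<in> carrier_mat (dim_row L) (m + k) \<and> B \<in> carrier_mat (m + k) (dim_col R) \<and> L * R = A * B"
      by (intro exI[of _ "A * g + A' * h"] exI[of _ "e * B + f * B'"]) (auto simp: dd intro!: carrier_matI)
  qed
qed

lemma triv_rank_zero:
  assumes V: "is_gmod G V" and "\<And>R L. inv_vecs V R \<Longrightarrow> inv_forms V L \<Longrightarrow> L * R = 0\<^sub>m (dim_row L) (dim_col R)"
  shows "triv_rank V 0"
  unfolding triv_rank_def
proof (intro conjI allI impI)
  show "\<exists>R L. inv_vecs V R \<and> inv_forms V L \<and> dim_col R = 0 \<and> dim_row L = 0 \<and> L * R = 1\<^sub>m 0"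
  proof (intro exI conjI)
    show "inv_vecs V (0\<^sub>m (gdim V) 0)" "inv_forms V (0\<^sub>m 0 (gdim V))"
      using is_gmod_dim[OF V] by (auto simp: inv_vecs_def inv_forms_def intro!: eq_matI)
    show "0\<^sub>m 0 (gdim V) * 0\<^sub>m (gdim V) 0 = 1\<^sub>m 0" by (auto intro!: eq_matI)
  qed auto
  fix R L assume "inv_vecs V R" "inv_forms V L"
  then have "L * R = 0\<^sub>m (dim_row L) (dim_col R)" by (rule assms(2))
  also have "\<dots> = 0\<^sub>m (dim_row L) 0 * 0\<^sub>m 0 (dim_col R)" by (auto intro!: eq_matI simp: scalar_prod_def)
  finally show "\<exists>A B. A \<in> carrier_mat (dim_row L) 0 \<and> B \<in> carrier_mat 0 (dim_col R) \<and> L * R = A * B"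
    by (meson zero_carrier_mat)
qed

lemma triv_rank_giso_gtriv:
  fixes V :: "('a, 'f :: field) gmod"
  assumes V: "is_gmod G V" and iso: "giso G V gtriv"
  shows "triv_rank V 1"
proof -
  obtain A B where A: "is_ghom G V gtriv A" and B: "is_ghom G gtriv V B"
    and AB: "A * B = 1\<^sub>m 1" "B * A = gid V"
    by (rule gisoE[OF iso V is_gmod_gtriv]) simp
  note d = is_ghomD(2,3)[OF A] is_ghomD(2,3)[OF B]
  have "inv_vecs gtriv (1\<^sub>m 1)" "inv_forms gtriv (1\<^sub>m 1)" by (auto simp: inv_vecs_def inv_forms_def)
  then have "inv_vecs V (B * 1\<^sub>m 1)" "inv_forms V (1\<^sub>m 1 * A)"
    using inv_vecs_ghom[OF is_gmod_gtriv V B] inv_forms_ghom[OF V is_gmod_gtriv A] by auto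
  then have BA: "inv_vecs V B" "inv_forms V A" using d by (simp_all add: mat_distribs del: One_nat_def)
  show ?thesis
    unfolding triv_rank_def
  proof (intro conjI allI impI)
    show "\<exists>R L. inv_vecs V R \<and> inv_forms V L \<and> dim_col R = 1 \<and> dim_row L = 1 \<and> L * R = 1\<^sub>m 1"
      using BA d AB by (intro exI[of _ B] exI[of _ A]) auto
    fix R L assume R: "inv_vecs V R" and L: "inv_forms V L"
    then have dR: "dim_row R = gdim V" "dim_col L = gdim V" by (auto simp: inv_vecs_def inv_forms_def)
    have "(L * B) * (A * R) = L * (B * A * R)" by (simp add: d dR mat_assoc)
    then have "L * R = (L * B) * (A * R)" by (simp add: AB dR mat_distribs)
    then show "\<exists>A B. A \<in> carrier_mat (dim_row L) 1 \<and> B \<in> carrier_mat 1 (dim_col R) \<and> L * R = A * B"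
      by (intro exI[of _ "L * B"] exI[of _ "A * R"]) (auto simp: d intro!: carrier_matI)
  qed
qed

lemma gindecomposableD:
  assumes "gindecomposable G V"
  shows "is_gmod G V" "gdim V \<noteq> 0"
    and "is_gmod G X \<Longrightarrow> is_gmod G Y \<Longrightarrow> giso G V (gsum X Y) \<Longrightarrow> gdim X = 0 \<or> gdim Y = 0"
  using assms unfolding gindecomposable_def by iprover+

text \<open>The image of \<open>1 - i * p\<close> complements the retract, and indecomposability
  forces this complement to be zero.\<close>

lemma indecomposable_retract:
  fixes V :: "('a, 'f :: field) gmod"
  assumes ind: "gindecomposable G V" and U: "is_gmod G U" "gdim U \<noteq> 0"
    and i: "is_ghom G U V i" and p: "is_ghom G V U p" and pi: "p * i = gid U"
  shows "giso G V U"
proof -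
  have V: "is_gmod G V" by (rule gindecomposableD(1)[OF ind])
  note d = is_ghomD(2,3)[OF i] is_ghomD(2,3)[OF p]
  define e where "e = gid V - i * p"
  have e: "is_ghom G V V e" unfolding e_def by (intro ghom_minus V ghom_one ghom_comp[OF U(1) V V i p])
  note de = is_ghomD(2,3)[OF e]
  have "e * e = e"
    unfolding e_def by (simp add: d mat_assoc mat_distribs mat_rewr[OF pi])
      (auto intro!: eq_matI simp: d simp del: index_mult_mat(1))
  then obtain K j q where K: "is_gmod G K" and j: "is_ghom G K V j" and q: "is_ghom G V K q"
    and qj: "q * j = gid K" and jq: "j * q = e"
    using idempotent_split[OF is_group V e] by blast
  note d = d de is_ghomD(2,3)[OF j] is_ghomD(2,3)[OF q]
  have "p * e = 0\<^sub>m (gdim U) (gdim V)" unfolding e_def by (simp add: d mat_distribs mat_rewr[OF pi] mat_diff_self)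
  then have "p * (j * q) * j = 0\<^sub>m (gdim U) (gdim K)" by (simp add: jq d mat_zeros)
  then have pj: "p * j = 0\<^sub>m (gdim U) (gdim K)" by (simp add: d mat_assoc qj mat_distribs)
  have "e * i = 0\<^sub>m (gdim V) (gdim U)" unfolding e_def by (simp add: d mat_assoc pi mat_distribs mat_diff_self)
  then have "q * (j * q * i) = 0\<^sub>m (gdim K) (gdim U)" by (simp add: jq d mat_zeros)
  then have qi: "q * i = 0\<^sub>m (gdim K) (gdim U)" by (simp add: d mat_assoc mat_rewr[OF qj] mat_distribs)
  have sum: "i * p + j * q = gid V" unfolding jq e_def by (rule eq_matI) (simp_all add: d del: index_mult_mat(1))
  have S: "is_biprod G U K V i j p q"
    using U K V i j p q pi qj pj qi sum by (simp add: is_biprod_def)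
  obtain i' j' p' q' where S': "is_biprod G U K (gsum U K) i' j' p' q'" by (rule gsum_biprod[OF U(1) K])
  have "giso G V (gsum U K)" by (rule giso_biprod[OF S S' giso_refl[OF U(1)] giso_refl[OF K]])
  then have "gdim K = 0" using gindecomposableD(3)[OF ind U(1) K] U(2) by simp
  then have "j * q = 0\<^sub>m (gdim V) (gdim V)" using d by (auto intro!: eq_matI simp: scalar_prod_def)
  then have "i * p = gid V" using sum by (simp add: d mat_zeros)
  then show ?thesis using p pi is_ghomD(1)[OF i] by (intro gisoI[of _ _ _ p i]) auto
qed

text \<open>If some invariant form is nonzero on some invariant vector, the two maps exhibit the
  trivial module as a retract of \<open>V\<close>.\<close>

lemma triv_rank_indecomposable:
  fixes V :: "('a, 'f :: field) gmod"
  assumes ind: "gindecomposable G V"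
  shows "triv_rank V (if giso G V gtriv then 1 else 0)"
proof (cases "giso G V gtriv")
  case True
  then show ?thesis using triv_rank_giso_gtriv[OF gindecomposableD(1)[OF ind]] by simp
next
  case False
  have V: "is_gmod G V" by (rule gindecomposableD(1)[OF ind])
  have "L * R = 0\<^sub>m (dim_row L) (dim_col R)" if R: "inv_vecs V R" and L: "inv_forms V L" for R L
  proof (rule ccontr)
    assume "L * R \<noteq> 0\<^sub>m (dim_row L) (dim_col R)"
    then obtain x y where xy: "x < dim_row L" "y < dim_col R" "(L * R) $$ (x, y) \<noteq> 0"
      by (metis eq_matI index_mult_mat(2,3) index_zero_mat)
    have dR: "dim_row R = gdim V" "dim_col L = gdim V" using R L by (auto simp: inv_vecs_def inv_forms_def)
    define c where "c = (L * R) $$ (x, y)"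
    define r where "r = mat (gdim V) 1 (\<lambda>(i, _). R $$ (i, y))"
    \<comment> \<open>The scaling by \<open>inverse c\<close> gives
      \<open>l * r = 1\<close>.\<close>
    define l where "l = mat 1 (gdim V) (\<lambda>(_, j). inverse c * L $$ (x, j))"
    have d: "dim_row r = gdim V" "dim_col r = 1" "dim_row l = 1" "dim_col l = gdim V" by (auto simp: r_def l_def)
    have r: "is_ghom G gtriv V r"
      unfolding is_ghom_def
    proof (intro conjI ballI)
      fix g assume g: "g \<in> carrier G"
      have "gact V g * r = r"
      proof (rule eq_matI)
        fix i j assume "i < dim_row r" "j < dim_col r"
        then have i: "i < gdim V" "j = 0" by (auto simp: d)
        have "row (gact V g) i \<bullet> col R y = (gact V g * R) $$ (i, y)"
          using i xy is_gmod_dim[OF V g] by simp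
        also have "\<dots> = R $$ (i, y)" using R g by (simp add: inv_vecs_def)
        finally show "(gact V g * r) $$ (i, j) = r $$ (i, j)"
          using i xy is_gmod_dim[OF V g] dR by (simp add: r_def scalar_prod_def)
      qed (use is_gmod_dim[OF V g] d in auto)
      then show "r * gact gtriv g = gact V g * r" by (simp add: d mat_distribs del: One_nat_def)
    qed (auto simp: d intro!: carrier_matI)
    have l: "is_ghom G V gtriv l"
      unfolding is_ghom_def
    proof (intro conjI ballI)
      fix g assume g: "g \<in> carrier G"
      have "l * gact V g = l"
      proof (rule eq_matI)
        fix i j assume "i < dim_row l" "j < dim_col l"
        then have i: "i = 0" "j < gdim V" by (auto simp: d)
        have "row L x \<bullet> col (gact V g) j = (L * gact V g) $$ (x, j)"
          using i xy is_gmod_dim[OF V g] by simp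
        also have "\<dots> = L $$ (x, j)" using L g by (simp add: inv_forms_def)
        finally show "(l * gact V g) $$ (i, j) = l $$ (i, j)"
          using i xy is_gmod_dim[OF V g] dR by (simp add: l_def scalar_prod_def mult.assoc sum_distrib_left[symmetric])
      qed (use is_gmod_dim[OF V g] d in auto)
      then show "l * gact V g = gact gtriv g * l" by (simp add: d mat_distribs del: One_nat_def)
    qed (auto simp: d intro!: carrier_matI)
    have "l * r = gid gtriv"
    proof (rule eq_matI)
      fix i j assume "i < dim_row (gid gtriv :: 'f mat)" "j < dim_col (gid gtriv :: 'f mat)"
      then have ij: "i = 0" "j = 0" by auto
      have "(l * r) $$ (i, j) = inverse c * (L * R) $$ (x, y)"
        using ij xy dR by (simp add: l_def r_def scalar_prod_def sum_distrib_left mult.assoc)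
      then show "(l * r) $$ (i, j) = (gid gtriv :: 'f mat) $$ (i, j)" using xy ij by (simp add: c_def del: index_mult_mat)
    qed (auto simp: d)
    then have "giso G V gtriv" using indecomposable_retract[OF ind is_gmod_gtriv _ r l] by simp
    with False show False by simp
  qed
  then show ?thesis using False triv_rank_zero[OF V] by simp
qed

lemma triv_rank_gsum_list:
  fixes Vs :: "('a, 'f :: field) gmod list"
  assumes "\<And>V. V \<in> set Vs \<Longrightarrow> is_gmod G V \<and> triv_rank V (if Q V then 1 else 0)"
  shows "triv_rank (gsum_list Vs) (length (filter Q Vs))"
  using assms
proof (induction Vs)
  case Nil
  have "triv_rank (gzero :: ('a, 'f) gmod) 0"
    by (rule triv_rank_zero[OF is_gmod_gzero]) (auto simp: inv_vecs_def inv_forms_def scalar_prod_def intro!: eq_matI)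
  then show ?case by simp
next
  case (Cons V Vs)
  have "triv_rank (gsum V (gsum_list Vs)) ((if Q V then 1 else 0) + length (filter Q Vs))"
    using Cons by (intro triv_rank_gsum is_gmod_gsum_list) auto
  then show ?case by (simp split: if_splits)
qed

lemma indecomposable_decomposition:
  fixes V :: "('a, 'f :: field) gmod"
  assumes "is_gmod G V"
  shows "\<exists>Vs. (\<forall>X \<in> set Vs. gindecomposable G X) \<and> giso G V (gsum_list Vs)"
  using assms
proof (induction "gdim V" arbitrary: V rule: less_induct)
  case less
  note V = less.prems
  consider "gdim V = 0" | "gindecomposable G V" | "gdim V \<noteq> 0" "\<not> gindecomposable G V" by blast
  then show ?case
  proof cases
    case 1
    have "giso G V gzero"
      by (rule gisoI[of _ _ _ "1\<^sub>m 0" "1\<^sub>m 0"])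
        (use 1 is_gmod_dim[OF V] in \<open>auto simp: is_ghom_def intro!: eq_matI carrier_matI\<close>)
    then show ?thesis by (intro exI[of _ "[]"]) simp
  next
    case 2
    have "giso G V (gsum V gzero)"
      using giso_sym[OF giso_gsum_zero_right[OF V is_gmod_gzero]] V by (simp add: is_gmod_gsum is_gmod_gzero)
    then show ?thesis using 2 by (intro exI[of _ "[V]"]) simp
  next
    case 3
    then obtain X Y where X: "is_gmod G X" "gdim X \<noteq> 0" and Y: "is_gmod G Y" "gdim Y \<noteq> 0"
      and iso: "giso G V (gsum X Y)" using V by (auto simp: gindecomposable_def)
    have "gdim V = gdim X + gdim Y" using giso_dim[OF iso V is_gmod_gsum[OF X(1) Y(1)]] by simp
    then obtain Xs Ys where Xs: "\<forall>X \<in> set Xs. gindecomposable G X" "giso G X (gsum_list Xs)"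
      and Ys: "\<forall>X \<in> set Ys. gindecomposable G X" "giso G Y (gsum_list Ys)"
      using less.hyps[of X] less.hyps[of Y] X Y by auto
    have ind: "is_gmod G V" if "V \<in> set (Xs @ Ys)" for V
      using Xs(1) Ys(1) that gindecomposableD(1) by auto
    then have g: "is_gmod G (gsum_list Xs)" "is_gmod G (gsum_list Ys)" "is_gmod G (gsum_list (Xs @ Ys))"
      by (auto intro!: is_gmod_gsum_list)
    have "giso G (gsum X Y) (gsum (gsum_list Xs) (gsum_list Ys))"
      using X Y Xs Ys g by (intro giso_gsum) auto
    moreover have "giso G (gsum (gsum_list Xs) (gsum_list Ys)) (gsum_list (Xs @ Ys))"
      using ind by (intro giso_gsum_list_append) auto
    ultimately have "giso G (gsum X Y) (gsum_list (Xs @ Ys))"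
      using X Y g by (meson giso_trans is_gmod_gsum)
    then have "giso G V (gsum_list (Xs @ Ys))"
      using giso_trans[OF iso] V X Y g by (simp add: is_gmod_gsum)
    then show ?thesis using Xs(1) Ys(1) by (intro exI[of _ "Xs @ Ys"]) auto
  qed
qed

text \<open>In every decomposition into indecomposables the number of trivial summands is the rank
  of the pairing, which depends only on the stable class. This gives the uniqueness demanded by the
  definite description, and allows the rank to be computed on the stably isomorphic module
  \<open>Z\<close>.\<close>

lemma multiplicity_in_triv:
  fixes V W Z :: "('a, 'f :: field) gmod"
  assumes card0: "of_nat (card (carrier G)) = (0 :: 'f)"
    and W: "is_gmod G W" "giso G W gtriv" and sim: "sim V Z" and Z: "triv_rank Z m"
  shows "multiplicity_in G V W = m"
proof -
  have V: "is_gmod G V" using sim by (rule sim_gmod)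
  have eq: "length (filter (\<lambda>X. giso G X W) Vs) = m"
    if ind: "\<forall>X \<in> set Vs. gindecomposable G X" and iso: "giso G V (gsum_list Vs)" for Vs
  proof -
    have g: "is_gmod G X" if "X \<in> set Vs" for X using ind that gindecomposableD(1) by blast
    have "giso G X W \<longleftrightarrow> giso G X gtriv" if "X \<in> set Vs" for X
      using g[OF that] W giso_trans[of G X W gtriv] giso_trans[of G X gtriv W] giso_sym[of G W gtriv]
        is_gmod_gtriv by blast
    then have "filter (\<lambda>X. giso G X W) Vs = filter (\<lambda>X. giso G X gtriv) Vs" by (rule filter_cong[OF refl])
    moreover have "triv_rank (gsum_list Vs) (length (filter (\<lambda>X. giso G X gtriv) Vs))"
      using ind triv_rank_indecomposable g by (intro triv_rank_gsum_list) blast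
    moreover have "sim (gsum_list Vs) Z"
      using sim sim_sym[OF giso_imp_sim[OF iso V is_gmod_gsum_list[OF g]]] sim_trans by blast
    ultimately show ?thesis using triv_rank_unique[OF card0 _ _ Z] by metis
  qed
  obtain Vs where "\<forall>X \<in> set Vs. gindecomposable G X" "giso G V (gsum_list Vs)"
    using indecomposable_decomposition[OF V] by blast
  with eq show ?thesis unfolding multiplicity_in_def by (intro the_equality) blast+
qed

end

section \<open>Wedge products of vectors\<close>

lemma vkron_smult_right: "vkron u (c \<cdot>\<^sub>v v) = c \<cdot>\<^sub>v vkron u v" for u :: "'a :: comm_semiring_0 vec"
  by (auto intro!: eq_vecI simp: vkron_def div_mod_bounds mult.left_commute)

lemma vkron_diff_left:
  "dim_vec u = dim_vec v \<Longrightarrow> vkron (u - v) w = vkron u w - vkron v w" for u :: "'a :: comm_ring vec"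
  by (auto intro!: eq_vecI simp: vkron_def div_mod_bounds left_diff_distrib)

primrec tens :: "'a :: comm_semiring_1 vec list \<Rightarrow> 'a vec" where
  "tens [] = vec 1 (\<lambda>_. 1)"
| "tens (v # vs) = vkron v (tens vs)"

lemma tens_dim: "(\<And>v. v \<in> set vs \<Longrightarrow> dim_vec v = n) \<Longrightarrow> dim_vec (tens vs) = n ^ length vs"
  by (induction vs) auto

lemma unit_vec_tens:
  "k < n ^ i \<Longrightarrow> \<exists>js. length js = i \<and> set js \<subseteq> {..<n} \<and> unit_vec (n ^ i) k = tens (map (unit_vec n) js)"
proof (induction i arbitrary: k)
  case 0
  then show ?case by (auto intro!: exI[of _ "[]"] eq_vecI)
next
  case (Suc i)
  then have k: "k < n * n ^ i" by simp
  obtain js where "length js = i" "set js \<subseteq> {..<n}"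
    "unit_vec (n ^ i) (k mod n ^ i) = (tens (map (unit_vec n) js) :: 'a vec)"
    using Suc.IH[OF div_mod_bounds(2)[OF k]] by blast
  then show ?case using div_mod_bounds(1)[OF k]
    by (intro exI[of _ "k div n ^ i # js"]) (simp add: unit_vec_vkron[OF k])
qed

context sym_char
begin

definition wedge :: "'f vec list \<Rightarrow> 'f vec" where
  "wedge vs = alt (length vs) *\<^sub>v tens vs"

lemma wedge_dim [simp]: "dim_vec (wedge vs) = n ^ length vs"
  by (simp add: wedge_def)

lemma alt_s1:
  assumes "i + 2 < p"
  shows "alt (Suc (Suc i)) * s1 i = (- 1) \<cdot>\<^sub>m alt (Suc (Suc i))"
proof -
  have "(s1 i * alt (Suc (Suc i)))\<^sup>T = (alt (Suc (Suc i)))\<^sup>T * (s1 i)\<^sup>T"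
    by (rule transpose_mult) (auto intro!: carrier_matI simp del: alt.simps)
  moreover have "((- 1) \<cdot>\<^sub>m alt (Suc (Suc i)))\<^sup>T = (- 1) \<cdot>\<^sub>m (alt (Suc (Suc i)))\<^sup>T"
    by (auto intro!: eq_matI simp del: alt.simps)
  ultimately show ?thesis unfolding s1_alt[OF assms] alt_transpose s1_transpose by simp
qed

lemma alt_L:
  assumes "i + 1 < p"
  shows "alt (Suc i) * L i = alt (Suc i)"
proof -
  have "(L i * alt (Suc i))\<^sup>T = (alt (Suc i))\<^sup>T * (L i)\<^sup>T"
    by (rule transpose_mult) (auto intro!: carrier_matI simp del: alt.simps)
  then show ?thesis unfolding L_alt[OF assms] by (simp add: alt_transpose kron_transpose transpose_one del: alt.simps)
qed

text \<open>The antisymmetrizer absorbs the one on the last factors, so the tail may be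
  antisymmetrized first.\<close>

lemma wedge_Cons:
  assumes "length vs + 1 < p" "v \<in> carrier_vec n" "set vs \<subseteq> carrier_vec n"
  shows "wedge (v # vs) = alt (Suc (length vs)) *\<^sub>v vkron v (wedge vs)"
proof -
  have d: "dim_vec (tens vs) = n ^ length vs" using assms(3) by (intro tens_dim) auto
  have "wedge (v # vs) = (alt (Suc (length vs)) * L (length vs)) *\<^sub>v vkron v (tens vs)"
    by (simp only: wedge_def alt_L[OF assms(1)] tens.simps list.size add_0_right add_Suc_right)
  also have "\<dots> = alt (Suc (length vs)) *\<^sub>v (L (length vs) *\<^sub>v vkron v (tens vs))"
    using assms(2) d by (intro mat_vec_assoc) (auto simp del: alt.simps)
  also have "L (length vs) *\<^sub>v vkron v (tens vs) = vkron v (wedge vs)"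
    using assms(2) d by (simp add: kron_mult_vkron wedge_def)
  finally show ?thesis .
qed

text \<open>At the front this is \<open>alt * s1 = -alt\<close>; leading factors are then added by
  \<open>wedge_Cons\<close>.\<close>

lemma wedge_swap_adjacent:
  assumes "length us + 2 + length ws < p" "set us \<union> {v, w} \<union> set ws \<subseteq> carrier_vec n"
  shows "wedge (us @ v # w # ws) = (- 1) \<cdot>\<^sub>v wedge (us @ w # v # ws)"
  using assms
proof (induction us)
  case Nil
  let ?k = "length ws"
  have vw: "v \<in> carrier_vec n" "w \<in> carrier_vec n" using Nil by auto
  have d: "dim_vec (tens ws) = n ^ ?k" using Nil by (intro tens_dim) auto
  have dd: "dim_vec v = n" "dim_vec w = n" using vw by auto
  have e: "wedge (v # w # ws) = alt (Suc (Suc ?k)) *\<^sub>v vkron v (vkron w (tens ws))"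
    if "v \<in> carrier_vec n" "w \<in> carrier_vec n" for v w by (simp add: wedge_def del: alt.simps)
  have sw: "s1 ?k *\<^sub>v vkron w (vkron v (tens ws)) = vkron v (vkron w (tens ws))"
  proof -
    have "s1 ?k *\<^sub>v vkron (vkron w v) (tens ws) = vkron (swap *\<^sub>v vkron w v) (1\<^sub>m (n ^ ?k) *\<^sub>v tens ws)"
      unfolding s1_def by (rule kron_mult_vkron) (simp_all add: dd d)
    also have "\<dots> = vkron (vkron v w) (tens ws)" using d vw by (simp add: kron_swap carrier_vec_dim_vec[of "tens ws", unfolded d])
    finally show ?thesis by (simp add: vkron_assoc)
  qed
  have "wedge (v # w # ws) = (alt (Suc (Suc ?k)) * s1 ?k) *\<^sub>v vkron w (vkron v (tens ws))"
    unfolding e[OF vw] sw[symmetric] using vw d by (intro mat_vec_assoc[symmetric]) (auto simp del: alt.simps)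
  also have "\<dots> = ((- 1) \<cdot>\<^sub>m alt (Suc (Suc ?k))) *\<^sub>v vkron w (vkron v (tens ws))"
    using alt_s1[of ?k] Nil by simp
  also have "\<dots> = (- 1) \<cdot>\<^sub>v wedge (w # v # ws)"
    unfolding e[OF vw(2,1)] using d dd
    by (intro eq_vecI) (simp_all add: scalar_prod_def sum_negf sum_distrib_left del: alt.simps)
  finally show ?case by simp
next
  case (Cons u us)
  have u: "u \<in> carrier_vec n" and IH: "wedge (us @ v # w # ws) = (- 1) \<cdot>\<^sub>v wedge (us @ w # v # ws)"
    using Cons by auto
  have 1: "length (us @ v # w # ws) + 1 < p" "length (us @ w # v # ws) + 1 < p"
    "set (us @ v # w # ws) \<subseteq> carrier_vec n" "set (us @ w # v # ws) \<subseteq> carrier_vec n" using Cons.prems by auto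
  let ?t = "wedge (us @ w # v # ws)" and ?k = "Suc (length us + 2 + length ws)"
  have t: "vkron u ?t \<in> carrier_vec (n ^ ?k)" using u by (auto intro!: carrier_vecI)
  have "wedge (u # us @ v # w # ws) = alt ?k *\<^sub>v vkron u ((- 1) \<cdot>\<^sub>v ?t)"
    using wedge_Cons[OF 1(1) u 1(3)] by (simp add: IH del: alt.simps)
  also have "\<dots> = (- 1) \<cdot>\<^sub>v (alt ?k *\<^sub>v vkron u ?t)"
    unfolding vkron_smult_right by (rule mult_mat_vec[OF alt_carrier t])
  also have "alt ?k *\<^sub>v vkron u ?t = wedge (u # us @ w # v # ws)"
    using wedge_Cons[OF 1(2) u 1(4)] by (simp del: alt.simps)
  finally show ?case by simp
qed

text \<open>Moving \<open>v\<close> past \<open>x\<close>, exchanging \<open>v\<close> and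
  \<open>w\<close>, and moving \<open>x\<close> past \<open>w\<close> gives three sign
  changes.\<close>

lemma wedge_swap:
  assumes "length us + length vs + length ws + 2 < p" "set us \<union> {v, w} \<union> set vs \<union> set ws \<subseteq> carrier_vec n"
  shows "wedge (us @ v # vs @ w # ws) = (- 1) \<cdot>\<^sub>v wedge (us @ w # vs @ v # ws)"
  using assms
proof (induction vs arbitrary: us)
  case Nil
  then show ?case using wedge_swap_adjacent[of us ws v w] by simp
next
  case (Cons x vs)
  have "wedge (us @ v # x # vs @ w # ws) = (- 1) \<cdot>\<^sub>v wedge ((us @ [x]) @ v # vs @ w # ws)"
    using wedge_swap_adjacent[of us "vs @ w # ws" v x] Cons.prems by simp
  also have "wedge ((us @ [x]) @ v # vs @ w # ws) = (- 1) \<cdot>\<^sub>v wedge ((us @ [x]) @ w # vs @ v # ws)"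
    by (rule Cons.IH) (use Cons.prems in auto)
  also have "wedge ((us @ [x]) @ w # vs @ v # ws) = (- 1) \<cdot>\<^sub>v wedge (us @ w # x # vs @ v # ws)"
    using wedge_swap_adjacent[of us "vs @ v # ws" x w] Cons.prems by simp
  finally show ?case by (simp add: smult_smult_assoc)
qed

lemma two_neq_0: "(2 :: 'f) \<noteq> 0"
  using of_nat_neq_0[of 2] p_ge_3 by simp

text \<open>Exchanging two equal entries shows that the wedge equals its negative, and
  \<open>2\<close> is invertible in \<open>F\<close>.\<close>

lemma wedge_not_distinct:
  assumes "length vs < p" "set vs \<subseteq> carrier_vec n" "\<not> distinct vs"
  shows "wedge vs = 0\<^sub>v (n ^ length vs)"
proof -
  obtain us v ys ws where vs: "vs = us @ v # ys @ v # ws"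
    using not_distinct_decomp[OF assms(3)] by auto
  have "wedge vs = (- 1) \<cdot>\<^sub>v wedge vs"
    unfolding vs by (rule wedge_swap) (use assms vs in auto)
  then have "wedge vs $ i = - wedge vs $ i" if "i < n ^ length vs" for i
    using that by (metis index_smult_vec(1) mult_minus1 wedge_dim)
  then have "2 * wedge vs $ i = 0" if "i < n ^ length vs" for i
    using that by (metis add.right_inverse mult_2)
  then show ?thesis using two_neq_0 by (intro eq_vecI) auto
qed

text \<open>Induction over transpositions. As \<open>cs\<close> is distinct, exchanging two of its
  values exchanges exactly two positions of the list.\<close>

lemma wedge_perm:
  assumes cs: "distinct cs" "length cs < p" and \<sigma>: "\<sigma> permutes set cs" and f: "\<And>c. f c \<in> carrier_vec n"
  shows "wedge (map (f \<circ> \<sigma>) cs) = of_int (sign \<sigma>) \<cdot>\<^sub>v wedge (map f cs)"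
  using finite_set[of cs] \<sigma>
proof (induction rule: permutes_rev_induct)
  case id
  then show ?case by (simp add: sign_id)
next
  case (swap a b \<tau>)
  have tr: "wedge (map (g \<circ> transpose a b) cs) = (- 1) \<cdot>\<^sub>v wedge (map g cs)"
    if g: "\<And>c. g c \<in> carrier_vec n" for g
  proof -
    have swap': "wedge (map (g \<circ> transpose a b) cs) = (- 1) \<cdot>\<^sub>v wedge (map g cs)"
      if ab: "cs = us @ a # vs @ b # ws" for us vs ws a b
    proof -
      have "a \<noteq> b" "a \<notin> set us \<union> set vs \<union> set ws" "b \<notin> set us \<union> set vs \<union> set ws" using cs(1) ab by auto
      then have "map (g \<circ> transpose a b) cs = map g us @ g b # map g vs @ g a # map g ws"
        unfolding ab by (auto simp: transpose_def)
      moreover have "wedge (map g us @ g b # map g vs @ g a # map g ws)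
          = (- 1) \<cdot>\<^sub>v wedge (map g us @ g a # map g vs @ g b # map g ws)"
        using cs(2) g by (intro wedge_swap) (auto simp: ab)
      ultimately show ?thesis by (simp only: ab) simp
    qed
    obtain us xs where us: "cs = us @ a # xs" using split_list[OF swap(1)] by blast
    consider "b \<in> set xs" | "b \<in> set us" using swap(2,3) us by auto
    then show ?thesis
    proof cases
      case 1
      then obtain vs ws where "xs = vs @ b # ws" using split_list by fastforce
      then show ?thesis using swap'[of us a vs b ws] us by simp
    next
      case 2
      then obtain vs ws where "us = vs @ b # ws" using split_list by fastforce
      then show ?thesis using swap'[of vs b ws a xs] us by (simp add: transpose_commute)
    qed
  qed
  have "sign (\<tau> \<circ> transpose a b) = - sign \<tau>"
    using sign_compose[of \<tau> "transpose a b"] swap permutation_permutes permutation_swap_id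
    by (metis List.finite_set mult_minus1_right sign_swap_id)
  moreover have "wedge (map (f \<circ> (\<tau> \<circ> transpose a b)) cs) = (- 1) \<cdot>\<^sub>v (of_int (sign \<tau>) \<cdot>\<^sub>v wedge (map f cs))"
    using tr[of "f \<circ> \<tau>"] f swap.IH by (simp add: comp_assoc)
  ultimately show ?case by (simp only: smult_smult_assoc of_int_minus mult_minus1)
qed

text \<open>On a unit vector, \<open>n + 1\<close> indices below \<open>n\<close> must repeat. The
  degree \<open>n + 1 = p - 1\<close> is the last one in which all denominators of the
  antisymmetrizer are invertible.\<close>

lemma alt_top: "alt (Suc n) = 0\<^sub>m (n ^ Suc n) (n ^ Suc n)"
proof (rule mat_eqI_unit[OF alt_carrier])
  fix k assume "k < n ^ Suc n"
  then obtain js where js: "length js = Suc n" "set js \<subseteq> {..<n}"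
    "unit_vec (n ^ Suc n) k = (tens (map (unit_vec n) js) :: 'f vec)"
    using unit_vec_tens by blast
  have "\<not> distinct js"
    using js(1,2) card_mono[of "{..<n}" "set js"] by (auto dest: distinct_card)
  then have "wedge (map (unit_vec n) js) = 0\<^sub>v (n ^ length (map (unit_vec n) js :: 'f vec list))"
    using js(1) n_props by (intro wedge_not_distinct) (auto simp: distinct_map)
  then show "alt (Suc n) *\<^sub>v unit_vec (n ^ Suc n) k = 0\<^sub>m (n ^ Suc n) (n ^ Suc n) *\<^sub>v unit_vec (n ^ Suc n) k"
  proof -
    have "dim_vec (tens (map (unit_vec n) js) :: 'f vec) = n ^ Suc n"
      using js(3) by (metis index_unit_vec(3))
    moreover from \<open>wedge (map (unit_vec n) js) = _\<close>
    have "alt (Suc n) *\<^sub>v tens (map (unit_vec n) js) = 0\<^sub>v (n ^ Suc n)"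
      by (simp only: wedge_def length_map js(1))
    ultimately show ?thesis
      unfolding js(3) by (auto intro!: eq_vecI simp: scalar_prod_def simp del: alt.simps)
  qed
qed simp

lemma gdim_X_top: "gdim (X (Suc n)) = 0"
proof (rule ccontr)
  assume nz: "gdim (X (Suc n)) \<noteq> 0"
  have p: "Suc n < p" using n_props by simp
  have "prj (Suc n) * inc (Suc n) = prj (Suc n) * (alt (Suc n) * inc (Suc n))" by (simp only: alt_inc[OF p])
  also have "\<dots> = 0\<^sub>m (gdim (X (Suc n))) (gdim (X (Suc n)))"
    unfolding alt_top by (simp add: X_dim[OF p] mat_zeros)
  finally have "(gid (X (Suc n)) :: 'f mat) $$ (0, 0) = 0\<^sub>m (gdim (X (Suc n))) (gdim (X (Suc n))) $$ (0, 0)"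
    unfolding X_props(4)[OF p] by simp
  then show False using nz by simp
qed

section \<open>Stable decomposition of the tensor powers of T\<close>

lemma giso_X:
  assumes "i < p" "alt i = I i"
  shows "giso \<S> (X i) (Tp i)"
  using X_props[OF assms(1)] X_dim[OF assms(1)] assms(2)
  by (intro gisoI[of _ _ _ "inc i" "prj i"]) (auto intro!: carrier_matI)

lemma giso_X_0: "giso \<S> (X 0) gtriv"
  using giso_X[of 0] p_ge_3 by simp

lemma giso_X_1: "giso \<S> (X 1) T"
  using giso_X[of 1] p_ge_3 by (simp add: gtensor_gtriv_right)

lemma is_gmod_X: "i < p \<Longrightarrow> is_gmod \<S> (X i)"
  by (rule X_props)

text \<open>Neighbours in the path graph with the labels lowered by one: \<open>i\<close> stands for
  the vertex \<open>i + 1\<close> and for the module \<open>X i\<close>.\<close>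

definition nbrs :: "nat \<Rightarrow> nat list" where
  "nbrs i = (if i < n then [Suc i] else []) @ (if 0 < i then [i - 1] else [])"

text \<open>The end points of all walks of length \<open>k\<close> starting from \<open>0\<close>,
  with multiplicity. The list indexes the stable summands of the \<open>k\<close>-th tensor
  power.\<close>

primrec ends :: "nat \<Rightarrow> nat list" where
  "ends 0 = [0]"
| "ends (Suc k) = concat (map nbrs (ends k))"

lemma ends_le: "i \<in> set (ends k) \<Longrightarrow> i \<le> n"
proof (induction k arbitrary: i)
  case (Suc k)
  then obtain j where "j \<in> set (ends k)" "i \<in> set (nbrs j)" by auto
  then show ?case using Suc.IH[of j] by (auto simp: nbrs_def split: if_splits)
qed simp

text \<open>At \<open>0\<close> the tensor product is \<open>T\<close> itself. At \<open>n\<close>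
  the upper neighbour is missing because \<open>X (Suc n)\<close> has dimension zero.\<close>

lemma sim_T_X_nbrs:
  assumes "i \<le> n"
  shows "sim (gtensor T (X i)) (gsum_list (map X (nbrs i)))"
proof -
  have g: "is_gmod \<S> (X k)" if "k \<le> Suc n" for k using that n_props by (intro is_gmod_X) simp
  note gz = giso_imp_sim[OF giso_gsum_zero_right] is_gmod_gzero is_gmod_gsum g
  consider "i = 0" | j where "i = Suc j" "i < n" | j where "i = Suc j" "i = n"
    using assms by (cases i) fastforce+
  then show ?thesis
  proof cases
    case 1
    have "sim (gtensor T (X 0)) (gtensor T gtriv)"
      by (intro sim_gtensor_right giso_imp_sim giso_X_0 is_gmod_gtriv is_gmod_T g) simp
    also have "gtensor T gtriv = T" by (rule gtensor_gtriv_right)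
    also have "sim T (X 1)"
      using n_props by (intro sim_sym[OF giso_imp_sim] giso_X_1 is_gmod_T g) simp
    also have "sim (X 1) (gsum (X 1) gzero)" using n_props by (intro sim_sym[OF gz(1)] gz) auto
    finally show ?thesis using 1 n_props by (simp add: nbrs_def)
  next
    case 2
    have "sim (gtensor T (X (Suc j))) (gsum (X (Suc (Suc j))) (X j))"
      using 2 n_props by (intro sim_T_X) simp
    also have "sim \<dots> (gsum (X (Suc (Suc j))) (gsum (X j) gzero))"
      using 2 by (intro sim_gsum sim_refl sim_sym[OF gz(1)] gz) auto
    finally show ?thesis using 2 by (simp add: nbrs_def)
  next
    case 3
    have "sim (gtensor T (X (Suc j))) (gsum (X (Suc (Suc j))) (X j))"
      using 3 n_props by (intro sim_T_X) simp
    also have "sim \<dots> (X j)"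
      using 3 gdim_X_top by (intro giso_imp_sim giso_gsum_zero_left gz) auto
    also have "sim (X j) (gsum (X j) gzero)" using 3 by (intro sim_sym[OF gz(1)] gz) auto
    finally show ?thesis using 3 by (simp add: nbrs_def)
  qed
qed

text \<open>One more factor \<open>T\<close> replaces every summand by its neighbours, which is one
  further step of all the walks.\<close>

lemma sim_Tp_ends: "sim (Tp k) (gsum_list (map X (ends k)))"
proof (induction k)
  case 0
  have "sim gtriv (X 0)" using n_props
    by (intro sim_sym[OF giso_imp_sim] giso_X_0 is_gmod_X is_gmod_gtriv) simp
  also have "sim (X 0) (gsum (X 0) gzero)" using n_props
    by (intro sim_sym[OF giso_imp_sim] giso_gsum_zero_right is_gmod_X is_gmod_gzero is_gmod_gsum) auto
  finally show ?case by simp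
next
  case (Suc k)
  have g: "is_gmod \<S> (X i)" if "i \<le> n" for i using that n_props by (intro is_gmod_X) simp
  have nb: "j \<le> n" if "i \<in> set (ends k)" "j \<in> set (nbrs i)" for i j
    using ends_le[OF that(1)] that(2) by (auto simp: nbrs_def split: if_splits)
  have "sim (gtensor T (Tp k)) (gtensor T (gsum_list (map X (ends k))))"
    by (intro sim_gtensor_right Suc is_gmod_T)
  also have "sim \<dots> (gsum_list (map (gtensor T) (map X (ends k))))"
    by (intro sim_gtensor_gsum_list is_gmod_T) (auto intro: g ends_le)
  also have "sim \<dots> (gsum_list (map gsum_list (map (\<lambda>i. map X (nbrs i)) (ends k))))"
    by (intro sim_gsum_list) (auto simp: list_all2_map1 list_all2_map2 list.rel_refl_strong intro!: list.rel_refl_strong sim_T_X_nbrs ends_le)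
  also have "sim \<dots> (gsum_list (concat (map (\<lambda>i. map X (nbrs i)) (ends k))))"
    by (intro sim_sym[OF sim_gsum_list_concat]) (use g nb in fastforce)
  finally show ?case by (simp add: map_concat comp_def)
qed

text \<open>\<open>ends\<close> prolongs walks at their end. Symmetry of adjacency turns this into a
  recursion over the neighbours of \<open>j\<close>, which is also satisfied by walks starting at
  \<open>j + 1\<close> and by paths starting at height \<open>j\<close>.\<close>

lemma count_ends_Suc:
  assumes "j \<le> n"
  shows "count_list (ends (Suc k)) j = (if j < n then count_list (ends k) (Suc j) else 0)
    + (if 0 < j then count_list (ends k) (j - 1) else 0)"
proof -
  have "count_list (ends (Suc k)) j = sum_list (map (\<lambda>i. count_list (nbrs i) j) (ends k))"
    by (simp add: count_list_concat comp_def)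
  also have "\<dots> = sum_list (map (\<lambda>i. (if i = Suc j then 1 else 0) + (if 0 < j \<and> i = j - 1 then 1 else 0)) (ends k))"
    by (intro arg_cong[of _ _ sum_list] map_cong refl) (use ends_le assms in \<open>fastforce simp: nbrs_def\<close>)
  also have "\<dots> = count_list (ends k) (Suc j) + (if 0 < j then count_list (ends k) (j - 1) else 0)"
  proof -
    have "sum_list (map (\<lambda>i. if i = c then 1 else 0) xs) = count_list xs c" for c :: nat and xs
      by (induction xs) auto
    then show ?thesis by (cases j) (simp_all add: sum_list_addf)
  qed
  also have "count_list (ends k) (Suc j) = (if j < n then count_list (ends k) (Suc j) else 0)"
    using ends_le[of "Suc j" k] assms by (auto simp: count_list_0_iff)
  finally show ?thesis .
qed

end

section \<open>Hook Specht modules and their simple quotients\<close>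

definition vsum :: "nat \<Rightarrow> ('b \<Rightarrow> 'a :: comm_monoid_add vec) \<Rightarrow> 'b set \<Rightarrow> 'a vec" where
  "vsum m f S = vec m (\<lambda>i. \<Sum>s\<in>S. f s $ i)"

lemma vsum_dim [simp]: "dim_vec (vsum m f S) = m"
  by (simp add: vsum_def)

lemma vsum_carrier [simp]: "vsum m f S \<in> carrier_vec m"
  by (simp add: carrier_vecI)

lemma vsum_cong: "S = S' \<Longrightarrow> (\<And>s. s \<in> S' \<Longrightarrow> f s = g s) \<Longrightarrow> vsum m f S = vsum m g S'"
  by (auto simp: vsum_def intro!: eq_vecI sum.cong)

lemma vsum_empty [simp]: "vsum m f {} = 0\<^sub>v m"
  by (auto simp: vsum_def)

lemma vsum_insert:
  "finite S \<Longrightarrow> x \<notin> S \<Longrightarrow> f x \<in> carrier_vec m \<Longrightarrow> vsum m f (insert x S) = f x + vsum m f S"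
  by (auto simp: vsum_def intro!: eq_vecI)

lemma mult_mat_vsum:
  fixes A :: "'a :: semiring_0 mat"
  assumes A: "A \<in> carrier_mat k m" and f: "\<And>s. s \<in> S \<Longrightarrow> f s \<in> carrier_vec m"
  shows "A *\<^sub>v vsum m f S = vsum k (\<lambda>s. A *\<^sub>v f s) S"
proof (rule eq_vecI)
  fix i assume "i < dim_vec (vsum k (\<lambda>s. A *\<^sub>v f s) S)"
  then have i: "i < k" by simp
  have d: "dim_vec (f s) = m" if "s \<in> S" for s using f[OF that] by simp
  have "(A *\<^sub>v vsum m f S) $ i = (\<Sum>l = 0..<m. A $$ (i, l) * (\<Sum>s\<in>S. f s $ l))"
    using i A by (auto simp: scalar_prod_def vsum_def)
  also have "\<dots> = (\<Sum>s\<in>S. \<Sum>l = 0..<m. A $$ (i, l) * f s $ l)"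
    by (subst sum.swap) (simp add: sum_distrib_left)
  also have "\<dots> = (\<Sum>s\<in>S. (A *\<^sub>v f s) $ i)"
    using i A d by (intro sum.cong refl) (auto simp: scalar_prod_def)
  finally show "(A *\<^sub>v vsum m f S) $ i = vsum k (\<lambda>s. A *\<^sub>v f s) S $ i" using i by (simp add: vsum_def)
qed (use A in auto)

lemma msum_mult_vec:
  fixes F :: "'b \<Rightarrow> 'a :: semiring_0 mat"
  assumes F: "\<And>s. s \<in> S \<Longrightarrow> F s \<in> carrier_mat m k" and x: "x \<in> carrier_vec k"
  shows "msum m k F S *\<^sub>v x = vsum m (\<lambda>s. F s *\<^sub>v x) S"
proof (rule eq_vecI)
  fix i assume "i < dim_vec (vsum m (\<lambda>s. F s *\<^sub>v x) S)"
  then have i: "i < m" by simp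
  have "(msum m k F S *\<^sub>v x) $ i = (\<Sum>l = 0..<k. (\<Sum>s\<in>S. F s $$ (i, l)) * x $ l)"
    using i x by (auto simp: scalar_prod_def msum_def)
  also have "\<dots> = (\<Sum>s\<in>S. \<Sum>l = 0..<k. F s $$ (i, l) * x $ l)"
    by (subst sum.swap) (simp add: sum_distrib_right)
  also have "\<dots> = (\<Sum>s\<in>S. (F s *\<^sub>v x) $ i)"
  proof (intro sum.cong refl)
    fix s assume "s \<in> S"
    then show "(\<Sum>l = 0..<k. F s $$ (i, l) * x $ l) = (F s *\<^sub>v x) $ i" using F[of s] i x by (auto simp: scalar_prod_def)
  qed
  finally show "(msum m k F S *\<^sub>v x) $ i = vsum m (\<lambda>s. F s *\<^sub>v x) S $ i" using i by (simp add: vsum_def)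
qed auto

lemma linear_fun_mat:
  fixes f :: "'a :: field vec \<Rightarrow> 'a vec"
  assumes im: "\<And>x. x \<in> carrier_vec n \<Longrightarrow> f x \<in> carrier_vec m"
    and add: "\<And>x y. x \<in> carrier_vec n \<Longrightarrow> y \<in> carrier_vec n \<Longrightarrow> f (x + y) = f x + f y"
    and smult: "\<And>c x. x \<in> carrier_vec n \<Longrightarrow> f (c \<cdot>\<^sub>v x) = c \<cdot>\<^sub>v f x"
  obtains A where "A \<in> carrier_mat m n" "\<And>x. x \<in> carrier_vec n \<Longrightarrow> A *\<^sub>v x = f x"
proof
  let ?A = "mat m n (\<lambda>(i, j). f (unit_vec n j) $ i)"
  show "?A \<in> carrier_mat m n" by simp
  fix x :: "'a vec" assume x: "x \<in> carrier_vec n"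
  let ?x = "\<lambda>k. vec n (\<lambda>j. if j < k then x $ j else 0)"
  have "f (?x k) = vec m (\<lambda>i. \<Sum>j<k. f (unit_vec n j) $ i * x $ j)" if "k \<le> n" for k
    using that
  proof (induction k)
    case 0
    have "?x 0 = 0 \<cdot>\<^sub>v ?x 0" by auto
    then have "f (?x 0) = 0 \<cdot>\<^sub>v f (?x 0)" using smult[of "?x 0" 0] by simp
    also have "\<dots> = 0\<^sub>v m" using im[of "?x 0"] by auto
    finally show ?case by (auto intro!: eq_vecI)
  next
    case (Suc k)
    have "?x (Suc k) = ?x k + x $ k \<cdot>\<^sub>v unit_vec n k"
      using Suc.prems by (auto intro!: eq_vecI simp: less_Suc_eq)
    then have "f (?x (Suc k)) = f (?x k) + x $ k \<cdot>\<^sub>v f (unit_vec n k)"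
      using add smult by simp
    then show ?case using Suc im[of "unit_vec n k"] by (auto intro!: eq_vecI simp: mult.commute)
  qed
  from this[of n] have "f (?x n) = vec m (\<lambda>i. \<Sum>j<n. f (unit_vec n j) $ i * x $ j)" by simp
  moreover have "?x n = x" using x by (auto intro!: eq_vecI)
  ultimately show "?A *\<^sub>v x = f x" using x by (auto intro!: eq_vecI simp: scalar_prod_def lessThan_atLeast0)
qed

locale hook = sym_char p F for p and F :: "'f :: field itself" +
  fixes i :: nat
  assumes i_le: "i \<le> n"
begin

definition lam :: "nat list" where "lam = (p - i) # replicate i 1"

lemma i_less: "i < p" "i + 1 < p" using i_le n_props by auto

lemma sum_lam [simp]: "sum_list lam = p"
  using i_less by (simp add: lam_def sum_list_replicate)

lemma length_lam [simp]: "length lam = Suc i" by (simp add: lam_def)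

lemma cells_lam: "cells lam = {(0, j) | j. j < p - i} \<union> {(k, 0) | k. k \<le> i}"
proof -
  have "lam ! k = (if k = 0 then p - i else 1)" if "k \<le> i" for k
    using that by (cases k) (auto simp: lam_def)
  then show ?thesis using i_less by (auto simp: cells_def less_Suc_eq_le split: if_splits)
qed

abbreviation tabx :: "(nat \<times> nat \<Rightarrow> nat) set" where "tabx \<equiv> tableaux lam"

text \<open>Entries of the first column; the other columns of a hook are single cells.
  \<open>legs\<close> leaves out the corner and collects the entries of the one-cell rows.\<close>

definition col :: "(nat \<times> nat \<Rightarrow> nat) \<Rightarrow> nat set" where "col t = (\<lambda>k. t (k, 0)) ` {..i}"
definition legs :: "(nat \<times> nat \<Rightarrow> nat) \<Rightarrow> nat set" where "legs t = (\<lambda>k. t (k, 0)) ` {1..i}"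

lemma tabxD:
  assumes "t \<in> tabx"
  shows "bij_betw t (cells lam) {1..p}" "inj_on (\<lambda>k. t (k, 0)) {..i}" "col t \<subseteq> {1..p}"
    "card (col t) = Suc i" "finite (col t)"
proof -
  show b: "bij_betw t (cells lam) {1..p}" using assms by (simp add: tableaux_def)
  have c: "(k, 0) \<in> cells lam" if "k \<le> i" for k using that by (auto simp: cells_lam)
  show inj: "inj_on (\<lambda>k. t (k, 0)) {..i}"
    using b c by (auto simp: bij_betw_def inj_on_def)
  show "col t \<subseteq> {1..p}" using b c by (auto simp: bij_betw_def col_def)
  show "card (col t) = Suc i" using inj by (simp add: col_def card_image)
  show "finite (col t)" by (simp add: col_def)
qed

lemma tabx_comp: "g permutes {1..p} \<Longrightarrow> t \<in> tabx \<Longrightarrow> g \<circ> t \<in> tabx"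
  unfolding tableaux_def using bij_betw_trans[OF _ permutes_imp_bij] by auto

lemma tabloid_row0:
  assumes "t \<in> tabx"
  shows "{t (0, j) | j. (0, j) \<in> cells lam} = {1..p} - legs t"
proof -
  have b: "bij_betw t (cells lam) {1..p}" using assms by (rule tabxD)
  let ?L = "(\<lambda>k. (k, 0 :: nat)) ` {1..i}"
  have L: "?L \<subseteq> cells lam" by (auto simp: cells_lam)
  have "cells lam - ?L = (\<lambda>j. (0, j)) ` {..<p - i}"
  proof (intro Set.set_eqI iffI)
    fix c assume "c \<in> cells lam - ?L"
    then obtain k j where c: "c = (k, j)" "(k, j) \<in> cells lam" "(k, j) \<notin> ?L" by (cases c) simp
    then have "k = 0" "j < p - i" using i_less by (cases "k = 0"; force simp: cells_lam image_iff)+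
    then show "c \<in> (\<lambda>j. (0, j)) ` {..<p - i}" using c by simp
  next
    fix c assume "c \<in> (\<lambda>j. (0 :: nat, j)) ` {..<p - i}"
    then obtain j where "c = (0, j)" "j < p - i" by auto
    then show "c \<in> cells lam - ?L" by (simp add: cells_lam image_iff)
  qed
  moreover have "{t (0, j) | j. (0, j) \<in> cells lam} = t ` (\<lambda>j. (0, j)) ` {..<p - i}"
  proof -
    have "(0, j) \<in> cells lam \<longleftrightarrow> j < p - i" for j using i_less by (auto simp: cells_lam)
    then show ?thesis by auto
  qed
  ultimately have "{t (0, j) | j. (0, j) \<in> cells lam} = t ` (cells lam - ?L)" by (simp only:)
  also have "\<dots> = t ` cells lam - t ` ?L"
    by (rule inj_on_image_set_diff[OF bij_betw_imp_inj_on[OF b]]) (use L in auto)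
  also have "t ` ?L = legs t" by (simp only: legs_def image_image)
  finally show ?thesis by (simp only: bij_betw_imp_surj_on[OF b])
qed

lemma tabloid_row: "1 \<le> k \<Longrightarrow> k \<le> i \<Longrightarrow> {t (k, j) | j. (k, j) \<in> cells lam} = {t (k, 0)}"
  by (auto simp: cells_lam)

lemma tabloid_nth: "1 \<le> k \<Longrightarrow> k \<le> i \<Longrightarrow> tabloid lam t ! k = {t (k, 0)}"
  using tabloid_row[of k t] unfolding tabloid_def by (subst nth_map) (auto simp del: upt_Suc)

text \<open>The rows below the first have one cell each, and the first row is the complement of the
  legs.\<close>

lemma tabloid_eqI:
  assumes "t \<in> tabx" "u \<in> tabx" "\<And>k. 1 \<le> k \<Longrightarrow> k \<le> i \<Longrightarrow> t (k, 0) = u (k, 0)"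
  shows "tabloid lam t = tabloid lam u"
  unfolding tabloid_def
proof (rule map_cong[OF refl])
  fix k assume "k \<in> set [0..<length lam]"
  then have "k = 0 \<or> (1 \<le> k \<and> k \<le> i)" by auto
  moreover have "legs t = legs u" using assms(3) by (auto simp: legs_def)
  ultimately show "{t (k, j) | j. (k, j) \<in> cells lam} = {u (k, j) | j. (k, j) \<in> cells lam}"
  proof (elim disjE conjE)
    assume "k = 0"
    then show ?thesis using tabloid_row0[OF assms(1)] tabloid_row0[OF assms(2)] \<open>legs t = legs u\<close> by (simp only:)
  next
    assume k: "1 \<le> k" "k \<le> i"
    then show ?thesis using assms(3)[OF k] by (simp only: tabloid_row)
  qed
qed

lemma tabloid_comp: "tabloid lam (g \<circ> t) = map ((`) g) (tabloid lam t)"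
  unfolding tabloid_def map_map by (rule map_cong[OF refl]) auto

text \<open>A permutation that preserves the one-cell columns fixes every entry outside the first
  column.\<close>

lemma column_stabilizer_lam:
  assumes t: "t \<in> tabx"
  shows "column_stabilizer lam t = {\<sigma>. \<sigma> permutes col t}"
proof -
  have b: "bij_betw t (cells lam) {1..p}" using t by (rule tabxD)
  have col0: "{t (k, 0) | k. (k, 0) \<in> cells lam} = col t"
    using i_less by (auto simp: cells_lam col_def)
  have colj: "{t (k, j) | k. (k, j) \<in> cells lam} = (if j < p - i then {t (0, j)} else {})" if "j > 0" for j
    using that by (auto simp: cells_lam)
  have out: "t (0, j) \<notin> col t" if "j > 0" "j < p - i" for j
    using that inj_onD[OF bij_betw_imp_inj_on[OF b], of "(0, j)"] by (auto simp: col_def cells_lam)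
  have cover: "\<exists>j. 0 < j \<and> j < p - i \<and> x = t (0, j)" if "x \<in> {1..p} - col t" for x
  proof -
    have "x \<in> t ` cells lam" using b that by (auto simp: bij_betw_def)
    then obtain k j where kj: "(k, j) \<in> cells lam" "x = t (k, j)" by auto
    then show ?thesis using that by (auto simp: cells_lam col_def intro!: exI[of _ j] gr0I)
  qed
  show ?thesis
  proof (intro Set.set_eqI iffI)
    fix \<sigma> assume \<sigma>: "\<sigma> \<in> column_stabilizer lam t"
    then have perm: "\<sigma> permutes {1..p}"
      and stab: "\<And>j. \<sigma> ` {t (k, j) | k. (k, j) \<in> cells lam} = {t (k, j) | k. (k, j) \<in> cells lam}"
      by (auto simp: column_stabilizer_def)
    have "\<sigma> x = x" if "x \<in> {1..p} - col t" for x
    proof -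
      obtain j where j: "0 < j" "j < p - i" "x = t (0, j)" using cover[OF \<open>x \<in> _\<close>] by blast
      then show ?thesis using stab[of j] by (simp only: colj) simp
    qed
    then show "\<sigma> \<in> {\<sigma>. \<sigma> permutes col t}" using perm by (auto intro: permutes_superset)
  next
    fix \<sigma> assume "\<sigma> \<in> {\<sigma>. \<sigma> permutes col t}"
    then have perm: "\<sigma> permutes col t" by simp
    have "\<sigma> ` {t (k, j) | k. (k, j) \<in> cells lam} = {t (k, j) | k. (k, j) \<in> cells lam}" for j
    proof (cases "j = 0")
      case True
      then show ?thesis using permutes_image[OF perm] col0 by simp
    next
      case False
      then show ?thesis using permutes_not_in[OF perm out[of j]] by (simp only: colj) simp
    qed
    then show "\<sigma> \<in> column_stabilizer lam t"
      using permutes_subset[OF perm tabxD(3)[OF t]] by (simp add: column_stabilizer_def)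
  qed
qed

section \<open>Column antisymmetrizers\<close>

abbreviation "CS t \<equiv> {\<sigma>. \<sigma> permutes col t}"

definition sg :: "(nat \<Rightarrow> nat) \<Rightarrow> 'f" where "sg \<sigma> = of_int (sign \<sigma>)"

lemma CS_perm: "t \<in> tabx \<Longrightarrow> \<sigma> \<in> CS t \<Longrightarrow> \<sigma> permutes {1..p}"
  using permutes_subset tabxD(3) by blast

lemma CS_carrier: "t \<in> tabx \<Longrightarrow> \<sigma> \<in> CS t \<Longrightarrow> \<sigma> \<in> carrier \<S>"
  using CS_perm by (simp add: carrier_iff)

lemma finite_CS: "t \<in> tabx \<Longrightarrow> finite (CS t)"
  using finite_permutations tabxD(5) by blast

lemma perm_permutation: "t \<in> tabx \<Longrightarrow> \<sigma> \<in> CS t \<Longrightarrow> permutation \<sigma>"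
  using CS_perm permutation_permutes by blast

lemma sg_comp: "permutation \<sigma> \<Longrightarrow> permutation \<tau> \<Longrightarrow> sg (\<sigma> \<circ> \<tau>) = sg \<sigma> * sg \<tau>"
  by (simp add: sg_def sign_compose)

lemma sg_sg: "sg \<sigma> * sg \<sigma> = 1"
  unfolding sg_def by (metis of_int_1 of_int_mult sign_idempotent)

lemma sg_swap: "a \<noteq> b \<Longrightarrow> sg (transpose a b) = - 1"
  by (simp add: sg_def sign_swap_id)

lemma CS_right: "\<tau> \<in> CS t \<Longrightarrow> bij_betw (\<lambda>\<sigma>. \<sigma> \<circ> \<tau>) (CS t) (CS t)"
  by (rule bij_betw_byWitness[where f' = "\<lambda>\<sigma>. \<sigma> \<circ> inv_into UNIV \<tau>"])
    (auto simp: comp_assoc permutes_inv_o permutes_compose permutes_inv)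

lemma CS_left: "\<tau> \<in> CS t \<Longrightarrow> bij_betw (\<lambda>\<sigma>. \<tau> \<circ> \<sigma>) (CS t) (CS t)"
  by (rule bij_betw_byWitness[where f' = "\<lambda>\<sigma>. inv_into UNIV \<tau> \<circ> \<sigma>"])
    (auto simp: comp_assoc[symmetric] permutes_inv_o permutes_compose permutes_inv)

lemma neg_eq_self: "x = - x \<Longrightarrow> x = (0 :: 'f)"
proof -
  assume "x = - x"
  then have "x + x = x + - x" by (rule arg_cong)
  then have "2 * x = 0" by (simp only: mult_2 right_minus)
  then show "x = 0" using two_neq_0 by simp
qed

text \<open>Composition with the transposition reverses the sign and preserves \<open>f\<close>, so
  the sum equals its own negative; \<open>2\<close> is invertible in \<open>F\<close>.\<close>

lemma sum_antisym_eq_0: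
  fixes f :: "(nat \<Rightarrow> nat) \<Rightarrow> 'f"
  assumes t: "t \<in> tabx" and xy: "x \<in> col t" "y \<in> col t" "x \<noteq> y"
    and f: "\<And>\<sigma>. \<sigma> \<in> CS t \<Longrightarrow> f (\<sigma> \<circ> transpose x y) = f \<sigma>"
  shows "(\<Sum>\<sigma>\<in>CS t. sg \<sigma> * f \<sigma>) = 0"
proof -
  have \<tau>: "transpose x y \<in> CS t" using xy by (simp add: permutes_swap_id)
  have "(\<Sum>\<sigma>\<in>CS t. sg \<sigma> * f \<sigma>) = (\<Sum>\<sigma>\<in>CS t. sg (\<sigma> \<circ> transpose x y) * f (\<sigma> \<circ> transpose x y))"
    by (rule sum.reindex_bij_betw[OF CS_right[OF \<tau>], symmetric])
  also have "\<dots> = (\<Sum>\<sigma>\<in>CS t. - (sg \<sigma> * f \<sigma>))"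
    using f xy perm_permutation[OF t] by (intro sum.cong refl) (simp add: sg_comp permutation_swap_id sg_swap)
  finally have "(\<Sum>\<sigma>\<in>CS t. sg \<sigma> * f \<sigma>) = - (\<Sum>\<sigma>\<in>CS t. sg \<sigma> * f \<sigma>)" by (simp only: sum_negf)
  from neg_eq_self[OF this] show ?thesis .
qed

definition e :: "(nat \<times> nat \<Rightarrow> nat) \<Rightarrow> nat set list \<Rightarrow> 'f" where "e t = polytabloid lam t"

lemma e_eq: "t \<in> tabx \<Longrightarrow> e t R = (\<Sum>\<sigma>\<in>CS t. sg \<sigma> * (if tabloid lam (\<sigma> \<circ> t) = R then 1 else 0))"
  unfolding e_def polytabloid_def column_stabilizer_lam sg_def by (intro sum.cong) auto

lemma permutes_conj:
  fixes g :: "nat \<Rightarrow> nat"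
  assumes g: "bij g" and \<rho>: "\<rho> permutes C"
  shows "g \<circ> \<rho> \<circ> inv_into UNIV g permutes g ` C"
proof (rule bij_imp_permutes)
  have gi: "inv_into UNIV g (g x) = x" "g (inv_into UNIV g x) = x" for x
    using g by (simp_all add: bij_is_inj bij_is_surj surj_f_inv_f)
  have "bij (g \<circ> \<rho> \<circ> inv_into UNIV g)"
    by (intro bij_comp g permutes_bij[OF \<rho>] bij_imp_bij_inv)
  moreover have "(g \<circ> \<rho> \<circ> inv_into UNIV g) ` g ` C = g ` C"
    using permutes_image[OF \<rho>] by (simp add: gi image_image) (metis image_image)
  ultimately show "bij_betw (g \<circ> \<rho> \<circ> inv_into UNIV g) (g ` C) (g ` C)"
    by (metis bij_betw_def bij_is_inj inj_on_subset top_greatest)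
  fix x assume "x \<notin> g ` C"
  then have "inv_into UNIV g x \<notin> C" using gi by (metis imageI)
  then show "(g \<circ> \<rho> \<circ> inv_into UNIV g) x = x" using permutes_not_in[OF \<rho>] gi by simp
qed

lemma bij_betw_CS_conj:
  assumes g: "g permutes {1..p}"
  shows "bij_betw (\<lambda>\<rho>. g \<circ> \<rho> \<circ> inv_into UNIV g) (CS t) (CS (g \<circ> t))"
proof -
  have col: "col (g \<circ> t) = g ` col t" by (auto simp: col_def)
  have gi: "inv_into UNIV g \<circ> g = id" "g \<circ> inv_into UNIV g = id" using permutes_inv_o[OF g] by auto
  have b: "bij g" "bij (inv_into UNIV g)" using permutes_bij[OF g] permutes_bij[OF permutes_inv[OF g]] by auto
  have ii: "inv_into UNIV (inv_into UNIV g) = g" using permutes_inv_inv[OF g] .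
  have ic: "inv_into UNIV g ` g ` col t = col t" using gi by (simp add: image_comp)
  show ?thesis
  proof (rule bij_betw_byWitness[where f' = "\<lambda>\<sigma>. inv_into UNIV g \<circ> \<sigma> \<circ> g"])
    show "\<forall>\<rho>\<in>CS t. inv_into UNIV g \<circ> (g \<circ> \<rho> \<circ> inv_into UNIV g) \<circ> g = \<rho>"
      "\<forall>\<sigma>\<in>CS (g \<circ> t). g \<circ> (inv_into UNIV g \<circ> \<sigma> \<circ> g) \<circ> inv_into UNIV g = \<sigma>"
      using gi by (auto simp: fun_eq_iff)
    show "(\<lambda>\<rho>. g \<circ> \<rho> \<circ> inv_into UNIV g) ` CS t \<subseteq> CS (g \<circ> t)"
      using permutes_conj[OF b(1)] by (auto simp: col)
    show "(\<lambda>\<sigma>. inv_into UNIV g \<circ> \<sigma> \<circ> g) ` CS (g \<circ> t) \<subseteq> CS t"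
      using permutes_conj[OF b(2), of _ "g ` col t"] by (auto simp: col ii ic)
  qed
qed

lemma sg_conj:
  assumes g: "g permutes {1..p}" and t: "t \<in> tabx" and \<rho>: "\<rho> \<in> CS t"
  shows "sg (g \<circ> \<rho> \<circ> inv_into UNIV g) = sg \<rho>"
proof -
  have pg: "permutation g" "permutation (inv_into UNIV g)" "permutation \<rho>"
    using g permutes_inv[OF g] perm_permutation[OF t \<rho>] by (auto simp: permutation_permutes)
  have "sg (g \<circ> \<rho> \<circ> inv_into UNIV g) = (sg g * sg (inv_into UNIV g)) * sg \<rho>"
    using pg by (simp add: sg_comp permutation_compose mult_ac)
  also have "sg (inv_into UNIV g) = sg g" using pg by (simp add: sg_def sign_inverse)
  finally show ?thesis by (simp only: sg_sg mult_1_left)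
qed

text \<open>Conjugation by \<open>g\<close> turns the column stabilizer of \<open>t\<close> into
  that of \<open>g \<circ> t\<close> and preserves signs, which brings \<open>g\<close> to the left
  of \<open>\<rho>\<close>.\<close>

lemma e_comp:
  assumes t: "t \<in> tabx" and g: "g permutes {1..p}"
  shows "e (g \<circ> t) R = (\<Sum>\<rho>\<in>CS t. sg \<rho> * (if tabloid lam (g \<circ> \<rho> \<circ> t) = R then 1 else 0))"
proof -
  let ?h = "\<lambda>\<rho>. g \<circ> \<rho> \<circ> inv_into UNIV g"
  have gi: "inv_into UNIV g (g x) = x" for x using permutes_inverses[OF g] by simp
  have hg: "?h \<rho> \<circ> (g \<circ> t) = g \<circ> \<rho> \<circ> t" for \<rho> by (simp add: fun_eq_iff gi)
  have "e (g \<circ> t) R = (\<Sum>\<sigma>\<in>CS (g \<circ> t). sg \<sigma> * (if tabloid lam (\<sigma> \<circ> (g \<circ> t)) = R then 1 else 0))"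
    by (rule e_eq[OF tabx_comp[OF g t]])
  also have "\<dots> = (\<Sum>\<rho>\<in>CS t. sg (?h \<rho>) * (if tabloid lam (?h \<rho> \<circ> (g \<circ> t)) = R then 1 else 0))"
    by (rule sum.reindex_bij_betw[OF bij_betw_CS_conj[OF g], symmetric])
  also have "\<dots> = (\<Sum>\<rho>\<in>CS t. sg \<rho> * (if tabloid lam (g \<circ> \<rho> \<circ> t) = R then 1 else 0))"
    unfolding hg by (intro sum.cong refl) (simp only: sg_conj[OF g t])
  finally show ?thesis .
qed

lemma tabloid_act_e:
  assumes t: "t \<in> tabx" and g: "g permutes {1..p}"
  shows "tabloid_act g (e t) = e (g \<circ> t)"
proof
  fix R
  have eq: "tabloid lam (\<rho> \<circ> t) = map ((`) (inv_into UNIV g)) R \<longleftrightarrow> tabloid lam (g \<circ> \<rho> \<circ> t) = R" for \<rho>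
  proof -
    have "tabloid lam (g \<circ> \<rho> \<circ> t) = map ((`) g) (tabloid lam (\<rho> \<circ> t))" by (simp only: comp_assoc tabloid_comp)
    moreover have "map ((`) g) (map ((`) (inv_into UNIV g)) U) = U" "map ((`) (inv_into UNIV g)) (map ((`) g) U) = U" for U
      using permutes_inv_o[OF g] by (simp_all add: comp_def image_comp[unfolded comp_def] image_image permutes_inverses[OF g])
    ultimately show ?thesis by metis
  qed
  show "tabloid_act g (e t) R = e (g \<circ> t) R"
    unfolding tabloid_act_def e_eq[OF t] eq e_comp[OF t g] ..
qed

text \<open>The key step of James' submodule theorem: a column antisymmetrizer maps a tabloid to a multiple
  of the polytabloid, since two column entries in the first row cancel.\<close>

lemma antisym_tabloid:
  assumes t: "t \<in> tabx" and u: "u \<in> tabx"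
  shows "\<exists>d. \<forall>R. (\<Sum>\<sigma>\<in>CS t. sg \<sigma> * (if tabloid lam (\<sigma> \<circ> u) = R then 1 else 0)) = d * e t R"
proof (cases "\<exists>x y. x \<in> col t - legs u \<and> y \<in> col t - legs u \<and> x \<noteq> y")
  case True
  \<comment> \<open>Two column entries outside the legs of \<open>u\<close> lie in its first row, so
    exchanging them first does not change the tabloid.\<close>
  then obtain x y where xy: "x \<in> col t" "y \<in> col t" "x \<noteq> y" "x \<notin> legs u" "y \<notin> legs u" by blast
  have "(\<Sum>\<sigma>\<in>CS t. sg \<sigma> * (if tabloid lam (\<sigma> \<circ> u) = R then 1 else 0)) = 0" for R
  proof (rule sum_antisym_eq_0[OF t xy(1-3)])
    fix \<sigma> assume \<sigma>: "\<sigma> \<in> CS t"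
    have \<tau>: "transpose x y \<in> CS t" using xy by (simp add: permutes_swap_id)
    have "tabloid lam (\<sigma> \<circ> (transpose x y \<circ> u)) = tabloid lam (\<sigma> \<circ> u)"
    proof (rule tabloid_eqI)
      show "\<sigma> \<circ> (transpose x y \<circ> u) \<in> tabx" "\<sigma> \<circ> u \<in> tabx"
        using CS_perm[OF t \<sigma>] CS_perm[OF t \<tau>] u tabx_comp by blast+
      fix k assume "1 \<le> k" "k \<le> i"
      then have "u (k, 0) \<noteq> x" "u (k, 0) \<noteq> y" using xy by (auto simp: legs_def)
      then show "(\<sigma> \<circ> (transpose x y \<circ> u)) (k, 0) = (\<sigma> \<circ> u) (k, 0)" by (simp add: transpose_def)
    qed
    then show "(if tabloid lam ((\<sigma> \<circ> transpose x y) \<circ> u) = R then 1 else 0) = (if tabloid lam (\<sigma> \<circ> u) = R then 1 else (0 :: 'f))"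
      by (simp add: comp_assoc)
  qed
  then show ?thesis by (intro exI[of _ 0]) simp
next
  case False
  note Cu = tabxD[OF u] and Ct = tabxD[OF t]
  have legs: "finite (legs u)" "card (legs u) = i"
    using card_image[OF inj_on_subset[OF Cu(2), of "{1..i}"]] by (auto simp: legs_def)
  have "card (col t - legs u) \<le> 1"
    using False by (metis Ct(5) card_le_Suc0_iff_eq finite_Diff One_nat_def)
  moreover have "card (col t) = card (col t - legs u) + card (col t \<inter> legs u)"
    using Ct(5) by (metis card_Diff_subset_Int card_mono finite_Int inf_le1 le_add_diff_inverse2)
  moreover have "card (col t \<inter> legs u) \<le> i" using legs by (metis card_mono inf_le2)
  ultimately have cards: "card (col t \<inter> legs u) = i" "card (col t - legs u) = 1" using Ct(4) by auto
  have "col t \<inter> legs u = legs u" using legs cards by (intro card_subset_eq) auto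
  then have sub: "legs u \<subseteq> col t" by blast
  \<comment> \<open>Now the column of \<open>t\<close> consists of the legs of \<open>u\<close> and
    one further entry \<open>z\<close>. Hence some permutation \<open>s\<close> of the column
    carries each leg of \<open>t\<close> to the corresponding leg of \<open>u\<close>, and
    \<open>u\<close> has the same tabloid as \<open>s \<circ> t\<close>.\<close>
  obtain z where z: "col t - legs u = {z}" using cards(2) by (metis card_1_singletonE)
  define g where "g k = (if k = 0 then z else u (k, 0))" for k
  have "g ` {..i} = insert z (legs u)"
  proof -
    have "{..i} = insert 0 {1..i}" by auto
    then show ?thesis by (auto simp: g_def legs_def image_iff)
  qed
  also have "\<dots> = col t" using z sub by blast
  finally have gim: "g ` {..i} = col t" .
  then have "inj_on g {..i}" using Ct(4) by (intro eq_card_imp_inj_on) auto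
  then have bg: "bij_betw g {..i} (col t)" using gim by (simp add: bij_betw_def)
  have bt: "bij_betw (\<lambda>k. t (k, 0)) {..i} (col t)" using Ct(2) by (simp add: bij_betw_def col_def)
  define s where "s x = (if x \<in> col t then g (inv_into {..i} (\<lambda>k. t (k, 0)) x) else x)" for x
  have s_t: "s (t (k, 0)) = g k" if "k \<le> i" for k
    using that bij_betw_inv_into_left[OF bt, of k] by (auto simp: s_def col_def)
  have "bij_betw s (col t) (col t)"
  proof -
    have "bij_betw (g \<circ> inv_into {..i} (\<lambda>k. t (k, 0))) (col t) (col t)"
      by (rule bij_betw_trans[OF bij_betw_inv_into[OF bt] bg])
    then show ?thesis by (rule iffD1[OF bij_betw_cong, rotated]) (simp add: s_def)
  qed
  then have s: "s \<in> CS t" using bij_imp_permutes[of s "col t"] by (simp add: s_def)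
  have tab: "tabloid lam (\<sigma> \<circ> u) = tabloid lam (\<sigma> \<circ> s \<circ> t)" if \<sigma>: "\<sigma> \<in> CS t" for \<sigma>
  proof (rule tabloid_eqI)
    show "\<sigma> \<circ> u \<in> tabx" by (rule tabx_comp[OF CS_perm[OF t \<sigma>] u])
    show "\<sigma> \<circ> s \<circ> t \<in> tabx" using tabx_comp[OF CS_perm[OF t \<sigma>] tabx_comp[OF CS_perm[OF t s] t]] by (simp add: comp_assoc)
    fix k assume "1 \<le> k" "k \<le> i"
    then show "(\<sigma> \<circ> u) (k, 0) = (\<sigma> \<circ> s \<circ> t) (k, 0)" using s_t[of k] by (simp add: g_def)
  qed
  have "(\<Sum>\<sigma>\<in>CS t. sg \<sigma> * (if tabloid lam (\<sigma> \<circ> u) = R then 1 else 0)) = sg s * e t R" for R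
  proof -
    have "(\<Sum>\<sigma>\<in>CS t. sg \<sigma> * (if tabloid lam (\<sigma> \<circ> u) = R then 1 else 0))
      = (\<Sum>\<sigma>\<in>CS t. sg s * (sg (\<sigma> \<circ> s) * (if tabloid lam (\<sigma> \<circ> s \<circ> t) = R then 1 else 0)))"
    proof (intro sum.cong refl)
      fix \<sigma> assume \<sigma>: "\<sigma> \<in> CS t"
      have "sg s * sg (\<sigma> \<circ> s) = sg \<sigma>"
        using perm_permutation[OF t \<sigma>] perm_permutation[OF t s] sg_sg[of s] by (simp add: sg_comp mult.left_commute)
      then show "sg \<sigma> * (if tabloid lam (\<sigma> \<circ> u) = R then 1 else 0)
        = sg s * (sg (\<sigma> \<circ> s) * (if tabloid lam (\<sigma> \<circ> s \<circ> t) = R then 1 else 0))"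
        unfolding tab[OF \<sigma>] by (simp only: mult.assoc[symmetric])
    qed
    also have "\<dots> = sg s * (\<Sum>\<sigma>\<in>CS t. sg (\<sigma> \<circ> s) * (if tabloid lam ((\<sigma> \<circ> s) \<circ> t) = R then 1 else 0))"
      by (simp add: sum_distrib_left)
    also have "(\<Sum>\<sigma>\<in>CS t. sg (\<sigma> \<circ> s) * (if tabloid lam ((\<sigma> \<circ> s) \<circ> t) = R then 1 else 0)) = e t R"
      unfolding e_eq[OF t]
      by (rule sum.reindex_bij_betw[OF CS_right[OF s], of "\<lambda>\<sigma>. sg \<sigma> * (if tabloid lam (\<sigma> \<circ> t) = R then 1 else 0)"])
    finally show ?thesis .
  qed
  then show ?thesis by blast
qed

definition kap :: "(nat \<times> nat \<Rightarrow> nat) \<Rightarrow> (nat set list \<Rightarrow> 'f) \<Rightarrow> nat set list \<Rightarrow> 'f" where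
  "kap t x = (\<lambda>R. \<Sum>\<sigma>\<in>CS t. sg \<sigma> * tabloid_act \<sigma> x R)"

text \<open>A polytabloid is a signed sum of tabloids, and each of them is sent to a multiple of
  \<open>e t\<close>.\<close>

lemma kap_e:
  assumes t: "t \<in> tabx" and u: "u \<in> tabx"
  shows "\<exists>d. kap t (e u) = (\<lambda>R. d * e t R)"
proof -
  have pu: "\<rho> \<circ> u \<in> tabx" if "\<rho> \<in> CS u" for \<rho> using CS_perm[OF u that] u by (rule tabx_comp)
  have "\<forall>\<rho>\<in>CS u. \<exists>d. \<forall>R. (\<Sum>\<sigma>\<in>CS t. sg \<sigma> * (if tabloid lam (\<sigma> \<circ> (\<rho> \<circ> u)) = R then 1 else 0)) = d * e t R"
    by (intro ballI antisym_tabloid[OF t pu])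
  from bchoice[OF this] obtain d where "\<forall>\<rho>\<in>CS u. \<forall>R. (\<Sum>\<sigma>\<in>CS t. sg \<sigma> * (if tabloid lam (\<sigma> \<circ> (\<rho> \<circ> u)) = R then 1 else 0)) = d \<rho> * e t R" ..
  then have d: "(\<Sum>\<sigma>\<in>CS t. sg \<sigma> * (if tabloid lam (\<sigma> \<circ> (\<rho> \<circ> u)) = R then 1 else 0)) = d \<rho> * e t R"
    if "\<rho> \<in> CS u" for \<rho> R using that by blast
  have "kap t (e u) R = (\<Sum>\<rho>\<in>CS u. sg \<rho> * d \<rho>) * e t R" for R
  proof -
    have "kap t (e u) R = (\<Sum>\<sigma>\<in>CS t. sg \<sigma> * (\<Sum>\<rho>\<in>CS u. sg \<rho> * (if tabloid lam (\<sigma> \<circ> \<rho> \<circ> u) = R then 1 else 0)))"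
      unfolding kap_def using tabloid_act_e[OF u CS_perm[OF t]] e_comp[OF u CS_perm[OF t]]
      by (intro sum.cong refl) simp
    also have "\<dots> = (\<Sum>\<sigma>\<in>CS t. \<Sum>\<rho>\<in>CS u. sg \<rho> * (sg \<sigma> * (if tabloid lam (\<sigma> \<circ> (\<rho> \<circ> u)) = R then 1 else 0)))"
      by (simp only: sum_distrib_left mult.left_commute comp_assoc)
    also have "\<dots> = (\<Sum>\<rho>\<in>CS u. sg \<rho> * (\<Sum>\<sigma>\<in>CS t. sg \<sigma> * (if tabloid lam (\<sigma> \<circ> (\<rho> \<circ> u)) = R then 1 else 0)))"
      by (subst sum.swap) (simp only: sum_distrib_left)
    also have "\<dots> = (\<Sum>\<rho>\<in>CS u. sg \<rho> * (d \<rho> * e t R))" using d by (intro sum.cong refl) simp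
    finally show ?thesis by (simp add: sum_distrib_right mult.assoc)
  qed
  then show ?thesis by blast
qed

text \<open>Composing with a member of the stabilizer only multiplies the signed sum by its sign, so
  every term of the outer sum contributes the same. The factor \<open>(i + 1)!\<close> is nonzero in
  \<open>F\<close> since \<open>i + 1 < p\<close>.\<close>

lemma kap_e_self:
  assumes t: "t \<in> tabx"
  shows "kap t (e t) = (\<lambda>R. of_nat (fact (Suc i)) * e t R)"
proof
  fix R
  have "kap t (e t) R = (\<Sum>\<sigma>\<in>CS t. sg \<sigma> * (\<Sum>\<rho>\<in>CS t. sg \<rho> * (if tabloid lam (\<sigma> \<circ> \<rho> \<circ> t) = R then 1 else 0)))"
    unfolding kap_def using tabloid_act_e[OF t CS_perm[OF t]] e_comp[OF t CS_perm[OF t]]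
    by (intro sum.cong refl) simp
  also have "\<dots> = (\<Sum>\<sigma>\<in>CS t. e t R)"
  proof (intro sum.cong refl)
    fix \<sigma> assume \<sigma>: "\<sigma> \<in> CS t"
    have "sg \<sigma> * (\<Sum>\<rho>\<in>CS t. sg \<rho> * (if tabloid lam (\<sigma> \<circ> \<rho> \<circ> t) = R then 1 else 0))
      = (\<Sum>\<rho>\<in>CS t. sg (\<sigma> \<circ> \<rho>) * (if tabloid lam ((\<sigma> \<circ> \<rho>) \<circ> t) = R then 1 else 0))"
      unfolding sum_distrib_left using perm_permutation[OF t] \<sigma>
      by (intro sum.cong refl) (simp only: sg_comp mult.assoc)
    also have "\<dots> = e t R"
      unfolding e_eq[OF t]
      by (rule sum.reindex_bij_betw[OF CS_left[OF \<sigma>], of "\<lambda>\<sigma>. sg \<sigma> * (if tabloid lam (\<sigma> \<circ> t) = R then 1 else 0)"])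
    finally show "sg \<sigma> * (\<Sum>\<rho>\<in>CS t. sg \<rho> * (if tabloid lam (\<sigma> \<circ> \<rho> \<circ> t) = R then 1 else 0)) = e t R" .
  qed
  finally show "kap t (e t) R = of_nat (fact (Suc i)) * e t R"
    using card_permutations[OF tabxD(4,5)[OF t]] by simp
qed

lemma fact_neq_0: "k < p \<Longrightarrow> (of_nat (fact k) :: 'f) \<noteq> 0"
  using prime_dvd_fact_iff[OF prime_p] by (simp add: of_nat_eq_0_iff del: of_nat_fact)

section \<open>The Specht module\<close>

abbreviation Sp :: "(nat set list \<Rightarrow> 'f) set" where "Sp \<equiv> specht lam"

lemma e_in_Sp: "t \<in> tabx \<Longrightarrow> e t \<in> Sp"
  unfolding specht_def by (auto intro!: exI[of _ "{t}"] exI[of _ "\<lambda>_. 1"] simp: e_def)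

lemma SpE:
  assumes "x \<in> Sp"
  obtains A c where "finite A" "A \<subseteq> tabx" "x = (\<lambda>R. \<Sum>t\<in>A. c t * e t R)"
proof -
  have "\<exists>A c. x = (\<lambda>R. \<Sum>t\<in>A. c t * e t R) \<and> finite A \<and> A \<subseteq> tabx"
    using assms unfolding specht_def e_def by (rule CollectD)
  then show thesis by (elim exE conjE) (rule that)
qed

lemma Sp_add:
  assumes "x \<in> Sp" "y \<in> Sp"
  shows "(\<lambda>R. x R + y R) \<in> Sp"
proof -
  obtain A c where A: "finite A" "A \<subseteq> tabx" "x = (\<lambda>R. \<Sum>t\<in>A. c t * e t R)" by (rule SpE[OF assms(1)])
  obtain A' c' where A': "finite A'" "A' \<subseteq> tabx" "y = (\<lambda>R. \<Sum>t\<in>A'. c' t * e t R)" by (rule SpE[OF assms(2)])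
  let ?c = "\<lambda>t. (if t \<in> A then c t else 0) + (if t \<in> A' then c' t else 0)"
  have "x R + y R = (\<Sum>t\<in>A \<union> A'. ?c t * e t R)" for R
  proof -
    have "(\<Sum>t\<in>A \<union> A'. ?c t * e t R)
      = (\<Sum>t\<in>A \<union> A'. if t \<in> A then c t * e t R else 0) + (\<Sum>t\<in>A \<union> A'. if t \<in> A' then c' t * e t R else 0)"
      unfolding sum.distrib[symmetric] by (intro sum.cong refl) (simp add: distrib_right)
    then show ?thesis
      using A(1) A'(1) unfolding A(3) A'(3) by (simp add: sum.If_cases Int_absorb1 Int_Un_distrib2)
  qed
  then show ?thesis using A(1,2) A'(1,2) unfolding specht_def e_def
    by (auto intro!: exI[of _ "A \<union> A'"] exI[of _ ?c])
qed

lemma Sp_smult: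
  assumes "x \<in> Sp"
  shows "(\<lambda>R. k * x R) \<in> Sp"
proof -
  obtain A c where A: "finite A" "A \<subseteq> tabx" "x = (\<lambda>R. \<Sum>t\<in>A. c t * e t R)" by (rule SpE[OF assms])
  then show ?thesis unfolding specht_def e_def[symmetric]
    by (auto intro!: exI[of _ A] exI[of _ "\<lambda>t. k * c t"] simp: sum_distrib_left mult.assoc)
qed

lemma Sp_sum:
  assumes "finite S" "\<And>s. s \<in> S \<Longrightarrow> x s \<in> Sp"
  shows "(\<lambda>R. \<Sum>s\<in>S. k s * x s R) \<in> Sp"
  using assms
proof (induction S)
  case empty
  then show ?case unfolding specht_def by (auto intro!: exI[of _ "{}"])
next
  case (insert s S)
  then show ?case using Sp_add[OF Sp_smult[of "x s" "k s"]] by simp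
qed

lemma tabloid_act_sum: "tabloid_act g (\<lambda>R. \<Sum>s\<in>S. k s * x s R) = (\<lambda>R. \<Sum>s\<in>S. k s * tabloid_act g (x s) R)"
  by (simp add: tabloid_act_def)

lemma tabloid_act_Sp:
  assumes g: "g permutes {1..p}" and "x \<in> Sp"
  shows "tabloid_act g x \<in> Sp"
proof -
  obtain A c where A: "finite A" "A \<subseteq> tabx" "x = (\<lambda>R. \<Sum>t\<in>A. c t * e t R)" by (rule SpE[OF assms(2)])
  show ?thesis unfolding A(3) tabloid_act_sum
    using A tabloid_act_e[OF _ g] e_in_Sp tabx_comp[OF g] by (intro Sp_sum) (auto simp: subset_iff)
qed

lemma kap_Sp_scalar:
  assumes t: "t \<in> tabx" and "x \<in> Sp"
  shows "\<exists>d. kap t x = (\<lambda>R. d * e t R)"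
proof -
  obtain A c where A: "finite A" "A \<subseteq> tabx" "x = (\<lambda>R. \<Sum>u\<in>A. c u * e u R)" by (rule SpE[OF assms(2)])
  have "\<forall>u\<in>A. \<exists>d. kap t (e u) = (\<lambda>R. d * e t R)" using kap_e[OF t] A(2) by (intro ballI) (simp add: subset_iff)
  from bchoice[OF this] obtain d where d: "\<forall>u\<in>A. kap t (e u) = (\<lambda>R. d u * e t R)" ..
  have "kap t x R = (\<Sum>u\<in>A. c u * d u) * e t R" for R
  proof -
    have "kap t x R = (\<Sum>\<sigma>\<in>CS t. \<Sum>u\<in>A. c u * (sg \<sigma> * tabloid_act \<sigma> (e u) R))"
      unfolding kap_def A(3) tabloid_act_sum by (simp only: sum_distrib_left mult.left_commute)
    also have "\<dots> = (\<Sum>u\<in>A. c u * kap t (e u) R)"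
      unfolding kap_def by (subst sum.swap) (simp only: sum_distrib_left)
    also have "\<dots> = (\<Sum>u\<in>A. c u * (d u * e t R))" using d by (intro sum.cong refl) simp
    finally show ?thesis by (simp add: sum_distrib_right mult.assoc)
  qed
  then show ?thesis by blast
qed

text \<open>Tableaux are functions on all pairs, and \<open>g \<circ> t\<close> is known to agree
  with \<open>u\<close> only on the cells. Equality is therefore asserted for the polytabloids,
  which see only the cells.\<close>

lemma tabx_transitive:
  assumes t: "t \<in> tabx" and u: "u \<in> tabx"
  shows "\<exists>g. g permutes {1..p} \<and> e (g \<circ> t) = e u"
proof -
  have bt: "bij_betw t (cells lam) {1..p}" and bu: "bij_betw u (cells lam) {1..p}"
    using tabxD(1)[OF t] tabxD(1)[OF u] by auto
  define g where "g x = (if x \<in> {1..p} then u (inv_into (cells lam) t x) else x)" for x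
  have "bij_betw (u \<circ> inv_into (cells lam) t) {1..p} {1..p}"
    by (rule bij_betw_trans[OF bij_betw_inv_into[OF bt] bu])
  then have "bij_betw g {1..p} {1..p}" by (rule iffD1[OF bij_betw_cong, rotated]) (simp add: g_def)
  then have g: "g permutes {1..p}" by (rule bij_imp_permutes) (simp only: g_def if_False)
  have agree: "(g \<circ> t) c = u c" if "c \<in> cells lam" for c
    using that bij_betw_inv_into_left[OF bt that] bij_betwE[OF bt] by (simp add: g_def)
  have col: "col (g \<circ> t) = col u" using agree by (auto simp: col_def cells_lam)
  have tab: "tabloid lam (\<sigma> \<circ> (g \<circ> t)) = tabloid lam (\<sigma> \<circ> u)" for \<sigma>
    unfolding tabloid_def using agree by (intro map_cong refl) (auto, metis+)
  have "e (g \<circ> t) R = e u R" for R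
    unfolding e_eq[OF tabx_comp[OF g t]] e_eq[OF u] col tab ..
  with g show ?thesis by blast
qed

end

section \<open>Simple quotients of the hook Specht module\<close>

lemma vsum_smult_const:
  fixes v :: "'a :: semiring_0 vec"
  assumes "v \<in> carrier_vec m"
  shows "vsum m (\<lambda>s. k s \<cdot>\<^sub>v v) S = (\<Sum>s\<in>S. k s) \<cdot>\<^sub>v v"
  using assms by (auto intro!: eq_vecI simp: vsum_def sum_distrib_right)

lemma zero_smult_vec: "v \<in> carrier_vec m \<Longrightarrow> 0 \<cdot>\<^sub>v v = (0\<^sub>v m :: 'a :: semiring_0 vec)"
  by (auto intro!: eq_vecI)

lemma smult_zero_vec: "c \<cdot>\<^sub>v 0\<^sub>v m = (0\<^sub>v m :: 'a :: semiring_0 vec)"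
  by (auto intro!: eq_vecI)

lemma smult_vec_eq_0:
  fixes v :: "'a :: field vec"
  assumes v: "v \<in> carrier_vec m" and z: "c \<cdot>\<^sub>v v = 0\<^sub>v m"
  shows "c = 0 \<or> v = 0\<^sub>v m"
proof (rule disjCI)
  assume nz: "v \<noteq> 0\<^sub>v m"
  have "\<exists>k<m. v $ k \<noteq> 0"
  proof (rule ccontr)
    assume "\<not> (\<exists>k<m. v $ k \<noteq> 0)"
    then have "v = 0\<^sub>v m" using v by (intro eq_vecI) auto
    with nz show False ..
  qed
  then obtain k where k: "k < m" "v $ k \<noteq> 0" by blast
  have "(c \<cdot>\<^sub>v v) $ k = 0" unfolding z using k by simp
  then show "c = 0" using k v by simp
qed

context hook
begin

definition specht_map :: "'f smod \<Rightarrow> ((nat set list \<Rightarrow> 'f) \<Rightarrow> 'f vec) \<Rightarrow> bool" where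
  "specht_map V \<phi> \<longleftrightarrow> is_gmod \<S> V \<and> \<phi> ` Sp = gvecs V \<and>
     (\<forall>x \<in> Sp. \<forall>y \<in> Sp. \<phi> (\<lambda>R. x R + y R) = \<phi> x + \<phi> y) \<and>
     (\<forall>c. \<forall>x \<in> Sp. \<phi> (\<lambda>R. c * x R) = c \<cdot>\<^sub>v \<phi> x) \<and>
     (\<forall>g \<in> carrier \<S>. \<forall>x \<in> Sp. \<phi> (tabloid_act g x) = gact V g *\<^sub>v \<phi> x)"

lemma is_specht_quotient_iff: "is_specht_quotient lam V \<longleftrightarrow> (\<exists>\<phi>. specht_map V \<phi>)"
  unfolding is_specht_quotient_def specht_map_def sum_lam by (rule ex_simps(2)[symmetric])

lemma specht_mapD:
  assumes "specht_map V \<phi>"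
  shows "is_gmod \<S> V" "\<phi> ` Sp = gvecs V"
    "x \<in> Sp \<Longrightarrow> \<phi> x \<in> gvecs V" "x \<in> Sp \<Longrightarrow> y \<in> Sp \<Longrightarrow> \<phi> (\<lambda>R. x R + y R) = \<phi> x + \<phi> y"
    "x \<in> Sp \<Longrightarrow> \<phi> (\<lambda>R. c * x R) = c \<cdot>\<^sub>v \<phi> x"
    "g \<in> carrier \<S> \<Longrightarrow> x \<in> Sp \<Longrightarrow> \<phi> (tabloid_act g x) = gact V g *\<^sub>v \<phi> x"
  using assms unfolding specht_map_def by (simp_all add: set_eq_iff image_iff) blast

lemma specht_map_ex:
  assumes "specht_map V \<phi>" "v \<in> gvecs V"
  shows "\<exists>x. x \<in> Sp \<and> \<phi> x = v"
proof -
  have "v \<in> \<phi> ` Sp" unfolding specht_mapD(2)[OF assms(1)] by (rule assms(2))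
  then show ?thesis by blast
qed

lemma specht_map_sum:
  assumes \<phi>: "specht_map V \<phi>" and S: "finite S" "\<And>s. s \<in> S \<Longrightarrow> x s \<in> Sp"
  shows "\<phi> (\<lambda>R. \<Sum>s\<in>S. k s * x s R) = vsum (gdim V) (\<lambda>s. k s \<cdot>\<^sub>v \<phi> (x s)) S"
  using S
proof (induction S)
  case empty
  have z: "(\<lambda>R. 0) \<in> Sp" using Sp_sum[of "{}"] by simp
  have "\<phi> (\<lambda>R. 0) = 0 \<cdot>\<^sub>v \<phi> (\<lambda>R. 0)" using specht_mapD(5)[OF \<phi> z, of 0] by simp
  also have "\<dots> = 0\<^sub>v (gdim V)" by (rule zero_smult_vec[OF specht_mapD(3)[OF \<phi> z]])
  finally show ?case by simp
next
  case (insert s S)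
  have x: "x s \<in> Sp" "\<And>s. s \<in> S \<Longrightarrow> x s \<in> Sp" using insert.prems by auto
  have "\<phi> (\<lambda>R. k s * x s R + (\<Sum>s\<in>S. k s * x s R)) = \<phi> (\<lambda>R. k s * x s R) + \<phi> (\<lambda>R. \<Sum>s\<in>S. k s * x s R)"
    by (rule specht_mapD(4)[OF \<phi> Sp_smult[OF x(1)] Sp_sum[OF insert.hyps(1) x(2)]])
  also have "\<dots> = k s \<cdot>\<^sub>v \<phi> (x s) + vsum (gdim V) (\<lambda>s. k s \<cdot>\<^sub>v \<phi> (x s)) S"
    by (simp only: specht_mapD(5)[OF \<phi> x(1)] insert.IH[OF x(2)])
  finally have "\<phi> (\<lambda>R. k s * x s R + (\<Sum>s\<in>S. k s * x s R)) = k s \<cdot>\<^sub>v \<phi> (x s) + vsum (gdim V) (\<lambda>s. k s \<cdot>\<^sub>v \<phi> (x s)) S" .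
  then show ?case
    using insert.hyps specht_mapD(3)[OF \<phi> x(1)] by (subst vsum_insert) simp_all
qed

lemma specht_map_zero:
  assumes "specht_map V \<phi>"
  shows "\<phi> (\<lambda>R. 0) = 0\<^sub>v (gdim V)"
  using specht_map_sum[OF assms, of "{}"] by simp

text \<open>The operator of the column antisymmetrizer on an arbitrary module; unlike
  \<open>kap\<close> it makes sense away from functions on tabloids.\<close>

definition Kmat :: "'f smod \<Rightarrow> (nat \<times> nat \<Rightarrow> nat) \<Rightarrow> 'f mat" where
  "Kmat V t = msum (gdim V) (gdim V) (\<lambda>\<sigma>. sg \<sigma> \<cdot>\<^sub>m gact V \<sigma>) (CS t)"

lemma Kmat_carrier [simp]: "Kmat V t \<in> gmats V V"
  by (simp add: Kmat_def)

lemma Kmat_dim [simp]: "dim_row (Kmat V t) = gdim V" "dim_col (Kmat V t) = gdim V"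
  by (simp_all add: Kmat_def)

lemma Kmat_vec:
  assumes V: "is_gmod \<S> V" and t: "t \<in> tabx" and v: "v \<in> gvecs V"
  shows "Kmat V t *\<^sub>v v = vsum (gdim V) (\<lambda>\<sigma>. sg \<sigma> \<cdot>\<^sub>v (gact V \<sigma> *\<^sub>v v)) (CS t)"
proof -
  have c: "gact V \<sigma> \<in> gmats V V" if "\<sigma> \<in> CS t" for \<sigma>
    using is_gmodD(1)[OF V CS_carrier[OF t that]] .
  have s: "(a \<cdot>\<^sub>m A) *\<^sub>v v = a \<cdot>\<^sub>v (A *\<^sub>v v)" if "A \<in> gmats V V" for a and A :: "'f mat"
    using that v by (auto intro!: eq_vecI simp: scalar_prod_def sum_distrib_left mult.assoc)
  have "Kmat V t *\<^sub>v v = vsum (gdim V) (\<lambda>\<sigma>. (sg \<sigma> \<cdot>\<^sub>m gact V \<sigma>) *\<^sub>v v) (CS t)"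
    unfolding Kmat_def by (rule msum_mult_vec[OF smult_carrier_mat[OF c] v])
  also have "\<dots> = vsum (gdim V) (\<lambda>\<sigma>. sg \<sigma> \<cdot>\<^sub>v (gact V \<sigma> *\<^sub>v v)) (CS t)"
    by (rule vsum_cong[OF refl s[OF c]])
  finally show ?thesis .
qed

lemma Kmat_phi:
  assumes \<phi>: "specht_map V \<phi>" and t: "t \<in> tabx" and x: "x \<in> Sp"
  shows "Kmat V t *\<^sub>v \<phi> x = \<phi> (kap t x)"
proof -
  have "\<phi> (kap t x) = vsum (gdim V) (\<lambda>\<sigma>. sg \<sigma> \<cdot>\<^sub>v \<phi> (tabloid_act \<sigma> x)) (CS t)"
    unfolding kap_def by (rule specht_map_sum[OF \<phi> finite_CS[OF t]]) (rule tabloid_act_Sp[OF CS_perm[OF t] x])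
  also have "\<dots> = Kmat V t *\<^sub>v \<phi> x"
    unfolding Kmat_vec[OF specht_mapD(1)[OF \<phi>] t specht_mapD(3)[OF \<phi> x]]
    by (intro vsum_cong refl) (simp only: specht_mapD(6)[OF \<phi> CS_carrier[OF t] x])
  finally show ?thesis by simp
qed

lemma Kmat_phi_scalar:
  assumes \<phi>: "specht_map V \<phi>" and t: "t \<in> tabx" and v: "v \<in> gvecs V"
  shows "\<exists>d. Kmat V t *\<^sub>v v = d \<cdot>\<^sub>v \<phi> (e t)"
proof -
  obtain x where x: "x \<in> Sp" "v = \<phi> x" using v specht_mapD(2)[OF \<phi>] by blast
  obtain d where d: "kap t x = (\<lambda>R. d * e t R)" using kap_Sp_scalar[OF t x(1)] by blast
  show ?thesis unfolding x(2) Kmat_phi[OF \<phi> t x(1)] d specht_mapD(5)[OF \<phi> e_in_Sp[OF t]] by blast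
qed

lemma Kmat_e:
  assumes \<phi>: "specht_map V \<phi>" and t: "t \<in> tabx"
  shows "Kmat V t *\<^sub>v \<phi> (e t) = of_nat (fact (Suc i)) \<cdot>\<^sub>v \<phi> (e t)"
  unfolding Kmat_phi[OF \<phi> t e_in_Sp[OF t]] kap_e_self[OF t] specht_mapD(5)[OF \<phi> e_in_Sp[OF t]] ..

text \<open>The first column is prescribed, and the remaining numbers fill the arm in any
  order.\<close>

lemma tabx_exists:
  assumes cs: "inj_on c {..i}" "c ` {..i} \<subseteq> {1..p}"
  obtains t where "t \<in> tabx" "\<forall>k\<le>i. t (k, 0) = c k"
proof -
  let ?A = "(\<lambda>k. (k, 0 :: nat)) ` {..i}" and ?B = "(\<lambda>j. (0 :: nat, j)) ` {1..<p - i}"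
  have cells: "cells lam = ?A \<union> ?B" using i_less by (auto simp: cells_lam image_iff)
  have "card ?B = p - i - 1" by (simp add: card_image inj_on_def)
  moreover have "card ({1..p} - c ` {..i}) = p - Suc i"
    using cs by (simp add: card_Diff_subset card_image)
  ultimately obtain h where h: "bij_betw h ?B ({1..p} - c ` {..i})"
    using finite_same_card_bij[of ?B "{1..p} - c ` {..i}"] by auto
  define t where "t a = (if a \<in> ?A then c (fst a) else h a)" for a
  have "bij_betw (\<lambda>a. c (fst a)) ?A (c ` {..i})"
    using cs(1) by (auto simp: bij_betw_def inj_on_def image_image)
  then have 1: "bij_betw t ?A (c ` {..i})" by (rule iffD1[OF bij_betw_cong, rotated]) (simp add: t_def)
  have "?A \<inter> ?B = {}" by auto
  then have 2: "bij_betw t ?B ({1..p} - c ` {..i})"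
    by (intro iffD1[OF bij_betw_cong h]) (auto simp: t_def)
  have "bij_betw t (cells lam) (c ` {..i} \<union> ({1..p} - c ` {..i}))"
    unfolding cells by (rule bij_betw_combine[OF 1 2]) blast
  moreover have "c ` {..i} \<union> ({1..p} - c ` {..i}) = {1..p}" using cs(2) by blast
  ultimately have "t \<in> tabx" by (simp add: tableaux_def)
  moreover have "\<forall>k\<le>i. t (k, 0) = c k" by (simp add: t_def)
  ultimately show thesis by (rule that)
qed

lemma tabx_nonempty: obtains t where "t \<in> tabx"
  by (rule tabx_exists[of Suc]) (use i_less in auto)

text \<open>The group permutes the polytabloids transitively and they span the Specht module, so if
  one image vanished the whole quotient would.\<close>

lemma phi_e_neq_0:
  assumes \<phi>: "specht_map V \<phi>" and dim: "gdim V \<noteq> 0" and t: "t \<in> tabx"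
  shows "\<phi> (e t) \<noteq> 0\<^sub>v (gdim V)"
proof
  assume z: "\<phi> (e t) = 0\<^sub>v (gdim V)"
  have all: "\<phi> (e u) = 0\<^sub>v (gdim V)" if u: "u \<in> tabx" for u
  proof -
    obtain g where g: "g permutes {1..p}" "e (g \<circ> t) = e u" using tabx_transitive[OF t u] by blast
    then have gc: "g \<in> carrier \<S>" by (simp only: carrier_iff)
    have "\<phi> (e u) = gact V g *\<^sub>v 0\<^sub>v (gdim V)"
      unfolding g(2)[symmetric] tabloid_act_e[OF t g(1), symmetric] specht_mapD(6)[OF \<phi> gc e_in_Sp[OF t]] z ..
    then show ?thesis using is_gmod_dim[OF specht_mapD(1)[OF \<phi>] gc] by (auto intro!: eq_vecI simp: scalar_prod_def)
  qed
  have "v = 0\<^sub>v (gdim V)" if v: "v \<in> gvecs V" for v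
  proof -
    obtain x where x: "x \<in> Sp" "v = \<phi> x" using v specht_mapD(2)[OF \<phi>] by blast
    obtain A c where A: "finite A" "A \<subseteq> tabx" "x = (\<lambda>R. \<Sum>t\<in>A. c t * e t R)" by (rule SpE[OF x(1)])
    have "v = vsum (gdim V) (\<lambda>u. c u \<cdot>\<^sub>v \<phi> (e u)) A"
      unfolding x(2) A(3) using A by (intro specht_map_sum[OF \<phi>] e_in_Sp) auto
    also have "\<dots> = vsum (gdim V) (\<lambda>u. 0\<^sub>v (gdim V)) A" using A(2) by (intro vsum_cong refl) (simp only: all smult_zero_vec subset_iff)
    finally show ?thesis by (auto simp: vsum_def intro!: eq_vecI)
  qed
  from this[of "unit_vec (gdim V) 0"] have "unit_vec (gdim V) 0 $ 0 = (0 :: 'f)" using dim by simp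
  then show False using dim by simp
qed

lemma Kmat_comp:
  assumes V: "is_gmod \<S> V" and t: "t \<in> tabx" and g: "g permutes {1..p}"
  shows "Kmat V (g \<circ> t) * gact V g = gact V g * Kmat V t"
proof -
  let ?N = "gdim V" and ?h = "\<lambda>\<rho>. g \<circ> \<rho> \<circ> inv_into UNIV g"
  have gc: "g \<in> carrier \<S>" using g by (simp only: carrier_iff)
  note D = is_gmodD[OF V]
  have rc: "\<rho> \<in> carrier \<S>" if "\<rho> \<in> CS t" for \<rho> using CS_carrier[OF t that] .
  have hc: "?h \<rho> \<in> carrier \<S>" if "\<rho> \<in> CS t" for \<rho>
    using CS_perm[OF t that] g by (simp only: carrier_iff permutes_compose permutes_inv)
  have mul: "gact V (a \<circ> b) = gact V a * gact V b" if "a \<in> carrier \<S>" "b \<in> carrier \<S>" for a b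
    using D(3)[OF that] by (simp add: sym_group_def)
  have e: "sg (?h \<rho>) \<cdot>\<^sub>m gact V (?h \<rho>) * gact V g = gact V g * (sg \<rho> \<cdot>\<^sub>m gact V \<rho>)" if r: "\<rho> \<in> CS t" for \<rho>
  proof -
    have "?h \<rho> \<circ> g = g \<circ> \<rho>" by (simp add: fun_eq_iff permutes_inverses[OF g])
    then have "gact V (?h \<rho>) * gact V g = gact V g * gact V \<rho>"
      using mul[OF hc[OF r] gc] mul[OF gc rc[OF r]] by simp
    then show ?thesis
      using is_gmod_dim[OF V hc[OF r]] is_gmod_dim[OF V gc] is_gmod_dim[OF V rc[OF r]]
      by (simp only: sg_conj[OF g t r] mat_smult_mult mat_mult_smult)
  qed
  have "Kmat V (g \<circ> t) = msum ?N ?N (\<lambda>\<rho>. sg (?h \<rho>) \<cdot>\<^sub>m gact V (?h \<rho>)) (CS t)"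
    unfolding Kmat_def by (rule msum_reindex_bij_betw[OF bij_betw_CS_conj[OF g], symmetric])
  then have "Kmat V (g \<circ> t) * gact V g = msum ?N ?N (\<lambda>\<rho>. sg (?h \<rho>) \<cdot>\<^sub>m gact V (?h \<rho>) * gact V g) (CS t)"
    using D(1)[OF hc] by (simp only: msum_mult[OF D(1)[OF gc]] smult_carrier_mat)
  also have "\<dots> = msum ?N ?N (\<lambda>\<rho>. gact V g * (sg \<rho> \<cdot>\<^sub>m gact V \<rho>)) (CS t)"
    by (rule msum_cong[OF refl e])
  also have "\<dots> = gact V g * Kmat V t"
    unfolding Kmat_def using D(1)[OF rc] by (subst mult_msum[OF D(1)[OF gc]]) (simp_all only: smult_carrier_mat)
  finally show ?thesis .
qed

text \<open>The common kernel of all column antisymmetrizers is a submodule. It is proper because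
  \<open>Kmat V t\<close> multiplies the nonzero vector \<open>\<phi> (e t)\<close> by the nonzero
  scalar \<open>(i + 1)!\<close>; simplicity then leaves only zero.\<close>

lemma Kmat_kernel:
  assumes \<phi>: "specht_map V \<phi>" and simple: "gsimple \<S> V" and v: "v \<in> gvecs V"
    and z: "\<And>t. t \<in> tabx \<Longrightarrow> Kmat V t *\<^sub>v v = 0\<^sub>v (gdim V)"
  shows "v = 0\<^sub>v (gdim V)"
proof -
  let ?N = "gdim V"
  note V = specht_mapD(1)[OF \<phi>]
  define U where "U = {v \<in> gvecs V. \<forall>t\<in>tabx. Kmat V t *\<^sub>v v = 0\<^sub>v ?N}"
  have zero: "A *\<^sub>v 0\<^sub>v ?N = 0\<^sub>v ?N" if "A \<in> carrier_mat ?N ?N" for A :: "'f mat"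
    using that by (auto intro!: eq_vecI simp: scalar_prod_def)
  have "is_submodule \<S> V U"
    unfolding is_submodule_def
  proof (intro conjI ballI allI)
    show "U \<subseteq> gvecs V" by (auto simp: U_def)
    show "0\<^sub>v ?N \<in> U" by (simp add: U_def zero)
    fix u assume u: "u \<in> U"
    then have u': "u \<in> gvecs V" "\<And>t. t \<in> tabx \<Longrightarrow> Kmat V t *\<^sub>v u = 0\<^sub>v ?N" by (auto simp: U_def)
    show "u + w \<in> U" if "w \<in> U" for w
      using that u by (simp add: U_def mult_add_distrib_mat_vec[OF Kmat_carrier])
    show "c \<cdot>\<^sub>v u \<in> U" for c
      using u by (simp add: U_def mult_mat_vec[OF Kmat_carrier] smult_zero_vec)
    fix g assume g: "g \<in> carrier \<S>"
    then have gp: "g permutes {1..p}" by (simp only: carrier_iff)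
    have "Kmat V t *\<^sub>v (gact V g *\<^sub>v u) = 0\<^sub>v ?N" if t: "t \<in> tabx" for t
    proof -
      \<comment> \<open>Moving \<open>Kmat V t\<close> past \<open>g\<close> conjugates the column
        stabilizer, which replaces \<open>t\<close> by its preimage under \<open>g\<close>.\<close>
      define t' where "t' = inv_into UNIV g \<circ> t"
      have t': "t' \<in> tabx" unfolding t'_def by (rule tabx_comp[OF permutes_inv[OF gp] t])
      have gt: "g \<circ> t' = t" by (simp add: t'_def fun_eq_iff permutes_inverses[OF gp])
      have "Kmat V t *\<^sub>v (gact V g *\<^sub>v u) = (Kmat V (g \<circ> t') * gact V g) *\<^sub>v u"
        unfolding gt using u'(1) is_gmod_dim[OF V g] by (simp add: mat_vec_assoc)
      also have "\<dots> = gact V g *\<^sub>v (Kmat V t' *\<^sub>v u)"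
        unfolding Kmat_comp[OF V t' gp] using u'(1) is_gmod_dim[OF V g] by (simp add: mat_vec_assoc)
      finally show ?thesis using u'(2)[OF t'] zero[OF is_gmodD(1)[OF V g]] by simp
    qed
    moreover have "gact V g *\<^sub>v u \<in> gvecs V" using is_gmodD(1)[OF V g] u'(1) by simp
    ultimately show "gact V g *\<^sub>v u \<in> U" by (simp add: U_def)
  qed
  then consider "U = {0\<^sub>v ?N}" | "U = gvecs V" using simple by (auto simp: gsimple_def)
  then show ?thesis
  proof cases
    case 1
    then show ?thesis using v z by (auto simp: U_def)
  next
    case 2
    obtain t where t: "t \<in> tabx" by (rule tabx_nonempty)
    have et: "\<phi> (e t) \<in> gvecs V" by (rule specht_mapD(3)[OF \<phi> e_in_Sp[OF t]])
    then have "\<phi> (e t) \<in> U" using 2 by simp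
    then have "of_nat (fact (Suc i)) \<cdot>\<^sub>v \<phi> (e t) = 0\<^sub>v ?N" using Kmat_e[OF \<phi> t] t by (simp add: U_def)
    from smult_vec_eq_0[OF et this] have "\<phi> (e t) = 0\<^sub>v ?N" using fact_neq_0[of "Suc i"] i_less(2) by (simp only: Suc_eq_plus1) blast
    then show ?thesis using phi_e_neq_0[OF \<phi> _ t] simple by (simp add: gsimple_def)
  qed
qed

text \<open>The right side mentions neither \<open>\<phi>\<close> nor \<open>V\<close>: all maps
  onto simple quotients have the same kernel, which is why the simple quotient is unique.\<close>

lemma phi_eq_0_iff:
  assumes \<phi>: "specht_map V \<phi>" and simple: "gsimple \<S> V" and x: "x \<in> Sp"
  shows "\<phi> x = 0\<^sub>v (gdim V) \<longleftrightarrow> (\<forall>t\<in>tabx. kap t x = (\<lambda>R. 0))"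
proof
  assume z: "\<phi> x = 0\<^sub>v (gdim V)"
  show "\<forall>t\<in>tabx. kap t x = (\<lambda>R. 0)"
  proof
    fix t assume t: "t \<in> tabx"
    obtain d where d: "kap t x = (\<lambda>R. d * e t R)" using kap_Sp_scalar[OF t x] by blast
    have "d \<cdot>\<^sub>v \<phi> (e t) = Kmat V t *\<^sub>v \<phi> x"
      unfolding Kmat_phi[OF \<phi> t x] d specht_mapD(5)[OF \<phi> e_in_Sp[OF t]] ..
    also have "\<dots> = 0\<^sub>v (gdim V)" unfolding z by (auto intro!: eq_vecI simp: scalar_prod_def)
    finally have "d \<cdot>\<^sub>v \<phi> (e t) = 0\<^sub>v (gdim V)" .
    moreover have "\<phi> (e t) \<noteq> 0\<^sub>v (gdim V)" "\<phi> (e t) \<in> gvecs V"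
      using phi_e_neq_0[OF \<phi> _ t] simple specht_mapD(3)[OF \<phi> e_in_Sp[OF t]] by (auto simp: gsimple_def)
    ultimately have "d = 0" using smult_vec_eq_0 by blast
    then show "kap t x = (\<lambda>R. 0)" using d by simp
  qed
next
  assume z: "\<forall>t\<in>tabx. kap t x = (\<lambda>R. 0)"
  show "\<phi> x = 0\<^sub>v (gdim V)"
    by (rule Kmat_kernel[OF \<phi> simple specht_mapD(3)[OF \<phi> x]]) (simp only: Kmat_phi[OF \<phi> _ x] z specht_map_zero[OF \<phi>])
qed

text \<open>Choose preimages under \<open>\<phi>\<close> and apply \<open>\<psi>\<close>; as the
  kernels agree, the result does not depend on the choice and is linear.\<close>

lemma simple_quotient_map:
  assumes \<phi>: "specht_map V \<phi>" and V: "gsimple \<S> V" and \<psi>: "specht_map W \<psi>" and W: "gsimple \<S> W"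
  obtains A where "A \<in> gmats V W" "\<forall>x\<in>Sp. A *\<^sub>v \<phi> x = \<psi> x"
proof -
  note D\<phi> = specht_mapD[OF \<phi>] and D\<psi> = specht_mapD[OF \<psi>]
  define r where "r v = (SOME x. x \<in> Sp \<and> \<phi> x = v)" for v
  have r: "r v \<in> Sp" "\<phi> (r v) = v" if "v \<in> gvecs V" for v
  proof -
    from someI_ex[OF specht_map_ex[OF \<phi> that]] have "r v \<in> Sp \<and> \<phi> (r v) = v" unfolding r_def .
    then show "r v \<in> Sp" "\<phi> (r v) = v" by auto
  qed
  have wd: "\<psi> x = \<psi> y" if "x \<in> Sp" "y \<in> Sp" "\<phi> x = \<phi> y" for x y
  proof -
    have m: "(\<lambda>R. - 1 * y R) \<in> Sp" by (rule Sp_smult[OF that(2)])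
    have z: "(\<lambda>R. x R + - 1 * y R) \<in> Sp" by (rule Sp_add[OF that(1) m])
    have "\<phi> (\<lambda>R. x R + - 1 * y R) = \<phi> x + (- 1) \<cdot>\<^sub>v \<phi> y" unfolding D\<phi>(4)[OF that(1) m] D\<phi>(5)[OF that(2)] ..
    also have "\<dots> = 0\<^sub>v (gdim V)" using D\<phi>(3)[OF that(2)] by (auto simp: that(3) intro!: eq_vecI)
    finally have "\<psi> (\<lambda>R. x R + - 1 * y R) = 0\<^sub>v (gdim W)"
      using phi_eq_0_iff[OF \<phi> V z] phi_eq_0_iff[OF \<psi> W z] by blast
    then have "\<psi> x + (- 1) \<cdot>\<^sub>v \<psi> y = 0\<^sub>v (gdim W)" unfolding D\<psi>(4)[OF that(1) m] D\<psi>(5)[OF that(2)] .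
    then have eq: "(\<psi> x + (- 1) \<cdot>\<^sub>v \<psi> y) $ k = 0\<^sub>v (gdim W) $ k" for k by simp
    show ?thesis
    proof (rule eq_vecI)
      show "dim_vec (\<psi> x) = dim_vec (\<psi> y)" using D\<psi>(3)[OF that(1)] D\<psi>(3)[OF that(2)] by simp
      fix k assume "k < dim_vec (\<psi> y)"
      then show "\<psi> x $ k = \<psi> y $ k" using eq[of k] D\<psi>(3)[OF that(1)] D\<psi>(3)[OF that(2)] by simp
    qed
  qed
  obtain A where A: "A \<in> gmats V W" "\<And>v. v \<in> gvecs V \<Longrightarrow> A *\<^sub>v v = \<psi> (r v)"
  proof (rule linear_fun_mat)
    show "\<psi> (r v) \<in> gvecs W" if "v \<in> gvecs V" for v by (rule D\<psi>(3)[OF r(1)[OF that]])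
    fix v assume v: "v \<in> gvecs V"
    show "\<psi> (r (v + w)) = \<psi> (r v) + \<psi> (r w)" if w: "w \<in> gvecs V" for w
      unfolding D\<psi>(4)[OF r(1)[OF v] r(1)[OF w], symmetric]
    proof (rule wd)
      have vw: "v + w \<in> gvecs V" using v w by simp
      show "r (v + w) \<in> Sp" "(\<lambda>R. r v R + r w R) \<in> Sp" by (rule r(1)[OF vw], rule Sp_add[OF r(1)[OF v] r(1)[OF w]])
      show "\<phi> (r (v + w)) = \<phi> (\<lambda>R. r v R + r w R)"
        by (simp only: D\<phi>(4)[OF r(1)[OF v] r(1)[OF w]] r(2)[OF v] r(2)[OF w] r(2)[OF vw])
    qed
    show "\<psi> (r (c \<cdot>\<^sub>v v)) = c \<cdot>\<^sub>v \<psi> (r v)" for c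
      unfolding D\<psi>(5)[OF r(1)[OF v], symmetric]
    proof (rule wd)
      have cv: "c \<cdot>\<^sub>v v \<in> gvecs V" using v by simp
      show "r (c \<cdot>\<^sub>v v) \<in> Sp" "(\<lambda>R. c * r v R) \<in> Sp" by (rule r(1)[OF cv], rule Sp_smult[OF r(1)[OF v]])
      show "\<phi> (r (c \<cdot>\<^sub>v v)) = \<phi> (\<lambda>R. c * r v R)"
        by (simp only: D\<phi>(5)[OF r(1)[OF v]] r(2)[OF v] r(2)[OF cv])
    qed
  next
    fix A assume "A \<in> gmats V W" "\<And>v. v \<in> gvecs V \<Longrightarrow> A *\<^sub>v v = \<psi> (r v)"
    then show thesis by (rule that)
  qed
  have "A *\<^sub>v \<phi> x = \<psi> x" if x: "x \<in> Sp" for x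
    unfolding A(2)[OF D\<phi>(3)[OF x]] by (rule wd) (use r[OF D\<phi>(3)[OF x]] x in auto)
  then show thesis by (intro that[OF A(1)] ballI)
qed

lemma simple_quotient_unique:
  fixes V W :: "'f smod"
  assumes V: "gsimple \<S> V" "is_specht_quotient lam V" and W: "gsimple \<S> W" "is_specht_quotient lam W"
  shows "giso \<S> V W"
proof -
  obtain \<phi> \<psi> where \<phi>: "specht_map V \<phi>" and \<psi>: "specht_map W \<psi>" using V(2) W(2) is_specht_quotient_iff by blast
  obtain A where A: "A \<in> gmats V W" "\<forall>x\<in>Sp. A *\<^sub>v \<phi> x = \<psi> x"
    by (rule simple_quotient_map[OF \<phi> V(1) \<psi> W(1)])
  obtain C where C: "C \<in> gmats W V" "\<forall>x\<in>Sp. C *\<^sub>v \<psi> x = \<phi> x"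
    by (rule simple_quotient_map[OF \<psi> W(1) \<phi> V(1)])
  note D\<phi> = specht_mapD[OF \<phi>] and D\<psi> = specht_mapD[OF \<psi>]
  note d = carrier_matD[OF A(1)] carrier_matD[OF C(1)]
  have ex\<phi>: "\<exists>x\<in>Sp. v = \<phi> x" if "v \<in> gvecs V" for v using specht_map_ex[OF \<phi> that] by blast
  have ex\<psi>: "\<exists>x\<in>Sp. v = \<psi> x" if "v \<in> gvecs W" for v using specht_map_ex[OF \<psi> that] by blast
  show ?thesis
  proof (rule gisoI[OF _ C(1)])
    show "is_ghom \<S> V W A"
      unfolding is_ghom_def
    proof (intro conjI ballI A(1))
      fix g assume g: "g \<in> carrier \<S>"
      then have gp: "g permutes {1..p}" by (simp only: carrier_iff)
      note gd = is_gmod_dim[OF D\<phi>(1) g] is_gmod_dim[OF D\<psi>(1) g]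
      show "A * gact V g = gact W g * A"
      proof (rule mat_mult_eqI_vec)
        show "A * gact V g \<in> gmats V W" "gact W g * A \<in> gmats V W"
          by (auto intro!: carrier_matI simp: d gd)
        fix v assume v: "v \<in> gvecs V"
        obtain x where x: "x \<in> Sp" "v = \<phi> x" using ex\<phi>[OF v] by blast
        have "(A * gact V g) *\<^sub>v v = A *\<^sub>v \<phi> (tabloid_act g x)"
          using v by (simp add: mat_vec_assoc d gd D\<phi>(6)[OF g x(1)] x(2))
        also have "\<dots> = gact W g *\<^sub>v (A *\<^sub>v v)"
          unfolding x(2) bspec[OF A(2) x(1)] bspec[OF A(2) tabloid_act_Sp[OF gp x(1)]] by (rule D\<psi>(6)[OF g x(1)])
        also have "\<dots> = (gact W g * A) *\<^sub>v v" using v by (simp add: mat_vec_assoc d gd)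
        finally show "(A * gact V g) *\<^sub>v v = (gact W g * A) *\<^sub>v v" .
      qed
    qed
    show "A * C = gid W"
    proof (rule mat_mult_eqI_vec)
      fix v assume v: "v \<in> gvecs W"
      obtain x where x: "x \<in> Sp" "v = \<psi> x" using ex\<psi>[OF v] by blast
      have "(A * C) *\<^sub>v v = A *\<^sub>v (C *\<^sub>v v)" using v by (simp add: mat_vec_assoc d)
      then show "(A * C) *\<^sub>v v = gid W *\<^sub>v v" using v by (simp only: x bspec[OF A(2) x(1)] bspec[OF C(2) x(1)] one_mult_mat_vec[OF D\<psi>(3)[OF x(1)]])
    qed (use A C in auto)
    show "C * A = gid V"
    proof (rule mat_mult_eqI_vec)
      fix v assume v: "v \<in> gvecs V"
      obtain x where x: "x \<in> Sp" "v = \<phi> x" using ex\<phi>[OF v] by blast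
      have "(C * A) *\<^sub>v v = C *\<^sub>v (A *\<^sub>v v)" using v by (simp add: mat_vec_assoc d)
      then show "(C * A) *\<^sub>v v = gid V *\<^sub>v v" using v by (simp only: x bspec[OF A(2) x(1)] bspec[OF C(2) x(1)] one_mult_mat_vec[OF D\<phi>(3)[OF x(1)]])
    qed (use A C in auto)
  qed
qed

text \<open>A column antisymmetrizer multiplies an invariant vector by the sum of the signs of the
  stabilizer. This sum is zero as soon as the column has two entries, and then
  \<open>Kmat_kernel\<close> applies.\<close>

lemma invariants_zero:
  fixes V :: "'f smod"
  assumes V: "gsimple \<S> V" "is_specht_quotient lam V" and i: "1 \<le> i" and R: "inv_vecs V R"
  shows "R = 0\<^sub>m (gdim V) (dim_col R)"
proof -
  obtain \<phi> where \<phi>: "specht_map V \<phi>" using V(2) is_specht_quotient_iff by blast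
  note g = specht_mapD(1)[OF \<phi>]
  have R': "dim_row R = gdim V" "\<And>h. h \<in> carrier \<S> \<Longrightarrow> gact V h * R = R" using R by (auto simp: inv_vecs_def)
  have col: "Matrix.col R j = 0\<^sub>v (gdim V)" if j: "j < dim_col R" for j
  proof (rule Kmat_kernel[OF \<phi> V(1)])
    show v: "Matrix.col R j \<in> gvecs V" using R' by (auto intro!: carrier_vecI)
    have inv: "gact V h *\<^sub>v Matrix.col R j = Matrix.col R j" if "h \<in> carrier \<S>" for h
    proof -
      have "Matrix.col R j = Matrix.col (gact V h * R) j" using R'(2)[OF that] by simp
      also have "\<dots> = gact V h *\<^sub>v Matrix.col R j"
        using is_gmod_dim[OF g that] R' j by (intro eq_vecI) auto
      finally show ?thesis by simp
    qed
    fix t assume t: "t \<in> tabx"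
    have "(\<Sum>\<sigma>\<in>CS t. sg \<sigma> * 1) = 0"
    proof (rule sum_antisym_eq_0[OF t])
      show "t (0, 0) \<in> col t" "t (1, 0) \<in> col t" using i by (auto simp: col_def)
      show "t (0, 0) \<noteq> t (1, 0)" using inj_onD[OF tabxD(2)[OF t], of 0 1] i by auto
    qed simp
    moreover have "Kmat V t *\<^sub>v Matrix.col R j = vsum (gdim V) (\<lambda>\<sigma>. sg \<sigma> \<cdot>\<^sub>v Matrix.col R j) (CS t)"
      unfolding Kmat_vec[OF g t v] by (intro vsum_cong refl) (simp only: inv[OF CS_carrier[OF t]])
    moreover have "vsum (gdim V) (\<lambda>\<sigma>. sg \<sigma> \<cdot>\<^sub>v Matrix.col R j) (CS t) = (\<Sum>\<sigma>\<in>CS t. sg \<sigma>) \<cdot>\<^sub>v Matrix.col R j"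
      by (rule vsum_smult_const[OF v])
    ultimately show "Kmat V t *\<^sub>v Matrix.col R j = 0\<^sub>v (gdim V)" using zero_smult_vec[OF v] by simp
  qed
  show ?thesis
  proof (rule eq_matI)
    fix k j assume "k < dim_row (0\<^sub>m (gdim V) (dim_col R) :: 'f mat)" "j < dim_col (0\<^sub>m (gdim V) (dim_col R) :: 'f mat)"
    then show "R $$ (k, j) = 0\<^sub>m (gdim V) (dim_col R) $$ (k, j)"
      using col[of j] R' by (metis index_col index_zero_mat index_zero_vec(1))
  qed (use R' in auto)
qed

lemma triv_rank_simple:
  fixes V :: "'f smod"
  assumes V: "gsimple \<S> V" "is_specht_quotient lam V" and i: "1 \<le> i"
  shows "triv_rank V 0"
proof (rule triv_rank_zero)
  show "is_gmod \<S> V" using V(1) by (simp add: gsimple_def)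
  fix R L assume R: "inv_vecs V R" and L: "inv_forms V L"
  have "dim_col L = gdim V" using L by (simp add: inv_forms_def)
  then show "L * R = 0\<^sub>m (dim_row L) (dim_col R)"
    by (subst invariants_zero[OF V i R]) (auto intro!: eq_matI)
qed

end

section \<open>Exterior powers as simple quotients\<close>

lemma vkron_diff_right:
  "dim_vec u = dim_vec v \<Longrightarrow> vkron w (u - v) = vkron w u - vkron w v" for u :: "'a :: comm_ring vec"
  by (auto intro!: eq_vecI simp: vkron_def div_mod_bounds right_diff_distrib)

lemma tens_diff:
  fixes v w :: "'a :: comm_ring_1 vec"
  assumes "dim_vec v = dim_vec w"
  shows "tens (us @ (v - w) # vs) = tens (us @ v # vs) - tens (us @ w # vs)"
proof (induction us)
  case Nil
  then show ?case using assms by (simp add: vkron_diff_left)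
next
  case (Cons u us)
  have "dim_vec (tens (us @ v # vs)) = dim_vec (tens (us @ w # vs))"
    using assms by (induction us) auto
  then show ?case using Cons by (simp add: vkron_diff_right)
qed

text \<open>Additivity in one slot, applied to \<open>0 - 0\<close>.\<close>

lemma tens_zero:
  fixes us vs :: "'a :: comm_ring_1 vec list"
  shows "tens (us @ 0\<^sub>v m # vs) = 0\<^sub>v (dim_vec (tens (us @ 0\<^sub>v m # vs)))"
proof (rule eq_vecI)
  fix j assume "j < dim_vec (0\<^sub>v (dim_vec (tens (us @ 0\<^sub>v m # vs))) :: 'a vec)"
  then have j: "j < dim_vec (tens (us @ 0\<^sub>v m # vs))" by simp
  have "tens (us @ (0\<^sub>v m - 0\<^sub>v m) # vs) = tens (us @ 0\<^sub>v m # vs) - tens (us @ 0\<^sub>v m # vs)"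
    by (rule tens_diff) simp
  then have "tens (us @ 0\<^sub>v m # vs) = tens (us @ 0\<^sub>v m # vs) - tens (us @ 0\<^sub>v m # vs)" by simp
  then have "tens (us @ 0\<^sub>v m # vs) $ j = (tens (us @ 0\<^sub>v m # vs) - tens (us @ 0\<^sub>v m # vs)) $ j"
    by (rule arg_cong)
  also have "\<dots> = 0" using j by simp
  finally show "tens (us @ 0\<^sub>v m # vs) $ j = 0\<^sub>v (dim_vec (tens (us @ 0\<^sub>v m # vs))) $ j" using j by simp
qed simp

lemma vsum_singleton: "f a \<in> carrier_vec m \<Longrightarrow> vsum m f {a} = f a"
  by (auto intro!: eq_vecI simp: vsum_def)

lemma smult_vec_index: "v \<in> carrier_vec m \<Longrightarrow> l < m \<Longrightarrow> (c \<cdot>\<^sub>v v) $ l = c * v $ l"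
  by simp

context sym_char
begin

definition tv :: "nat \<Rightarrow> 'f vec" where "tv y = vec n (\<lambda>k. qv k y)"

lemma tv_dim [simp]: "dim_vec (tv y) = n" by (simp add: tv_def)

lemma tv_carrier [simp]: "tv y \<in> carrier_vec n" by (simp add: carrier_vecI)

lemma tv_p: "tv p = 0\<^sub>v n"
  using qv_simps(3) by (auto intro!: eq_vecI simp: tv_def)

lemma tv_unit: "k < n \<Longrightarrow> tv (k + 1) = unit_vec n k"
  using qv_simps(1) by (auto intro!: eq_vecI simp: tv_def simp del: One_nat_def)

lemma T_tv:
  assumes "g \<in> carrier \<S>" "y \<in> {1..p}"
  shows "gact T g *\<^sub>v tv y = tv (g y) - tv (g p)"
  using T_qv[OF assms(1) _ assms(2)]
  by (auto intro!: eq_vecI simp: tv_def scalar_prod_def lessThan_atLeast0)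

lemma Tp_tens:
  assumes "set vs \<subseteq> carrier_vec n"
  shows "gact (Tp (length vs)) g *\<^sub>v tens vs = tens (map (\<lambda>v. gact T g *\<^sub>v v) vs)"
  using assms
proof (induction vs)
  case Nil
  then show ?case by (auto intro!: eq_vecI)
next
  case (Cons v vs)
  have "dim_vec (tens vs) = n ^ length vs" using Cons.prems by (intro tens_dim) auto
  moreover have "dim_col (gact (Tp k) g) = n ^ k" for k by (induction k) auto
  ultimately have "kronecker (gact T g) (gact (Tp (length vs)) g) *\<^sub>v vkron v (tens vs)
      = vkron (gact T g *\<^sub>v v) (gact (Tp (length vs)) g *\<^sub>v tens vs)"
    using Cons.prems by (intro kron_mult_vkron) auto
  then show ?case using Cons by simp
qed

end

context hook
begin

abbreviation ks :: "nat list" where "ks \<equiv> [1..<Suc i]"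

lemma set_ks: "set ks = {1..i}" by auto

lemma ip: "i < p" using i_less by simp

lemma tens_carrier:
  "length vs = i \<Longrightarrow> set vs \<subseteq> carrier_vec n \<Longrightarrow> tens vs \<in> carrier_vec (n ^ i)" for vs :: "'f vec list"
  by (rule carrier_vecI) (subst tens_dim[of vs n], auto)

text \<open>The sum vanishes because the swap of the entries in rows \<open>0\<close> and \<open>k\<close> does not change the summand.\<close>

lemma antisym_zero:
  fixes u :: "nat \<Rightarrow> 'f vec"
  assumes t: "t \<in> tabx" and k: "1 \<le> k" "k \<le> i" and pre: "set (pre @ post) \<subseteq> {1..i} - {k}"
    and len: "length pre + Suc (length post) = i"
    and u: "\<And>c. u c \<in> carrier_vec n" and d: "d \<in> carrier_vec n"
  shows "vsum (n ^ i) (\<lambda>\<sigma>. sg \<sigma> \<cdot>\<^sub>v tens (map (\<lambda>k. u (\<sigma> (t (k, 0)))) pre @ d # map (\<lambda>k. u (\<sigma> (t (k, 0))) - d) post)) (CS t) = 0\<^sub>v (n ^ i)"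
    (is "vsum _ (\<lambda>\<sigma>. _ \<cdot>\<^sub>v ?f \<sigma>) _ = _")
proof -
  have M: "?f \<sigma> \<in> carrier_vec (n ^ i)" for \<sigma>
    using len u d by (intro tens_carrier) auto
  have inj: "t (a, 0) \<noteq> t (b, 0)" if "a \<le> i" "b \<le> i" "a \<noteq> b" for a b
    using inj_onD[OF tabxD(2)[OF t], of a b] that by auto
  have "(\<Sum>\<sigma>\<in>CS t. sg \<sigma> * ?f \<sigma> $ l) = 0" for l
  proof (rule sum_antisym_eq_0[OF t])
    show "t (0, 0) \<in> col t" "t (k, 0) \<in> col t" using k by (auto simp: col_def)
    show "t (0, 0) \<noteq> t (k, 0)" by (rule inj) (use k in auto)
    fix \<sigma>
    have "transpose (t (0, 0)) (t (k, 0)) (t (a, 0)) = t (a, 0)" if "a \<in> set (pre @ post)" for a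
    proof -
      have a: "1 \<le> a" "a \<le> i" "a \<noteq> k" using subsetD[OF pre that] by auto
      have "t (a, 0) \<noteq> t (0, 0)" "t (a, 0) \<noteq> t (k, 0)" by (rule inj; use a k in simp)+
      then show ?thesis by (simp add: transpose_def)
    qed
    then have "map (\<lambda>k'. u ((\<sigma> \<circ> transpose (t (0, 0)) (t (k, 0))) (t (k', 0)))) pre = map (\<lambda>k. u (\<sigma> (t (k, 0)))) pre"
      "map (\<lambda>k'. u ((\<sigma> \<circ> transpose (t (0, 0)) (t (k, 0))) (t (k', 0))) - d) post = map (\<lambda>k. u (\<sigma> (t (k, 0))) - d) post"
      by simp_all
    then show "?f (\<sigma> \<circ> transpose (t (0, 0)) (t (k, 0))) $ l = ?f \<sigma> $ l" by (simp only:)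
  qed
  moreover have "(sg \<sigma> \<cdot>\<^sub>v ?f \<sigma>) $ l = sg \<sigma> * ?f \<sigma> $ l" if "l < n ^ i" for \<sigma> l
    by (rule smult_vec_index[OF M that])
  ultimately show ?thesis by (intro eq_vecI) (simp_all add: vsum_def)
qed

text \<open>The action sends \<open>tv y\<close> to \<open>tv (g y) - tv (g p)\<close>. The shift
  \<open>d\<close> is removed from one slot at a time: expanding a slot produces a term with the
  constant \<open>d\<close> in it, whose antisymmetrized sum vanishes by
  \<open>antisym_zero\<close>. The slots already treated are those in \<open>pre\<close>.\<close>

lemma antisym_shift:
  fixes u :: "nat \<Rightarrow> 'f vec"
  assumes t: "t \<in> tabx" and u: "\<And>c. u c \<in> carrier_vec n" and d: "d \<in> carrier_vec n"
    and "distinct (pre @ post)" "set (pre @ post) \<subseteq> {1..i}" "length (pre @ post) = i"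
  shows "vsum (n ^ i) (\<lambda>\<sigma>. sg \<sigma> \<cdot>\<^sub>v tens (map (\<lambda>k. u (\<sigma> (t (k, 0)))) pre @ map (\<lambda>k. u (\<sigma> (t (k, 0))) - d) post)) (CS t)
    = vsum (n ^ i) (\<lambda>\<sigma>. sg \<sigma> \<cdot>\<^sub>v tens (map (\<lambda>k. u (\<sigma> (t (k, 0)))) (pre @ post))) (CS t)"
  using assms(4-6)
proof (induction post arbitrary: pre)
  case Nil
  then show ?case by simp
next
  case (Cons k post)
  let ?P = "\<lambda>\<sigma>. map (\<lambda>k. u (\<sigma> (t (k, 0)))) pre" and ?Q = "\<lambda>\<sigma>. map (\<lambda>k. u (\<sigma> (t (k, 0))) - d) post"
  let ?a = "\<lambda>\<sigma>. tens (?P \<sigma> @ u (\<sigma> (t (k, 0))) # ?Q \<sigma>)" and ?b = "\<lambda>\<sigma>. tens (?P \<sigma> @ d # ?Q \<sigma>)"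
  have ab: "?a \<sigma> \<in> carrier_vec (n ^ i)" "?b \<sigma> \<in> carrier_vec (n ^ i)" for \<sigma>
    by (rule tens_carrier; use Cons.prems u d in auto)+
  have k: "1 \<le> k" "k \<le> i" "set (pre @ post) \<subseteq> {1..i} - {k}" "length pre + Suc (length post) = i"
    using Cons.prems by auto
  have "tens (?P \<sigma> @ (u (\<sigma> (t (k, 0))) - d) # ?Q \<sigma>) = ?a \<sigma> - ?b \<sigma>" for \<sigma>
    by (rule tens_diff) (metis u d carrier_vecD)
  then have "vsum (n ^ i) (\<lambda>\<sigma>. sg \<sigma> \<cdot>\<^sub>v tens (?P \<sigma> @ map (\<lambda>k. u (\<sigma> (t (k, 0))) - d) (k # post))) (CS t)
    = vsum (n ^ i) (\<lambda>\<sigma>. sg \<sigma> \<cdot>\<^sub>v (?a \<sigma> - ?b \<sigma>)) (CS t)" by simp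
  also have "\<dots> = vsum (n ^ i) (\<lambda>\<sigma>. sg \<sigma> \<cdot>\<^sub>v ?a \<sigma>) (CS t) - vsum (n ^ i) (\<lambda>\<sigma>. sg \<sigma> \<cdot>\<^sub>v ?b \<sigma>) (CS t)"
  proof (rule eq_vecI)
    fix l assume "l < dim_vec (vsum (n ^ i) (\<lambda>\<sigma>. sg \<sigma> \<cdot>\<^sub>v ?a \<sigma>) (CS t) - vsum (n ^ i) (\<lambda>\<sigma>. sg \<sigma> \<cdot>\<^sub>v ?b \<sigma>) (CS t))"
    then have l: "l < n ^ i" by simp
    then have "(sg \<sigma> \<cdot>\<^sub>v (?a \<sigma> - ?b \<sigma>)) $ l = (sg \<sigma> \<cdot>\<^sub>v ?a \<sigma>) $ l - (sg \<sigma> \<cdot>\<^sub>v ?b \<sigma>) $ l" for \<sigma>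
      using carrier_vecD[OF ab(1)[of \<sigma>]] carrier_vecD[OF ab(2)[of \<sigma>]] by (simp add: right_diff_distrib)
    then show "vsum (n ^ i) (\<lambda>\<sigma>. sg \<sigma> \<cdot>\<^sub>v (?a \<sigma> - ?b \<sigma>)) (CS t) $ l
      = (vsum (n ^ i) (\<lambda>\<sigma>. sg \<sigma> \<cdot>\<^sub>v ?a \<sigma>) (CS t) - vsum (n ^ i) (\<lambda>\<sigma>. sg \<sigma> \<cdot>\<^sub>v ?b \<sigma>) (CS t)) $ l"
      using l by (simp only: vsum_def index_minus_vec dim_vec index_vec sum_subtractf)
  qed simp
  also have "vsum (n ^ i) (\<lambda>\<sigma>. sg \<sigma> \<cdot>\<^sub>v ?b \<sigma>) (CS t) = 0\<^sub>v (n ^ i)"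
    by (rule antisym_zero[OF t k u d])
  also have "vsum (n ^ i) (\<lambda>\<sigma>. sg \<sigma> \<cdot>\<^sub>v ?a \<sigma>) (CS t) - 0\<^sub>v (n ^ i) = vsum (n ^ i) (\<lambda>\<sigma>. sg \<sigma> \<cdot>\<^sub>v ?a \<sigma>) (CS t)"
    by (auto intro!: eq_vecI)
  also have "\<dots> = vsum (n ^ i) (\<lambda>\<sigma>. sg \<sigma> \<cdot>\<^sub>v tens (map (\<lambda>k. u (\<sigma> (t (k, 0)))) (pre @ k # post))) (CS t)"
    using Cons.IH[of "pre @ [k]"] Cons.prems by simp
  finally show ?case .
qed

definition TB :: "nat set list set" where "TB = tabloid lam ` tabx"

lemma finite_TB: "finite TB"
proof (rule finite_subset)
  have "t (k, j) \<in> {1..p}" if "t \<in> tabx" "(k, j) \<in> cells lam" for t k j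
    using bij_betwE[OF tabxD(1)[OF that(1)]] that(2) by blast
  then show "TB \<subseteq> {xs. set xs \<subseteq> Pow {1..p} \<and> length xs = Suc i}"
    by (auto simp: TB_def tabloid_def)
  show "finite {xs. set xs \<subseteq> Pow {1..p} \<and> length xs = Suc i}" by (intro finite_lists_length_eq) auto
qed

text \<open>The wedge of the classes of the leg entries; \<open>the_elem\<close> reads off the only
  entry of a lower row.\<close>

definition mon :: "nat set list \<Rightarrow> 'f vec" where
  "mon R = prj i *\<^sub>v tens (map (\<lambda>k. tv (the_elem (R ! k))) ks)"

lemma mon_carrier [simp]: "mon R \<in> gvecs (X i)"
  unfolding mon_def using X_dim[OF ip] by (auto intro!: carrier_vecI)

text \<open>The linear extension to all functions on tabloids. Because of the base point
  \<open>p\<close> it is in general not equivariant there; equivariance holds on the span of the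
  polytabloids.\<close>

definition phiX :: "(nat set list \<Rightarrow> 'f) \<Rightarrow> 'f vec" where
  "phiX x = vsum (gdim (X i)) (\<lambda>R. x R \<cdot>\<^sub>v mon R) TB"

lemma phiX_carrier [simp]: "phiX x \<in> gvecs (X i)" by (simp add: phiX_def)

lemma phiX_index: "l < gdim (X i) \<Longrightarrow> phiX x $ l = (\<Sum>R\<in>TB. x R * mon R $ l)"
  unfolding phiX_def vsum_def by (simp add: smult_vec_index[OF mon_carrier])

lemma phiX_sum: "phiX (\<lambda>R. \<Sum>s\<in>S. k s * x s R) = vsum (gdim (X i)) (\<lambda>s. k s \<cdot>\<^sub>v phiX (x s)) S"
proof (rule eq_vecI)
  fix l assume "l < dim_vec (vsum (gdim (X i)) (\<lambda>s. k s \<cdot>\<^sub>v phiX (x s)) S)"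
  then have l: "l < gdim (X i)" by simp
  have "phiX (\<lambda>R. \<Sum>s\<in>S. k s * x s R) $ l = (\<Sum>s\<in>S. \<Sum>R\<in>TB. k s * (x s R * mon R $ l))"
    unfolding phiX_index[OF l] by (subst sum.swap) (simp only: sum_distrib_right mult.assoc)
  also have "\<dots> = (\<Sum>s\<in>S. k s * phiX (x s) $ l)" unfolding phiX_index[OF l] by (simp only: sum_distrib_left)
  finally show "phiX (\<lambda>R. \<Sum>s\<in>S. k s * x s R) $ l = vsum (gdim (X i)) (\<lambda>s. k s \<cdot>\<^sub>v phiX (x s)) S $ l"
    using l by (simp add: vsum_def smult_vec_index[OF phiX_carrier])
qed (simp add: phiX_def)

text \<open>The additional permutation \<open>g\<close> lets one formula describe both
  \<open>phiX (e t)\<close> and the image of the translated polytabloid.\<close>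

lemma phiX_e_comp:
  assumes t: "t \<in> tabx" and g: "g permutes {1..p}"
  shows "phiX (e (g \<circ> t)) = prj i *\<^sub>v vsum (n ^ i)
    (\<lambda>\<sigma>. sg \<sigma> \<cdot>\<^sub>v tens (map (\<lambda>k. tv (g (\<sigma> (t (k, 0))))) ks)) (CS t)"
proof -
  let ?w = "\<lambda>\<sigma>. tens (map (\<lambda>k. tv (g (\<sigma> (t (k, 0))))) ks)" and ?tab = "\<lambda>\<sigma>. tabloid lam (g \<circ> \<sigma> \<circ> t)"
  have w: "?w \<sigma> \<in> carrier_vec (n ^ i)" for \<sigma> by (rule tens_carrier) auto
  have tab: "?tab \<sigma> \<in> TB" if "\<sigma> \<in> CS t" for \<sigma>
    unfolding TB_def comp_assoc by (intro imageI tabx_comp[OF g] tabx_comp[OF CS_perm[OF t that]] t)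
  have map: "map (\<lambda>k. tv (the_elem (?tab \<sigma> ! k))) ks = map (\<lambda>k. tv (g (\<sigma> (t (k, 0))))) ks" for \<sigma>
  proof (rule map_cong[OF refl])
    fix k assume "k \<in> set ks"
    then have "1 \<le> k" "k \<le> i" by auto
    then show "tv (the_elem (?tab \<sigma> ! k)) = tv (g (\<sigma> (t (k, 0))))" by (simp add: tabloid_nth del: One_nat_def)
  qed
  have mon: "mon (?tab \<sigma>) = prj i *\<^sub>v ?w \<sigma>" for \<sigma> unfolding mon_def map ..
  have "phiX (e (g \<circ> t)) = vsum (gdim (X i)) (\<lambda>\<sigma>. prj i *\<^sub>v (sg \<sigma> \<cdot>\<^sub>v ?w \<sigma>)) (CS t)"
  proof (rule eq_vecI)
    fix l assume "l < dim_vec (vsum (gdim (X i)) (\<lambda>\<sigma>. prj i *\<^sub>v (sg \<sigma> \<cdot>\<^sub>v ?w \<sigma>)) (CS t))"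
    then have l: "l < gdim (X i)" by simp
    have "phiX (e (g \<circ> t)) $ l = (\<Sum>\<sigma>\<in>CS t. \<Sum>R\<in>TB. sg \<sigma> * ((if ?tab \<sigma> = R then 1 else 0) * mon R $ l))"
      unfolding phiX_index[OF l] e_comp[OF t g] by (subst sum.swap) (simp only: sum_distrib_right mult.assoc)
    also have "\<dots> = (\<Sum>\<sigma>\<in>CS t. sg \<sigma> * mon (?tab \<sigma>) $ l)"
    proof (intro sum.cong refl)
      fix \<sigma> assume \<sigma>: "\<sigma> \<in> CS t"
      have "(\<Sum>R\<in>TB. sg \<sigma> * ((if ?tab \<sigma> = R then 1 else 0) * mon R $ l)) = (\<Sum>R\<in>TB. if ?tab \<sigma> = R then sg \<sigma> * mon R $ l else 0)"
        by (intro sum.cong refl) simp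
      also have "\<dots> = sg \<sigma> * mon (?tab \<sigma>) $ l"
        by (subst sum.delta'[OF finite_TB]) (simp only: tab[OF \<sigma>] if_True)
      finally show "(\<Sum>R\<in>TB. sg \<sigma> * ((if ?tab \<sigma> = R then 1 else 0) * mon R $ l)) = sg \<sigma> * mon (?tab \<sigma>) $ l" .
    qed
    also have "\<dots> = (\<Sum>\<sigma>\<in>CS t. (prj i *\<^sub>v (sg \<sigma> \<cdot>\<^sub>v ?w \<sigma>)) $ l)"
    proof (intro sum.cong refl)
      fix \<sigma>
      have "prj i *\<^sub>v (sg \<sigma> \<cdot>\<^sub>v ?w \<sigma>) = sg \<sigma> \<cdot>\<^sub>v (prj i *\<^sub>v ?w \<sigma>)"
        using X_dim[OF ip] by (intro mult_mat_vec[OF _ w]) (auto intro!: carrier_matI)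
      then show "sg \<sigma> * mon (?tab \<sigma>) $ l = (prj i *\<^sub>v (sg \<sigma> \<cdot>\<^sub>v ?w \<sigma>)) $ l"
        unfolding mon using l X_dim[OF ip] by simp
    qed
    finally show "phiX (e (g \<circ> t)) $ l = vsum (gdim (X i)) (\<lambda>\<sigma>. prj i *\<^sub>v (sg \<sigma> \<cdot>\<^sub>v ?w \<sigma>)) (CS t) $ l"
      using l by (simp add: vsum_def)
  qed (simp add: phiX_def)
  also have "\<dots> = prj i *\<^sub>v vsum (n ^ i) (\<lambda>\<sigma>. sg \<sigma> \<cdot>\<^sub>v ?w \<sigma>) (CS t)"
    by (rule mult_mat_vsum[symmetric]) (use X_dim[OF ip] w in \<open>auto intro!: carrier_matI\<close>)
  finally show ?thesis .
qed

lemma phiX_e: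
  assumes t: "t \<in> tabx"
  shows "phiX (e t) = prj i *\<^sub>v vsum (n ^ i) (\<lambda>\<sigma>. sg \<sigma> \<cdot>\<^sub>v tens (map (\<lambda>k. tv (\<sigma> (t (k, 0)))) ks)) (CS t)"
  using phiX_e_comp[OF t permutes_id] by (simp only: id_comp id_apply)

text \<open>The group action shifts every slot by \<open>tv (g p)\<close>, and
  \<open>antisym_shift\<close> removes the shift from the signed sum.\<close>

lemma phiX_e_act:
  assumes t: "t \<in> tabx" and g: "g \<in> carrier \<S>"
  shows "phiX (e (g \<circ> t)) = gact (X i) g *\<^sub>v phiX (e t)"
proof -
  have gp: "g permutes {1..p}" using g by (simp only: carrier_iff)
  let ?w = "\<lambda>\<sigma>. map (\<lambda>k. tv (\<sigma> (t (k, 0)))) ks"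
  let ?v = "vsum (n ^ i) (\<lambda>\<sigma>. sg \<sigma> \<cdot>\<^sub>v tens (?w \<sigma>)) (CS t)"
  note d = X_dim[OF ip] is_gmod_dim[OF X_props(1)[OF ip] g] is_gmod_dim[OF is_gmod_Tp[of i] g] Tp_dim
  have w: "tens (?w \<sigma>) \<in> carrier_vec (n ^ i)" for \<sigma> by (rule tens_carrier) auto
  have G: "gact (Tp i) g \<in> carrier_mat (n ^ i) (n ^ i)" using d by (auto intro!: carrier_matI)
  have T: "gact (Tp i) g *\<^sub>v tens (?w \<sigma>) = tens (map (\<lambda>k. tv (g (\<sigma> (t (k, 0)))) - tv (g p)) ks)"
    if \<sigma>: "\<sigma> \<in> CS t" for \<sigma>
  proof -
    have "gact (Tp (length (?w \<sigma>))) g *\<^sub>v tens (?w \<sigma>) = tens (map (\<lambda>v. gact T g *\<^sub>v v) (?w \<sigma>))"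
      by (rule Tp_tens) auto
    also have "map (\<lambda>v. gact T g *\<^sub>v v) (?w \<sigma>) = map (\<lambda>k. tv (g (\<sigma> (t (k, 0)))) - tv (g p)) ks"
      unfolding map_map comp_def
    proof (rule map_cong[OF refl])
      fix k assume "k \<in> set ks"
      then have "t (k, 0) \<in> col t" by (auto simp: col_def)
      then have "t (k, 0) \<in> {1..p}" using tabxD(3)[OF t] by blast
      then have "\<sigma> (t (k, 0)) \<in> {1..p}" using permutes_in_image[OF CS_perm[OF t \<sigma>]] by simp
      then show "gact T g *\<^sub>v tv (\<sigma> (t (k, 0))) = tv (g (\<sigma> (t (k, 0)))) - tv (g p)" by (rule T_tv[OF g])
    qed
    moreover have "length (?w \<sigma>) = i" by (simp del: upt_Suc)
    ultimately show ?thesis by (simp only:)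
  qed
  have "gact (X i) g *\<^sub>v phiX (e t) = (gact (X i) g * prj i) *\<^sub>v ?v"
    unfolding phiX_e[OF t] by (rule mat_vec_assoc[symmetric]) (simp_all add: d)
  also have "gact (X i) g * prj i = prj i * gact (Tp i) g" by (rule is_ghomD(4)[OF X_props(3)[OF ip] g, symmetric])
  also have "(prj i * gact (Tp i) g) *\<^sub>v ?v = prj i *\<^sub>v (gact (Tp i) g *\<^sub>v ?v)"
    by (rule mat_vec_assoc) (simp_all add: d)
  also have "gact (Tp i) g *\<^sub>v ?v = vsum (n ^ i) (\<lambda>\<sigma>. gact (Tp i) g *\<^sub>v (sg \<sigma> \<cdot>\<^sub>v tens (?w \<sigma>))) (CS t)"
    by (rule mult_mat_vsum[OF G smult_carrier_vec[THEN iffD2, OF w]])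
  also have "\<dots> = vsum (n ^ i) (\<lambda>\<sigma>. sg \<sigma> \<cdot>\<^sub>v tens (map (\<lambda>k. tv (g (\<sigma> (t (k, 0)))) - tv (g p)) ks)) (CS t)"
    by (rule vsum_cong[OF refl]) (simp only: mult_mat_vec[OF G w] T)
  also have "\<dots> = vsum (n ^ i) (\<lambda>\<sigma>. sg \<sigma> \<cdot>\<^sub>v tens (map (\<lambda>k. tv (g (\<sigma> (t (k, 0))))) ks)) (CS t)"
    using antisym_shift[OF t tv_carrier tv_carrier, of "[]" ks g "g p"]
    by (simp only: append_Nil list.map distinct_upt set_ks length_upt diff_Suc_1 order_refl)
  also have "prj i *\<^sub>v \<dots> = phiX (e (g \<circ> t))" by (rule phiX_e_comp[OF t gp, symmetric])
  finally show ?thesis ..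
qed

text \<open>For a tableau with \<open>p\<close> in the corner, a summand vanishes unless its permutation fixes \<open>p\<close>, because the
  class of \<open>e\<^sub>p - e\<^sub>p\<close> is zero; the remaining \<open>i!\<close> summands agree.\<close>

lemma phiX_e_unit:
  assumes t: "t \<in> tabx" and t0: "t (0, 0) = p"
  shows "phiX (e t) = of_nat (fact i) \<cdot>\<^sub>v (prj i *\<^sub>v tens (map (\<lambda>k. tv (t (k, 0))) ks))"
proof -
  let ?f = "\<lambda>c. tv (t (c, 0))" and ?w = "\<lambda>\<sigma>. map (\<lambda>k. tv (\<sigma> (t (k, 0)))) ks"
  let ?C = "{\<sigma>. \<sigma> permutes (col t - {p})}"
  have pc: "p \<in> col t" using t0 by (force simp: col_def)
  have inj: "t (a, 0) \<noteq> t (b, 0)" if "a \<le> i" "b \<le> i" "a \<noteq> b" for a b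
    using inj_onD[OF tabxD(2)[OF t], of a b] that by auto
  have w: "tens (?w \<sigma>) \<in> carrier_vec (n ^ i)" for \<sigma> by (rule tens_carrier) auto
  have P: "prj i \<in> carrier_mat (gdim (X i)) (n ^ i)" using X_dim[OF ip] by (auto intro!: carrier_matI)
  have len: "length (?w \<sigma>) = i" for \<sigma> by (simp del: upt_Suc)
  have cs: "distinct (map (\<lambda>k. t (k, 0)) ks)" "length (map (\<lambda>k. t (k, 0)) ks) < p"
    "set (map (\<lambda>k. t (k, 0)) ks) = col t - {p}"
  proof -
    show "distinct (map (\<lambda>k. t (k, 0)) ks)"
      unfolding distinct_map set_ks using inj_on_subset[OF tabxD(2)[OF t], of "{1..i}"] by auto
    show "length (map (\<lambda>k. t (k, 0)) ks) < p" using ip by (simp del: upt_Suc)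
    have "{..i} = insert 0 {1..i}" by auto
    then have "col t = insert p ((\<lambda>k. t (k, 0)) ` {1..i})" unfolding col_def by (simp only: image_insert t0)
    moreover have "p \<notin> (\<lambda>k. t (k, 0)) ` {1..i}"
    proof
      assume "p \<in> (\<lambda>k. t (k, 0)) ` {1..i}"
      then obtain k where "p = t (k, 0)" "k \<in> {1..i}" by (rule imageE)
      then show False using inj[of 0 k] t0 by simp
    qed
    ultimately show "set (map (\<lambda>k. t (k, 0)) ks) = col t - {p}" by (simp only: set_map set_ks) blast
  qed
  \<comment> \<open>The sign of \<open>\<sigma>\<close> cancels against the sign produced by
    reordering the wedge.\<close>
  have fix': "prj i *\<^sub>v (sg \<sigma> \<cdot>\<^sub>v tens (?w \<sigma>)) = prj i *\<^sub>v tens (?w id)" if \<sigma>: "\<sigma> \<in> ?C" for \<sigma>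
  proof -
    have "wedge (?w \<sigma>) = sg \<sigma> \<cdot>\<^sub>v wedge (?w id)"
      using wedge_perm[OF cs(1,2), of \<sigma> tv] \<sigma> unfolding cs(3) sg_def by (simp add: comp_def del: upt_Suc)
    then have "alt i *\<^sub>v tens (?w \<sigma>) = sg \<sigma> \<cdot>\<^sub>v (alt i *\<^sub>v tens (?w id))" unfolding wedge_def len .
    then have "sg \<sigma> \<cdot>\<^sub>v (alt i *\<^sub>v tens (?w \<sigma>)) = alt i *\<^sub>v tens (?w id)"
      by (simp only: smult_smult_assoc sg_sg one_smult_vec)
    then have "prj i *\<^sub>v (alt i *\<^sub>v (sg \<sigma> \<cdot>\<^sub>v tens (?w \<sigma>))) = prj i *\<^sub>v (alt i *\<^sub>v tens (?w id))"
      by (simp only: mult_mat_vec[OF alt_carrier w])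
    then have "(prj i * alt i) *\<^sub>v (sg \<sigma> \<cdot>\<^sub>v tens (?w \<sigma>)) = (prj i * alt i) *\<^sub>v tens (?w id)"
      using X_dim[OF ip] carrier_vecD[OF w[of \<sigma>]] carrier_vecD[OF w[of id]] by (simp only: mat_vec_assoc alt_dim index_smult_vec)
    then show ?thesis unfolding prj_alt[OF ip] .
  qed
  have zero: "tens (?w \<sigma>) = 0\<^sub>v (n ^ i)" if \<sigma>: "\<sigma> \<in> CS t" "\<sigma> \<notin> ?C" for \<sigma>
  proof -
    have perm: "\<sigma> permutes col t" using \<sigma> by simp
    have "\<sigma> p \<noteq> p"
    proof
      assume "\<sigma> p = p"
      then have "\<sigma> permutes (col t - {p})" by (intro permutes_superset[OF perm]) auto
      then show False using \<sigma>(2) by simp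
    qed
    have "p \<in> \<sigma> ` col t" using permutes_image[OF perm] pc by simp
    then obtain k where k: "k \<le> i" "\<sigma> (t (k, 0)) = p" by (auto simp: col_def)
    then have "k \<noteq> 0" using \<open>\<sigma> p \<noteq> p\<close> t0 by (cases "k = 0") simp_all
    then have "k \<in> set ks" using k by auto
    then obtain us vs where uv: "ks = us @ k # vs" by (meson split_list)
    have "?w \<sigma> = map (\<lambda>k. tv (\<sigma> (t (k, 0)))) us @ 0\<^sub>v n # map (\<lambda>k. tv (\<sigma> (t (k, 0)))) vs"
      unfolding uv using k tv_p by simp
    then show ?thesis using tens_zero[of "map (\<lambda>k. tv (\<sigma> (t (k, 0)))) us" n "map (\<lambda>k. tv (\<sigma> (t (k, 0)))) vs"] carrier_vecD[OF w[of \<sigma>]] by (simp only:)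
  qed
  have "phiX (e t) = vsum (gdim (X i)) (\<lambda>\<sigma>. prj i *\<^sub>v (sg \<sigma> \<cdot>\<^sub>v tens (?w \<sigma>))) (CS t)"
    unfolding phiX_e[OF t] by (rule mult_mat_vsum[OF P smult_carrier_vec[THEN iffD2, OF w]])
  also have "\<dots> = vsum (gdim (X i)) (\<lambda>\<sigma>. prj i *\<^sub>v tens (?w id)) ?C"
    unfolding vsum_def
  proof (rule eq_vecI; simp only: dim_vec index_vec)
    fix l assume l: "l < gdim (X i)"
    have sub: "?C \<subseteq> CS t" using permutes_subset by blast
    have "prj i *\<^sub>v (sg \<sigma> \<cdot>\<^sub>v 0\<^sub>v (n ^ i)) = 0\<^sub>v (gdim (X i))" for \<sigma>
      using P unfolding smult_zero_vec by (auto intro!: eq_vecI simp: scalar_prod_def)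
    then have P0: "(prj i *\<^sub>v (sg \<sigma> \<cdot>\<^sub>v 0\<^sub>v (n ^ i))) $ l = 0" for \<sigma> using l by simp
    have "(prj i *\<^sub>v (sg \<sigma> \<cdot>\<^sub>v tens (?w \<sigma>))) $ l = 0" if \<sigma>: "\<sigma> \<in> CS t - ?C" for \<sigma>
    proof -
      have "tens (?w \<sigma>) = 0\<^sub>v (n ^ i)" by (rule zero) (use \<sigma> in blast)+
      from arg_cong[OF this, of "\<lambda>v. (prj i *\<^sub>v (sg \<sigma> \<cdot>\<^sub>v v)) $ l"] P0[of \<sigma>] show ?thesis by (rule trans)
    qed
    then have "(\<Sum>\<sigma>\<in>CS t. (prj i *\<^sub>v (sg \<sigma> \<cdot>\<^sub>v tens (?w \<sigma>))) $ l) = (\<Sum>\<sigma>\<in>?C. (prj i *\<^sub>v (sg \<sigma> \<cdot>\<^sub>v tens (?w \<sigma>))) $ l)"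
      by (intro sum.mono_neutral_right finite_CS[OF t] sub) blast
    also have "\<dots> = (\<Sum>\<sigma>\<in>?C. (prj i *\<^sub>v tens (?w id)) $ l)"
      by (rule sum.cong[OF refl]) (simp only: fix')
    finally show "(\<Sum>\<sigma>\<in>CS t. (prj i *\<^sub>v (sg \<sigma> \<cdot>\<^sub>v tens (?w \<sigma>))) $ l) = (\<Sum>\<sigma>\<in>?C. (prj i *\<^sub>v tens (?w id)) $ l)" .
  qed
  also have "\<dots> = of_nat (card ?C) \<cdot>\<^sub>v (prj i *\<^sub>v tens (?w id))"
    using P by (auto intro!: eq_vecI simp: vsum_def simp del: upt_Suc)
  also have "card ?C = fact i"
    by (rule card_permutations) (use tabxD(4,5)[OF t] pc in auto)
  finally show ?thesis by (simp only: id_apply)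
qed

text \<open>A unit vector of the tensor power is a tensor of unit vectors. With a repeated index it
  projects to zero; otherwise a tableau with \<open>p\<close> in the corner and these indices on the
  legs reaches it up to the invertible factor \<open>i!\<close>.\<close>

lemma phiX_surj_unit:
  assumes k: "k < n ^ i"
  shows "\<exists>x\<in>Sp. phiX x = prj i *\<^sub>v unit_vec (n ^ i) k"
proof -
  obtain js where js: "length js = i" "set js \<subseteq> {..<n}" "unit_vec (n ^ i) k = (tens (map (unit_vec n) js) :: 'f vec)"
    using unit_vec_tens[OF k, where 'a = 'f] by blast
  have w: "(tens (map (unit_vec n) js) :: 'f vec) \<in> carrier_vec (n ^ i)" 
  proof -
    have "(unit_vec (n ^ i) k :: 'f vec) \<in> carrier_vec (n ^ i)" by simp
    then show ?thesis unfolding js(3) .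
  qed
  show ?thesis
  proof (cases "distinct js")
    case False
    have "wedge (map (unit_vec n) js) = 0\<^sub>v (n ^ length (map (unit_vec n) js :: 'f vec list))"
      using js ip False by (intro wedge_not_distinct) (auto simp: distinct_map)
    then have z: "alt i *\<^sub>v tens (map (unit_vec n) js) = 0\<^sub>v (n ^ i)" by (simp only: wedge_def length_map js(1))
    have "prj i *\<^sub>v unit_vec (n ^ i) k = (prj i * alt i) *\<^sub>v tens (map (unit_vec n) js)" unfolding prj_alt[OF ip] js(3) ..
    also have "\<dots> = prj i *\<^sub>v 0\<^sub>v (n ^ i)"
      unfolding z[symmetric] by (rule mat_vec_assoc) (simp_all only: X_dim[OF ip] carrier_vecD[OF w] alt_dim)
    also have "\<dots> = 0\<^sub>v (gdim (X i))" using X_dim[OF ip] by (auto intro!: eq_vecI simp: scalar_prod_def)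
    \<comment> \<open>Zero is presented as an empty combination so that \<open>phiX_sum\<close> and
      \<open>Sp_sum\<close> apply; the values \<open>undefined\<close> are placeholders under an
      empty sum.\<close>
    finally have "prj i *\<^sub>v unit_vec (n ^ i) k = phiX (\<lambda>R. \<Sum>s\<in>{}. undefined s * undefined s R)"
      unfolding phiX_sum by simp
    then show ?thesis using Sp_sum[of "{}" undefined undefined] by (intro bexI[of _ "\<lambda>R. \<Sum>s\<in>{}. undefined s * undefined s R"]) auto
  next
    case True
    \<comment> \<open>The first column of the wanted tableau: \<open>p\<close> in the corner, and an
      index \<open>k\<close> entered as \<open>k + 1\<close>, because \<open>tv (k + 1)\<close> is
      the unit vector with number \<open>k\<close>.\<close>
    define c where "c k = (if k = 0 then p else js ! (k - 1) + 1)" for k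
    have lt: "js ! m < n" if "m < i" for m using js that by (metis lessThan_iff nth_mem subsetD)
    have np: "n < p" "1 \<le> p" using n_props ip by linarith+
    have c: "c 0 = p" "a \<le> i \<Longrightarrow> a \<noteq> 0 \<Longrightarrow> c a = js ! (a - 1) + 1 \<and> a - 1 < i \<and> c a \<le> n" for a
    proof -
      assume a: "a \<le> i" "a \<noteq> 0"
      then have "a - 1 < i" by simp
      from this lt[OF this] a show "c a = js ! (a - 1) + 1 \<and> a - 1 < i \<and> c a \<le> n" by (simp add: c_def)
    qed (simp add: c_def)
    have inj: "inj_on c {..i}"
    proof (rule inj_onI)
      fix a b assume "a \<in> {..i}" "b \<in> {..i}" and ab: "c a = c b"
      then have le: "a \<le> i" "b \<le> i" by auto
      show "a = b"
      proof (cases "a = 0 \<or> b = 0")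
        case True
        then show ?thesis using c(1) c(2)[OF le(1)] c(2)[OF le(2)] ab np(1) by (cases "a = 0"; cases "b = 0") auto
      next
        case False
        then have "js ! (a - 1) = js ! (b - 1)" "a - 1 < length js" "b - 1 < length js"
          using c(2)[OF le(1)] c(2)[OF le(2)] ab js(1) by auto
        then have "a - 1 = b - 1" using nth_eq_iff_index_eq[OF True] by blast
        then show ?thesis using False by arith
      qed
    qed
    have im: "c ` {..i} \<subseteq> {1..p}"
    proof (rule image_subsetI)
      fix a assume "a \<in> {..i}"
      then show "c a \<in> {1..p}" using c(1) c(2)[of a] np by (cases "a = 0") auto
    qed
    obtain t where t: "t \<in> tabx" "\<forall>k\<le>i. t (k, 0) = c k" by (rule tabx_exists[OF inj im])
    have "map (\<lambda>k. tv (t (k, 0))) ks = map (unit_vec n) js"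
    proof (rule nth_equalityI)
      show "length (map (\<lambda>k. tv (t (k, 0))) ks) = length (map (unit_vec n) js :: 'f vec list)"
        by (simp add: js(1) del: upt_Suc)
      fix m assume "m < length (map (\<lambda>k. tv (t (k, 0))) ks)"
      then have m: "m < i" by (simp del: upt_Suc)
      then have "map (\<lambda>k. tv (t (k, 0))) ks ! m = tv (js ! m + 1)"
        using t(2) c(2)[of "Suc m"] by (simp del: upt_Suc)
      then show "map (\<lambda>k. tv (t (k, 0))) ks ! m = map (unit_vec n) js ! m"
        using tv_unit[OF lt[OF m]] m js(1) by simp
    qed
    moreover have "t (0, 0) = p" using t(2) c(1) by simp
    ultimately have "phiX (e t) = of_nat (fact i) \<cdot>\<^sub>v (prj i *\<^sub>v unit_vec (n ^ i) k)"
      using phiX_e_unit[OF t(1)] js(3) by (simp only:)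
    \<comment> \<open>Homogeneity is obtained from \<open>phiX_sum\<close> with a one-element index
      set.\<close>
    moreover have "phiX (\<lambda>R. inverse (of_nat (fact i)) * e t R) = inverse (of_nat (fact i)) \<cdot>\<^sub>v phiX (e t)"
    proof -
      have "vsum (gdim (X i)) (\<lambda>_. inverse (of_nat (fact i)) \<cdot>\<^sub>v phiX (e t)) {()} = inverse (of_nat (fact i)) \<cdot>\<^sub>v phiX (e t)"
        by (rule vsum_singleton) simp
      then show ?thesis
        using phiX_sum[of "\<lambda>_. inverse (of_nat (fact i))" "\<lambda>_. e t" "{()}"]
        by (simp only: sum.insert[OF finite.emptyI] empty_iff not_False_eq_True sum.empty add_0_right)
    qed
    ultimately have "phiX (\<lambda>R. inverse (of_nat (fact i)) * e t R) = prj i *\<^sub>v unit_vec (n ^ i) k"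
      using fact_neq_0[OF ip] by (simp add: smult_smult_assoc del: of_nat_fact)
    then show ?thesis using Sp_smult[OF e_in_Sp[OF t(1)]] by blast
  qed
qed

lemma phiX_surj: "phiX ` Sp = gvecs (X i)"
proof (intro equalityI subsetI)
  fix v assume "v \<in> phiX ` Sp"
  then show "v \<in> gvecs (X i)" by auto
next
  fix v assume v: "v \<in> gvecs (X i)"
  have P: "prj i \<in> carrier_mat (gdim (X i)) (n ^ i)" using X_dim[OF ip] by (auto intro!: carrier_matI)
  define w where "w = inc i *\<^sub>v v"
  have w: "w \<in> carrier_vec (n ^ i)" unfolding w_def using X_dim[OF ip] by (auto intro!: carrier_vecI)
  have "v = (prj i * inc i) *\<^sub>v v" unfolding X_props(4)[OF ip] using v by simp
  also have "\<dots> = prj i *\<^sub>v w" unfolding w_def by (rule mat_vec_assoc) (use X_dim[OF ip] v in auto)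
  finally have vw: "v = prj i *\<^sub>v w" .
  have "\<forall>k\<in>{..<n ^ i}. \<exists>x. x \<in> Sp \<and> phiX x = prj i *\<^sub>v unit_vec (n ^ i) k" using phiX_surj_unit by blast
  from bchoice[OF this] obtain x where x: "\<forall>k\<in>{..<n ^ i}. x k \<in> Sp \<and> phiX (x k) = prj i *\<^sub>v unit_vec (n ^ i) k" ..
  have "phiX (\<lambda>R. \<Sum>k<n ^ i. w $ k * x k R) = vsum (gdim (X i)) (\<lambda>k. prj i *\<^sub>v (w $ k \<cdot>\<^sub>v unit_vec (n ^ i) k)) {..<n ^ i}"
    unfolding phiX_sum by (rule vsum_cong[OF refl]) (use x in \<open>simp add: mult_mat_vec[OF P unit_vec_carrier]\<close>)
  also have "\<dots> = prj i *\<^sub>v vsum (n ^ i) (\<lambda>k. w $ k \<cdot>\<^sub>v unit_vec (n ^ i) k) {..<n ^ i}"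
    by (rule mult_mat_vsum[OF P, symmetric]) simp
  also have "vsum (n ^ i) (\<lambda>k. w $ k \<cdot>\<^sub>v unit_vec (n ^ i) k) {..<n ^ i} = w"
  proof (rule eq_vecI)
    fix l assume "l < dim_vec w"
    then have l: "l < n ^ i" using w by simp
    have "(\<Sum>k<n ^ i. (w $ k \<cdot>\<^sub>v unit_vec (n ^ i) k) $ l) = (\<Sum>k<n ^ i. if k = l then w $ k else 0)"
      using l by (intro sum.cong refl) auto
    then show "vsum (n ^ i) (\<lambda>k. w $ k \<cdot>\<^sub>v unit_vec (n ^ i) k) {..<n ^ i} $ l = w $ l"
      using l by (simp add: vsum_def)
  qed (use w in simp)
  finally have "phiX (\<lambda>R. \<Sum>k<n ^ i. w $ k * x k R) = v" unfolding vw .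
  moreover have "(\<lambda>R. \<Sum>k<n ^ i. w $ k * x k R) \<in> Sp" by (rule Sp_sum) (use x in auto)
  ultimately show "v \<in> phiX ` Sp" by (intro image_eqI) (simp_all only:)
qed

lemma specht_map_X: "specht_map (X i) phiX"
  unfolding specht_map_def
proof (intro conjI ballI allI phiX_surj X_props(1)[OF ip])
  fix x y :: "nat set list \<Rightarrow> 'f"
  show "phiX (\<lambda>R. x R + y R) = phiX x + phiX y"
    by (rule eq_vecI) (auto simp: phiX_index distrib_right sum.distrib carrier_vecD[OF phiX_carrier])
  show "phiX (\<lambda>R. c * x R) = c \<cdot>\<^sub>v phiX x" for c
    by (rule eq_vecI) (auto simp: phiX_index mult.assoc sum_distrib_left carrier_vecD[OF phiX_carrier])
next
  fix g and x :: "nat set list \<Rightarrow> 'f" assume g: "g \<in> carrier \<S>" and x: "x \<in> Sp"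
  then have gp: "g permutes {1..p}" by (simp only: carrier_iff)
  obtain A c where A: "finite A" "A \<subseteq> tabx" "x = (\<lambda>R. \<Sum>t\<in>A. c t * e t R)" by (rule SpE[OF x])
  note G = is_gmodD(1)[OF X_props(1)[OF ip] g]
  have "phiX (tabloid_act g x) = vsum (gdim (X i)) (\<lambda>t. c t \<cdot>\<^sub>v phiX (tabloid_act g (e t))) A"
    unfolding A(3) tabloid_act_sum by (rule phiX_sum)
  also have "\<dots> = vsum (gdim (X i)) (\<lambda>t. gact (X i) g *\<^sub>v (c t \<cdot>\<^sub>v phiX (e t))) A"
  proof (rule vsum_cong[OF refl])
    fix t assume "t \<in> A"
    then have t: "t \<in> tabx" using A(2) by blast
    show "c t \<cdot>\<^sub>v phiX (tabloid_act g (e t)) = gact (X i) g *\<^sub>v (c t \<cdot>\<^sub>v phiX (e t))"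
      unfolding mult_mat_vec[OF G phiX_carrier] tabloid_act_e[OF t gp] phiX_e_act[OF t g] ..
  qed
  also have "\<dots> = gact (X i) g *\<^sub>v phiX x"
    unfolding A(3) phiX_sum by (rule mult_mat_vsum[OF G, symmetric]) simp
  finally show "phiX (tabloid_act g x) = gact (X i) g *\<^sub>v phiX x" .
qed

end

section \<open>The invariant form and simplicity\<close>

lemma transpose_msum:
  assumes "\<And>s. s \<in> S \<Longrightarrow> f s \<in> carrier_mat m k"
  shows "(msum m k f S)\<^sup>T = msum k m (\<lambda>s. (f s)\<^sup>T) S"
proof (rule eq_matI)
  fix a b assume "a < dim_row (msum k m (\<lambda>s. (f s)\<^sup>T) S)" "b < dim_col (msum k m (\<lambda>s. (f s)\<^sup>T) S)"
  then have ab: "a < k" "b < m" by auto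
  have "(f s)\<^sup>T $$ (a, b) = f s $$ (b, a)" if "s \<in> S" for s
    using carrier_matD[OF assms[OF that]] ab by simp
  then show "(msum m k f S)\<^sup>T $$ (a, b) = msum k m (\<lambda>s. (f s)\<^sup>T) S $$ (a, b)"
    using ab by (simp add: msum_def)
qed simp_all

lemma vsum_scalar_prod:
  fixes y :: "'a :: comm_semiring_0 vec"
  assumes f: "\<And>s. s \<in> S \<Longrightarrow> f s \<in> carrier_vec m" and y: "y \<in> carrier_vec m"
  shows "vsum m f S \<bullet> y = (\<Sum>s\<in>S. f s \<bullet> y)"
proof -
  have "vsum m f S \<bullet> y = (\<Sum>l = 0..<m. \<Sum>s\<in>S. f s $ l * y $ l)"
    using y by (simp add: scalar_prod_def vsum_def sum_distrib_right)
  also have "\<dots> = (\<Sum>s\<in>S. f s \<bullet> y)"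
    using y by (subst sum.swap) (simp add: scalar_prod_def)
  finally show ?thesis .
qed

lemma submodule_vsum:
  assumes U: "is_submodule G V U" and S: "finite S" "\<And>s. s \<in> S \<Longrightarrow> f s \<in> U"
  shows "vsum (gdim V) f S \<in> U"
  using S
proof (induction S)
  case empty
  then show ?case using U by (simp add: is_submodule_def)
next
  case (insert s S)
  have "U \<subseteq> gvecs V" "\<forall>u\<in>U. \<forall>v\<in>U. u + v \<in> U" using U by (auto simp: is_submodule_def)
  then show ?case using insert by (subst vsum_insert) auto
qed

context sym_char
begin

text \<open>The form induced by the standard form on the permutation module; \<open>B\<close> is its Gram matrix on \<open>T\<close>.\<close>

definition Bm :: "'f mat" where "Bm = mat n n (\<lambda>(i, j). B i j)"

primrec bm :: "nat \<Rightarrow> 'f mat" where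
  "bm 0 = 1\<^sub>m 1"
| "bm (Suc k) = kronecker Bm (bm k)"

lemma Bm_carrier: "Bm \<in> carrier_mat n n" by (simp add: Bm_def)

lemma Bm_dim [simp]: "dim_row Bm = n" "dim_col Bm = n" by (simp_all add: Bm_def)

lemma Bm_index: "i < n \<Longrightarrow> j < n \<Longrightarrow> Bm $$ (i, j) = B i j" by (simp add: Bm_def)

lemma bm_dim [simp]: "dim_row (bm k) = n ^ k" "dim_col (bm k) = n ^ k"
  by (induction k) simp_all

lemma Bm_Bm: "Bm * Bm = 1\<^sub>m n"
proof (rule eq_matI)
  fix i j assume "i < dim_row (1\<^sub>m n :: 'f mat)" "j < dim_col (1\<^sub>m n :: 'f mat)"
  then have ij: "i < n" "j < n" by auto
  have "(Bm * Bm) $$ (i, j) = (\<Sum>k<n. B i k * B k j)"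
    using ij by (simp add: mat_mult_index[OF Bm_carrier Bm_carrier] Bm_index lessThan_atLeast0 del: index_mult_mat(1))
  then show "(Bm * Bm) $$ (i, j) = 1\<^sub>m n $$ (i, j)" using ij sum_B by simp
qed simp_all

lemma bm_bm: "bm k * bm k = I k"
  by (induction k) (simp_all add: kron_mult Bm_Bm kron_one)

text \<open>Invariance of \<open>cap\<close> in matrix form: the pair \<open>(j, k)\<close> is the
  tensor index \<open>j * n + k\<close>.\<close>

lemma T_form:
  assumes g: "g \<in> carrier \<S>"
  shows "(gact T g)\<^sup>T * (Bm * gact T g) = Bm"
proof (rule eq_matI)
  fix j k assume "j < dim_row Bm" "k < dim_col Bm"
  then have jk: "j < n" "k < n" by auto
  let ?t = "\<lambda>a b. gact T g $$ (a, b)" and ?m = "j * n + k"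
  have "j * n + k < Suc j * n" using jk by simp
  also have "\<dots> \<le> n * n" using jk by (intro mult_right_mono) auto
  finally have m: "?m < n * n" .
  have dm: "?m div n = j" "?m mod n = k" using jk by auto
  have 1: "(Bm * gact T g) $$ (a, k) = (\<Sum>b<n. B a b * ?t b k)" if "a < n" for a
    using that jk by (simp add: mat_mult_index[OF Bm_carrier T_carrier] Bm_index lessThan_atLeast0 del: index_mult_mat(1))
  have BT: "Bm * gact T g \<in> carrier_mat n n" by (rule mult_carrier_mat[OF Bm_carrier T_carrier])
  have "((gact T g)\<^sup>T * (Bm * gact T g)) $$ (j, k) = (\<Sum>a<n. (gact T g)\<^sup>T $$ (j, a) * (Bm * gact T g) $$ (a, k))"
    by (simp only: mat_mult_index[OF transpose_carrier_mat[THEN iffD2, OF T_carrier] BT jk] lessThan_atLeast0)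
  also have "\<dots> = (\<Sum>a<n. \<Sum>b<n. B a b * (?t a j * ?t b k))"
    using jk by (intro sum.cong refl) (simp add: 1 sum_distrib_left mult_ac del: index_mult_mat(1))
  also have "\<dots> = (\<Sum>x<n * n. B (x div n) (x mod n) * (?t (x div n) j * ?t (x mod n) k))"
    by (rule sum_div_mod[symmetric])
  also have "\<dots> = (\<Sum>x<n * n. cap $$ (0, x) * gact TT g $$ (x, ?m))"
  proof (intro sum.cong refl)
    fix x assume "x \<in> {..<n * n}"
    then have x: "x < n * n" by simp
    have "gact TT g $$ (x, ?m) = ?t (x div n) j * ?t (x mod n) k"
      using kron_index[of x "gact T g" "gact T g" ?m] x m dm by (simp add: TT_def)
    then show "B (x div n) (x mod n) * (?t (x div n) j * ?t (x mod n) k) = cap $$ (0, x) * gact TT g $$ (x, ?m)"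
      using x by (simp add: cap_def)
  qed
  also have "\<dots> = (cap * gact TT g) $$ (0, ?m)"
    by (subst mat_mult_index[of _ 1 "n * n" _ "n * n"]) (auto intro!: carrier_matI m simp: lessThan_atLeast0)
  also have "cap * gact TT g = cap"
    using is_ghomD(4)[OF cap_ghom g] by (simp add: mat_one_mult)
  also have "cap $$ (0, ?m) = Bm $$ (j, k)" using m jk dm by (simp add: cap_def Bm_def)
  finally show "((gact T g)\<^sup>T * (Bm * gact T g)) $$ (j, k) = Bm $$ (j, k)" .
qed simp_all

lemma Tp_form:
  assumes g: "g \<in> carrier \<S>"
  shows "(gact (Tp k) g)\<^sup>T * (bm k * gact (Tp k) g) = bm k"
proof (induction k)
  case 0
  show ?case by (simp add: transpose_one)
next
  case (Suc k)
  note d = is_gmod_dim[OF is_gmod_Tp[of k] g]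
  show ?case using Suc by (simp add: d kron_transpose kron_mult T_form[OF g])
qed

text \<open>\<open>bm\<close> is a tensor power of a single matrix, so it commutes with the swap of
  factors and hence with the antisymmetrizers.\<close>

lemma alt_bm: "alt k * bm k = bm k * alt k"
proof (induction k rule: alt.induct)
  case (3 k)
  let ?N = "n * (n * n ^ k)"
  define A where "A = L (Suc k)"
  define C where "C = bm (Suc (Suc k))"
  define S where "S = s1 k"
  have d: "dim_row A = ?N" "dim_col A = ?N" "dim_row C = ?N" "dim_col C = ?N" "dim_row S = ?N" "dim_col S = ?N"
    by (simp_all add: A_def C_def S_def del: alt.simps)
  have AC: "A * C = C * A" unfolding A_def C_def bm.simps(2)[of "Suc k"] using 3 by (simp add: kron_mult mat_distribs del: bm.simps(2))
  have C2: "C = kronecker (kronecker Bm Bm) (bm k)" by (simp add: C_def kron_assoc)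
  have SC: "S * C = C * S"
    unfolding C2 S_def s1_def by (simp add: kron_mult swap_kron[OF Bm_carrier Bm_carrier] mat_distribs)
  define M where "M = 1\<^sub>m ?N - of_nat (k + 1) \<cdot>\<^sub>m S"
  have dM: "dim_row M = ?N" "dim_col M = ?N" by (simp_all add: M_def d)
  have MC: "M * C = C * M" by (simp add: M_def d mat_distribs SC)
  have alt: "alt (Suc (Suc k)) = inverse (of_nat (k + 2)) \<cdot>\<^sub>m (A * (M * A))"
    unfolding alt.simps A_def[symmetric] S_def[symmetric] M_def by (simp add: d mat_assoc)
  have "(A * (M * A)) * C = A * (M * (C * A))" by (simp add: d dM mat_assoc AC)
  also have "\<dots> = A * (C * (M * A))" by (simp add: mat_rewr[OF MC] d dM mat_assoc)
  also have "\<dots> = C * (A * (M * A))" by (simp add: mat_rewr[OF AC] d dM mat_assoc)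
  finally have "(A * (M * A)) * C = C * (A * (M * A))" .
  then show ?case unfolding alt C_def[symmetric] by (simp add: d dM mat_distribs)
qed (simp_all add: mat_distribs)

text \<open>If \<open>alt (Suc k)\<close> vanished, so would its partial trace, which is a multiple
  of \<open>alt k\<close>. The scalar \<open>-(k + 2) / (k + 1)\<close> is nonzero because
  \<open>k + 2 < p\<close>.\<close>

lemma alt_neq_0: "k \<le> n \<Longrightarrow> alt k \<noteq> 0\<^sub>m (n ^ k) (n ^ k)"
proof (induction k)
  case 0
  show ?case
  proof
    assume "alt 0 = 0\<^sub>m (n ^ 0) (n ^ 0)"
    then have "(1\<^sub>m 1 :: 'f mat) $$ (0, 0) = 0\<^sub>m 1 1 $$ (0, 0)" by simp
    then show False by simp
  qed
next
  case (Suc k)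
  have k: "k + 1 < p" "k + 2 < p" using Suc.prems n_props by auto
  show ?case
  proof
    assume z: "alt (Suc k) = 0\<^sub>m (n ^ Suc k) (n ^ Suc k)"
    have "capi k * (L (Suc k) * cupi k) = 0\<^sub>m (n ^ k) (n ^ k)"
      unfolding z kron_zero_right by (simp add: mat_zeros mult.assoc)
    then have "(- of_nat (k + 2) / of_nat (k + 1)) \<cdot>\<^sub>m alt k = 0\<^sub>m (n ^ k) (n ^ k)"
      unfolding partial_trace[OF k(1)] .
    then have "((- of_nat (k + 2) / of_nat (k + 1)) \<cdot>\<^sub>m alt k) $$ (a, b) = (0 :: 'f)" if "a < n ^ k" "b < n ^ k" for a b
      using that by simp
    moreover have "(- of_nat (k + 2) / of_nat (k + 1) :: 'f) \<noteq> 0"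
      using of_nat_neq_0[of "k + 2"] of_nat_neq_0[of "k + 1"] k by (simp del: of_nat_add of_nat_Suc)
    ultimately have "alt k = 0\<^sub>m (n ^ k) (n ^ k)" by (intro eq_matI) auto
    then show False using Suc by simp
  qed
qed

end

context hook
begin

definition form :: "'f mat" where "form = (inc i)\<^sup>T * (bm i * inc i)"

lemma form_carrier: "form \<in> gmats (X i) (X i)"
  using X_dim[OF ip] by (auto intro!: carrier_matI simp: form_def)

lemma form_dim [simp]: "dim_row form = gdim (X i)" "dim_col form = gdim (X i)"
  using form_carrier by auto

lemma form_act:
  assumes g: "g \<in> carrier \<S>"
  shows "(gact (X i) g)\<^sup>T * (form * gact (X i) g) = form"
proof -
  let ?x = "gact (X i) g" and ?y = "gact (Tp i) g"
  note d = X_dim[OF ip] is_gmod_dim[OF X_props(1)[OF ip] g] is_gmod_dim[OF is_gmod_Tp[of i] g] Tp_dim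
  have h: "inc i * ?x = ?y * inc i" by (rule is_ghomD(4)[OF X_props(2)[OF ip] g])
  have "(inc i * ?x)\<^sup>T = (?y * inc i)\<^sup>T" by (simp only: h)
  then have hT: "?x\<^sup>T * (inc i)\<^sup>T = (inc i)\<^sup>T * ?y\<^sup>T"
    using d by (subst (asm) (1 2) transpose_mult) (auto intro!: carrier_matI)
  have "?x\<^sup>T * (form * ?x) = (?x\<^sup>T * (inc i)\<^sup>T) * (bm i * (inc i * ?x))"
    by (simp add: form_def d mat_assoc)
  also have "\<dots> = (inc i)\<^sup>T * ((?y\<^sup>T * (bm i * ?y)) * inc i)"
    unfolding hT h by (simp add: d mat_assoc)
  also have "\<dots> = form" unfolding Tp_form[OF g] form_def ..
  finally show ?thesis .
qed

text \<open>\<open>prj i * (bm i * (prj i)\<^sup>T)\<close> is a left inverse of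
  \<open>form\<close>, because \<open>alt\<close> commutes with \<open>bm\<close> and
  \<open>bm i * bm i\<close> is the identity.\<close>

lemma form_nondegenerate:
  assumes v: "v \<in> gvecs (X i)" and z: "form *\<^sub>v v = 0\<^sub>v (gdim (X i))"
  shows "v = 0\<^sub>v (gdim (X i))"
proof -
  note d = X_dim[OF ip]
  have zero: "A *\<^sub>v 0\<^sub>v m = 0\<^sub>v k" if "A \<in> carrier_mat k m" for A :: "'f mat" and m k
    using that by (auto intro!: eq_vecI simp: scalar_prod_def)
  have "(inc i * prj i)\<^sup>T = (alt i)\<^sup>T" by (simp only: X_props(5)[OF ip])
  then have pT: "(prj i)\<^sup>T * (inc i)\<^sup>T = alt i"
    unfolding alt_transpose using d by (subst (asm) transpose_mult) (auto intro!: carrier_matI)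
  have 1: "(prj i)\<^sup>T * form = bm i * inc i"
  proof -
    have "(prj i)\<^sup>T * form = ((prj i)\<^sup>T * (inc i)\<^sup>T) * (bm i * inc i)" by (simp add: form_def d mat_assoc)
    also have "\<dots> = (alt i * bm i) * inc i" unfolding pT by (simp add: d mat_assoc)
    also have "\<dots> = bm i * (alt i * inc i)" unfolding alt_bm by (simp add: d mat_assoc)
    finally show ?thesis unfolding alt_inc[OF ip] .
  qed
  have "prj i * (bm i * ((prj i)\<^sup>T * form)) = prj i * ((bm i * bm i) * inc i)"
    unfolding 1 by (simp add: d mat_assoc)
  also have "\<dots> = gid (X i)" unfolding bm_bm by (simp add: d mat_distribs X_props(4)[OF ip])
  finally have "v = (prj i * (bm i * ((prj i)\<^sup>T * form))) *\<^sub>v v" using v by simp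
  also have "\<dots> = (prj i * (bm i * (prj i)\<^sup>T)) *\<^sub>v (form *\<^sub>v v)"
    using v by (simp add: d mat_assoc mat_vec_assoc)
  also have "\<dots> = 0\<^sub>v (gdim (X i))" unfolding z by (rule zero) (auto intro!: carrier_matI simp: d)
  finally show ?thesis .
qed

text \<open>Inversion permutes the column stabilizer and preserves signs, so a column
  antisymmetrizer is self-adjoint for an invariant form.\<close>

lemma form_Kmat:
  assumes t: "t \<in> tabx"
  shows "form * Kmat (X i) t = (Kmat (X i) t)\<^sup>T * form"
proof -
  let ?N = "gdim (X i)"
  note V = X_props(1)[OF ip] and D = is_gmodD[OF X_props(1)[OF ip]]
  have c: "\<sigma> \<in> carrier \<S>" "inv_into UNIV \<sigma> \<in> carrier \<S>" if "\<sigma> \<in> CS t" for \<sigma>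
    using CS_carrier[OF t that] permutes_inv[OF CS_perm[OF t that]] by (simp_all only: carrier_iff)
  have a: "form * gact (X i) \<sigma> = (gact (X i) (inv_into UNIV \<sigma>))\<^sup>T * form" if \<sigma>: "\<sigma> \<in> CS t" for \<sigma>
  proof -
    let ?x = "gact (X i) \<sigma>" and ?y = "gact (X i) (inv_into UNIV \<sigma>)"
    note d = is_gmod_dim[OF V c(1)[OF \<sigma>]] is_gmod_dim[OF V c(2)[OF \<sigma>]]
    have "?y * ?x = gact (X i) (inv_into UNIV \<sigma> \<circ> \<sigma>)"
      using D(3)[OF c(2)[OF \<sigma>] c(1)[OF \<sigma>]] by (simp add: sym_group_def)
    also have "inv_into UNIV \<sigma> \<circ> \<sigma> = id" using permutes_inv_o(2)[OF CS_perm[OF t \<sigma>]] .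
    also have "gact (X i) id = 1\<^sub>m ?N" using D(2) by (simp add: sym_group_def)
    finally have yx: "?y * ?x = 1\<^sub>m ?N" .
    have "form * ?x = (?y\<^sup>T * (form * ?y)) * ?x" unfolding form_act[OF c(2)[OF \<sigma>]] ..
    also have "\<dots> = ?y\<^sup>T * (form * (?y * ?x))" by (simp add: d mat_assoc)
    finally show ?thesis unfolding yx by (simp add: mat_distribs)
  qed
  have Dc: "sg \<sigma> \<cdot>\<^sub>m gact (X i) \<sigma> \<in> carrier_mat ?N ?N" if "\<sigma> \<in> CS t" for \<sigma>
    by (rule smult_carrier_mat[OF D(1)[OF c(1)[OF that]]])
  have bij: "bij_betw (\<lambda>\<sigma>. inv_into UNIV \<sigma>) (CS t) (CS t)"
    by (rule bij_betw_byWitness[where f' = "\<lambda>\<sigma>. inv_into UNIV \<sigma>"]) (auto simp: permutes_inv permutes_inv_inv)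
  have "form * Kmat (X i) t = msum ?N ?N (\<lambda>\<sigma>. form * (sg \<sigma> \<cdot>\<^sub>m gact (X i) \<sigma>)) (CS t)"
    unfolding Kmat_def by (rule mult_msum[OF form_carrier Dc])
  also have "\<dots> = msum ?N ?N (\<lambda>\<sigma>. (sg (inv_into UNIV \<sigma>) \<cdot>\<^sub>m gact (X i) (inv_into UNIV \<sigma>))\<^sup>T * form) (CS t)"
  proof (rule msum_cong[OF refl])
    fix \<sigma> assume \<sigma>: "\<sigma> \<in> CS t"
    have sgi: "sg (inv_into UNIV \<sigma>) = sg \<sigma>" using perm_permutation[OF t \<sigma>] by (simp add: sg_def sign_inverse)
    have "(sg \<sigma> \<cdot>\<^sub>m gact (X i) (inv_into UNIV \<sigma>))\<^sup>T = sg \<sigma> \<cdot>\<^sub>m (gact (X i) (inv_into UNIV \<sigma>))\<^sup>T" by (auto intro!: eq_matI)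
    then show "form * (sg \<sigma> \<cdot>\<^sub>m gact (X i) \<sigma>) = (sg (inv_into UNIV \<sigma>) \<cdot>\<^sub>m gact (X i) (inv_into UNIV \<sigma>))\<^sup>T * form"
      unfolding sgi using is_gmod_dim[OF V c(1)[OF \<sigma>]] is_gmod_dim[OF V c(2)[OF \<sigma>]]
      by (simp add: mat_distribs a[OF \<sigma>])
  qed
  also have "\<dots> = msum ?N ?N (\<lambda>\<sigma>. (sg \<sigma> \<cdot>\<^sub>m gact (X i) \<sigma>)\<^sup>T * form) (CS t)"
    by (rule msum_reindex_bij_betw[OF bij])
  also have "\<dots> = msum ?N ?N (\<lambda>\<sigma>. (sg \<sigma> \<cdot>\<^sub>m gact (X i) \<sigma>)\<^sup>T) (CS t) * form"
    by (rule msum_mult[OF form_carrier transpose_carrier_mat[THEN iffD2, OF Dc], symmetric])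
  also have "msum ?N ?N (\<lambda>\<sigma>. (sg \<sigma> \<cdot>\<^sub>m gact (X i) \<sigma>)\<^sup>T) (CS t) = (Kmat (X i) t)\<^sup>T"
    unfolding Kmat_def by (rule transpose_msum[OF Dc, symmetric])
  finally show ?thesis .
qed

lemma gdim_X_neq_0: "gdim (X i) \<noteq> 0"
proof
  assume z: "gdim (X i) = 0"
  have "alt i = 0\<^sub>m (n ^ i) (n ^ i)"
    unfolding X_props(5)[OF ip, symmetric] using X_dim[OF ip] z
    by (auto intro!: eq_matI simp: scalar_prod_def)
  then show False using alt_neq_0[OF i_le] by simp
qed

text \<open>James' submodule theorem for a nondegenerate form. Either some antisymmetrizer is
  nonzero on \<open>U\<close>, which then contains the image of a polytabloid and hence everything;
  or \<open>U\<close> is orthogonal to all images of polytabloids and therefore zero.\<close>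

lemma gsimple_X: "gsimple \<S> (X i)"
  unfolding gsimple_def
proof (intro conjI allI impI gdim_X_neq_0 X_props(1)[OF ip])
  let ?N = "gdim (X i)"
  note \<phi> = specht_map_X and V = X_props(1)[OF ip]
  fix U assume U: "is_submodule \<S> (X i) U"
  have sub: "U \<subseteq> gvecs (X i)" and zeroU: "0\<^sub>v ?N \<in> U" and smult: "\<And>c u. u \<in> U \<Longrightarrow> c \<cdot>\<^sub>v u \<in> U"
    and act: "\<And>g u. g \<in> carrier \<S> \<Longrightarrow> u \<in> U \<Longrightarrow> gact (X i) g *\<^sub>v u \<in> U"
    using U by (auto simp: is_submodule_def)
  show "U = {0\<^sub>v ?N} \<or> U = gvecs (X i)"
  proof (cases "\<exists>v\<in>U. \<exists>t\<in>tabx. Kmat (X i) t *\<^sub>v v \<noteq> 0\<^sub>v ?N")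
    case True
    then obtain v t where v: "v \<in> U" and t: "t \<in> tabx" and nz: "Kmat (X i) t *\<^sub>v v \<noteq> 0\<^sub>v ?N" by blast
    have vV: "v \<in> gvecs (X i)" using v sub by blast
    obtain d where d: "Kmat (X i) t *\<^sub>v v = d \<cdot>\<^sub>v phiX (e t)" using Kmat_phi_scalar[OF \<phi> t vV] by blast
    have d0: "d \<noteq> 0" using nz zero_smult_vec[OF phiX_carrier[of "e t"]] unfolding d by auto
    have "Kmat (X i) t *\<^sub>v v \<in> U"
      unfolding Kmat_vec[OF V t vV]
      by (intro submodule_vsum[OF U finite_CS[OF t]] smult act v CS_carrier[OF t])
    then have "inverse d \<cdot>\<^sub>v (d \<cdot>\<^sub>v phiX (e t)) \<in> U" unfolding d by (rule smult)
    then have et: "phiX (e t) \<in> U" using d0 by (simp add: smult_smult_assoc)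
    have eu: "phiX (e u) \<in> U" if u: "u \<in> tabx" for u
    proof -
      obtain g where g: "g permutes {1..p}" "e (g \<circ> t) = e u" using tabx_transitive[OF t u] by blast
      then have "g \<in> carrier \<S>" by (simp only: carrier_iff)
      from act[OF this et] show ?thesis unfolding phiX_e_act[OF t \<open>g \<in> carrier \<S>\<close>, symmetric] g(2) .
    qed
    have "gvecs (X i) \<subseteq> U"
    proof
      fix w assume "w \<in> gvecs (X i)"
      then obtain x where x: "x \<in> Sp" "phiX x = w" using specht_map_ex[OF \<phi>] by blast
      obtain A c where A: "finite A" "A \<subseteq> tabx" "x = (\<lambda>R. \<Sum>t\<in>A. c t * e t R)" by (rule SpE[OF x(1)])
      show "w \<in> U" unfolding x(2)[symmetric] A(3) phiX_sum
        by (rule submodule_vsum[OF U A(1)]) (use eu smult A(2) in blast)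
    qed
    then show ?thesis using sub by blast
  next
    case False
    have "v = 0\<^sub>v ?N" if v: "v \<in> U" for v
    proof (rule form_nondegenerate)
      show vV: "v \<in> gvecs (X i)" using v sub by blast
      have fv: "form *\<^sub>v v \<in> gvecs (X i)" by (rule mult_mat_vec_carrier[OF form_carrier vV])
      \<comment> \<open>With \<open>K\<close> self-adjoint,
        \<open>(i + 1)! <e t, v> = <K (e t), v> = <e t, K v> = 0\<close>, and the factorial is
        invertible.\<close>
      have orth: "phiX (e t) \<bullet> (form *\<^sub>v v) = 0" if t: "t \<in> tabx" for t
      proof -
        have Kv: "Kmat (X i) t *\<^sub>v v = 0\<^sub>v ?N" using False v t by blast
        have "of_nat (fact (Suc i)) * (phiX (e t) \<bullet> (form *\<^sub>v v)) = (of_nat (fact (Suc i)) \<cdot>\<^sub>v phiX (e t)) \<bullet> (form *\<^sub>v v)"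
          by (rule smult_scalar_prod_distrib[OF phiX_carrier fv, symmetric])
        also have "\<dots> = (Kmat (X i) t *\<^sub>v phiX (e t)) \<bullet> (form *\<^sub>v v)" unfolding Kmat_e[OF \<phi> t] ..
        also have "\<dots> = (form *\<^sub>v v) \<bullet> (Kmat (X i) t *\<^sub>v phiX (e t))"
          by (rule comm_scalar_prod[OF mult_mat_vec_carrier[OF Kmat_carrier phiX_carrier] fv])
        also have "\<dots> = ((Kmat (X i) t)\<^sup>T *\<^sub>v (form *\<^sub>v v)) \<bullet> phiX (e t)"
          by (rule transpose_vec_mult_scalar[OF Kmat_carrier phiX_carrier fv, symmetric])
        also have "(Kmat (X i) t)\<^sup>T *\<^sub>v (form *\<^sub>v v) = form *\<^sub>v (Kmat (X i) t *\<^sub>v v)"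
        proof -
          have "(Kmat (X i) t)\<^sup>T *\<^sub>v (form *\<^sub>v v) = ((Kmat (X i) t)\<^sup>T * form) *\<^sub>v v"
            using vV by (subst mat_vec_assoc) auto
          also have "\<dots> = form *\<^sub>v (Kmat (X i) t *\<^sub>v v)"
            unfolding form_Kmat[OF t, symmetric] using vV by (subst mat_vec_assoc) auto
          finally show ?thesis .
        qed
        also have "form *\<^sub>v (Kmat (X i) t *\<^sub>v v) = 0\<^sub>v ?N"
          unfolding Kv using form_carrier by (auto intro!: eq_vecI simp: scalar_prod_def)
        also have "0\<^sub>v ?N \<bullet> phiX (e t) = 0" by (rule scalar_prod_left_zero[OF phiX_carrier])
        finally show ?thesis using fact_neq_0[of "Suc i"] i_less(2) by (simp del: of_nat_fact fact_Suc)
      qed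
      show "form *\<^sub>v v = 0\<^sub>v ?N"
      proof (rule eq_vecI)
        fix k assume "k < dim_vec (0\<^sub>v ?N :: 'f vec)"
        then have k: "k < ?N" by simp
        obtain x where x: "x \<in> Sp" "phiX x = unit_vec ?N k" using specht_map_ex[OF \<phi> unit_vec_carrier] by blast
        obtain A c where A: "finite A" "A \<subseteq> tabx" "x = (\<lambda>R. \<Sum>t\<in>A. c t * e t R)" by (rule SpE[OF x(1)])
        have "(form *\<^sub>v v) $ k = unit_vec ?N k \<bullet> (form *\<^sub>v v)"
          by (rule scalar_prod_left_unit[OF fv k, symmetric])
        also have "\<dots> = (\<Sum>t\<in>A. (c t \<cdot>\<^sub>v phiX (e t)) \<bullet> (form *\<^sub>v v))"
          unfolding x(2)[symmetric] A(3) phiX_sum by (rule vsum_scalar_prod[OF _ fv]) simp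
        also have "\<dots> = 0"
        proof (rule sum.neutral, rule ballI)
          fix t assume "t \<in> A"
          then have "t \<in> tabx" using A(2) by blast
          then show "(c t \<cdot>\<^sub>v phiX (e t)) \<bullet> (form *\<^sub>v v) = 0"
            unfolding smult_scalar_prod_distrib[OF phiX_carrier fv] by (simp only: orth mult_zero_right)
        qed
        finally show "(form *\<^sub>v v) $ k = 0\<^sub>v ?N $ k" using k by simp
      qed (use form_carrier in simp)
    qed
    then show ?thesis using zeroU by blast
  qed
qed

text \<open>The exterior power shows that the choice in \<open>james_simple\<close> has a witness,
  and uniqueness of the simple quotient identifies the chosen module with it.\<close>

lemma hook_simple_iso:
  shows "gsimple \<S> (hook_simple p i :: 'f smod)"
    and "is_specht_quotient lam (hook_simple p i :: 'f smod)"
    and "giso \<S> (hook_simple p i) (X i)"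
proof -
  have X: "gsimple \<S> (X i) \<and> is_specht_quotient lam (X i)"
    using gsimple_X specht_map_X is_specht_quotient_iff by blast
  have "hook_simple p i = james_simple lam" by (simp add: hook_simple_def lam_def)
  also have "\<dots> = (SOME V. gsimple \<S> V \<and> is_specht_quotient lam V)" by (simp only: james_simple_def sum_lam)
  finally have D: "(hook_simple p i :: 'f smod) = (SOME V. gsimple \<S> V \<and> is_specht_quotient lam V)" .
  have DD: "gsimple \<S> (hook_simple p i :: 'f smod) \<and> is_specht_quotient lam (hook_simple p i :: 'f smod)"
    unfolding D using X by (rule someI[of "\<lambda>V. gsimple \<S> V \<and> is_specht_quotient lam V"])
  then show "gsimple \<S> (hook_simple p i :: 'f smod)"
    "is_specht_quotient lam (hook_simple p i :: 'f smod)" by auto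
  show "giso \<S> (hook_simple p i) (X i)"
    using DD X by (intro simple_quotient_unique) auto
qed

lemma triv_rank_X: "1 \<le> i \<Longrightarrow> triv_rank (X i) 0"
  using gsimple_X specht_map_X is_specht_quotient_iff triv_rank_simple by blast

end

section \<open>Walks and Dyck paths\<close>

lemma path_graph_walks_Suc:
  assumes "u \<in> {1..r}"
  shows "path_graph_walks r (Suc k) u v = (\<lambda>s. u # s) ` (\<Union>w\<in>{w. path_graph_adj r u w}. path_graph_walks r k w v)"
proof (intro Set.set_eqI iffI)
  fix s assume "s \<in> path_graph_walks r (Suc k) u v"
  then have s: "length s = Suc (Suc k)" "set s \<subseteq> {1..r}" "\<And>t. t < Suc k \<Longrightarrow> path_graph_adj r (s ! t) (s ! Suc t)"
    "s ! 0 = u" "s ! Suc k = v" by (auto simp: path_graph_walks_def)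
  obtain s' where s': "s = u # s'" using s(1,4) by (cases s) auto
  have "path_graph_adj r u (s' ! 0)" using s(3)[of 0] s' by simp
  moreover have "s' \<in> path_graph_walks r k (s' ! 0) v"
    using s s(3)[of "Suc _"] unfolding path_graph_walks_def s' by auto
  ultimately show "s \<in> (\<lambda>s. u # s) ` (\<Union>w\<in>{w. path_graph_adj r u w}. path_graph_walks r k w v)"
    unfolding s' by blast
next
  fix s assume "s \<in> (\<lambda>s. u # s) ` (\<Union>w\<in>{w. path_graph_adj r u w}. path_graph_walks r k w v)"
  then obtain w s' where s': "s = u # s'" "path_graph_adj r u w" "s' \<in> path_graph_walks r k w v" by blast
  have "path_graph_adj r ((u # s') ! t) ((u # s') ! Suc t)" if "t < Suc k" for t
    using that s'(2,3) by (cases t) (auto simp: path_graph_walks_def)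
  then show "s \<in> path_graph_walks r (Suc k) u v"
    using s' assms by (auto simp: path_graph_walks_def)
qed

lemma finite_path_graph_walks: "finite (path_graph_walks r k u v)"
  by (rule finite_subset[OF _ finite_lists_length_eq[of "{1..r}" "Suc k"]]) (auto simp: path_graph_walks_def)

lemma card_path_graph_walks_Suc:
  assumes "u \<in> {1..r}"
  shows "card (path_graph_walks r (Suc k) u v) = (\<Sum>w\<in>{w. path_graph_adj r u w}. card (path_graph_walks r k w v))"
proof -
  have "finite {w. path_graph_adj r u w}"
    by (rule finite_subset[of _ "{1..r}"]) (auto simp: path_graph_adj_def)
  moreover have "path_graph_walks r k w v \<inter> path_graph_walks r k w' v = {}" if "w \<noteq> w'" for w w'
    using that by (auto simp: path_graph_walks_def)
  ultimately have "card (\<Union>w\<in>{w. path_graph_adj r u w}. path_graph_walks r k w v)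
      = (\<Sum>w\<in>{w. path_graph_adj r u w}. card (path_graph_walks r k w v))"
    by (intro card_UN_disjoint) (auto simp: finite_path_graph_walks)
  then show ?thesis unfolding path_graph_walks_Suc[OF assms] by (simp add: card_image)
qed

text \<open>Paths from height \<open>h\<close> to \<open>0\<close>, generalizing Dyck paths so that
  a recursion on the first step is possible.\<close>

definition height_paths :: "nat \<Rightarrow> nat \<Rightarrow> int \<Rightarrow> int list set" where
  "height_paths k c h = {xs. length xs = k \<and> set xs \<subseteq> {-1, 1} \<and> h + sum_list xs = 0 \<and>
     (\<forall>m \<le> k. h + sum_list (take m xs) \<in> {0..int c})}"

lemma dyck_paths_eq: "dyck_paths k c = height_paths k c 0"
  by (simp add: dyck_paths_def height_paths_def)

lemma height_paths_empty: "h \<notin> {0..int c} \<Longrightarrow> height_paths k c h = {}"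
  by (auto simp: height_paths_def dest!: spec[of _ 0])

lemma height_paths_Cons:
  assumes "h \<in> {0..int c}"
  shows "x # xs \<in> height_paths (Suc k) c h \<longleftrightarrow> x \<in> {-1, 1} \<and> xs \<in> height_paths k c (h + x)"
proof -
  have "(\<forall>m \<le> Suc k. h + sum_list (take m (x # xs)) \<in> {0..int c}) \<longleftrightarrow>
    (\<forall>m \<le> k. h + x + sum_list (take m xs) \<in> {0..int c})" (is "?l \<longleftrightarrow> ?r")
  proof
    assume l: ?l
    show ?r
    proof (intro allI impI)
      fix m assume "m \<le> k"
      then show "h + x + sum_list (take m xs) \<in> {0..int c}" using l[rule_format, of "Suc m"] by (simp add: add.assoc)
    qed
  next
    assume r: ?r
    show ?l
    proof (intro allI impI)
      fix m assume "m \<le> Suc k"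
      then show "h + sum_list (take m (x # xs)) \<in> {0..int c}"
        using r assms by (cases m) (simp_all add: add.assoc[symmetric])
    qed
  qed
  then show ?thesis unfolding height_paths_def by (auto simp: add.assoc)
qed

lemma height_paths_Suc:
  assumes "h \<in> {0..int c}"
  shows "height_paths (Suc k) c h = (#) 1 ` height_paths k c (h + 1) \<union> (#) (- 1) ` height_paths k c (h - 1)"
proof (intro Set.set_eqI)
  fix xs
  show "xs \<in> height_paths (Suc k) c h \<longleftrightarrow> xs \<in> (#) 1 ` height_paths k c (h + 1) \<union> (#) (- 1) ` height_paths k c (h - 1)"
  proof (cases xs)
    case Nil
    then show ?thesis by (auto simp: height_paths_def)
  next
    case (Cons x ys)
    then show ?thesis using height_paths_Cons[OF assms, of x ys k] by auto
  qed
qed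

lemma finite_height_paths: "finite (height_paths k c h)"
  by (rule finite_subset[OF _ finite_lists_length_eq[of "{-1, 1}" k]]) (auto simp: height_paths_def)

section \<open>Counting walks and paths\<close>

context sym_char
begin

lemma path_graph_adj_iff:
  assumes "j \<le> n"
  shows "{w. path_graph_adj (p - 1) (j + 1) w} = (if j < n then {j + 1 + 1} else {}) \<union> (if 0 < j then {j - 1 + 1} else {})"
proof -
  have "p - 1 = n + 1" using n_props(2) by linarith
  then show ?thesis using assms by (auto simp: path_graph_adj_def)
qed

text \<open>Removing the first step of a walk from \<open>j + 1\<close> gives the recursion of
  \<open>count_ends_Suc\<close>; vertices are \<open>ends\<close> values plus one.\<close>

lemma card_walks:
  assumes "j \<le> n"
  shows "card (path_graph_walks (p - 1) k (j + 1) 1) = count_list (ends k) j"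
  using assms
proof (induction k arbitrary: j)
  case 0
  have pn: "p - 1 = n + 1" using n_props(2) by linarith
  have "path_graph_walks (p - 1) 0 (j + 1) 1 = (if j = 0 then {[1]} else {})"
    unfolding path_graph_walks_def pn by (auto simp: length_Suc_conv)
  then show ?case by simp
next
  case (Suc k)
  have pn: "p - 1 = n + 1" using n_props(2) by linarith
  have "j + 1 \<in> {1..p - 1}" using Suc.prems pn by auto
  then have "card (path_graph_walks (p - 1) (Suc k) (j + 1) 1) =
    (\<Sum>w\<in>(if j < n then {j + 1 + 1} else {}) \<union> (if 0 < j then {j - 1 + 1} else {}). card (path_graph_walks (p - 1) k w 1))"
    by (simp only: card_path_graph_walks_Suc path_graph_adj_iff[OF Suc.prems])
  also have "\<dots> = (if j < n then card (path_graph_walks (p - 1) k (j + 1 + 1) 1) else 0)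
    + (if 0 < j then card (path_graph_walks (p - 1) k (j - 1 + 1) 1) else 0)"
    by (subst sum.union_disjoint) auto
  also have "\<dots> = count_list (ends (Suc k)) j"
    unfolding count_ends_Suc[OF Suc.prems]
  proof (intro arg_cong2[of _ _ _ _ "(+)"] if_cong refl)
    show "card (path_graph_walks (p - 1) k (j + 1 + 1) 1) = count_list (ends k) (Suc j)" if "j < n"
      using Suc.IH[of "j + 1"] that by simp
    show "card (path_graph_walks (p - 1) k (j - 1 + 1) 1) = count_list (ends k) (j - 1)"
      by (rule Suc.IH) (use Suc.prems in simp)
  qed
  finally show ?case .
qed

text \<open>Height \<open>j\<close> corresponds to the vertex \<open>j + 1\<close>, and the bound
  \<open>n = p - 2\<close> to the last vertex \<open>p - 1\<close>; again the recursion is that of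
  \<open>count_ends_Suc\<close>.\<close>

lemma card_height_paths:
  assumes "j \<le> n"
  shows "card (height_paths k n (int j)) = count_list (ends k) j"
  using assms
proof (induction k arbitrary: j)
  case 0
  have "height_paths 0 n (int j) = (if j = 0 then {[]} else {})" by (auto simp: height_paths_def)
  then show ?case by simp
next
  case (Suc k)
  have "card (height_paths (Suc k) n (int j)) = card (height_paths k n (int j + 1)) + card (height_paths k n (int j - 1))"
  proof -
    have "int j \<in> {0..int n}" using Suc.prems by simp
    moreover have "(#) 1 ` A \<inter> (#) (- 1) ` B = {}" for A B :: "int list set" by auto
    ultimately show ?thesis
      by (simp only: height_paths_Suc card_Un_disjoint finite_imageI finite_height_paths) (simp add: card_image)
  qed
  moreover have "card (height_paths k n (int j + 1)) = (if j < n then count_list (ends k) (Suc j) else 0)"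
    using Suc.IH[of "Suc j"] by (auto simp: height_paths_empty add.commute)
  moreover have "card (height_paths k n (int j - 1)) = (if 0 < j then count_list (ends k) (j - 1) else 0)"
    using Suc.IH[of "j - 1"] Suc.prems by (cases j) (auto simp: height_paths_empty)
  ultimately show ?case unfolding count_ends_Suc[OF Suc.prems] by simp
qed

text \<open>The path graph is bipartite, so each step changes the parity of the end point.\<close>

lemma even_ends: "j \<in> set (ends k) \<Longrightarrow> even (j + k)"
proof (induction k arbitrary: j)
  case (Suc k)
  then obtain l where l: "l \<in> set (ends k)" "j \<in> set (nbrs l)" by auto
  then have "even (l + k)" using Suc.IH by blast
  moreover have "j = Suc l \<or> l = Suc j" using l(2) by (auto simp: nbrs_def split: if_splits)
  ultimately show ?case by auto
qed simp

text \<open>Regroups the end points by value. Only even values up to \<open>p - 3\<close> occur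
  after an even number of steps, and their multiplicities are counted by
  \<open>card_walks\<close>.\<close>

lemma mset_ends:
  "mset (ends (2 * b)) = mset (concat (map (\<lambda>l. replicate (card (path_graph_walks (p - 1) (2 * b) (2 * l + 1) 1)) (2 * l))
    [0..<Suc ((p - 3) div 2)]))" (is "_ = mset (concat (map ?f ?ls))")
proof (rule multiset_eqI)
  fix j
  have podd: "odd p" using prime_p p_ge_3 prime_odd_nat by auto
  have "count (mset (concat (map ?f ls))) j = (\<Sum>l\<leftarrow>ls. if 2 * l = j then card (path_graph_walks (p - 1) (2 * b) (2 * l + 1) 1) else 0)" for ls
    by (induction ls) auto
  then have r: "count (mset (concat (map ?f ?ls))) j =
      (\<Sum>l\<in>{0..<Suc ((p - 3) div 2)}. if 2 * l = j then card (path_graph_walks (p - 1) (2 * b) (2 * l + 1) 1) else 0)"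
    by (simp only: interv_sum_list_conv_sum_set_nat set_upt)
  have l: "count (mset (ends (2 * b))) j = count_list (ends (2 * b)) j" by (simp add: count_mset)
  show "count (mset (ends (2 * b))) j = count (mset (concat (map ?f ?ls))) j"
  proof (cases "even j \<and> j \<le> n")
    case True
    then obtain a where a: "j = 2 * a" by blast
    \<comment> \<open>As \<open>p\<close> is odd, so is \<open>n = p - 2\<close>; an even
      \<open>j \<le> n\<close> is therefore at most \<open>p - 3\<close>.\<close>
    have "a \<le> (p - 3) div 2" using True podd n_props(2) unfolding a by presburger
    have "count (mset (concat (map ?f ?ls))) j = card (path_graph_walks (p - 1) (2 * b) (2 * a + 1) 1)"
      unfolding r using \<open>a \<le> _\<close> by (simp add: a)
    also have "\<dots> = count_list (ends (2 * b)) j" unfolding a by (rule card_walks) (use True a in simp)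
    finally show ?thesis unfolding l ..
  next
    case False
    have "j \<notin> set (ends (2 * b))" using False ends_le[of j "2 * b"] even_ends[of j "2 * b"] by auto
    moreover have "2 * l \<noteq> j" if "l \<in> {0..<Suc ((p - 3) div 2)}" for l
      using that False n_props(2) by auto
    ultimately show ?thesis unfolding l r by (simp add: count_list_0_iff)
  qed
qed

section \<open>Tensor powers of the first hook module and the multiplicity of the trivial
  module\<close>

lemma hook_interp: "i \<le> n \<Longrightarrow> hook TYPE('f) p i"
  by (intro hook.intro hook_axioms.intro sym_char_axioms)

lemma hook_simple_X:
  assumes "i \<le> n"
  shows "is_gmod \<S> (hook_simple p i :: 'f smod)" "sim (hook_simple p i) (X i)"
proof -
  interpret hook p F i by (rule hook_interp[OF assms])
  show D: "is_gmod \<S> (hook_simple p i :: 'f smod)" using hook_simple_iso(1) by (simp add: gsimple_def)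
  show "sim (hook_simple p i) (X i)" by (rule giso_imp_sim[OF hook_simple_iso(3) D is_gmod_X[OF ip]])
qed

lemma sim_gtensor_pow_hook_simple:
  "sim (gtensor_pow (hook_simple p 1) k) (gsum_list (map X (ends k)))"
proof -
  have "sim (hook_simple p 1) (X 1)" by (rule hook_simple_X) (use n_props in simp)
  also have "sim (X 1) T" by (rule giso_imp_sim[OF giso_X_1 is_gmod_X is_gmod_T]) (use p_ge_3 in simp)
  finally have "sim (gtensor_pow (hook_simple p 1) k) (Tp k)" by (rule sim_gtensor_pow)
  also have "sim (Tp k) (gsum_list (map X (ends k)))" by (rule sim_Tp_ends)
  finally show ?thesis .
qed

text \<open>The rank is \<open>1\<close> for a trivial module and \<open>0\<close> for
  \<open>X i\<close> with \<open>i \<ge> 1\<close>; uniqueness of the rank thus also shows that only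
  \<open>X 0\<close> is trivial.\<close>

lemma triv_rank_exterior:
  assumes "i \<le> n"
  shows "triv_rank (X i) (if giso \<S> (X i) gtriv then 1 else 0)" "giso \<S> (X i) gtriv \<longleftrightarrow> i = 0"
proof -
  have ip: "i < p" using assms n_props by simp
  have card0: "of_nat (card (carrier \<S>)) = (0 :: 'f)"
    using prime_p by (simp add: sym_group_card_carrier of_nat_eq_0_iff prime_dvd_fact_iff del: of_nat_fact)
  have r1: "triv_rank (X i) 1" if "giso \<S> (X i) gtriv" by (rule triv_rank_giso_gtriv[OF is_gmod_X[OF ip] that])
  have r0: "triv_rank (X i) 0" if "i \<noteq> 0"
    using hook.triv_rank_X[OF hook_interp[OF assms]] that by simp
  show iff: "giso \<S> (X i) gtriv \<longleftrightarrow> i = 0"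
    using triv_rank_unique[OF card0 sim_refl[OF is_gmod_X[OF ip]] r0 r1] giso_X_0 by auto
  show "triv_rank (X i) (if giso \<S> (X i) gtriv then 1 else 0)"
    using r1 r0 iff by auto
qed

text \<open>In the stable decomposition each \<open>X 0\<close> contributes one to the rank and
  every other summand nothing, so the closed walks are counted.\<close>

lemma multiplicity_trivial:
  "multiplicity_in \<S> (gtensor_pow (hook_simple p 1) k) (hook_simple p 0 :: 'f smod) = count_list (ends k) 0"
proof (rule multiplicity_in_triv)
  show "of_nat (card (carrier \<S>)) = (0 :: 'f)"
    using prime_p by (simp add: sym_group_card_carrier of_nat_eq_0_iff prime_dvd_fact_iff del: of_nat_fact)
  show D0: "is_gmod \<S> (hook_simple p 0 :: 'f smod)" by (rule hook_simple_X) simp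
  have p0: "0 < p" using p_ge_3 by simp
  show "giso \<S> (hook_simple p 0 :: 'f smod) gtriv"
    by (rule giso_trans[OF hook.hook_simple_iso(3)[OF hook_interp[of 0]] giso_X_0 D0 is_gmod_X[OF p0] is_gmod_gtriv]) simp
  show "sim (gtensor_pow (hook_simple p 1) k) (gsum_list (map X (ends k)))" by (rule sim_gtensor_pow_hook_simple)
  have g: "is_gmod \<S> V \<and> triv_rank V (if giso \<S> V gtriv then 1 else 0)" if "V \<in> set (map X (ends k))" for V
  proof -
    obtain j where j: "V = X j" "j \<in> set (ends k)" using \<open>V \<in> set (map X (ends k))\<close> by auto
    have "j \<le> n" by (rule ends_le[OF j(2)])
    moreover have "is_gmod \<S> (X j)" by (rule is_gmod_X) (use \<open>j \<le> n\<close> n_props in linarith)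
    ultimately show ?thesis unfolding j(1) using triv_rank_exterior(1) by blast
  qed
  have "length (filter (\<lambda>V. giso \<S> V gtriv) (map X (ends k))) = length (filter (\<lambda>j. giso \<S> (X j) gtriv) (ends k))"
    by (simp add: filter_map comp_def)
  also have "filter (\<lambda>j. giso \<S> (X j) gtriv) (ends k) = filter ((=) 0) (ends k)"
    by (rule filter_cong[OF refl]) (use triv_rank_exterior(2) ends_le in fastforce)
  also have "length \<dots> = count_list (ends k) 0" by (simp add: count_list_eq_length_filter)
  finally have len: "length (filter (\<lambda>V. giso \<S> V gtriv) (map X (ends k))) = count_list (ends k) 0" .
  have "triv_rank (gsum_list (map X (ends k))) (length (filter (\<lambda>V. giso \<S> V gtriv) (map X (ends k))))"
    by (rule triv_rank_gsum_list[OF g])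
  then show "triv_rank (gsum_list (map X (ends k))) (count_list (ends k) 0)" unfolding len .
qed

text \<open>The translates are pulled out of the tensor power, the power is decomposed along
  \<open>ends\<close>, and the translate is distributed over the summands. Permuting and regrouping
  the summands by value is harmless up to \<open>sim\<close>.\<close>

lemma sim_heller_gtensor_pow:
  "sim (gtensor_pow (heller_pow \<S> r (hook_simple p 1 :: 'f smod)) (2 * b))
     (gsum_list (map (\<lambda>l. gcopies (card (path_graph_walks (p - 1) (2 * b) (2 * l + 1) 1))
        (heller_pow \<S> (2 * b * r) (hook_simple p (2 * l)))) [0..<Suc ((p - 3) div 2)]))"
proof -
  let ?H = "heller_pow \<S> (2 * b * r)" and ?E = "ends (2 * b)" and ?ls = "[0..<Suc ((p - 3) div 2)]"
  let ?m = "\<lambda>l. card (path_graph_walks (p - 1) (2 * b) (2 * l + 1) 1)"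
  let ?D = "\<lambda>i. heller_pow \<S> (2 * b * r) (hook_simple p i :: 'f smod)"
  have gX: "is_gmod \<S> (X j)" if "j \<in> set ?E" for j
    by (rule is_gmod_X) (use ends_le[OF that] n_props in linarith)
  have gD: "is_gmod \<S> (?D j)" if "j \<le> n" for j by (rule is_gmod_heller_pow[OF hook_simple_X(1)[OF that]])
  have "sim (gtensor_pow (heller_pow \<S> r (hook_simple p 1 :: 'f smod)) (2 * b))
      (?H (gtensor_pow (hook_simple p 1) (2 * b)))"
    by (rule sim_heller_pow_gtensor_pow[OF hook_simple_X(1)]) (use n_props in simp)
  also have "sim \<dots> (?H (gsum_list (map X ?E)))" by (rule sim_heller_pow[OF sim_gtensor_pow_hook_simple])
  also have "sim \<dots> (gsum_list (map ?H (map X ?E)))"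
    by (rule sim_heller_pow_gsum_list) (use gX in auto)
  also have "sim \<dots> (gsum_list (map ?D ?E))"
  proof (rule sim_gsum_list)
    have "sim (?H (X j)) (?D j)" if "j \<in> set ?E" for j
      by (rule sim_heller_pow[OF sim_sym[OF hook_simple_X(2)[OF ends_le[OF that]]]])
    then show "list_all2 sim (map ?H (map X ?E)) (map ?D ?E)"
      by (simp add: list_all2_map1 list_all2_map2 list_all2_same)
  qed
  also have "sim \<dots> (gsum_list (map ?D (concat (map (\<lambda>l. replicate (?m l) (2 * l)) ?ls))))"
    by (rule sim_gsum_list_perm) (use gD ends_le in \<open>auto simp only: mset_map mset_ends set_map\<close>)
  also have "map ?D (concat (map (\<lambda>l. replicate (?m l) (2 * l)) ?ls)) = concat (map (\<lambda>l. replicate (?m l) (?D (2 * l))) ?ls)"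
    by (simp only: map_concat map_map comp_def map_replicate)
  also have "sim (gsum_list (concat (map (\<lambda>l. replicate (?m l) (?D (2 * l))) ?ls)))
      (gsum_list (map gsum_list (map (\<lambda>l. replicate (?m l) (?D (2 * l))) ?ls)))"
  proof (rule sim_gsum_list_concat)
    fix Vs V assume "Vs \<in> set (map (\<lambda>l. replicate (?m l) (?D (2 * l))) ?ls)" "V \<in> set Vs"
    then obtain l where l: "l < Suc ((p - 3) div 2)" "V = ?D (2 * l)" by (auto simp del: upt_Suc)
    have "2 * l \<le> n" using l(1) n_props(2) by linarith
    then show "is_gmod \<S> V" unfolding l(2) by (rule gD)
  qed
  also have "map gsum_list (map (\<lambda>l. replicate (?m l) (?D (2 * l))) ?ls) = map (\<lambda>l. gcopies (?m l) (?D (2 * l))) ?ls"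
    by (simp only: map_map comp_def gcopies_def)
  finally show ?thesis .
qed

end

theorem theorem4p4:
  fixes p b r :: nat
    and D :: "nat \<Rightarrow> (nat \<Rightarrow> nat, 'a :: alg_closed_field) gmod"
  assumes "prime p" and "p \<ge> 3"
    and "CHAR('a) = p"
    and "b \<ge> 1" and "r \<in> {0..2 * p - 3}"
    and "D = hook_simple p"
  shows "stably_iso (sym_group p)
           (gtensor_pow (heller_pow (sym_group p) r (D 1)) (2 * b))
           (gsum_list (map (\<lambda>l. gcopies (card (path_graph_walks (p - 1) (2 * b) (2 * l + 1) 1))
                                        (heller_pow (sym_group p) (2 * b * r) (D (2 * l))))
                           [0..<Suc ((p - 3) div 2)]))
       \<and> multiplicity_in (sym_group p) (gtensor_pow (D 1) (2 * b)) (D 0)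
           = card (dyck_paths (2 * b) (p - 2))"
proof -
  interpret sym_char p "TYPE('a)" using assms(1-3) by unfold_locales
  \<comment> \<open>Dyck paths are the height paths from \<open>0\<close>, and \<open>n\<close> is
    the bound \<open>p - 2\<close>.\<close>
  have "card (dyck_paths (2 * b) (p - 2)) = count_list (ends (2 * b)) 0"
    using card_height_paths[of 0 "2 * b"] by (simp add: dyck_paths_eq n_def)
  then show ?thesis
    unfolding assms(6) multiplicity_trivial
    using sim_imp_stably_iso[OF sim_heller_gtensor_pow] by simp
qed

end
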